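(* Let $Q$ be a connected quandle of order $2p$, where $p > 3$ is a prime number. Then $Q$ has order $10$ and is isomorphic (as a quandle) to the quandle of the conjugacy class of transpositions in the symmetric group $S_5$ of degree $5$, with operation $a \triangleright b = b^{-1}ab$.
   Context: A quandle is a set $Q$ together with a binary operation $\triangleright : Q\times Q\to Q$ satisfying: (Q1) for all $a,b\in Q$ there is a unique $x\in Q$ such that $b = x\triangleright a$; (Q2) for all $a,b,c\in Q$, $(a\triangleright b)\triangleright c = (a\triangleright c)\triangleright(b\triangleright c)$; (Q3) for all $a\in Q$, $a\triangleright a = a$. The order of a quandle is the cardinality of its underlying set. A quandle homomorphism is a map $\varphi$ with $\varphi(a\triangleright b) = \varphi(a)\triangleright\varphi(b)$ for all $a,b$; an isomorphism is a bijective homomorphism. For $a \in Q$, the right translation $\rho_a : Q\to Q$, $q\mapsto q\triangleright a$, is an automorphism of $Q$. The inner automorphism group $\mathrm{Inn}\,Q$ is the group of permutations of $Q$ generated by all $\rho_a$, $a\in Q$. A quandle $Q$ is connected if $\mathrm{Inn}\,Q$ acts transitively on $Q$. Any conjugacy class of a group $G$ is a quandle under the conjugation operation $a\triangleright b = b^{-1}ab$. *)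

theory Defs
  imports
    "HOL-Algebra.Algebra"
    "HOL-Computational_Algebra.Primes"
begin

section \<open>Quandles\<close>

record 'a quandle = "'a partial_object" +
  qop :: "'a \<Rightarrow> 'a \<Rightarrow> 'a"  (infixl \<open>\<triangleright>\<index>\<close> 70)

locale quandle =
  fixes Q (structure)
  assumes qop_closed: "\<lbrakk>a \<in> carrier Q; b \<in> carrier Q\<rbrakk> \<Longrightarrow> a \<triangleright> b \<in> carrier Q"
    and Q1: "\<lbrakk>a \<in> carrier Q; b \<in> carrier Q\<rbrakk> \<Longrightarrow> \<exists>!x. x \<in> carrier Q \<and> b = x \<triangleright> a"
    and Q2: "\<lbrakk>a \<in> carrier Q; b \<in> carrier Q; c \<in> carrier Q\<rbrakk>
              \<Longrightarrow> (a \<triangleright> b) \<triangleright> c = (a \<triangleright> c) \<triangleright> (b \<triangleright> c)"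
    and Q3: "a \<in> carrier Q \<Longrightarrow> a \<triangleright> a = a"

definition quandle_hom :: "('a, 'm) quandle_scheme \<Rightarrow> ('b, 'n) quandle_scheme \<Rightarrow> ('a \<Rightarrow> 'b) set"
  where "quandle_hom Q R =
    {\<phi> \<in> carrier Q \<rightarrow> carrier R.
      \<forall>a \<in> carrier Q. \<forall>b \<in> carrier Q. \<phi> (a \<triangleright>\<^bsub>Q\<^esub> b) = \<phi> a \<triangleright>\<^bsub>R\<^esub> \<phi> b}"

definition quandle_iso :: "('a, 'm) quandle_scheme \<Rightarrow> ('b, 'n) quandle_scheme \<Rightarrow> ('a \<Rightarrow> 'b) set"
  where "quandle_iso Q R = {\<phi> \<in> quandle_hom Q R. bij_betw \<phi> (carrier Q) (carrier R)}"

definition quandle_isomorphic :: "('a, 'm) quandle_scheme \<Rightarrow> ('b, 'n) quandle_scheme \<Rightarrow> bool"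
  where "quandle_isomorphic Q R \<longleftrightarrow> quandle_iso Q R \<noteq> {}"


section \<open>Inner automorphisms and connectedness\<close>

text \<open>Permutations of the carrier are extensional functions, as in \<^const>\<open>BijGroup\<close>.\<close>

definition right_translation :: "('a, 'm) quandle_scheme \<Rightarrow> 'a \<Rightarrow> 'a \<Rightarrow> 'a"
  where "right_translation Q a = (\<lambda>q \<in> carrier Q. q \<triangleright>\<^bsub>Q\<^esub> a)"

definition Inn :: "('a, 'm) quandle_scheme \<Rightarrow> ('a \<Rightarrow> 'a) monoid"
  where "Inn Q = (BijGroup (carrier Q))
    \<lparr>carrier := generate (BijGroup (carrier Q)) (right_translation Q ` carrier Q)\<rparr>"

locale connected_quandle = quandle +
  assumes transitive: "transitive_action (Inn Q) (carrier Q) (\<lambda>g. g)"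

lemma (in quandle) right_translation_Bij:
  assumes "a \<in> carrier Q" shows "right_translation Q a \<in> Bij (carrier Q)"
proof -
  have "inj_on (\<lambda>q. q \<triangleright> a) (carrier Q)"
  proof (rule inj_onI)
    fix x y assume xy: "x \<in> carrier Q" "y \<in> carrier Q" "x \<triangleright> a = y \<triangleright> a"
    have "\<exists>!z. z \<in> carrier Q \<and> x \<triangleright> a = z \<triangleright> a"
      by (rule Q1[OF assms qop_closed[OF xy(1) assms]])
    then show "x = y" by (rule ex1E) (use xy in metis)
  qed
  moreover have "(\<lambda>q. q \<triangleright> a) ` carrier Q = carrier Q"
  proof (intro equalityI subsetI)
    fix b assume "b \<in> carrier Q"
    then have "\<exists>x. x \<in> carrier Q \<and> b = x \<triangleright> a"
      by (rule ex1_implies_ex[OF Q1[OF assms]])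
    then show "b \<in> (\<lambda>q. q \<triangleright> a) ` carrier Q" by blast
  next
    fix b assume "b \<in> (\<lambda>q. q \<triangleright> a) ` carrier Q"
    then obtain x where "x \<in> carrier Q" "b = x \<triangleright> a" by (rule imageE)
    then show "b \<in> carrier Q" using qop_closed assms by simp
  qed
  ultimately have "bij_betw (\<lambda>q. q \<triangleright> a) (carrier Q) (carrier Q)"
    unfolding bij_betw_def by (rule conjI)
  then show ?thesis
    unfolding right_translation_def Bij_def by simp
qed

lemma (in quandle) subgroup_Inn: "subgroup (carrier (Inn Q)) (BijGroup (carrier Q))"
proof -
  have "right_translation Q ` carrier Q \<subseteq> carrier (BijGroup (carrier Q))"
    using right_translation_Bij by (auto simp: BijGroup_def)
  then show ?thesis
    by (simp add: Inn_def group.generate_is_subgroup[OF group_BijGroup])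
qed

lemma (in quandle) group_action_Inn: "group_action (Inn Q) (carrier Q) (\<lambda>g. g)"
proof -
  interpret B: group "BijGroup (carrier Q)" by (rule group_BijGroup)
  have "group (Inn Q)"
    using B.subgroup_imp_group[OF subgroup_Inn] by (simp add: Inn_def)
  moreover have "carrier (Inn Q) \<subseteq> carrier (BijGroup (carrier Q))"
    using subgroup_Inn by (rule subgroup.subset)
  ultimately show ?thesis
    by (auto simp: group_action_def group_hom_def group_hom_axioms_def hom_def Inn_def
        intro: group_BijGroup)
qed

text \<open>So the homomorphism part of \<^const>\<open>transitive_action\<close> imposes nothing on a quandle.\<close>

lemma (in quandle) connected_quandle_iff:
  "connected_quandle Q \<longleftrightarrow>
    (\<forall>x \<in> carrier Q. \<forall>y \<in> carrier Q. \<exists>g \<in> carrier (Inn Q). g x = y)"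
  using group_action_Inn quandle_axioms
  by (auto simp: connected_quandle_def connected_quandle_axioms_def
      transitive_action_def transitive_action_axioms_def)


section \<open>Conjugation quandles\<close>

definition conjugacy_class :: "('a, 'm) monoid_scheme \<Rightarrow> 'a \<Rightarrow> 'a set"
  where "conjugacy_class G x = {inv\<^bsub>G\<^esub> g \<otimes>\<^bsub>G\<^esub> x \<otimes>\<^bsub>G\<^esub> g | g. g \<in> carrier G}"

definition conjugation_quandle :: "('a, 'm) monoid_scheme \<Rightarrow> 'a set \<Rightarrow> 'a quandle"
  where "conjugation_quandle G C =
    \<lparr>carrier = C, qop = \<lambda>a b. inv\<^bsub>G\<^esub> b \<otimes>\<^bsub>G\<^esub> a \<otimes>\<^bsub>G\<^esub> b\<rparr>"

text \<open>The conjugacy class of any one transposition consists of all transpositions.\<close>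

lemma conjugacy_class_transpose:
  assumes "i \<in> {1..n}" "j \<in> {1..n}" "i \<noteq> j"
  shows "conjugacy_class (sym_group n) (transpose i j) =
    {transpose k l | k l. k \<in> {1..n} \<and> l \<in> {1..n} \<and> k \<noteq> l}"
proof -
  have conj: "inv' g \<circ> transpose i j \<circ> g = transpose (inv' g i) (inv' g j)"
    if "g permutes {1..n}" for g :: "nat \<Rightarrow> nat"
  proof
    fix x
    have "x = inv' g y \<longleftrightarrow> g x = y" for y
      unfolding permutes_inv_eq[OF that, symmetric] by (rule eq_commute)
    moreover have "inv' g (g x) = x"
      by (rule permutes_inverses(2)[OF that])
    ultimately show "(inv' g \<circ> transpose i j \<circ> g) x = transpose (inv' g i) (inv' g j) x"
      by (simp only: transpose_def o_apply if_distrib[of "inv' g"])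
  qed
  have class_iff: "t \<in> conjugacy_class (sym_group n) (transpose i j) \<longleftrightarrow>
      (\<exists>g. g permutes {1..n} \<and> t = transpose (inv' g i) (inv' g j))" for t
  proof -
    have "inv\<^bsub>sym_group n\<^esub> g \<otimes>\<^bsub>sym_group n\<^esub> transpose i j \<otimes>\<^bsub>sym_group n\<^esub> g =
        transpose (inv' g i) (inv' g j)" if "g permutes {1..n}" for g
      using conj[OF that] that by (simp add: sym_group_mult sym_group_carrier)
    then show ?thesis
      unfolding conjugacy_class_def mem_Collect_eq sym_group_carrier by metis
  qed
  show ?thesis
  proof (intro equalityI subsetI)
    fix t assume "t \<in> conjugacy_class (sym_group n) (transpose i j)"
    then obtain g where g: "g permutes {1..n}" and t: "t = transpose (inv' g i) (inv' g j)"
      using class_iff by blast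
    have "inv' g i \<in> {1..n}" "inv' g j \<in> {1..n}"
      using permutes_in_image[OF permutes_inv[OF g]] assms by blast+
    moreover have "inv' g i \<noteq> inv' g j"
      using permutes_inverses(1)[OF g] assms(3) by metis
    ultimately show "t \<in> {transpose k l | k l. k \<in> {1..n} \<and> l \<in> {1..n} \<and> k \<noteq> l}"
      using t by blast
  next
    fix t assume "t \<in> {transpose k l | k l. k \<in> {1..n} \<and> l \<in> {1..n} \<and> k \<noteq> l}"
    then obtain k l where kl: "k \<in> {1..n}" "l \<in> {1..n}" "k \<noteq> l" and t: "t = transpose k l"
      by blast
    define g where "g = transpose (transpose i k l) j \<circ> transpose i k"
    have "transpose i k l \<in> {1..n}"
      using assms kl by (auto simp: transpose_def)
    then have g: "g permutes {1..n}"
      unfolding g_def using assms kl by (intro permutes_compose permutes_swap_id)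
    have "g k = i" "g l = j"
      using assms kl by (auto simp: g_def transpose_def)
    then have "inv' g i = k" "inv' g j = l"
      using permutes_inv_eq[OF g] by auto
    then show "t \<in> conjugacy_class (sym_group n) (transpose i j)"
      using class_iff g t by blast
  qed
qed

lemma (in group) quandle_conjugacy_class:
  assumes x: "x \<in> carrier G"
  shows "quandle (conjugation_quandle G (conjugacy_class G x))"
proof -
  let ?C = "conjugacy_class G x"
  have sub: "a \<in> carrier G" if "a \<in> ?C" for a
    using that x by (auto simp: conjugacy_class_def)
  have closed: "inv b \<otimes> a \<otimes> b \<in> ?C" if a: "a \<in> ?C" and b: "b \<in> carrier G" for a b
  proof -
    obtain g where "g \<in> carrier G" "a = inv g \<otimes> x \<otimes> g"
      using a by (auto simp: conjugacy_class_def)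
    then have "inv b \<otimes> a \<otimes> b = inv (g \<otimes> b) \<otimes> x \<otimes> (g \<otimes> b)" "g \<otimes> b \<in> carrier G"
      using x b by (auto simp: m_assoc inv_mult_group)
    then show ?thesis by (auto simp: conjugacy_class_def)
  qed
  have cancel: "u \<otimes> (inv u \<otimes> v) = v" "inv u \<otimes> (u \<otimes> v) = v"
    if "u \<in> carrier G" "v \<in> carrier G" for u v
    using that by (simp_all add: m_assoc[symmetric])
  show ?thesis
  proof (unfold_locales, simp_all add: conjugation_quandle_def)
    fix a b assume ab: "a \<in> ?C" "b \<in> ?C"
    show "inv b \<otimes> a \<otimes> b \<in> ?C" using ab closed sub by blast
    show "\<exists>!y. y \<in> ?C \<and> b = inv a \<otimes> y \<otimes> a"
    proof (rule ex1I[of _ "inv (inv a) \<otimes> b \<otimes> inv a"])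
      show "inv (inv a) \<otimes> b \<otimes> inv a \<in> ?C \<and> b = inv a \<otimes> (inv (inv a) \<otimes> b \<otimes> inv a) \<otimes> a"
        using closed[of b "inv a"] ab sub by (simp add: m_assoc cancel)
      show "y = inv (inv a) \<otimes> b \<otimes> inv a" if "y \<in> ?C \<and> b = inv a \<otimes> y \<otimes> a" for y
        using that ab sub by (simp add: m_assoc cancel)
    qed
  next
    fix a b c assume "a \<in> ?C" "b \<in> ?C" "c \<in> ?C"
    then show "inv c \<otimes> (inv b \<otimes> a \<otimes> b) \<otimes> c =
        inv (inv c \<otimes> b \<otimes> c) \<otimes> (inv c \<otimes> a \<otimes> c) \<otimes> (inv c \<otimes> b \<otimes> c)"
      using sub by (simp add: m_assoc inv_mult_group cancel)
  next
    fix a assume "a \<in> ?C"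
    then show "inv a \<otimes> a \<otimes> a = a" using sub by simp
  qed
qed

end

theory Submission
  imports Defs "HOL-Combinatorics.Combinatorics" "Jordan_Normal_Form.Schur_Decomposition"
begin

text \<open>Let \<open>G\<close> be the inner automorphism group. An element of order \<open>p\<close> acts freely with two orbits, so
  \<open>G\<close>-invariant matrices become families of \<open>2 \<times> 2\<close> Fourier blocks. Let \<open>\<eta>\<close> be \<open>1\<close> on one
  orbit and \<open>-1\<close> on the other. Averaging \<open>\<eta> \<eta>\<^sup>T\<close> over \<open>G\<close> shows, since \<open>p\<close>-th roots of unity satisfy
  only one relation over the rationals,
  that either all \<open>G\<close>-invariant matrices are constant off the diagonal, or there is an invariant
  symmetric matrix \<open>R\<close> with zero diagonal and \<open>R\<^sup>2 = 1\<close>. Such an \<open>R\<close> is either minus a perfect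
  matching or, up to scaling, the difference of two graphs with valencies \<open>s(2s+1)\<close> and \<open>(s+1)(2s+1)\<close>.

  Let \<open>M\<close> count the solutions \<open>a\<close> of \<open>x \<triangleright> a = y\<close>. The traces of spectral idempotents of \<open>M\<close>
  composed with a translation are algebraic integers, and this pins down the weights of \<open>M\<close> modulo
  \<open>p\<close>. As they have a bounded sum, \<open>M\<close> is constant on the relations determined by \<open>R\<close>, which leaves
  few cases. If the quandle is Latin or \<open>R\<close> is a matching, passing to the fixed points of an involution
  gives an infinite descent. Otherwise commutation is the graph of valency \<open>s(2s+1)\<close>, which is strongly regular; counting lines
  through a point forces \<open>s = 1\<close>, so the graph is the Petersen graph, and it determines the quandle.\<close>

section \<open>Permutation groups and racks\<close>

text \<open>The two orbits are linked to all of \<open>G\<close> by the fact that the sign vector is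
  a common eigenvector of every invariant matrix: such a matrix has equal row sums and equal column
  sums, and it maps the vector to one that is constant on both orbits and has sum zero. Hence
  \<open>H\<close> is a multiple of a projection \<open>P\<close> on whose image every invariant
  matrix acts as a scalar. The trace of a Fourier block of \<open>P\<close> is 0, 1 or 2, which
  leaves the ranks 1, \<open>p\<close> and \<open>2 * p - 1\<close>; rank 1 would mean an invariant
  partition into two blocks, and for rank \<open>p\<close> the matrix \<open>R\<close> is the
  reflection \<open>2 * P - 1\<close>. Each 2 by 2 block then has one known eigenvalue, so that an
  invariant matrix is controlled by one weight for each shift along the orbits. Freeness of an
  element of order \<open>p\<close> is not automatic. It rests on faithfulness of the quandle, whose
  proof needs the matrix analysis already, because pairs of points with equal translations have to
  be excluded. The descents cannot preserve the order \<open>2 * p\<close>; they preserve the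
  residue 2 modulo 4, which an even involution passes to its fixed points.\<close>

locale perm_group =
  fixes Q :: "'a set" and G :: "('a \<Rightarrow> 'a) set"
  assumes fin: "finite Q"
    and perm: "g \<in> G \<Longrightarrow> g permutes Q"
    and id_in: "id \<in> G"
    and comp_in: "g \<in> G \<Longrightarrow> h \<in> G \<Longrightarrow> g \<circ> h \<in> G"
begin

lemma fin_G: "finite G"
  by (rule finite_subset[OF _ finite_permutations[OF fin]]) (use perm in auto)

lemma power_in: "g \<in> G \<Longrightarrow> g ^^ n \<in> G"
  by (induction n) (auto simp: id_in comp_in id_def[symmetric])

lemma mem: "g \<in> G \<Longrightarrow> x \<in> Q \<Longrightarrow> g x \<in> Q"
  using perm permutes_in_image by metis

lemma inj_G: "g \<in> G \<Longrightarrow> g x = g y \<longleftrightarrow> x = y"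
  using perm permutes_inj by (metis injD)

lemma finite_order: "g \<in> G \<Longrightarrow> \<exists>n>0. g ^^ n = id"
  using permutation_is_nilpotent[of g] perm fin permutation_permutes by metis

lemma inv_in: assumes "g \<in> G" shows "inv_into UNIV g \<in> G"
proof -
  obtain n where n: "n > 0" "g ^^ n = id" using finite_order assms by blast
  have "g \<circ> g ^^ (n - 1) = id" using n by (metis Suc_diff_1 funpow.simps(2))
  moreover have "bij g" using perm[OF assms] permutes_bij by blast
  ultimately have "inv_into UNIV g = g ^^ (n - 1)"
    by (metis comp_assoc comp_id bij_is_inj id_comp inv_o_cancel)
  then show ?thesis using power_in assms by simp
qed

lemma inv_left [simp]: "g \<in> G \<Longrightarrow> inv_into UNIV g (g x) = x"
  using perm permutes_inverses by metis

lemma inv_right [simp]: "g \<in> G \<Longrightarrow> g (inv_into UNIV g x) = x"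
  using perm permutes_inverses by metis

lemma is_group: "group \<lparr>carrier = G, monoid.mult = (\<circ>), one = id\<rparr>"
proof (rule groupI)
  fix x assume "x \<in> carrier \<lparr>carrier = G, monoid.mult = (\<circ>), one = id\<rparr>"
  then have x: "x \<in> G" by simp
  have "inv_into UNIV x \<circ> x = id" using x by (auto simp: fun_eq_iff)
  then show "\<exists>y\<in>carrier \<lparr>carrier = G, monoid.mult = (\<circ>), one = id\<rparr>.
      y \<otimes>\<^bsub>\<lparr>carrier = G, monoid.mult = (\<circ>), one = id\<rparr>\<^esub> x = \<one>\<^bsub>\<lparr>carrier = G, monoid.mult = (\<circ>), one = id\<rparr>\<^esub>"
    using inv_in[OF x] by auto
qed (auto simp: id_in comp_in)

text \<open>The first Sylow theorem with exponent 1 gives a subgroup of order \<open>q\<close>, and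
  every element of it has the identity as its \<open>q\<close>-th power.\<close>

lemma cauchy:
  assumes q: "Factorial_Ring.prime q" and dvd: "q dvd card G"
  shows "\<exists>g\<in>G. g \<noteq> id \<and> g ^^ q = id"
proof -
  let ?G = "\<lparr>carrier = G, monoid.mult = (\<circ>), one = id\<rparr>"
  interpret g: group ?G by (rule is_group)
  obtain m where m: "card G = q * m" using dvd by blast
  obtain H where H: "subgroup H ?G" "card H = q"
    using sylow_thm[OF q is_group, of 1 m] m fin_G by (auto simp: Coset.order_def)
  have "card H > 1" using H q prime_gt_1_nat by auto
  have "\<exists>x\<in>H. x \<noteq> id"
  proof (rule ccontr)
    assume "\<not> ?thesis"
    then have "H \<subseteq> {id}" by blast
    then have "card H \<le> 1" by (metis card_mono finite.emptyI finite.insertI is_singletonI is_singleton_altdef)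
    then show False using \<open>card H > 1\<close> by simp
  qed
  then obtain x where x: "x \<in> H" "x \<noteq> id" by blast
  interpret h: group "?G\<lparr>carrier := H\<rparr>" using g.subgroup_imp_group[OF H(1)] .
  have "x [^]\<^bsub>?G\<lparr>carrier := H\<rparr>\<^esub> q = \<one>\<^bsub>?G\<lparr>carrier := H\<rparr>\<^esub>"
    using h.pow_order_eq_1[of x] x H by (simp add: Coset.order_def)
  moreover have "x [^]\<^bsub>?G\<lparr>carrier := H\<rparr>\<^esub> (k::nat) = x ^^ k" for k
    by (induction k) (auto simp: funpow_swap1 fun_eq_iff nat_pow_def)
  ultimately have "x ^^ q = id" by simp
  then show ?thesis using x H(1) subgroup.subset[OF H(1)] by auto
qed

lemma orbit_stabilizer:
  assumes trans: "\<forall>y\<in>Q. \<exists>g\<in>G. g x = y" and x: "x \<in> Q"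
  shows "card G = card Q * card {g\<in>G. g x = x}"
proof -
  have "card G = (\<Sum>y\<in>Q. card {g\<in>G. g x = y})"
  proof -
    have "G = (\<Union>y\<in>Q. {g\<in>G. g x = y})" using x mem by blast
    then have "card G = card (\<Union>y\<in>Q. {g\<in>G. g x = y})" by simp
    also have "\<dots> = (\<Sum>y\<in>Q. card {g\<in>G. g x = y})"
      by (rule card_UN_disjoint) (use fin fin_G in auto)
    finally show ?thesis .
  qed
  also have "\<dots> = (\<Sum>y\<in>Q. card {g\<in>G. g x = x})"
  proof (rule sum.cong[OF refl])
    fix y assume "y \<in> Q"
    then obtain t where t: "t \<in> G" "t x = y" using trans by blast
    have "bij_betw (\<lambda>g. t \<circ> g) {g\<in>G. g x = x} {g\<in>G. g x = y}"
    proof (rule bij_betw_byWitness[where f' = "\<lambda>g. inv_into UNIV t \<circ> g"])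
      have "inv_into UNIV t y = x" using t by auto
      then show "(\<lambda>g. inv_into UNIV t \<circ> g) ` {g\<in>G. g x = y} \<subseteq> {g\<in>G. g x = x}"
        using t inv_in comp_in by auto
    qed (use t comp_in in \<open>auto simp: fun_eq_iff\<close>)
    then show "card {g\<in>G. g x = y} = card {g\<in>G. g x = x}" by (simp add: bij_betw_same_card)
  qed
  finally show ?thesis by simp
qed

lemma reindex_left:
  assumes "h \<in> G" shows "(\<Sum>g\<in>G. f (g \<circ> h)) = (\<Sum>g\<in>G. f g)"
proof (rule sum.reindex_bij_witness[where i = "\<lambda>g. g \<circ> inv_into UNIV h" and j = "\<lambda>g. g \<circ> h"])
qed (use assms comp_in inv_in in \<open>auto simp: fun_eq_iff\<close>)

lemma sum_image: assumes "h \<in> G" shows "(\<Sum>x\<in>Q. f (h x)) = (\<Sum>x\<in>Q. f x)"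
  using sum.permute[OF perm[OF assms], of f] by (simp add: o_def)

end

text \<open>Inverses are absent from the rules: in a finite permutation group they are powers, so
  the generated monoid is already the generated group.\<close>

inductive_set gen :: "('a \<Rightarrow> 'a) set \<Rightarrow> ('a \<Rightarrow> 'a) set" for S where
  gen_id: "id \<in> gen S"
| gen_step: "s \<in> S \<Longrightarrow> g \<in> gen S \<Longrightarrow> s \<circ> g \<in> gen S"

lemma gen_comp: "g \<in> gen S \<Longrightarrow> h \<in> gen S \<Longrightarrow> g \<circ> h \<in> gen S"
  by (induction rule: gen.induct) (auto simp: comp_assoc intro: gen.intros)

lemma gen_base: "s \<in> S \<Longrightarrow> s \<in> gen S"
  using gen_step[OF _ gen_id] by fastforce

lemma perm_group_gen:
  assumes "finite Q" "\<And>s. s \<in> S \<Longrightarrow> s permutes Q"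
  shows "perm_group Q (gen S)"
proof
  fix g assume "g \<in> gen S"
  then show "g permutes Q"
    by induction (use assms permutes_compose permutes_id in \<open>auto simp del: id_apply o_apply\<close>)
qed (use assms gen_comp gen_id in auto)

text \<open>Splitting off the transposition of \<open>x\<close> and \<open>f x\<close> leaves an
  involution with two moved points fewer, and each removal flips the sign.\<close>

lemma sign_involution:
  assumes "finite Y" "f permutes Y" "f \<circ> f = id"
  shows "\<exists>m. card {x\<in>Y. f x \<noteq> x} = 2 * m \<and> sign f = (-1) ^ m"
  using assms(2,3)
proof (induction "card {x\<in>Y. f x \<noteq> x}" arbitrary: f rule: less_induct)
  case less
  show ?case
  proof (cases "{x\<in>Y. f x \<noteq> x} = {}")
    case True
    then have "f = id" using less.prems(1) by (auto simp: fun_eq_iff permutes_def)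
    then show ?thesis using True by (intro exI[of _ 0]) (auto simp: sign_id)
  next
    case False
    then obtain x where x: "x \<in> Y" "f x \<noteq> x" by blast
    have inv: "f (f y) = y" for y using less.prems(2) by (metis comp_apply id_apply)
    define h where "h = transpose x (f x) \<circ> f"
    have fx: "f x \<in> Y" using less.prems(1) x permutes_in_image by metis
    have hp: "h permutes Y" unfolding h_def
      by (intro permutes_compose less.prems permutes_swap_id x fx)
    have hv: "h y = (if y = x then x else if y = f x then f x else f y)" for y
      using inv by (auto simp: h_def transpose_def) metis+
    have hh: "h \<circ> h = id" using inv by (auto simp: fun_eq_iff hv) metis+
    have set: "{y\<in>Y. f y \<noteq> y} = insert x (insert (f x) {y\<in>Y. h y \<noteq> y})"
      using x fx inv by (auto simp: hv)
    have "x \<notin> insert (f x) {y\<in>Y. h y \<noteq> y}" "f x \<notin> {y\<in>Y. h y \<noteq> y}"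
      using x by (auto simp: hv)
    moreover have "finite {y\<in>Y. h y \<noteq> y}" using assms(1) by simp
    ultimately have c: "card {y\<in>Y. f y \<noteq> y} = 2 + card {y\<in>Y. h y \<noteq> y}"
      unfolding set by simp
    then obtain m where m: "card {y\<in>Y. h y \<noteq> y} = 2 * m" "sign h = (-1) ^ m"
      using less.hyps[of h] hp hh by auto
    have pf: "permutation f" "permutation h"
      using less.prems(1) hp assms(1) permutation_permutes by blast+
    have "f = transpose x (f x) \<circ> h" by (auto simp: h_def fun_eq_iff)
    then have "sign f = sign (transpose x (f x)) * sign h"
      using pf by (metis permutation_swap_id sign_compose)
    then have "sign f = (-1) ^ (Suc m)" using x m by (simp add: sign_swap_id)
    then show ?thesis using c m by (intro exI[of _ "Suc m"]) auto
  qed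
qed

text \<open>An even involution is a product of an even number of disjoint transpositions, so the
  number of moved points is a multiple of 4. This is the invariant carried by both descents.\<close>

lemma even_involution_fix:
  assumes "finite Y" "f permutes Y" "f \<circ> f = id" "sign f = 1" "card Y mod 4 = 2"
  shows "card {x\<in>Y. f x = x} mod 4 = 2"
proof -
  obtain m where m: "card {x\<in>Y. f x \<noteq> x} = 2 * m" "sign f = (-1) ^ m"
    using sign_involution assms by blast
  have "even m" using m(2) assms(4) by (cases "even m") auto
  then obtain l where "m = 2 * l" by blast
  moreover have "card Y = card {x\<in>Y. f x = x} + card {x\<in>Y. f x \<noteq> x}"
    by (subst card_Un_disjoint[symmetric]) (use assms(1) in \<open>auto intro: arg_cong[where f = card]\<close>)
  ultimately show ?thesis using m assms(5) by presburger
qed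

text \<open>A permutation in the sense of \<open>permutes\<close> is the identity outside
  \<open>Y\<close>, while a translation has arbitrary values there.\<close>

definition restr :: "'a set \<Rightarrow> ('a \<Rightarrow> 'a) \<Rightarrow> 'a \<Rightarrow> 'a"
  where "restr Y f = (\<lambda>x. if x \<in> Y then f x else x)"

lemma restr_permutes:
  assumes "finite Y" "\<And>x. x \<in> Y \<Longrightarrow> f x \<in> Y" "inj_on f Y"
  shows "restr Y f permutes Y"
proof (rule bij_imp_permutes)
  have "f ` Y = Y" using assms by (intro endo_inj_surj) auto
  then have "bij_betw f Y Y" using assms(3) by (simp add: bij_betw_def)
  moreover have "bij_betw (restr Y f) Y Y \<longleftrightarrow> bij_betw f Y Y"
    by (rule bij_betw_cong) (simp add: restr_def)
  ultimately show "bij_betw (restr Y f) Y Y" by blast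
qed (simp add: restr_def)

lemma even_card_fixpoint_free:
  assumes "finite S" "\<And>x. x \<in> S \<Longrightarrow> f x \<in> S" "\<And>x. x \<in> S \<Longrightarrow> f (f x) = x" "\<And>x. x \<in> S \<Longrightarrow> f x \<noteq> x"
  shows "even (card S)"
proof -
  have "inj_on f S" using assms(3) by (rule inj_on_inverseI)
  then have "restr S f permutes S" using assms by (intro restr_permutes)
  moreover have "restr S f \<circ> restr S f = id" using assms by (auto simp: restr_def fun_eq_iff)
  moreover have "{x \<in> S. restr S f x \<noteq> x} = S" using assms by (auto simp: restr_def)
  ultimately show ?thesis using sign_involution[OF assms(1)] by fastforce
qed

context perm_group
begin

lemma even_card_involution:
  assumes j: "j \<in> G" "j \<noteq> id" "j \<circ> j = id"
  shows "even (card G)"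
proof (rule even_card_fixpoint_free[where f = "\<lambda>h. j \<circ> h"])
  show "j \<circ> (j \<circ> h) = h" for h using j(3) by (metis comp_assoc id_comp)
  show "j \<circ> h \<noteq> h" if "h \<in> G" for h
  proof
    assume "j \<circ> h = h"
    then have "j \<circ> (h \<circ> inv_into UNIV h) = h \<circ> inv_into UNIV h" by (metis comp_assoc)
    moreover have "h \<circ> inv_into UNIV h = id" using inv_right[OF that] by (simp add: fun_eq_iff)
    ultimately show False using j(2) by simp
  qed
qed (use fin_G j comp_in in simp_all)

text \<open>Inversion pairs off the elements whose square is not the identity. Hence the involutions
  together with the identity have the parity of \<open>card G\<close>, which is even.\<close>

lemma odd_card_involutions:
  assumes j: "j \<in> G" "j \<noteq> id" "j \<circ> j = id"
  shows "odd (card {g\<in>G. g \<noteq> id \<and> g \<circ> g = id})"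
proof -
  let ?J = "{g\<in>G. g \<noteq> id \<and> g \<circ> g = id}" and ?N = "{g\<in>G. g \<circ> g \<noteq> id}"
  have "even (card ?N)"
  proof (rule even_card_fixpoint_free[where f = "\<lambda>h. inv_into UNIV h"])
    fix h assume "h \<in> ?N"
    then have h: "h \<in> G" "h \<circ> h \<noteq> id" by simp_all
    have eq: "h \<circ> inv_into UNIV h = id" "inv_into UNIV h \<circ> h = id"
      using inv_right[OF h(1)] inv_left[OF h(1)] by (simp_all add: fun_eq_iff)
    show "inv_into UNIV (inv_into UNIV h) = h" by (rule inv_unique_comp[OF eq(2) eq(1)])
    show "inv_into UNIV h \<noteq> h"
    proof
      assume "inv_into UNIV h = h" then show False using eq(1) h(2) by metis
    qed
    have "inv_into UNIV h \<circ> inv_into UNIV h \<noteq> id"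
    proof
      assume "inv_into UNIV h \<circ> inv_into UNIV h = id"
      then have "h (h x) = x" for x
        using inv_left[OF h(1)] by (metis comp_apply id_apply)
      then show False using h(2) by (simp add: fun_eq_iff)
    qed
    then show "inv_into UNIV h \<in> ?N" using inv_in[OF h(1)] by simp
  qed (use fin_G in simp)
  moreover have "card G = Suc (card ?J + card ?N)"
  proof -
    have "G = insert id (?J \<union> ?N)" using id_in by auto
    moreover have "card (insert id (?J \<union> ?N)) = Suc (card (?J \<union> ?N))"
      by (rule card_insert_disjoint) (use fin_G in auto)
    moreover have "card (?J \<union> ?N) = card ?J + card ?N"
      by (rule card_Un_disjoint) (use fin_G in auto)
    ultimately show ?thesis by simp
  qed
  ultimately show ?thesis using even_card_involution[OF j] by simp
qed

end

section \<open>Finite quandles and their inner groups\<close>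

lemma ex1D: "\<exists>!u. P u \<Longrightarrow> P u \<Longrightarrow> P v \<Longrightarrow> u = v"
  by blast

text \<open>The value \<open>r a x\<close> stands for \<open>x \<triangleright> a\<close>.\<close>

locale finite_rack =
  fixes Y :: "'a set" and r :: "'a \<Rightarrow> 'a \<Rightarrow> 'a"
  assumes finY: "finite Y"
    and r_closed: "a \<in> Y \<Longrightarrow> x \<in> Y \<Longrightarrow> r a x \<in> Y"
    and r_inj: "a \<in> Y \<Longrightarrow> inj_on (r a) Y"
    and r_distr: "a \<in> Y \<Longrightarrow> x \<in> Y \<Longrightarrow> y \<in> Y \<Longrightarrow> r a (r x y) = r (r a x) (r a y)"
    and r_idem: "a \<in> Y \<Longrightarrow> r a a = a"
begin

definition R :: "'a \<Rightarrow> 'a \<Rightarrow> 'a" where "R a = restr Y (r a)"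

definition I :: "('a \<Rightarrow> 'a) set" where "I = gen (R ` Y)"

lemma R_permutes: "a \<in> Y \<Longrightarrow> R a permutes Y"
  unfolding R_def by (rule restr_permutes) (use finY r_closed r_inj in auto)

lemma R_apply [simp]: "x \<in> Y \<Longrightarrow> R a x = r a x"
  by (simp add: R_def restr_def)

sublocale perm_group Y I
  unfolding I_def by (rule perm_group_gen) (use finY R_permutes in auto)

lemma R_in: "a \<in> Y \<Longrightarrow> R a \<in> I"
  unfolding I_def by (rule gen_base) simp

lemma aut:
  assumes "g \<in> I" "x \<in> Y" "y \<in> Y" shows "g (r x y) = r (g x) (g y)"
  using assms(1) unfolding I_def
proof induction
  case (gen_step s g)
  then obtain a where a: "a \<in> Y" "s = R a" by blast
  have g: "g \<in> I" using gen_step(2) by (simp add: I_def)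
  have "g x \<in> Y" "g y \<in> Y" by (rule mem[OF g assms(2)], rule mem[OF g assms(3)])
  then show ?case using gen_step(3) a r_distr[of a "g x" "g y"] r_closed assms by simp
qed simp

text \<open>An automorphism transports the translation by \<open>x\<close> to the translation by
  \<open>g x\<close>; this is what makes all translations conjugate once \<open>I\<close> is
  transitive.\<close>

lemma R_conj: assumes "g \<in> I" "x \<in> Y" shows "R (g x) \<circ> g = g \<circ> R x"
proof
  fix y show "(R (g x) \<circ> g) y = (g \<circ> R x) y"
  proof (cases "y \<in> Y")
    case False
    then have "g y = y" using perm[OF assms(1)] by (simp add: permutes_def)
    then show ?thesis using False by (simp add: R_def restr_def)
  qed (use assms aut[OF assms(1,2)] mem[OF assms(1)] r_closed in simp)
qed

lemma restrict_subset:
  assumes "Z \<subseteq> Y" "\<And>a x. a \<in> Z \<Longrightarrow> x \<in> Z \<Longrightarrow> r a x \<in> Z"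
  shows "finite_rack Z r"
proof
  show "finite Z" using finite_subset[OF assms(1) finY] .
  show "inj_on (r a) Z" if "a \<in> Z" for a
    using inj_on_subset[OF r_inj assms(1)] that assms(1) by blast
  show "r a (r x y) = r (r a x) (r a y)" if "a \<in> Z" "x \<in> Z" "y \<in> Z" for a x y
    by (rule r_distr) (use that assms(1) in blast)+
  show "r a a = a" if "a \<in> Z" for a
    by (rule r_idem) (use that assms(1) in blast)
qed (rule assms(2))

lemma fix_rack: "g \<in> I \<Longrightarrow> finite_rack {x\<in>Y. g x = x} r"
  using r_closed aut[of g] by (intro restrict_subset) auto

end

section \<open>Descent along fixed points of involutions\<close>

text \<open>In the Latin case any two translations are conjugate and have the same sign, so products
  of two of them are even, and these products are already transitive. Therefore an even involution
  exists, and its fixed points form a smaller Latin quandle whose order is again 2 modulo 4.\<close>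

theorem no_latin_quandle:
  assumes "finite_rack Y r" "card Y mod 4 = 2"
    and "\<And>a b. a \<in> Y \<Longrightarrow> b \<in> Y \<Longrightarrow> \<exists>!u. u \<in> Y \<and> r u a = b"
  shows False
  using assms
proof (induction "card Y" arbitrary: Y rule: less_induct)
  case less
  interpret finite_rack Y r by fact
  define E where "E = {g\<in>I. sign g = 1}"
  have pm: "permutation g" if "g \<in> I" for g using perm[OF that] finY permutation_permutes by blast
  interpret E: perm_group Y E
    by unfold_locales (auto simp: E_def finY perm id_in comp_in sign_compose pm)
  have same_sign: "sign (R u) = sign (R a)" if ua: "u \<in> Y" "a \<in> Y" for u a
  proof -
    obtain w where w: "w \<in> Y" "r w u = a" using ex1_implies_ex[OF less.prems(3)[OF ua]] by blast
    have "R (R w u) \<circ> R w = R w \<circ> R u" by (rule R_conj[OF R_in[OF w(1)] ua(1)])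
    then have "sign (R a \<circ> R w) = sign (R w \<circ> R u)" using w ua by simp
    then have "sign (R a) * sign (R w) = sign (R w) * sign (R u)"
      unfolding sign_compose[OF pm[OF R_in[OF ua(2)]] pm[OF R_in[OF w(1)]]]
        sign_compose[OF pm[OF R_in[OF w(1)]] pm[OF R_in[OF ua(1)]]] .
    then show ?thesis by (cases rule: sign_cases[of "R w"]) simp_all
  qed
  have trans: "\<forall>b\<in>Y. \<exists>g\<in>E. g a = b" if a: "a \<in> Y" for a
  proof
    fix b assume "b \<in> Y"
    then obtain u where u: "u \<in> Y" "r u a = b" using ex1_implies_ex[OF less.prems(3)[OF a]] by blast
    have "(R u \<circ> R a) a = b" using u a r_idem by simp
    moreover have "sign (R u \<circ> R a) = 1"
      unfolding sign_compose[OF pm[OF R_in[OF u(1)]] pm[OF R_in[OF a]]] same_sign[OF u(1) a]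
      by (cases rule: sign_cases[of "R a"]) simp_all
    ultimately have "R u \<circ> R a \<in> E" "(R u \<circ> R a) a = b"
      using R_in u a comp_in by (auto simp: E_def)
    then show "\<exists>g\<in>E. g a = b" by blast
  qed
  have "Y \<noteq> {}" using less.prems(2) by auto
  then obtain a where a: "a \<in> Y" by blast
  have "even (card Y)" using less.prems(2) by presburger
  then have "2 dvd card E" using E.orbit_stabilizer[OF trans[OF a] a] by simp
  then obtain j where j: "j \<in> E" "j \<noteq> id" "j ^^ 2 = id" using E.cauchy[of 2] by auto
  have jj: "j \<circ> j = id" using j(3) by (simp add: numeral_2_eq_2)
  have jI: "j \<in> I" "sign j = 1" using j by (auto simp: E_def)
  let ?F = "{x\<in>Y. j x = x}"
  have F2: "card ?F mod 4 = 2"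
    by (rule even_involution_fix) (use finY perm jI jj less.prems(2) in auto)
  have "?F \<noteq> Y"
  proof
    assume "?F = Y"
    then have "j x = x" for x using perm[OF jI(1)] by (cases "x \<in> Y") (auto simp: permutes_def)
    then show False using j(2) by auto
  qed
  then have lt: "card ?F < card Y" using finY by (intro psubset_card_mono) auto
  \<comment> \<open>The solution \<open>u\<close> found in \<open>Y\<close> is fixed by
    \<open>j\<close>, since \<open>j u\<close> solves the same equation.\<close>
  have "\<exists>!u. u \<in> ?F \<and> r u a = b" if ab: "a \<in> ?F" "b \<in> ?F" for a b
  proof -
    have abY: "a \<in> Y" "b \<in> Y" using ab by auto
    have ex: "\<exists>!u. u \<in> Y \<and> r u a = b" by (rule less.prems(3)[OF abY])
    obtain u where u: "u \<in> Y" "r u a = b" using ex1_implies_ex[OF ex] by blast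
    have uniq: "v = u" if "v \<in> Y" "r v a = b" for v
      by (rule ex1D[OF ex]) (simp_all add: u that)
    have "r (j u) a = b" using aut[OF jI(1) u(1) abY(1)] u ab by simp
    then have "j u = u" by (rule uniq[OF mem[OF jI(1) u(1)]])
    then have "u \<in> ?F \<and> r u a = b" using u by simp
    then show ?thesis
    proof (rule ex1I)
      show "v = u" if "v \<in> ?F \<and> r v a = b" for v by (rule uniq) (use that in simp_all)
    qed
  qed
  from less.hyps[OF lt fix_rack[OF jI(1)] F2 this] show False .
qed

text \<open>This structure is what a faithful quandle becomes when \<open>R\<close> is minus the matching \<open>s\<close>; unlike
  the order condition \<open>2p\<close>, it passes to the fixed points of inner automorphisms.\<close>

locale star_rack = finite_rack Y r for Y :: "'a set" and r :: "'a \<Rightarrow> 'a \<Rightarrow> 'a" +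
  fixes s :: "'a \<Rightarrow> 'a" and n :: nat
  assumes s_closed: "x \<in> Y \<Longrightarrow> s x \<in> Y"
    and s_s: "x \<in> Y \<Longrightarrow> s (s x) = x"
    and s_ne: "x \<in> Y \<Longrightarrow> s x \<noteq> x"
    and s_comm: "a \<in> Y \<Longrightarrow> x \<in> Y \<Longrightarrow> r a (s x) = s (r a x)"
    and s_inverse: "a \<in> Y \<Longrightarrow> x \<in> Y \<Longrightarrow> r (s a) (r a x) = x"
    and odd_n: "odd n"
    and r_pow: "a \<in> Y \<Longrightarrow> x \<in> Y \<Longrightarrow> (r a ^^ n) x = x"
    and move: "x \<in> Y \<Longrightarrow> y \<in> Y \<Longrightarrow> y \<noteq> x \<Longrightarrow> y \<noteq> s x \<Longrightarrow> \<exists>!u. u \<in> Y \<and> r u x = y"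
begin

lemma move_ex:
  assumes "x \<in> Y" "y \<in> Y" "y \<noteq> x" "y \<noteq> s x" obtains u where "u \<in> Y" "r u x = y"
  using ex1_implies_ex[OF move[OF assms]] that by (elim exE conjE)

lemma move_unique:
  "\<lbrakk>x \<in> Y; u \<in> Y; v \<in> Y; r u x = r v x; r u x \<noteq> x; r u x \<noteq> s x\<rbrakk> \<Longrightarrow> u = v"
  by (rule ex1D[OF move[of x "r u x"]]) (simp_all add: r_closed)

lemma aut_s: assumes "g \<in> I" "x \<in> Y" shows "g (s x) = s (g x)"
  using assms(1) unfolding I_def
proof induction
  case (gen_step t g)
  then obtain a where a: "a \<in> Y" "t = R a" by blast
  have g: "g \<in> I" using gen_step(2) by (simp add: I_def)
  have "g x \<in> Y" by (rule mem[OF g assms(2)])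
  then show ?case using gen_step a s_closed s_comm assms by simp
qed simp

lemma R_pow: "a \<in> Y \<Longrightarrow> R a ^^ n = id"
proof
  fix x assume a: "a \<in> Y"
  have "(R a ^^ k) x = (if x \<in> Y then (r a ^^ k) x else x) \<and> (x \<in> Y \<longrightarrow> (r a ^^ k) x \<in> Y)" for k
  proof (induction k)
    case (Suc k)
    then show ?case using r_closed[OF a] by (cases "x \<in> Y") (simp_all add: R_def restr_def)
  qed simp
  then show "(R a ^^ n) x = id x" using r_pow[OF a, of x] by (cases "x \<in> Y") simp_all
qed

text \<open>Translations have odd period \<open>n\<close>, so their sign has \<open>n\<close>-th
  power 1 and is 1.\<close>

lemma sign_I: assumes "g \<in> I" shows "sign g = 1"
  using assms unfolding I_def
proof induction
  case (gen_step t g)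
  then obtain a where a: "a \<in> Y" "t = R a" by blast
  have "g \<in> I" using gen_step(2) by (simp add: I_def)
  then have p: "permutation (R a)" "permutation g"
    using R_permutes[OF a(1)] perm finY permutation_permutes by blast+
  have "sign (R a ^^ k) = sign (R a) ^ k" for k
  proof (induction k)
    case (Suc k)
    have "R a ^^ k \<in> I" using power_in R_in a(1) by blast
    then have "permutation (R a ^^ k)" using perm finY permutation_permutes by blast
    then have "sign (R a \<circ> R a ^^ k) = sign (R a) * sign (R a ^^ k)" by (rule sign_compose[OF p(1)])
    then show ?case by (simp only: funpow.simps(2) Suc power_Suc)
  qed (simp add: sign_id)
  then have "sign (R a) ^ n = 1" using R_pow[OF a(1)] by (metis sign_id)
  then have "sign (R a) = 1" using odd_n by (cases rule: sign_cases[of "R a"]) simp_all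
  moreover have "sign (R a \<circ> g) = sign (R a) * sign g" by (rule sign_compose[OF p])
  ultimately show ?case using gen_step(3) a(2) by (simp only: mult_1)
qed (simp add: sign_id)

text \<open>The one existence condition is \<open>move\<close>, and its solution is fixed by
  \<open>g\<close> because it is unique.\<close>

lemma fix_star_rack: assumes g: "g \<in> I" shows "star_rack {x\<in>Y. g x = x} r s n"
proof -
  show ?thesis
  proof (intro star_rack.intro star_rack_axioms.intro)
    show "finite_rack {x\<in>Y. g x = x} r" by (rule fix_rack[OF g])
    show "odd n" by (rule odd_n)
    fix x assume "x \<in> {x\<in>Y. g x = x}"
    then have x: "x \<in> Y" "g x = x" by auto
    show "s x \<in> {x\<in>Y. g x = x}" using s_closed[OF x(1)] aut_s[OF g x(1)] x(2) by simp
    show "s (s x) = x" "s x \<noteq> x" using s_s[OF x(1)] s_ne[OF x(1)] by auto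
    {
      fix a assume "a \<in> {x\<in>Y. g x = x}"
      then have a: "a \<in> Y" by simp
      show "r a (s x) = s (r a x)" by (rule s_comm[OF a x(1)])
      show "r (s a) (r a x) = x" by (rule s_inverse[OF a x(1)])
      show "(r a ^^ n) x = x" by (rule r_pow[OF a x(1)])
    }
    fix y assume "y \<in> {x\<in>Y. g x = x}" and ne: "y \<noteq> x" "y \<noteq> s x"
    then have y: "y \<in> Y" "g y = y" by auto
    obtain u where u: "u \<in> Y" "r u x = y" using move_ex[OF x(1) y(1) ne] by blast
    have "r (g u) x = y" using aut[OF g u(1) x(1)] u x y by simp
    then have "g u = u"
      using move_unique[OF x(1) u(1) mem[OF g u(1)]] u ne by simp
    then have "u \<in> {x\<in>Y. g x = x} \<and> r u x = y" using u by simp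
    moreover have "v = u" if "v \<in> {x\<in>Y. g x = x} \<and> r v x = y" for v
      using move_unique[OF x(1) _ u(1), of v] that u ne by simp
    ultimately show "\<exists>!u. u \<in> {x\<in>Y. g x = x} \<and> r u x = y" by (rule ex1I)
  qed
qed

end

text \<open>In a minimal counterexample a nontrivial involution of \<open>I\<close> that fixes
  \<open>x\<close> fixes only \<open>x\<close> and \<open>s x\<close>, because its fixed points form
  a smaller structure of the same kind. The contradiction arises from two commuting involutions
  \<open>t\<close> and \<open>j\<close> with \<open>t a = s a\<close> and
  \<open>j a = a\<close>.\<close>

theorem star_rack_card:
  assumes "star_rack Y r s n" "card Y mod 4 = 2"
  shows "card Y = 2"
  using assms
proof (induction "card Y" arbitrary: Y rule: less_induct)
  case less
  interpret star_rack Y r s n by fact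
  show ?case
  proof (rule ccontr)
    assume ne2: "card Y \<noteq> 2"
    have "Y \<noteq> {}" using less.prems(2) by auto
    then obtain a0 where a0: "a0 \<in> Y" by blast
    have ex_third: "\<exists>c\<in>Y. c \<noteq> a \<and> c \<noteq> s a" if "a \<in> Y" for a
    proof (rule ccontr)
      assume "\<not> ?thesis"
      then have "Y = {a, s a}" using that s_closed by blast
      then show False using ne2 s_ne[OF that] by (metis card_2_iff)
    qed
    have trans: "\<forall>b\<in>Y. \<exists>g\<in>I. g a = b" if a: "a \<in> Y" for a
    proof
      fix b assume b: "b \<in> Y"
      consider "b = a" | "b = s a" | "b \<noteq> a" "b \<noteq> s a" by blast
      then show "\<exists>g\<in>I. g a = b"
      proof cases
        case 1 then show ?thesis using id_in by (metis id_apply)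
      next
        case 2
        obtain c where c: "c \<in> Y" "c \<noteq> a" "c \<noteq> s a" using ex_third a by blast
        obtain u where u: "u \<in> Y" "r u a = c" using move_ex[OF a c(1)] c by blast
        have "b \<noteq> c" "b \<noteq> s c" using c 2 s_s a by metis+
        then obtain v where v: "v \<in> Y" "r v c = b" using move_ex[OF c(1) b] by blast
        have "(R v \<circ> R u) a = b" using u v a c by simp
        then show ?thesis using comp_in R_in u v by metis
      next
        case 3
        then obtain u where "u \<in> Y" "r u a = b" using move_ex[OF a b] by blast
        then show ?thesis using R_in a by (metis R_apply)
      qed
    qed
    have fix_inv: "{x\<in>Y. j x = x} = {x, s x}"
      if j: "j \<in> I" "j \<noteq> id" "j \<circ> j = id" and x: "x \<in> Y" "j x = x" for j x
    proof -
      let ?F = "{x\<in>Y. j x = x}"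
      have F2: "card ?F mod 4 = 2"
        by (rule even_involution_fix) (use finY perm j sign_I less.prems in auto)
      have "?F \<noteq> Y"
      proof
        assume "?F = Y"
        then have "j x = x" for x using perm[OF j(1)] by (cases "x \<in> Y") (auto simp: permutes_def)
        then show False using j(2) by auto
      qed
      then have "card ?F < card Y" using finY by (intro psubset_card_mono) auto
      then have "card ?F = 2" using less.hyps[of ?F] fix_star_rack[OF j(1)] F2 by blast
      moreover have "{x, s x} \<subseteq> ?F" using x s_closed aut_s[OF j(1)] by auto
      moreover have "card {x, s x} = 2" using s_ne[OF x(1)] by (metis card_2_iff)
      moreover have "finite ?F" using finY by simp
      ultimately show ?thesis by (metis (no_types, lifting) card_subset_eq)
    qed
    have ex_fix: "\<exists>x\<in>Y. j x = x" if j: "j \<in> I" "j \<circ> j = id" for j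
    proof -
      have "card {x\<in>Y. j x = x} mod 4 = 2"
        by (rule even_involution_fix) (use finY perm j sign_I less.prems in auto)
      then show ?thesis by (metis (mono_tags, lifting) Collect_empty_eq card.empty mod_0 zero_neq_numeral)
    qed
    have "even (card Y)" using less.prems(2) by presburger
    then have "2 dvd card I" using orbit_stabilizer[OF trans[OF a0] a0] by simp
    then obtain t where t: "t \<in> I" "t \<noteq> id" "t ^^ 2 = id" using cauchy[of 2] by auto
    have tt: "t (t x) = x" for x using t(3) by (metis comp_apply eq_id_iff funpow_0 funpow_Suc_right id_apply numeral_2_eq_2)
    have tto: "t \<circ> t = id" using tt by auto
    \<comment> \<open>If \<open>t x\<close> is neither \<open>x\<close> nor \<open>s x\<close>, the
      point \<open>u\<close> that moves \<open>x\<close> to \<open>t x\<close> will do: both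
      \<open>t u\<close> and \<open>s u\<close> move \<open>t x\<close> back to \<open>x\<close>, so
      they agree.\<close>
    have "\<exists>a\<in>Y. t a = s a"
    proof -
      obtain x0 where x0: "x0 \<in> Y" "t x0 = x0" using ex_fix t tto by blast
      obtain x where x: "x \<in> Y" "x \<noteq> x0" "x \<noteq> s x0" using ex_third x0 by blast
      then have tx: "t x \<noteq> x" using fix_inv[OF t(1,2) tto x0] by blast
      show ?thesis
      proof (cases "t x = s x")
        case False
        have tY: "t x \<in> Y" using mem[OF t(1) x(1)] .
        obtain u where u: "u \<in> Y" "r u x = t x" using move_ex[OF x(1) tY] tx False by blast
        have "r (t u) (t x) = x" using aut[OF t(1) u(1) x(1)] u tt[of x] by simp
        moreover have "r (s u) (t x) = x" using s_inverse[OF u(1) x(1)] u by simp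
        moreover have "x \<noteq> t x" "x \<noteq> s (t x)" using tx False s_s[OF tY] by metis+
        ultimately have "t u = s u"
          using move_unique[of "t x" "t u" "s u"] tY mem[OF t(1) u(1)] u s_closed by simp
        then show ?thesis using u by blast
      qed (use x in blast)
    qed
    then obtain a where a: "a \<in> Y" "t a = s a" by blast
    have tsa: "t (s a) = a" using tt a by metis
    define J where "J = {j\<in>I. j a = a \<and> j \<noteq> id \<and> j \<circ> j = id}"
    have "finite J" using fin_G by (auto simp: J_def)
    \<comment> \<open>A conjugate of \<open>t\<close> fixes \<open>a\<close>, so the stabilizer of
      \<open>a\<close> contains an involution and hence an odd number of them.\<close>
    have "odd (card J)"
    proof -
      define H where "H = {g\<in>I. g a = a}"
      interpret H: perm_group Y H
        by unfold_locales (auto simp: H_def finY perm id_in comp_in)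
      obtain x0 where x0: "x0 \<in> Y" "t x0 = x0" using ex_fix t tto by blast
      obtain g where g: "g \<in> I" "g x0 = a" using trans[OF x0(1)] a by blast
      let ?j = "g \<circ> t \<circ> inv_into UNIV g"
      have gi: "inv_into UNIV g a = x0" using g inv_left by metis
      have jH: "?j \<in> H" using g t inv_in[OF g(1)] comp_in gi x0 by (auto simp: H_def)
      have jne: "?j \<noteq> id"
      proof
        assume "?j = id"
        then have "g (t (inv_into UNIV g (g x))) = g x" for x by (metis comp_apply id_apply)
        then have "t x = x" for x using g inj_G by (metis inv_left)
        then show False using t(2) by auto
      qed
      have jj: "?j \<circ> ?j = id" using g tt by (auto simp: fun_eq_iff)
      have "odd (card {h\<in>H. h \<noteq> id \<and> h \<circ> h = id})"
        by (rule H.odd_card_involutions[OF jH jne jj])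
      moreover have "J = {h\<in>H. h \<noteq> id \<and> h \<circ> h = id}" by (auto simp: J_def H_def)
      ultimately show ?thesis by simp
    qed
    \<comment> \<open>Conjugation by \<open>t\<close> preserves \<open>J\<close>, as
      \<open>t\<close> swaps \<open>a\<close> and \<open>s a\<close> and every member of
      \<open>J\<close> fixes both; an involution on a set of odd size has a fixed point.\<close>
    have "\<exists>j\<in>J. t \<circ> j \<circ> t = j"
    proof (rule ccontr)
      assume no: "\<not> ?thesis"
      have "even (card J)"
      proof (rule even_card_fixpoint_free[where f = "\<lambda>j. t \<circ> j \<circ> t"])
        fix j assume j: "j \<in> J"
        then have jI: "j \<in> I" "j a = a" "j \<noteq> id" and jj: "\<And>x. j (j x) = x"
          by (auto simp: J_def fun_eq_iff)
        have "j (s a) = s a" using aut_s[OF jI(1) a(1)] jI(2) by simp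
        then have "(t \<circ> j \<circ> t) a = a" using a tsa by simp
        moreover have "t \<circ> j \<circ> t \<noteq> id"
        proof
          assume "t \<circ> j \<circ> t = id"
          then have "t (j (t (t x))) = t x" for x by (metis comp_apply id_apply)
          then have "j x = x" for x unfolding tt inj_G[OF t(1)] .
          then show False using jI by auto
        qed
        moreover have "(t \<circ> j \<circ> t) \<circ> (t \<circ> j \<circ> t) = id" by (auto simp: tt jj)
        ultimately show "t \<circ> j \<circ> t \<in> J" using jI t comp_in by (auto simp: J_def)
        show "t \<circ> (t \<circ> j \<circ> t) \<circ> t = j" by (auto simp: tt)
        show "t \<circ> j \<circ> t \<noteq> j" using no j by blast
      qed (use \<open>finite J\<close> in auto)
      then show False using \<open>odd (card J)\<close> by simp
    qed
    then obtain j where j: "j \<in> J" "t \<circ> j \<circ> t = j" by blast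
    then have jI: "j \<in> I" "j a = a" "j \<noteq> id" "j \<circ> j = id" and jj: "\<And>x. j (j x) = x"
      by (auto simp: J_def fun_eq_iff)
    have comm: "t (j x) = j (t x)" for x using j(2) tt by (metis comp_apply)
    obtain x where x: "x \<in> Y" "t x = x" using ex_fix t tto by blast
    have "t (j x) = j x" using comm x by simp
    then have "j x \<in> {x, s x}" using fix_inv[OF t(1,2) tto x] mem[OF jI(1) x(1)] by blast
    moreover have "j x \<noteq> x"
    proof
      assume "j x = x"
      then have "x \<in> {a, s a}" using fix_inv[OF jI(1,3,4) a(1) jI(2)] x by blast
      then show False using x a tsa s_ne[OF a(1)] by auto
    qed
    ultimately have jx: "j x = s x" by blast
    have "x \<noteq> a" "x \<noteq> s a" using x a tsa s_ne[OF a(1)] by auto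
    then obtain u where u: "u \<in> Y" "r u a = x" using move_ex[OF a(1) x(1)] by blast
    have tu: "t u \<in> Y" "j u \<in> Y" using mem[OF t(1) u(1)] mem[OF jI(1) u(1)] by auto
    have "s (r (t u) a) = x" using aut[OF t(1) u(1) a(1)] u x a s_comm[OF tu(1) a(1)] by simp
    then have 1: "r (t u) a = s x" using s_s r_closed tu a by metis
    have 2: "r (j u) a = s x" using aut[OF jI(1) u(1) a(1)] u jx jI by simp
    have "s x \<noteq> a" "s x \<noteq> s a" using \<open>x \<noteq> a\<close> \<open>x \<noteq> s a\<close> s_s x a by metis+
    \<comment> \<open>Both \<open>t u\<close> and \<open>j u\<close> move \<open>a\<close> to
      \<open>s x\<close>, and \<open>move\<close> allows only one such point.\<close>
    then have tuju: "t u = j u" using move_unique[of a "t u" "j u"] 1 2 a tu by simp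
    \<comment> \<open>The product of \<open>t\<close> and \<open>j\<close> is an involution fixing
      \<open>u\<close> and \<open>t u\<close>, so only \<open>t u = u\<close> and
      \<open>t u = s u\<close> remain.\<close>
    let ?k = "t \<circ> j"
    have k: "?k \<in> I" "?k \<noteq> id" "?k \<circ> ?k = id"
    proof -
      show "?k \<in> I" by (rule comp_in[OF t(1) jI(1)])
      have "?k a = s a" using a jI by simp
      then show "?k \<noteq> id" using s_ne[OF a(1)] by (metis id_apply)
      show "?k \<circ> ?k = id" using comm tt jj by (auto simp: fun_eq_iff)
    qed
    have "?k u = u" using tt[of u] tuju by simp
    moreover have "?k (t u) = t u" using tuju jj tt by (simp add: comm)
    ultimately have "t u \<in> {u, s u}" using fix_inv[OF k u(1)] tu by blast
    then show False
    proof
      assume "t u = u"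
      then show False using 1 u s_ne[OF x(1)] by simp
    next
      assume "t u \<in> {s u}"
      then have "r (s u) a = s x" using 1 by simp
      then have "r u (s x) = a" using s_inverse[OF s_closed[OF u(1)] a(1)] s_s u by simp
      then have "s (r u x) = a" using s_comm u x by simp
      \<comment> \<open>Here two applications of \<open>r u\<close> act on \<open>a\<close> like
        \<open>s\<close>. As \<open>n\<close> is odd, \<open>2 * n\<close> applications still give
        \<open>s a\<close>, against the period \<open>n\<close>.\<close>
      then have ra: "r u (r u a) = s a" using u s_s r_closed x by metis
      have pc: "(r u ^^ m) (s y) = s ((r u ^^ m) y) \<and> (r u ^^ m) y \<in> Y" if "y \<in> Y" for m y
        using that by (induction m) (auto simp: s_comm u r_closed)
      have two: "(r u ^^ (2 * m)) a = (s ^^ m) a \<and> (s ^^ m) a \<in> Y" for m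
      proof (induction m)
        case (Suc m)
        have cm: "(s ^^ m) (r u y) = r u ((s ^^ m) y) \<and> (s ^^ m) y \<in> Y" if "y \<in> Y" for y
          using that by (induction m) (auto simp: s_comm u s_closed)
        have "(r u ^^ (2 * Suc m)) a = r u (r u ((s ^^ m) a))" using Suc by simp
        also have "\<dots> = (s ^^ m) (s a)" using cm ra a r_closed u by metis
        finally show ?case using cm[OF s_closed[OF a(1)]] by (simp add: funpow_swap1)
      qed (use a in simp)
      have "(s ^^ m) a = (if even m then a else s a)" for m
        by (induction m) (auto simp: s_s a)
      then have "(r u ^^ (2 * n)) a = s a" using two[of n] odd_n by simp
      moreover have "(r u ^^ (2 * n)) a = a"
        using r_pow[OF u(1)] a by (simp add: mult_2 funpow_add)
      ultimately show False using s_ne[OF a(1)] by simp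
    qed
  qed
qed

section \<open>Cyclotomic integers\<close>

definition root1 :: "nat \<Rightarrow> complex" where "root1 N = cis (2 * pi / N)"

lemma root1_power: "root1 N ^ k = cis (2 * pi * real k / real N)"
  by (simp add: root1_def DeMoivre mult.commute)

lemma root1_power_N: "N > 0 \<Longrightarrow> root1 N ^ N = 1"
  by (simp add: root1_power)

lemma root1_nz [simp]: "root1 N \<noteq> 0"
  by (simp add: root1_def)

lemma root1_power_mod: "N > 0 \<Longrightarrow> root1 N ^ (k mod N) = root1 N ^ k"
proof -
  assume N: "N > 0"
  have "root1 N ^ k = root1 N ^ (N * (k div N) + k mod N)" by simp
  also have "\<dots> = root1 N ^ (k mod N)"
    unfolding power_add power_mult root1_power_N[OF N] by simp
  finally show ?thesis by simp
qed

lemma root1_power_eq_1: assumes "N > 0" shows "root1 N ^ k = 1 \<longleftrightarrow> N dvd k"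
proof -
  have inj: "inj_on (\<lambda>k. cis (2 * pi * real k / real N)) {..<N}"
    using bij_betw_roots_unity[OF assms] by (simp add: bij_betw_def)
  have "root1 N ^ k = 1 \<longleftrightarrow> cis (2 * pi * real (k mod N) / real N) = cis (2 * pi * real 0 / real N)"
    using root1_power_mod[OF assms, of k] by (simp add: root1_power)
  also have "\<dots> \<longleftrightarrow> k mod N = 0" using inj assms by (intro inj_on_eq_iff) auto
  finally show ?thesis by (simp add: dvd_eq_mod_eq_0)
qed

lemma root1_dvd: assumes "N > 0" "n dvd N" shows "root1 n = root1 N ^ (N div n)"
proof -
  have "n > 0" using assms by (metis dvd_0_left_iff gr0I)
  then have "real (N div n) = real N / real n" using assms by (simp add: real_of_nat_div)
  then show ?thesis using assms \<open>n > 0\<close> unfolding root1_power by (simp add: root1_def)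
qed

lemma sum_root1: assumes "N > 0" "\<not> N dvd j" shows "(\<Sum>k<N. root1 N ^ (j * k)) = 0"
proof -
  have "(\<Sum>k<N. root1 N ^ (j * k)) = (\<Sum>k<N. (root1 N ^ j) ^ k)" by (simp add: power_mult)
  also have "\<dots> = ((root1 N ^ j) ^ N - 1) / (root1 N ^ j - 1)"
    by (rule geometric_sum) (use root1_power_eq_1[OF assms(1)] assms in auto)
  also have "(root1 N ^ j) ^ N = 1" using root1_power_N[OF assms(1)]
    by (metis mult.commute power_mult power_one)
  finally show ?thesis by simp
qed

text \<open>The ring generated over the integers by a primitive \<open>N\<close>-th root of unity.
  As the set of values of integer polynomials, it inherits its closure properties from polynomial
  arithmetic.\<close>

definition zring :: "nat \<Rightarrow> complex set"
  where "zring N = range (\<lambda>f :: int poly. poly (map_poly of_int f) (root1 N))"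

lemma zring_add: "x \<in> zring N \<Longrightarrow> y \<in> zring N \<Longrightarrow> x + y \<in> zring N"
  unfolding zring_def by (auto simp: poly_add[symmetric] of_int_poly_hom.hom_add[symmetric] simp del: poly_add)

lemma zring_mult: "x \<in> zring N \<Longrightarrow> y \<in> zring N \<Longrightarrow> x * y \<in> zring N"
  unfolding zring_def by (auto simp: poly_mult[symmetric] of_int_poly_hom.hom_mult[symmetric] simp del: poly_mult)

lemma zring_int: "of_int c \<in> zring N"
  unfolding zring_def by (intro image_eqI[of _ _ "[:c:]"]) (auto simp: of_int_hom.map_poly_pCons_hom)

lemma zring_numbers [simp]: "0 \<in> zring N" "1 \<in> zring N" "of_nat m \<in> zring N" "numeral k \<in> zring N"
  using zring_int[of 0] zring_int[of 1] zring_int[of "int m"] zring_int[of "numeral k"] by simp_all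

lemma zring_minus: "x \<in> zring N \<Longrightarrow> - x \<in> zring N"
  using zring_mult[OF zring_int[of "-1"]] by simp

lemma zring_diff: "x \<in> zring N \<Longrightarrow> y \<in> zring N \<Longrightarrow> x - y \<in> zring N"
  using zring_add[OF _ zring_minus] by (metis diff_conv_add_uminus)

lemma zring_root1: "root1 N \<in> zring N"
  unfolding zring_def by (intro image_eqI[of _ _ "[:0, 1:]"]) (auto simp: map_poly_pCons)

lemma zring_power: "x \<in> zring N \<Longrightarrow> x ^ k \<in> zring N"
  by (induction k) (auto intro: zring_mult)

lemma zring_sum: "(\<And>i. i \<in> A \<Longrightarrow> f i \<in> zring N) \<Longrightarrow> sum f A \<in> zring N"
  by (induction A rule: infinite_finite_induct) (auto intro: zring_add)

lemma zring_root_of_unity: assumes "N > 0" "n dvd N" "x ^ n = 1" shows "x \<in> zring N"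
proof -
  have "n > 0" using assms by (metis dvd_0_left_iff gr0I)
  obtain k where "x = cis (2 * pi * real k / real n)"
    using bij_betw_roots_unity[OF \<open>n > 0\<close>] assms(3) by (auto simp: bij_betw_def image_iff)
  then have "x = (root1 N ^ (N div n)) ^ k"
    using root1_dvd[OF assms(1,2)] by (metis root1_power)
  then show ?thesis by (simp add: zring_power zring_root1)
qed

text \<open>Exponents are reduced modulo \<open>N\<close>. The powers below \<open>N\<close> are a
  spanning set and not a basis, which is enough for an integer matrix of multiplication.\<close>

lemma zring_rep:
  assumes N: "N > 0" and y: "y \<in> zring N"
  shows "\<exists>c :: nat \<Rightarrow> int. y = (\<Sum>i<N. of_int (c i) * root1 N ^ i)"
proof -
  obtain f :: "int poly" where f: "y = poly (map_poly of_int f) (root1 N)"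
    using y by (auto simp: zring_def)
  have "\<exists>c :: nat \<Rightarrow> int. poly (map_poly of_int f) (root1 N) = (\<Sum>i<N. of_int (c i) * root1 N ^ i)"
  proof (induction f)
    case 0
    show ?case by (intro exI[of _ "\<lambda>_. 0"]) simp
  next
    case (pCons a f)
    then obtain c :: "nat \<Rightarrow> int"
      where c: "poly (map_poly of_int f) (root1 N) = (\<Sum>i<N. of_int (c i) * root1 N ^ i)" by blast
    obtain M where M: "N = Suc M" using N gr0_conv_Suc by blast
    define d where "d = (\<lambda>i. if i = 0 then a + c M else c (i - 1))"
    have pM: "root1 N ^ Suc M = 1" using root1_power_N[OF N] M by simp
    have "(\<Sum>i<N. of_int (d i) * root1 N ^ i) = of_int (a + c M) + (\<Sum>i<M. of_int (c i) * root1 N ^ Suc i)"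
      unfolding M by (subst sum.lessThan_Suc_shift) (simp add: d_def)
    also have "\<dots> = of_int a + (\<Sum>i<Suc M. of_int (c i) * root1 N ^ Suc i)"
      unfolding sum.lessThan_Suc pM by simp
    also have "(\<Sum>i<Suc M. of_int (c i) * root1 N ^ Suc i) = root1 N * poly (map_poly of_int f) (root1 N)"
    proof -
      have "poly (map_poly of_int f) (root1 N) = (\<Sum>i<Suc M. of_int (c i) * root1 N ^ i)"
        using c M by simp
      then show ?thesis by (simp only: sum_distrib_left power_Suc mult_ac)
    qed
    finally have "poly (map_poly of_int (pCons a f)) (root1 N) = (\<Sum>i<N. of_int (d i) * root1 N ^ i)"
      by (simp add: of_int_hom.map_poly_pCons_hom)
    then show ?case by blast
  qed
  then show ?thesis using f by simp
qed

text \<open>Multiplication by \<open>x\<close> acts on the spanning powers through an integer matrix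
  \<open>A\<close>. The vector of these powers is an eigenvector for \<open>x\<close>, so
  \<open>x\<close> is a root of the monic characteristic polynomial of \<open>A\<close>.\<close>

lemma zring_algebraic_int:
  assumes N: "N > 0" and x: "x \<in> zring N" shows "algebraic_int x"
proof -
  have "\<forall>i. \<exists>c :: nat \<Rightarrow> int. x * root1 N ^ i = (\<Sum>j<N. of_int (c j) * root1 N ^ j)"
    using zring_rep[OF N] zring_mult[OF x zring_power[OF zring_root1]] by blast
  then obtain c :: "nat \<Rightarrow> nat \<Rightarrow> int"
    where c: "\<And>i. x * root1 N ^ i = (\<Sum>j<N. of_int (c i j) * root1 N ^ j)" by metis
  define A where "A = mat N N (\<lambda>(i,j). c i j)"
  define v where "v = vec N (\<lambda>i. root1 N ^ i)"
  have A: "A \<in> carrier_mat N N" by (simp add: A_def)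
  let ?A = "map_mat (of_int :: int \<Rightarrow> complex) A"
  have A': "?A \<in> carrier_mat N N" using A by simp
  have "?A *\<^sub>v v = x \<cdot>\<^sub>v v"
  proof (rule eq_vecI)
    fix i assume "i < dim_vec (x \<cdot>\<^sub>v v)"
    then have i: "i < N" by (simp add: v_def)
    have "(?A *\<^sub>v v) $ i = (\<Sum>j = 0..<N. of_int (c i j) * root1 N ^ j)"
      using i by (simp add: A_def v_def scalar_prod_def)
    also have "\<dots> = x * root1 N ^ i" by (simp add: c lessThan_atLeast0)
    finally show "(?A *\<^sub>v v) $ i = (x \<cdot>\<^sub>v v) $ i" using i by (simp add: v_def)
  qed (simp add: A_def v_def)
  moreover have "v \<noteq> 0\<^sub>v N"
  proof
    assume "v = 0\<^sub>v N"
    then have "v $ 0 = 0" using N by simp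
    then show False using N by (simp add: v_def)
  qed
  ultimately have "eigenvalue ?A x"
    unfolding eigenvalue_def eigenvector_def using A by (intro exI[of _ v]) (simp add: v_def A_def)
  then have "poly (map_poly of_int (char_poly A)) x = 0"
    using eigenvalue_root_char_poly[OF A'] of_int_hom.char_poly_hom[OF A] by metis
  moreover have "lead_coeff (char_poly A) = 1" using degree_monic_char_poly[OF A] by simp
  ultimately show ?thesis unfolding algebraic_int_altdef_ipoly by blast
qed

lemma zring_rational: "N > 0 \<Longrightarrow> x \<in> zring N \<Longrightarrow> x \<in> \<rat> \<Longrightarrow> x \<in> \<int>"
  using rational_algebraic_int_is_int zring_algebraic_int by blast

section \<open>Traces of periodic matrices\<close>

definition mmul :: "'a set \<Rightarrow> ('a \<Rightarrow> 'a \<Rightarrow> 'b::comm_ring_1) \<Rightarrow> ('a \<Rightarrow> 'a \<Rightarrow> 'b) \<Rightarrow> 'a \<Rightarrow> 'a \<Rightarrow> 'b"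
  where "mmul Q K L = (\<lambda>x y. \<Sum>w\<in>Q. K x w * L w y)"

lemma trace_similar:
  assumes "similar_mat (A :: complex mat) B" "A \<in> carrier_mat m m"
  shows "(\<Sum>i<m. A $$ (i,i)) = (\<Sum>i<m. B $$ (i,i))"
proof -
  obtain P R where "similar_mat_wit A B P R" using assms(1) by (auto simp: similar_mat_def)
  then have c: "B \<in> carrier_mat m m" "P \<in> carrier_mat m m" "R \<in> carrier_mat m m"
    and RP: "R * P = 1\<^sub>m m" and eq: "A = P * B * R"
    using assms(2) by (auto simp: similar_mat_wit_def Let_def)
  have tr: "(\<Sum>i<m. (K * L) $$ (i,i)) = (\<Sum>i<m. (L * K) $$ (i,i))"
    if "K \<in> carrier_mat m m" "L \<in> carrier_mat m m" for K L :: "complex mat"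
  proof -
    have "(\<Sum>i<m. (K * L) $$ (i,i)) = (\<Sum>i<m. \<Sum>j<m. K $$ (i,j) * L $$ (j,i))"
      using that by (intro sum.cong) (auto simp: scalar_prod_def lessThan_atLeast0)
    also have "\<dots> = (\<Sum>j<m. \<Sum>i<m. L $$ (j,i) * K $$ (i,j))"
      by (subst sum.swap) (simp add: mult.commute)
    also have "\<dots> = (\<Sum>i<m. (L * K) $$ (i,i))"
      using that by (intro sum.cong) (auto simp: scalar_prod_def lessThan_atLeast0)
    finally show ?thesis .
  qed
  have "A = P * (B * R)" using eq c by (simp add: assoc_mult_mat[of P m m B m R m])
  then have "(\<Sum>i<m. A $$ (i,i)) = (\<Sum>i<m. (B * R * P) $$ (i,i))"
    using tr[of P "B * R"] c by simp
  also have "B * R * P = B" using c RP by (simp add: assoc_mult_mat[of B m m R m P m])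
  finally show ?thesis .
qed

text \<open>After triangularization the trace is the sum of the eigenvalues. Each of them satisfies
  \<open>e ^ Suc n = e\<close> and is therefore 0 or an \<open>n\<close>-th root of unity.\<close>

lemma trace_periodic_mat:
  assumes A: "A \<in> carrier_mat m m" and N: "N > 0" "n dvd N" "n > 0" and per: "A ^\<^sub>m Suc n = A"
  shows "(\<Sum>i<m. A $$ (i,i)) \<in> zring N"
proof -
  obtain es where es: "char_poly A = (\<Prod>a\<leftarrow>es. [:- a, 1:])" using char_poly_factorized[OF A] by blast
  obtain B where B: "B \<in> carrier_mat m m" "upper_triangular B" "similar_mat A B"
    using schur_decomposition_exists[OF A es] by blast
  have "B $$ (i,i) \<in> zring N" if i: "i < m" for i
  proof -
    let ?e = "B $$ (i,i)"
    have "char_poly A = (\<Prod>a\<leftarrow>diag_mat B. [:- a, 1:])"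
      using char_poly_similar[OF B(3)] char_poly_upper_triangular[OF B(1,2)] by simp
    moreover have "?e \<in> set (diag_mat B)" using i B(1) by (auto simp: diag_mat_def)
    ultimately have "poly (char_poly A) ?e = 0"
      by (auto simp: poly_prod_list prod_list_zero_iff o_def)
    then obtain v where v: "eigenvector A v ?e"
      using eigenvalue_root_char_poly[OF A] by (auto simp: eigenvalue_def)
    have vc: "v \<in> carrier_vec m" "v \<noteq> 0\<^sub>v m" "A *\<^sub>v v = ?e \<cdot>\<^sub>v v"
      using v A by (auto simp: eigenvector_def)
    have "?e ^ Suc n \<cdot>\<^sub>v v = ?e \<cdot>\<^sub>v v"
      using eigenvector_pow[OF A v, of "Suc n"] per vc by simp
    moreover have "\<exists>j<m. v $ j \<noteq> 0"
    proof (rule ccontr)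
      assume "\<not> ?thesis"
      then have "v = 0\<^sub>v m" using vc(1) by (intro eq_vecI) auto
      then show False using vc(2) by simp
    qed
    then obtain j where j: "j < m" "v $ j \<noteq> 0" by blast
    ultimately have "(?e ^ Suc n \<cdot>\<^sub>v v) $ j = (?e \<cdot>\<^sub>v v) $ j" by simp
    then have "?e ^ Suc n * v $ j = ?e * v $ j"
      using j(1) vc(1) by simp
    then have "?e ^ Suc n = ?e" using j by simp
    then have "?e = 0 \<or> ?e ^ n = 1" by auto
    then show ?thesis using zring_root_of_unity[OF N(1,2)] by auto
  qed
  then have "(\<Sum>i<m. B $$ (i,i)) \<in> zring N" by (intro zring_sum) simp
  then show ?thesis using trace_similar[OF B(3) A] by simp
qed

text \<open>Transport of \<open>trace_periodic_mat\<close> to an arbitrary finite index set.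
  Iterating \<open>n\<close> times from \<open>B\<close> multiplies \<open>n + 1\<close> copies of
  \<open>B\<close>, which accounts for the exponent \<open>Suc n\<close>.\<close>

lemma trace_periodic:
  fixes B :: "'a \<Rightarrow> 'a \<Rightarrow> complex"
  assumes Q: "finite Q" and N: "N > 0" "n dvd N" "n > 0"
    and per: "\<And>x y. x \<in> Q \<Longrightarrow> y \<in> Q \<Longrightarrow> ((\<lambda>K. mmul Q K B) ^^ n) B x y = B x y"
  shows "(\<Sum>x\<in>Q. B x x) \<in> zring N"
proof -
  obtain f where f: "bij_betw f {..<card Q} Q"
    using bij_betw_from_nat_into_finite[OF Q] by blast
  let ?m = "card Q"
  define M where "M = (\<lambda>K. mat ?m ?m (\<lambda>(i,j). K (f i) (f j)) :: complex mat)"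
  have M: "M K \<in> carrier_mat ?m ?m" for K by (simp add: M_def)
  have mul: "M (mmul Q K L) = M K * M L" for K L
  proof (rule eq_matI)
    fix i j assume "i < dim_row (M K * M L)" "j < dim_col (M K * M L)"
    then have ij: "i < ?m" "j < ?m" by (simp_all add: M_def)
    have "(M K * M L) $$ (i,j) = (\<Sum>k<?m. K (f i) (f k) * L (f k) (f j))"
      using ij by (simp add: M_def scalar_prod_def lessThan_atLeast0)
    also have "\<dots> = (\<Sum>w\<in>Q. K (f i) w * L w (f j))" by (rule sum.reindex_bij_betw[OF f])
    finally show "M (mmul Q K L) $$ (i,j) = (M K * M L) $$ (i,j)"
      using ij by (simp add: M_def mmul_def)
  qed (simp_all add: M_def)
  have pow: "M (((\<lambda>K. mmul Q K B) ^^ k) B) = M B ^\<^sub>m Suc k" for k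
  proof (induction k)
    case 0 show ?case using M[of B] by simp
  next
    case (Suc k)
    then show ?case by (simp add: mul)
  qed
  have "M (((\<lambda>K. mmul Q K B) ^^ n) B) = M B"
    using per bij_betwE[OF f] by (auto simp: M_def intro!: eq_matI)
  then have "(\<Sum>i<?m. M B $$ (i,i)) \<in> zring N"
    using trace_periodic_mat[OF M N] pow by metis
  also have "(\<Sum>i<?m. M B $$ (i,i)) = (\<Sum>i<?m. B (f i) (f i))" by (simp add: M_def)
  also have "\<dots> = (\<Sum>x\<in>Q. B x x)" by (rule sum.reindex_bij_betw[OF f])
  finally show ?thesis .
qed

section \<open>Divisibility by \<open>root1 p - 1\<close> and relations between \<open>p\<close>-th
  roots of unity\<close>

lemma tau_factor: "(root1 p ^ m - 1) = (root1 p - 1) * (\<Sum>l<m. root1 p ^ l)"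
  by (simp add: power_diff_1_eq)

lemma tau_in: "p dvd N \<Longrightarrow> N > 0 \<Longrightarrow> root1 p ^ k \<in> zring N"
  unfolding root1_dvd[of N p] by (intro zring_power zring_root1)

context
  fixes p N :: nat
  assumes p: "Factorial_Ring.prime p" and N: "N > 0" "p dvd N"
begin

text \<open>Expand \<open>(1 + t) ^ p = 1\<close> for \<open>t = root1 p - 1\<close>. The inner
  binomial coefficients are divisible by \<open>p\<close>, and the linear one equals
  \<open>p\<close>; division by \<open>t\<close> leaves \<open>t ^ (p - 1)\<close> as
  \<open>p\<close> times a factor congruent to -1 modulo \<open>t\<close>.\<close>

lemma tau_power: "\<exists>g\<in>zring N. \<exists>h\<in>zring N. (root1 p - 1) ^ (p - 1) = of_nat p * g \<and> g = -1 + (root1 p - 1) * h"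
proof -
  define t where "t = root1 p - 1"
  have p0: "p > 0" "p > 1" using prime_gt_0_nat[OF p] prime_gt_1_nat[OF p] by auto
  have tz: "t \<in> zring N" unfolding t_def using tau_in[OF N(2,1), of 1] by (auto intro: zring_diff)
  have t0: "t \<noteq> 0" using root1_power_eq_1[of p 1] p0 by (auto simp: t_def)
  define b where "b = (\<lambda>k. (p choose k) div p)"
  have b: "p choose k = p * b k" if "0 < k" "k < p" for k
    using that dvd_choose_prime[of k p] p by (simp add: b_def)
  have "1 = (1 + t) ^ p" using root1_power_N p0 by (simp add: t_def)
  also have "\<dots> = (\<Sum>k\<le>p. of_nat (p choose k) * t ^ k)"
    using binomial_ring[of t 1 p] by (simp add: add.commute)
  also have "{..p} = insert 0 (insert p {1..<p})" using p0 by auto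
  also have "(\<Sum>k\<in>insert 0 (insert p {1..<p}). of_nat (p choose k) * t ^ k)
      = 1 + t ^ p + (\<Sum>k\<in>{1..<p}. of_nat (p choose k) * t ^ k)" using p0 by simp
  also have "(\<Sum>k\<in>{1..<p}. of_nat (p choose k) * t ^ k) = (\<Sum>k\<in>{1..<p}. t * (of_nat p * (of_nat (b k) * t ^ (k - 1))))"
  proof (rule sum.cong[OF refl])
    fix k assume k: "k \<in> {1..<p}"
    then have "t ^ k = t * t ^ (k - 1)" by (cases k) auto
    then show "of_nat (p choose k) * t ^ k = t * (of_nat p * (of_nat (b k) * t ^ (k - 1)))"
      using b[of k] k by simp
  qed
  also have "\<dots> = t * (of_nat p * (\<Sum>k\<in>{1..<p}. of_nat (b k) * t ^ (k - 1)))"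
    by (simp add: sum_distrib_left)
  finally have "t ^ p = t * (of_nat p * - (\<Sum>k\<in>{1..<p}. of_nat (b k) * t ^ (k - 1)))"
    by (simp add: algebra_simps eq_neg_iff_add_eq_0)
  moreover have "t ^ p = t * t ^ (p - 1)" using p0 by (cases p) auto
  ultimately have 1: "t ^ (p - 1) = of_nat p * - (\<Sum>k\<in>{1..<p}. of_nat (b k) * t ^ (k - 1))"
    using t0 by (metis mult_left_cancel)
  let ?h = "- (\<Sum>k\<in>{2..<p}. of_nat (b k) * t ^ (k - 2))"
  have hz: "?h \<in> zring N" by (intro zring_minus zring_sum zring_mult zring_power tz) simp
  have "{1..<p} = insert 1 {2..<p}" using p0 by auto
  moreover have "b 1 = 1" using p0 by (simp add: b_def)
  ultimately have "- (\<Sum>k\<in>{1..<p}. of_nat (b k) * t ^ (k - 1)) = -1 - (\<Sum>k\<in>{2..<p}. of_nat (b k) * t ^ (k - 1))"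
    by simp
  also have "(\<Sum>k\<in>{2..<p}. of_nat (b k) * t ^ (k - 1)) = (\<Sum>k\<in>{2..<p}. t * (of_nat (b k) * t ^ (k - 2)))"
  proof (rule sum.cong[OF refl])
    fix k assume "k \<in> {2..<p}"
    then have "k - 1 = Suc (k - 2)" by auto
    then show "of_nat (b k) * t ^ (k - 1) = t * (of_nat (b k) * t ^ (k - 2))" by simp
  qed
  finally have 2: "- (\<Sum>k\<in>{1..<p}. of_nat (b k) * t ^ (k - 1)) = -1 + t * ?h"
    by (simp add: sum_distrib_left)
  show ?thesis
    unfolding t_def[symmetric]
  proof -
    have "-1 + t * ?h \<in> zring N" by (intro zring_add zring_mult zring_minus[OF zring_numbers(2)] tz hz)
    moreover have "t ^ (p - 1) = of_nat p * (-1 + t * ?h)" using 1 unfolding 2 .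
    then have "\<exists>h\<in>zring N. t ^ (p - 1) = of_nat p * (-1 + t * ?h) \<and> -1 + t * ?h = -1 + t * h"
      using hz by (intro bexI[of _ ?h] conjI) simp_all
    ultimately show "\<exists>g\<in>zring N. \<exists>h\<in>zring N. t ^ (p - 1) = of_nat p * g \<and> g = -1 + t * h"
      by (rule bexI[rotated])
  qed
qed

text \<open>The power \<open>p - 1\<close> turns the factor \<open>root1 p - 1\<close> into a
  multiple of \<open>p\<close>. The cofactor is a rational algebraic integer, so \<open>p\<close>
  divides \<open>D ^ (p - 1)\<close> among the integers.\<close>

lemma tau_dvd_int:
  assumes D: "of_int D = (root1 p - 1) * a" and a: "a \<in> zring N"
  shows "int p dvd D"
proof -
  obtain g where g: "g \<in> zring N" "(root1 p - 1) ^ (p - 1) = of_nat p * g" using tau_power by blast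
  have p0: "p > 0" "p > 1" using prime_gt_0_nat[OF p] prime_gt_1_nat[OF p] by auto
  have eq: "of_int (D ^ (p - 1)) = of_nat p * (g * a ^ (p - 1))"
    using D g by (simp add: power_mult_distrib)
  have "g * a ^ (p - 1) \<in> zring N" by (intro zring_mult g zring_power a)
  moreover have "g * a ^ (p - 1) = of_int (D ^ (p - 1)) / of_nat p" using eq p0 by simp
  then have "g * a ^ (p - 1) \<in> \<rat>" by (metis Rats_divide Rats_of_int Rats_of_nat)
  ultimately have "g * a ^ (p - 1) \<in> \<int>" using zring_rational N by blast
  then obtain c where "g * a ^ (p - 1) = of_int c" by (auto elim: Ints_cases)
  then have "of_int (D ^ (p - 1)) = (of_int (int p * c) :: complex)" using eq by simp
  then have "D ^ (p - 1) = int p * c" by (simp only: of_int_eq_iff)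
  then have "int p dvd D ^ (p - 1)" by simp
  moreover have "Factorial_Ring.prime (int p)" using p by simp
  ultimately show ?thesis using Factorial_Ring.prime_dvd_power by blast
qed

text \<open>Fourier inversion writes \<open>p * (w k - w 0)\<close> as a sum of the transforms
  \<open>T j\<close> times differences of powers of \<open>root1 p\<close>. Frequency 0 drops out,
  and every difference is divisible by \<open>root1 p - 1\<close>, so \<open>tau_dvd_int\<close>
  applies.\<close>

lemma coeffs_cong:
  fixes w :: "nat \<Rightarrow> int"
  assumes S: "\<And>j. j \<in> {1..<p} \<Longrightarrow> (\<Sum>k<p. of_int (w k) * root1 p ^ (j * k)) / of_nat p \<in> zring N"
    and k: "k < p"
  shows "int p dvd w k - w 0"
proof -
  have p0: "p > 0" "p > 1" using prime_gt_0_nat[OF p] prime_gt_1_nat[OF p] by auto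
  define T where "T = (\<lambda>j. \<Sum>k<p. of_int (w k) * root1 p ^ (j * k))"
  have inv: "(\<Sum>j<p. T j * root1 p ^ (j * (p - k))) = of_nat p * of_int (w (if k = p then 0 else k))" if "k \<le> p" "k > 0" for k
  proof -
    have "(\<Sum>j<p. T j * root1 p ^ (j * (p - k))) = (\<Sum>j<p. \<Sum>l<p. of_int (w l) * root1 p ^ ((l + (p - k)) * j))"
      unfolding T_def sum_distrib_right by (intro sum.cong refl) (simp add: power_add[symmetric] algebra_simps)
    also have "\<dots> = (\<Sum>l<p. of_int (w l) * (\<Sum>j<p. root1 p ^ ((l + (p - k)) * j)))"
      by (subst sum.swap) (simp add: sum_distrib_left)
    also have "\<dots> = (\<Sum>l<p. if l = (if k = p then 0 else k) then of_nat p * of_int (w l) else 0)"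
    proof (rule sum.cong[OF refl])
      fix l assume l: "l \<in> {..<p}"
      have d: "p dvd l + (p - k) \<longleftrightarrow> l = (if k = p then 0 else k)"
      proof
        assume "p dvd l + (p - k)"
        then obtain c where c: "l + (p - k) = p * c" by blast
        have "l + (p - k) < p * 2" using l that by auto
        then have "c < 2" using c by (metis mult_less_cancel1)
        then show "l = (if k = p then 0 else k)" using c l that p0 by (auto simp: less_2_cases_iff)
      next
        assume "l = (if k = p then 0 else k)"
        then show "p dvd l + (p - k)" using that by (auto split: if_splits)
      qed
      show "of_int (w l) * (\<Sum>j<p. root1 p ^ ((l + (p - k)) * j)) = (if l = (if k = p then 0 else k) then of_nat p * of_int (w l) else 0)"
      proof (cases "p dvd l + (p - k)")
        case True
        then have "root1 p ^ ((l + (p - k)) * j) = 1" for j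
          unfolding root1_power_eq_1[OF p0(1)] by (rule dvd_mult2)
        then show ?thesis using True d by simp
      next
        case False
        then show ?thesis using d sum_root1[OF p0(1)] by simp
      qed
    qed
    also have "\<dots> = of_nat p * of_int (w (if k = p then 0 else k))" using that p0 by auto
    finally show ?thesis .
  qed
  show ?thesis
  proof (cases "k = 0")
    case False
    have "of_nat p * of_int (w k - w 0) = (\<Sum>j<p. T j * (root1 p ^ (j * (p - k)) - 1))"
      using inv[of k] inv[of p] k False p0
      by (simp add: algebra_simps sum_subtractf)
    also have "\<dots> = (\<Sum>j\<in>{1..<p}. T j * (root1 p ^ (j * (p - k)) - 1))"
      using p0 by (intro sum.mono_neutral_right) (auto simp: not_le Suc_le_eq)
    finally have "of_int (w k - w 0) = (\<Sum>j\<in>{1..<p}. T j * (root1 p ^ (j * (p - k)) - 1)) / of_nat p"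
      using p0 by (simp add: field_simps)
    also have "\<dots> = (root1 p - 1) * (\<Sum>j\<in>{1..<p}. T j / of_nat p * (\<Sum>l<j * (p - k). root1 p ^ l))"
      unfolding tau_factor sum_distrib_left sum_divide_distrib by (intro sum.cong refl) simp
    finally show ?thesis
    proof (rule tau_dvd_int)
      show "(\<Sum>j\<in>{1..<p}. T j / of_nat p * (\<Sum>l<j * (p - k). root1 p ^ l)) \<in> zring N"
        unfolding T_def by (intro zring_sum zring_mult S tau_in N)
    qed
  qed simp
qed

lemma tau_not_unit: "1 \<noteq> (root1 p - 1) * a" if "a \<in> zring N" for a
  using tau_dvd_int[of 1 a] that p by (auto simp: not_prime_unit)

text \<open>Take the first coefficient that \<open>p\<close> does not divide and multiply by the
  power of \<open>t = root1 p - 1\<close> that brings its term to \<open>t ^ (p - 2)\<close>. Every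
  other term is then divisible by \<open>p\<close>, either through its coefficient or through
  \<open>t ^ (p - 1)\<close>. So \<open>p\<close> would divide \<open>t ^ (p - 2)\<close>, one power
  of \<open>t\<close> too few.\<close>

lemma tau_relation_dvd:
  fixes s :: "nat \<Rightarrow> int"
  assumes rel: "(\<Sum>i<p - 1. of_int (s i) * (root1 p - 1) ^ i) = 0" and i: "i < p - 1"
  shows "int p dvd s i"
proof (rule ccontr)
  assume "\<not> int p dvd s i"
  define i0 where "i0 = (LEAST i. i < p - 1 \<and> \<not> int p dvd s i)"
  have i0: "i0 < p - 1" "\<not> int p dvd s i0"
    using LeastI[of "\<lambda>i. i < p - 1 \<and> \<not> int p dvd s i" i] i \<open>\<not> int p dvd s i\<close> by (auto simp: i0_def)
  have low: "int p dvd s i" if "i < i0" for i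
    using not_less_Least[of i "\<lambda>i. i < p - 1 \<and> \<not> int p dvd s i"] that i0 by (auto simp: i0_def)
  define t where "t = root1 p - 1"
  have p0: "p > 0" "p > 1" using prime_gt_0_nat[OF p] prime_gt_1_nat[OF p] by auto
  have tz: "t \<in> zring N" unfolding t_def using tau_in[OF N(2,1), of 1] by (auto intro: zring_diff)
  have t0: "t \<noteq> 0" using root1_power_eq_1[of p 1] p0 by (auto simp: t_def)
  obtain g h where g: "g \<in> zring N" "h \<in> zring N" "t ^ (p - 1) = of_nat p * g" "g = -1 + t * h"
    using tau_power unfolding t_def by blast
  define P where "P = (\<lambda>x. \<exists>a\<in>zring N. x = of_nat p * a)"
  have Padd: "P (x + y)" if "P x" "P y" for x y
    using that unfolding P_def by (metis distrib_left zring_add)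
  have Pmul: "P (x * y)" if "P x" "y \<in> zring N" for x y
    using that unfolding P_def by (metis mult.assoc zring_mult)
  have Psum: "P (sum f A)" if "\<And>x. x \<in> A \<Longrightarrow> P (f x)" for f and A :: "nat set"
    using that
  proof (induction A rule: infinite_finite_induct)
    case (insert x F)
    then show ?case by (simp add: Padd)
  qed (auto simp: P_def intro!: bexI[of _ 0])
  have Pint: "P (of_int c)" if "int p dvd c" for c
    using that zring_int unfolding P_def by (auto elim!: dvdE)
  have Pt: "P (t ^ k)" if k: "k \<ge> p - 1" for k
  proof -
    have "t ^ k = t ^ (p - 1) * t ^ (k - (p - 1))" using k by (simp add: power_add[symmetric])
    moreover have "P (t ^ (p - 1))" using g by (auto simp: P_def)
    ultimately show ?thesis using Pmul[OF _ zring_power[OF tz]] by simp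
  qed
  define m where "m = p - 2 - i0"
  have m: "i0 + m = p - 2" using i0 by (simp add: m_def)
  have "0 = (\<Sum>i<p - 1. of_int (s i) * t ^ (i + m))"
    using arg_cong[OF rel, of "\<lambda>x. x * t ^ m"] by (simp add: sum_distrib_right t_def power_add mult.assoc)
  also have "\<dots> = of_int (s i0) * t ^ (p - 2) + (\<Sum>i\<in>{..<p - 1} - {i0}. of_int (s i) * t ^ (i + m))"
    using i0 m by (subst sum.remove[of _ i0]) auto
  finally have e: "of_int (s i0) * t ^ (p - 2) = - (\<Sum>i\<in>{..<p - 1} - {i0}. of_int (s i) * t ^ (i + m))"
    by (simp add: eq_neg_iff_add_eq_0)
  have "P (\<Sum>i\<in>{..<p - 1} - {i0}. of_int (s i) * t ^ (i + m))"
  proof (rule Psum)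
    fix i assume ii: "i \<in> {..<p - 1} - {i0}"
    show "P (of_int (s i) * t ^ (i + m))"
    proof (cases "i < i0")
      case True
      show ?thesis by (rule Pmul[OF Pint[OF low[OF True]] zring_power[OF tz]])
    next
      case False
      then have "i + m \<ge> p - 1" using ii m by auto
      then show ?thesis using Pmul[OF Pt zring_int] by (simp add: mult.commute)
    qed
  qed
  then have Ps: "P (of_int (s i0) * t ^ (p - 2))"
    unfolding e using Pmul[OF _ zring_int[of "-1"]] by simp
  have "coprime (s i0) (int p)"
    using i0(2) p by (metis coprime_commute prime_imp_coprime prime_nat_int_transfer)
  then obtain u v where uv: "u * s i0 + v * int p = 1"
    using bezout_int[of "s i0" "int p"] by (auto simp: coprime_iff_gcd_eq_1)
  have "t ^ (p - 2) = of_int (u * s i0 + v * int p) * t ^ (p - 2)" using uv by simp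
  also have "\<dots> = of_int (s i0) * t ^ (p - 2) * of_int u + of_int (int p) * (of_int v * t ^ (p - 2))"
    by (simp add: algebra_simps)
  finally have eq: "t ^ (p - 2) = of_int (s i0) * t ^ (p - 2) * of_int u + of_int (int p) * (of_int v * t ^ (p - 2))" .
  have "P (t ^ (p - 2))"
    by (subst eq) (intro Padd Pmul[OF Ps zring_int] Pmul[OF Pint] zring_mult zring_int zring_power tz, simp)
  then obtain b where b: "b \<in> zring N" "t ^ (p - 2) = of_nat p * b" by (auto simp: P_def)
  \<comment> \<open>Comparing \<open>p - 1\<close>-th powers leads to
    \<open>of_nat p * b ^ (p - 1) = g ^ (p - 2)\<close>. The left side is divisible by
    \<open>t\<close>, and the right side is a sign modulo \<open>t\<close>, so \<open>t\<close>
    would be a unit.\<close>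
  have "(t ^ (p - 2)) ^ (p - 1) = (t ^ (p - 1)) ^ (p - 2)"
    by (simp only: power_mult[symmetric] mult.commute)
  then have "of_nat p ^ (p - 1) * b ^ (p - 1) = (t ^ (p - 1)) ^ (p - 2)"
    unfolding b(2) power_mult_distrib .
  also have "\<dots> = of_nat p ^ (p - 2) * g ^ (p - 2)" using g by (simp add: power_mult_distrib)
  also have "(of_nat p :: complex) ^ (p - 1) = of_nat p ^ (p - 2) * of_nat p"
    using p0 by (metis Suc_diff_Suc numeral_2_eq_2 power_Suc2 One_nat_def)
  finally have "of_nat p * b ^ (p - 1) = g ^ (p - 2)" using p0 by simp
  moreover have "of_nat p = - t * (\<Sum>k<p. \<Sum>l<k. root1 p ^ l)"
  proof -
    have "(\<Sum>k<p. root1 p ^ (1 * k)) = 0" by (rule sum_root1) (use p0 in auto)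
    then have "of_nat p = (\<Sum>k<p. 1 - root1 p ^ k)" by (simp add: sum_subtractf)
    also have "\<dots> = (\<Sum>k<p. - t * (\<Sum>l<k. root1 p ^ l))"
      using tau_factor[of p] by (intro sum.cong refl) (simp add: t_def algebra_simps eq_diff_eq)
    finally show ?thesis by (simp add: sum_distrib_left)
  qed
  moreover have "\<exists>c\<in>zring N. g ^ k = (-1) ^ k + t * c" for k
  proof (induction k)
    case 0 show ?case by (intro bexI[of _ 0]) auto
  next
    case (Suc k)
    then obtain c where c: "c \<in> zring N" "g ^ k = (-1) ^ k + t * c" by blast
    have "g ^ Suc k = (-1) ^ Suc k + t * (h * g ^ k - c)"
      using c by (simp add: g(4) algebra_simps)
    then show ?case using c g zring_diff zring_mult zring_power by metis
  qed
  then obtain c where c: "c \<in> zring N" "g ^ (p - 2) = (-1) ^ (p - 2) + t * c" by blast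
  let ?S = "\<Sum>k<p. \<Sum>l<k. root1 p ^ l"
  have "?S \<in> zring N" by (intro zring_sum tau_in N)
  ultimately have "(-1) ^ (p - 2) = t * (- ?S * b ^ (p - 1) - c)"
    using c by (simp add: algebra_simps)
  then have "1 = t * ((- ?S * b ^ (p - 1) - c) * (-1) ^ (p - 2))"
  proof -
    assume e: "(-1) ^ (p - 2) = t * (- ?S * b ^ (p - 1) - c)"
    have "(1::complex) = (-1) ^ (p - 2) * (-1) ^ (p - 2)" by (simp add: power_mult_distrib[symmetric])
    also have "\<dots> = t * ((- ?S * b ^ (p - 1) - c) * (-1) ^ (p - 2))" by (subst e) (rule mult.assoc)
    finally show ?thesis .
  qed
  moreover have "(- ?S * b ^ (p - 1) - c) * (-1) ^ (p - 2) \<in> zring N"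
    by (intro zring_mult zring_diff zring_minus zring_power c b \<open>?S \<in> zring N\<close>) simp_all
  ultimately show False using tau_not_unit unfolding t_def by blast
qed

text \<open>Infinite descent: all coefficients are divisible by \<open>p\<close>, and dividing by
  \<open>p\<close> keeps the relation while the sum of absolute values drops.\<close>

lemma tau_relation:
  fixes s :: "nat \<Rightarrow> int"
  assumes "(\<Sum>i<p - 1. of_int (s i) * (root1 p - 1) ^ i) = 0" and "i < p - 1"
  shows "s i = 0"
  using assms
proof (induction "nat (\<Sum>i<p - 1. \<bar>s i\<bar>)" arbitrary: s rule: less_induct)
  case less
  have p0: "p > 1" using prime_gt_1_nat[OF p] by auto
  show ?case
  proof (rule ccontr)
    assume ne: "s i \<noteq> 0"
    have dv: "int p dvd s i" if "i < p - 1" for i using tau_relation_dvd[OF less.prems(1) that] .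
    define u where "u = (\<lambda>i. s i div int p)"
    have su: "s i = int p * u i" if "i < p - 1" for i using dv[OF that] by (simp add: u_def)
    have "of_nat p * (\<Sum>i<p - 1. of_int (u i) * (root1 p - 1) ^ i) = (\<Sum>i<p - 1. of_int (s i) * (root1 p - 1) ^ i)"
      unfolding sum_distrib_left by (intro sum.cong refl) (simp add: su)
    then have rel: "(\<Sum>i<p - 1. of_int (u i) * (root1 p - 1) ^ i) = 0" using less.prems p0 by simp
    have "(\<Sum>i<p - 1. \<bar>s i\<bar>) = int p * (\<Sum>i<p - 1. \<bar>u i\<bar>)"
      unfolding sum_distrib_left by (intro sum.cong refl) (simp add: su abs_mult)
    moreover have "(\<Sum>i<p - 1. \<bar>u i\<bar>) > 0"
    proof (rule sum_pos2)
      show "0 < \<bar>u i\<bar>" using ne su[OF less.prems(2)] by auto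
    qed (use less.prems in auto)
    ultimately have "(\<Sum>i<p - 1. \<bar>u i\<bar>) < (\<Sum>i<p - 1. \<bar>s i\<bar>)" using p0 by simp
    then have "nat (\<Sum>i<p - 1. \<bar>u i\<bar>) < nat (\<Sum>i<p - 1. \<bar>s i\<bar>)"
      using \<open>(\<Sum>i<p - 1. \<bar>u i\<bar>) > 0\<close> by simp
    from less.hyps[OF this rel less.prems(2)] show False using ne su[OF less.prems(2)] by simp
  qed
qed

text \<open>Since the sum of all powers vanishes, the last coefficient can be subtracted from every
  coefficient, which lowers the degree to at most \<open>p - 2\<close>. The substitution
  \<open>x = 1 + t\<close> then turns the relation into one for \<open>tau_relation\<close>. In
  effect this is the irreducibility of the cyclotomic polynomial.\<close>

lemma root1_relation:
  fixes q :: "nat \<Rightarrow> int"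
  assumes "(\<Sum>k<p. of_int (q k) * root1 p ^ k) = 0" and "k < p"
  shows "q k = q (p - 1)"
proof -
  have p0: "p > 1" using prime_gt_1_nat[OF p] by auto
  define f where "f = (\<Sum>k<p - 1. monom (q k - q (p - 1)) k)"
  define g where "g = pcompose f [:1, 1:]"
  have "poly (map_poly of_int f) (root1 p) = (\<Sum>k<p - 1. of_int (q k - q (p - 1)) * root1 p ^ k)"
    by (simp add: f_def of_int_hom.map_poly_hom_monom of_int_poly_hom.hom_sum poly_sum poly_monom)
  also have "\<dots> = (\<Sum>k<p. of_int (q k - q (p - 1)) * root1 p ^ k)"
  proof (rule sum.mono_neutral_left)
    have "i = p - 1" if "i \<in> {..<p} - {..<p - 1}" for i using that by auto
    then have "q i - q (p - 1) = 0" if "i \<in> {..<p} - {..<p - 1}" for i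
      using that by (metis diff_self)
    then show "\<forall>i\<in>{..<p} - {..<p - 1}. of_int (q i - q (p - 1)) * root1 p ^ i = 0"
      by (metis mult_zero_left of_int_0)
  qed auto
  also have "\<dots> = 0 - of_int (q (p - 1)) * (\<Sum>k<p. root1 p ^ (1 * k))"
    unfolding assms(1)[symmetric] sum_distrib_left sum_subtractf[symmetric]
    by (intro sum.cong refl) (simp add: algebra_simps)
  also have "(\<Sum>k<p. root1 p ^ (1 * k)) = 0" by (rule sum_root1) (use p0 in auto)
  finally have fz: "poly (map_poly of_int f) (root1 p) = 0" by simp
  have "map_poly of_int g = pcompose (map_poly of_int f) [:1, 1 :: complex:]"
    unfolding g_def by (simp add: of_int_hom.map_poly_pcompose of_int_hom.map_poly_pCons_hom)
  then have gz: "poly (map_poly of_int g) (root1 p - 1) = 0" using fz by (simp add: poly_pcompose)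
  have "degree f \<le> p - 2"
    unfolding f_def by (rule degree_sum_le) (auto intro: order_trans[OF degree_monom_le])
  then have dg: "degree g \<le> p - 2" unfolding g_def by (simp add: degree_pcompose)
  have "poly (map_poly of_int g) (root1 p - 1) = (\<Sum>i\<le>degree g. of_int (coeff g i) * (root1 p - 1) ^ i)"
    by (simp add: poly_altdef of_int_hom.degree_map_poly_hom)
  also have "\<dots> = (\<Sum>i<p - 1. of_int (coeff g i) * (root1 p - 1) ^ i)"
    using dg p0 by (intro sum.mono_neutral_left) (auto simp: not_le coeff_eq_0)
  finally have rel: "(\<Sum>i<p - 1. of_int (coeff g i) * (root1 p - 1) ^ i) = 0" using gz by simp
  have "coeff g i = 0" for i
  proof (cases "i < p - 1")
    case False
    then show ?thesis using dg p0 by (intro coeff_eq_0) auto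
  qed (rule tau_relation[OF rel])
  then have "g = 0" by (intro poly_eqI) simp
  then have "f = 0" unfolding g_def by (simp add: pcompose_eq_0_iff)
  then have "coeff f k = 0" by simp
  moreover have "coeff f k = (if k < p - 1 then q k - q (p - 1) else 0)"
    unfolding f_def coeff_sum coeff_monom by (auto simp: sum.delta)
  ultimately show ?thesis using assms(2) by (cases "k < p - 1") (auto intro: arg_cong[where f = q])
qed

end

lemma sum_periodic_shift:
  fixes f :: "nat \<Rightarrow> 'b::comm_monoid_add"
  assumes "\<And>k. f (k + p) = f k"
  shows "(\<Sum>k<p. f (k + l)) = (\<Sum>k<p. f k)"
proof (induction l)
  case (Suc l)
  have "(\<Sum>k<p. f (k + Suc l)) + f l = f l + (\<Sum>k<p. f (Suc k + l))" by (simp add: add.commute)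
  also have "\<dots> = (\<Sum>k<Suc p. f (k + l))" by (simp add: sum.lessThan_Suc_shift del: sum.lessThan_Suc)
  also have "\<dots> = (\<Sum>k<p. f (k + l)) + f l" using assms[of l] by (simp add: add.commute)
  finally have "(\<Sum>k<p. f (k + Suc l)) + f l = (\<Sum>k<p. f (k + l)) + f l" .
  show ?case
  proof (cases p)
    case (Suc q)
    have "(\<Sum>k<p. f (k + Suc l)) = (\<Sum>k<q. f (Suc (k + l))) + f (q + Suc l)" using Suc by simp
    also have "f (q + Suc l) = f l" using assms[of l] Suc by (simp add: add.commute)
    also have "(\<Sum>k<q. f (Suc (k + l))) + f l = (\<Sum>k<p. f (k + l))"
      unfolding Suc by (subst sum.lessThan_Suc_shift) (simp add: add.commute)
    finally show ?thesis using Suc.IH by simp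
  qed simp
qed simp

text \<open>Unless the trace is 1, the mixed equations kill the off-diagonal entries, and the
  diagonal entries are idempotent numbers.\<close>

lemma idempotent_2x2_trace:
  fixes a b c d :: complex
  assumes "a * a + b * c = a" "a * b + b * d = b" "c * a + d * c = c" "c * b + d * d = d"
  shows "a + d \<in> {0, 1, 2}"
proof (cases "a + d = 1")
  case False
  have "b * (a + d - 1) = 0" "c * (a + d - 1) = 0" using assms(2,3) by (simp_all add: algebra_simps)
  then have "b = 0" "c = 0" using False by auto
  then have "a * (a - 1) = 0" "d * (d - 1) = 0" using assms(1,4) by (simp_all add: algebra_simps)
  then have "a = 0 \<or> a = 1" "d = 0 \<or> d = 1" by auto
  then show ?thesis by auto
qed simp

section \<open>Invariant matrices of a permutation group of degree \<open>2p\<close>\<close>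

definition ginv :: "('a \<Rightarrow> 'a) set \<Rightarrow> 'a set \<Rightarrow> ('a \<Rightarrow> 'a \<Rightarrow> 'b) \<Rightarrow> bool"
  where "ginv G Q K \<longleftrightarrow> (\<forall>g\<in>G. \<forall>x\<in>Q. \<forall>y\<in>Q. K (g x) (g y) = K x y)"

text \<open>The orbits of \<open>z\<close> have the base points \<open>bp True\<close> and \<open>bp False\<close>; the assumption \<open>no_sign\<close>
  says that \<open>G\<close> preserves no partition of \<open>Q\<close> into two blocks.\<close>

locale two_orbits = perm_group Q G for Q :: "'a set" and G :: "('a \<Rightarrow> 'a) set" +
  fixes p :: nat and z :: "'a \<Rightarrow> 'a" and bp :: "bool \<Rightarrow> 'a"
  assumes p: "Factorial_Ring.prime p" and p2: "p > 2"
    and zG: "z \<in> G" and zp: "z ^^ p = id"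
    and coords: "bij_betw (\<lambda>(b, k). (z ^^ k) (bp b)) (UNIV \<times> {..<p}) Q"
    and trans: "x \<in> Q \<Longrightarrow> y \<in> Q \<Longrightarrow> \<exists>g\<in>G. g x = y"
    and no_sign: "\<lbrakk>\<And>x. x \<in> Q \<Longrightarrow> \<eta> x = 1 \<or> \<eta> x = (-1::real);
      \<And>g. g \<in> G \<Longrightarrow> (\<forall>x\<in>Q. \<eta> (g x) = \<eta> x) \<or> (\<forall>x\<in>Q. \<eta> (g x) = - \<eta> x); x \<in> Q; y \<in> Q\<rbrakk> \<Longrightarrow> \<eta> x = \<eta> y"
begin

lemma p_pos: "p > 0" "p > 1" using p2 by auto

abbreviation \<zeta> where "\<zeta> \<equiv> root1 p"

definition pt :: "bool \<Rightarrow> nat \<Rightarrow> 'a" where "pt b k = (z ^^ k) (bp b)"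

lemma z_pow: "z ^^ (k + p) = z ^^ k"
  by (simp add: funpow_add zp)

lemma pt_add_p: "pt b (k + p) = pt b k"
  unfolding pt_def z_pow ..

lemma pt_shift: "(z ^^ l) (pt b k) = pt b (l + k)"
  by (simp add: pt_def funpow_add)

lemma pt_bij: "bij_betw (\<lambda>(b, k). pt b k) (UNIV \<times> {..<p}) Q"
  using coords unfolding pt_def .

lemma pt_in_lt: "k < p \<Longrightarrow> pt b k \<in> Q"
  using bij_betwE[OF pt_bij] by force

lemma bp_in: "bp b \<in> Q"
  using pt_in_lt[of 0 b] p_pos by (simp add: pt_def)

lemma pt_in: "pt b k \<in> Q"
  unfolding pt_def by (rule mem[OF power_in[OF zG] bp_in])

lemma pt_0: "pt b 0 = bp b" by (simp add: pt_def)

lemma pt_inj: "k < p \<Longrightarrow> l < p \<Longrightarrow> pt b k = pt c l \<longleftrightarrow> b = c \<and> k = l"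
  using bij_betw_imp_inj_on[OF pt_bij] by (auto simp: inj_on_def)

lemma pt_cases: assumes "x \<in> Q" obtains b k where "k < p" "x = pt b k"
  using assms bij_betw_imp_surj_on[OF pt_bij] by auto

lemma sum_pt: "(\<Sum>x\<in>Q. f x) = (\<Sum>b\<in>UNIV. \<Sum>k<p. f (pt b k))"
proof -
  have "(\<Sum>x\<in>Q. f x) = (\<Sum>(b, k)\<in>UNIV \<times> {..<p}. f (pt b k))"
    using sum.reindex_bij_betw[OF pt_bij, of f] by (simp add: case_prod_beta)
  then show ?thesis by (simp add: sum.cartesian_product)
qed

lemma card_Q: "card Q = 2 * p"
  using bij_betw_same_card[OF coords] by (simp add: card_cartesian_product)

definition zinv :: "('a \<Rightarrow> 'a \<Rightarrow> 'b) \<Rightarrow> bool"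
  where "zinv K \<longleftrightarrow> (\<forall>x\<in>Q. \<forall>y\<in>Q. K (z x) (z y) = K x y)"

lemma ginv_zinv: "ginv G Q K \<Longrightarrow> zinv K"
  using zG by (auto simp: ginv_def zinv_def)

lemma zinv_pow: assumes K: "zinv K" and "x \<in> Q" "y \<in> Q"
  shows "K ((z ^^ l) x) ((z ^^ l) y) = K x y"
proof (induction l)
  case (Suc l)
  have "(z ^^ l) x \<in> Q" "(z ^^ l) y \<in> Q" using mem[OF power_in[OF zG]] assms by auto
  then show ?case using K Suc by (simp add: zinv_def)
qed simp

lemma zinv_pt: "zinv K \<Longrightarrow> K (pt a l) (pt b (l + k)) = K (bp a) (pt b k)"
  using zinv_pow[OF _ bp_in[of a] pt_in[of b k], of K l] unfolding pt_shift by (simp add: pt_def)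

text \<open>Entry \<open>(a, b)\<close> of the \<open>j\<close>-th block in the decomposition of
  \<open>K\<close> under the cyclic group generated by \<open>z\<close>. Only the rows at the base
  points are read, since the others are their shifts.\<close>

definition F :: "nat \<Rightarrow> ('a \<Rightarrow> 'a \<Rightarrow> complex) \<Rightarrow> bool \<Rightarrow> bool \<Rightarrow> complex"
  where "F j K a b = (\<Sum>k<p. K (bp a) (pt b k) * \<zeta> ^ (j * k))"

lemma zeta_period: "\<zeta> ^ (j * (k + p)) = \<zeta> ^ (j * k)"
proof -
  have "\<zeta> ^ (j * (k + p)) = \<zeta> ^ (j * k) * (\<zeta> ^ p) ^ j"
    by (simp add: distrib_left power_add power_mult[symmetric] mult.commute)
  then show ?thesis using root1_power_N[OF p_pos(1)] by simp
qed

text \<open>Invariance under \<open>z\<close> makes the matrix product a convolution along the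
  orbits, which the transform turns into the product of blocks.\<close>

lemma F_mult:
  assumes "zinv L"
  shows "F j (mmul Q K L) a b = (\<Sum>c\<in>UNIV. F j K a c * F j L c b)"
proof -
  have inner: "(\<Sum>k<p. L (pt c l) (pt b k) * \<zeta> ^ (j * k)) = \<zeta> ^ (j * l) * F j L c b" for c l
  proof -
    have "(\<Sum>k<p. L (pt c l) (pt b k) * \<zeta> ^ (j * k)) = (\<Sum>k<p. L (pt c l) (pt b (k + l)) * \<zeta> ^ (j * (k + l)))"
      by (rule sum_periodic_shift[symmetric]) (simp only: pt_add_p zeta_period)
    also have "\<dots> = (\<Sum>k<p. \<zeta> ^ (j * l) * (L (bp c) (pt b k) * \<zeta> ^ (j * k)))"
      using zinv_pt[OF assms, of c l b]
      by (intro sum.cong refl) (simp add: add.commute distrib_left power_add)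
    finally show ?thesis by (simp add: F_def sum_distrib_left)
  qed
  have "F j (mmul Q K L) a b = (\<Sum>k<p. \<Sum>c\<in>UNIV. \<Sum>l<p. K (bp a) (pt c l) * (L (pt c l) (pt b k) * \<zeta> ^ (j * k)))"
    unfolding F_def mmul_def sum_pt sum_distrib_right by (simp add: mult.assoc)
  also have "\<dots> = (\<Sum>c\<in>UNIV. \<Sum>k<p. \<Sum>l<p. K (bp a) (pt c l) * (L (pt c l) (pt b k) * \<zeta> ^ (j * k)))"
    by (rule sum.swap)
  also have "\<dots> = (\<Sum>c\<in>UNIV. \<Sum>l<p. \<Sum>k<p. K (bp a) (pt c l) * (L (pt c l) (pt b k) * \<zeta> ^ (j * k)))"
    by (rule sum.cong[OF refl]) (rule sum.swap)
  also have "\<dots> = (\<Sum>c\<in>UNIV. \<Sum>l<p. K (bp a) (pt c l) * (\<zeta> ^ (j * l) * F j L c b))"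
    by (simp only: sum_distrib_left[symmetric] inner)
  also have "\<dots> = (\<Sum>c\<in>UNIV. F j K a c * F j L c b)"
    by (simp only: mult.assoc[symmetric] sum_distrib_right[symmetric]) (simp add: F_def)
  finally show ?thesis .
qed

lemma F_mult2:
  "zinv L \<Longrightarrow> F j (mmul Q K L) a b = F j K a True * F j L True b + F j K a False * F j L False b"
  unfolding F_mult UNIV_bool by simp

lemma F_inverse:
  assumes "k < p"
  shows "(\<Sum>j<p. F j K a b * \<zeta> ^ (j * (p - k))) = of_nat p * K (bp a) (pt b k)"
proof -
  have "(\<Sum>j<p. F j K a b * \<zeta> ^ (j * (p - k)))
      = (\<Sum>j<p. \<Sum>l<p. K (bp a) (pt b l) * \<zeta> ^ ((l + (p - k)) * j))"
    unfolding F_def sum_distrib_right by (intro sum.cong refl) (simp add: power_add[symmetric] algebra_simps)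
  also have "\<dots> = (\<Sum>l<p. K (bp a) (pt b l) * (\<Sum>j<p. \<zeta> ^ ((l + (p - k)) * j)))"
    by (subst sum.swap) (simp add: sum_distrib_left)
  also have "\<dots> = (\<Sum>l<p. if l = k then of_nat p * K (bp a) (pt b l) else 0)"
  proof (rule sum.cong[OF refl])
    fix l assume l: "l \<in> {..<p}"
    show "K (bp a) (pt b l) * (\<Sum>j<p. \<zeta> ^ ((l + (p - k)) * j)) = (if l = k then of_nat p * K (bp a) (pt b l) else 0)"
    proof (cases "l = k")
      case True
      then have "\<zeta> ^ ((l + (p - k)) * j) = 1" for j
        using assms unfolding root1_power_eq_1[OF p_pos(1)] by simp
      then show ?thesis using True by simp
    next
      case False
      have "\<not> p dvd l + (p - k)"
      proof
        assume "p dvd l + (p - k)"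
        then obtain c where c: "l + (p - k) = p * c" by blast
        have "p * c < p * 2" "p * c > 0" using l assms c[symmetric] by auto
        then have "c = 1" by (simp add: less_2_cases_iff)
        then show False using c False assms by simp
      qed
      then show ?thesis using False sum_root1[OF p_pos(1)] by simp
    qed
  qed
  finally show ?thesis using assms by simp
qed

text \<open>A matrix invariant under \<open>z\<close> is determined by its rows at the two base
  points, and \<open>F_inverse\<close> recovers these.\<close>

lemma F_zero:
  assumes K: "zinv K" and z: "\<And>j a b. j < p \<Longrightarrow> F j K a b = 0" and xy: "x \<in> Q" "y \<in> Q"
  shows "K x y = 0"
proof -
  have 0: "K (bp a) (pt b k) = 0" if "k < p" for a b k
    using F_inverse[OF that, of K a b] z p_pos by simp
  obtain a l where a: "l < p" "x = pt a l" using pt_cases[OF xy(1)] .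
  obtain b m where b: "m < p" "y = pt b m" using pt_cases[OF xy(2)] .
  note ab = a b
  have "l + (m + p - l) = m + p" using a by simp
  then have "y = pt b (l + (m + p - l))" using b pt_add_p[of b m] by simp
  then have "K x y = K (bp a) (pt b (m + p - l))" using a zinv_pt[OF K, of a l b "m + p - l"] by simp
  also have "pt b (m + p - l) = pt b ((m + p - l) mod p)"
  proof (cases "m + p - l < p")
    case False
    then have "(m + p - l) mod p = m - l" "m + p - l = m - l + p" using ab by (auto simp: mod_if)
    then show ?thesis using pt_add_p by metis
  qed simp
  finally show ?thesis using 0 p_pos by simp
qed

lemma trace_F: assumes "zinv K"
  shows "(\<Sum>x\<in>Q. K x x) = (\<Sum>j<p. F j K True True + F j K False False)"
proof -
  have "K (pt b k) (pt b k) = K (bp b) (bp b)" for b k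
    using zinv_pt[OF assms, of b k b 0] by (simp add: pt_0)
  then have "(\<Sum>x\<in>Q. K x x) = of_nat p * K (bp True) (bp True) + of_nat p * K (bp False) (bp False)"
    unfolding sum_pt UNIV_bool by (simp add: add.commute)
  also have "\<dots> = (\<Sum>j<p. F j K True True) + (\<Sum>j<p. F j K False False)"
  proof -
    have "\<zeta> ^ (j * p) = 1" for j unfolding root1_power_eq_1[OF p_pos(1)] by simp
    then show ?thesis
      using F_inverse[OF p_pos(1), of K True True] F_inverse[OF p_pos(1), of K False False] by (simp add: pt_0)
  qed
  finally show ?thesis by (simp add: sum.distrib)
qed

section \<open>The sign vector of the two orbits and its average\<close>

definition \<eta> :: "'a \<Rightarrow> real" where "\<eta> x = (if \<exists>k<p. x = pt True k then 1 else -1)"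

lemma eta_pt_lt: "k < p \<Longrightarrow> \<eta> (pt b k) = (if b then 1 else -1)"
  using pt_inj by (auto simp: \<eta>_def)

lemma eta_z: assumes "x \<in> Q" shows "\<eta> (z x) = \<eta> x"
proof -
  obtain b k where k: "k < p" "x = pt b k" using pt_cases[OF assms] .
  have zx: "z x = pt b (Suc k)" using k pt_shift[of 1 b k] by simp
  show ?thesis
  proof (cases "Suc k < p")
    case True then show ?thesis using zx k eta_pt_lt by simp
  next
    case False
    then have "Suc k = 0 + p" using k by simp
    then have "z x = pt b 0" using zx pt_add_p by metis
    then show ?thesis using k p_pos eta_pt_lt by simp
  qed
qed

lemma eta_pt: "\<eta> (pt b k) = (if b then 1 else -1)"
proof (induction k)
  case (Suc k)
  have "pt b (Suc k) = z (pt b k)" using pt_shift[of 1 b k] by simp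
  then show ?case using eta_z[OF pt_in] Suc by simp
qed (use eta_pt_lt[of 0] p_pos in simp)

lemma eta_pm: "\<eta> x = 1 \<or> \<eta> x = -1" by (simp add: \<eta>_def)

lemma eta_cases: "x \<in> Q \<Longrightarrow> \<eta> x = 1 \<or> \<eta> x = -1" by (simp add: \<eta>_def)

lemma eta_sq [simp]: "\<eta> x * \<eta> x = 1" by (simp add: \<eta>_def)

lemma abs_eta [simp]: "\<bar>\<eta> x\<bar> = 1" by (simp add: \<eta>_def)

lemma sum_eta: "(\<Sum>x\<in>Q. \<eta> x) = 0"
  unfolding sum_pt by (simp add: eta_pt UNIV_bool)

lemma rowsum_const:
  fixes K :: "'a \<Rightarrow> 'a \<Rightarrow> 'b::comm_monoid_add"
  assumes K: "ginv G Q K" and xy: "x \<in> Q" "y \<in> Q"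
  shows "(\<Sum>w\<in>Q. K x w) = (\<Sum>w\<in>Q. K y w)"
proof -
  obtain g where g: "g \<in> G" "g x = y" using trans xy by blast
  have "(\<Sum>w\<in>Q. K y w) = (\<Sum>w\<in>Q. K y (g w))"
    by (rule sum_image[OF g(1), of "K y", symmetric])
  also have "\<dots> = (\<Sum>w\<in>Q. K x w)" using K g xy by (intro sum.cong) (auto simp: ginv_def)
  finally show ?thesis by simp
qed

lemma ginv_transpose: "ginv G Q K \<Longrightarrow> ginv G Q (\<lambda>x y. K y x)"
  by (auto simp: ginv_def)

text \<open>A normalized quadratic form, which by \<open>eta_right\<close> is the eigenvalue of
  \<open>K\<close> at \<open>\<eta>\<close>. The symmetric shape makes it visibly invariant under
  transposition.\<close>

definition ev :: "('a \<Rightarrow> 'a \<Rightarrow> real) \<Rightarrow> real"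
  where "ev K = (\<Sum>x\<in>Q. \<Sum>y\<in>Q. \<eta> x * K x y * \<eta> y) / (2 * p)"

lemma ev_transpose: "ev (\<lambda>x y. K y x) = ev K"
  unfolding ev_def by (subst sum.swap) (simp add: mult.commute mult.assoc mult.left_commute)

text \<open>The image of \<open>\<eta>\<close> is constant on the orbits of \<open>z\<close>, and
  its sum is 0 because all column sums of \<open>K\<close> agree. Only multiples of
  \<open>\<eta>\<close> have both properties.\<close>

lemma eta_right: assumes K: "ginv G Q K" and x: "x \<in> Q" shows "(\<Sum>y\<in>Q. K x y * \<eta> y) = ev K * \<eta> x"
proof -
  define f where "f = (\<lambda>x. \<Sum>y\<in>Q. K x y * \<eta> y)"
  have fz: "f (z x) = f x" if "x \<in> Q" for x
  proof -
    have "f (z x) = (\<Sum>y\<in>Q. K (z x) (z y) * \<eta> (z y))" unfolding f_def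
      by (rule sum_image[OF zG, of "\<lambda>y. K (z x) y * \<eta> y", symmetric])
    also have "\<dots> = f x" unfolding f_def
      using K zG that eta_z by (intro sum.cong) (auto simp: ginv_def)
    finally show ?thesis .
  qed
  have fpt: "f (pt b k) = f (bp b)" for b k
  proof (induction k)
    case (Suc k)
    have "pt b (Suc k) = z (pt b k)" using pt_shift[of 1 b k] by simp
    then show ?case using fz[OF pt_in] Suc by simp
  qed (simp add: pt_0)
  have "(\<Sum>x\<in>Q. f x) = (\<Sum>y\<in>Q. (\<Sum>x\<in>Q. K x y) * \<eta> y)"
    unfolding f_def by (subst sum.swap) (simp add: sum_distrib_right)
  also have "\<dots> = (\<Sum>y\<in>Q. (\<Sum>w\<in>Q. K w (bp True)) * \<eta> y)"
    by (intro sum.cong refl arg_cong2[where f = "(*)"] rowsum_const[OF ginv_transpose[OF K] _ bp_in])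
  also have "\<dots> = 0" by (simp add: sum_distrib_left[symmetric] sum_eta)
  finally have "real p * f (bp True) + real p * f (bp False) = 0"
    unfolding sum_pt fpt UNIV_bool by (simp add: add.commute)
  then have "real p * (f (bp True) + f (bp False)) = 0" by (simp only: distrib_left)
  then have neg: "f (bp False) = - f (bp True)" using p_pos by simp
  have feta: "f x = f (bp True) * \<eta> x" if xQ: "x \<in> Q" for x
  proof -
    obtain b k where "k < p" "x = pt b k" using pt_cases[OF xQ] .
    then show ?thesis using neg by (cases b) (simp_all add: fpt eta_pt)
  qed
  have "(2 * p) * ev K = (\<Sum>x\<in>Q. \<Sum>y\<in>Q. \<eta> x * K x y * \<eta> y)"
    unfolding ev_def using p_pos by simp
  also have "\<dots> = (\<Sum>x\<in>Q. \<eta> x * f x)"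
    unfolding f_def by (simp add: sum_distrib_left mult.assoc)
  also have "\<dots> = (\<Sum>x\<in>Q. f (bp True))"
  proof (rule sum.cong[OF refl])
    fix x assume "x \<in> Q"
    then have "\<eta> x * f x = f (bp True) * (\<eta> x * \<eta> x)" by (simp only: feta mult_ac)
    then show "\<eta> x * f x = f (bp True)" by simp
  qed
  also have "\<dots> = 2 * p * f (bp True)" using card_Q by simp
  finally have "ev K = f (bp True)" using p_pos by simp
  then show ?thesis using feta[OF x] unfolding f_def by simp
qed

lemma eta_left: "ginv G Q K \<Longrightarrow> y \<in> Q \<Longrightarrow> (\<Sum>x\<in>Q. \<eta> x * K x y) = ev K * \<eta> y"
  using eta_right[OF ginv_transpose[of K], of y] ev_transpose[of K] by (simp add: mult.commute)

definition H :: "'a \<Rightarrow> 'a \<Rightarrow> real" where "H x y = (\<Sum>g\<in>G. \<eta> (g x) * \<eta> (g y))"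

lemma H_sym: "H x y = H y x" by (simp add: H_def mult.commute)

lemma H_ginv: "ginv G Q H"
  unfolding ginv_def
proof (intro ballI)
  fix h x y assume "h \<in> G"
  then show "H (h x) (h y) = H x y"
    using reindex_left[of h "\<lambda>g. \<eta> (g x) * \<eta> (g y)"] by (simp add: H_def)
qed

lemma H_diag: "H x x = card G" by (simp add: H_def)

text \<open>Every translate of \<open>\<eta>\<close> under \<open>G\<close> is an eigenvector of
  \<open>K\<close> for the same eigenvalue, and \<open>H\<close> is a sum of products of such
  translates.\<close>

lemma H_right: assumes K: "ginv G Q K" and xy: "x \<in> Q" "y \<in> Q"
  shows "mmul Q H K x y = ev K * H x y"
proof -
  have "mmul Q H K x y = (\<Sum>w\<in>Q. \<Sum>g\<in>G. \<eta> (g x) * (\<eta> (g w) * K w y))"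
    unfolding mmul_def H_def sum_distrib_right by (simp add: mult.assoc)
  also have "\<dots> = (\<Sum>g\<in>G. \<eta> (g x) * (\<Sum>w\<in>Q. \<eta> (g w) * K w y))"
    by (subst sum.swap) (simp add: sum_distrib_left)
  also have "\<dots> = (\<Sum>g\<in>G. \<eta> (g x) * (ev K * \<eta> (g y)))"
  proof (rule sum.cong[OF refl])
    fix g assume g: "g \<in> G"
    have "(\<Sum>w\<in>Q. \<eta> (g w) * K w y) = (\<Sum>w\<in>Q. \<eta> (g w) * K (g w) (g y))"
      using K g xy by (intro sum.cong) (auto simp: ginv_def)
    also have "\<dots> = (\<Sum>w\<in>Q. \<eta> w * K w (g y))" using sum_image[OF g, of "\<lambda>w. \<eta> w * K w (g y)"] by simp
    also have "\<dots> = ev K * \<eta> (g y)" by (rule eta_left[OF K mem[OF g xy(2)]])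
    finally show "\<eta> (g x) * (\<Sum>w\<in>Q. \<eta> (g w) * K w y) = \<eta> (g x) * (ev K * \<eta> (g y))" by simp
  qed
  finally show ?thesis unfolding H_def by (simp add: sum_distrib_left mult.left_commute)
qed

lemma mmul_transpose: "mmul Q (\<lambda>x y. K y x) (\<lambda>x y. L y x) x y = mmul Q L K y x"
  by (simp add: mmul_def mult.commute)

lemma H_left: assumes K: "ginv G Q K" and xy: "x \<in> Q" "y \<in> Q"
  shows "mmul Q K H x y = ev K * H x y"
  using H_right[OF ginv_transpose[OF K] xy(2,1)] mmul_transpose[of H K y x] H_sym ev_transpose[of K]
  by (simp add: mmul_def mult.commute)

definition S :: "('a \<Rightarrow> 'a) \<Rightarrow> real" where "S g = (\<Sum>x\<in>Q. \<eta> x * \<eta> (g x))"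

lemma evH_S: "2 * p * ev H = (\<Sum>g\<in>G. (S g)\<^sup>2)"
proof -
  have "2 * p * ev H = (\<Sum>x\<in>Q. \<Sum>y\<in>Q. \<eta> x * H x y * \<eta> y)"
    unfolding ev_def using p_pos by simp
  also have "\<dots> = (\<Sum>x\<in>Q. \<Sum>y\<in>Q. \<Sum>g\<in>G. (\<eta> x * \<eta> (g x)) * (\<eta> y * \<eta> (g y)))"
    unfolding H_def sum_distrib_left sum_distrib_right by (simp only: mult_ac)
  also have "\<dots> = (\<Sum>x\<in>Q. \<Sum>g\<in>G. \<Sum>y\<in>Q. (\<eta> x * \<eta> (g x)) * (\<eta> y * \<eta> (g y)))"
    by (intro sum.cong refl sum.swap)
  also have "\<dots> = (\<Sum>g\<in>G. \<Sum>x\<in>Q. \<Sum>y\<in>Q. (\<eta> x * \<eta> (g x)) * (\<eta> y * \<eta> (g y)))"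
    by (rule sum.swap)
  also have "\<dots> = (\<Sum>g\<in>G. (S g)\<^sup>2)"
    by (simp only: S_def power2_eq_square sum_product)
  finally show ?thesis .
qed

lemma S_le: assumes "g \<in> G" shows "(S g)\<^sup>2 \<le> (2 * real p)\<^sup>2"
proof -
  have "\<bar>S g\<bar> \<le> (\<Sum>x\<in>Q. \<bar>\<eta> x * \<eta> (g x)\<bar>)" unfolding S_def by (rule sum_abs)
  also have "\<dots> = 2 * p" using card_Q by (simp add: abs_mult)
  finally have "\<bar>S g\<bar> \<le> \<bar>2 * real p\<bar>" by simp
  then show ?thesis by (simp only: abs_le_square_iff)
qed

lemma evH_pos: "ev H > 0"
proof -
  have "S id = 2 * real p" using card_Q by (simp add: S_def)
  then have "(2 * real p)\<^sup>2 \<le> (\<Sum>g\<in>G. (S g)\<^sup>2)"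
    using member_le_sum[of id G "\<lambda>g. (S g)\<^sup>2"] id_in fin_G by simp
  moreover have "0 < (2 * real p)\<^sup>2" using p_pos by simp
  ultimately have "0 < 2 * p * ev H" unfolding evH_S by linarith
  then show ?thesis by (rule zero_less_mult_pos) (use p_pos in simp)
qed

lemma S_eq_imp: assumes g: "g \<in> G" and S: "(S g)\<^sup>2 = (2 * real p)\<^sup>2"
  shows "(\<forall>x\<in>Q. \<eta> (g x) = \<eta> x) \<or> (\<forall>x\<in>Q. \<eta> (g x) = - \<eta> x)"
proof -
  have key: "\<forall>x\<in>Q. \<eta> (g x) = e * \<eta> x" if e: "S g = e * (2 * p)" "e = 1 \<or> e = -1" for e :: real
  proof -
    have "(\<Sum>x\<in>Q. 1 - e * (\<eta> x * \<eta> (g x))) = 0"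
    proof -
      have "(\<Sum>x\<in>Q. 1 - e * (\<eta> x * \<eta> (g x))) = 2 * p - e * S g"
        using card_Q by (simp add: sum_subtractf sum_distrib_left S_def)
      then show ?thesis using e by (elim disjE) simp_all
    qed
    moreover have "0 \<le> 1 - e * (\<eta> x * \<eta> (g x))" for x
      using e(2) eta_pm[of x] eta_pm[of "g x"] by (elim disjE) simp_all
    ultimately have z: "1 - e * (\<eta> x * \<eta> (g x)) = 0" if "x \<in> Q" for x
      using sum_nonneg_eq_0_iff[OF fin, of "\<lambda>x. 1 - e * (\<eta> x * \<eta> (g x))"] that by blast
    show ?thesis
    proof
      fix x assume "x \<in> Q"
      from z[OF this] show "\<eta> (g x) = e * \<eta> x"
        using e(2) eta_pm[of x] eta_pm[of "g x"] by (elim disjE) simp_all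
    qed
  qed
  have "S g = 2 * real p \<or> S g = - (2 * real p)" using S by (simp only: power2_eq_iff)
  then show ?thesis
  proof
    assume "S g = 2 * real p"
    then show ?thesis using key[of 1] by simp
  next
    assume "S g = - (2 * real p)"
    then show ?thesis using key[of "-1"] by simp
  qed
qed

text \<open>By \<open>evH_S\<close> and \<open>S_le\<close> this value is the largest one possible.
  It is attained only if every \<open>g\<close> fixes \<open>\<eta>\<close> up to sign, and then
  \<open>no_sign\<close> would make \<open>\<eta>\<close> constant.\<close>

lemma evH_ne: "ev H \<noteq> 2 * p * card G"
proof
  assume e: "ev H = 2 * p * card G"
  have "(\<Sum>g\<in>G. (2 * real p)\<^sup>2 - (S g)\<^sup>2) = 0"
    unfolding sum_subtractf evH_S[symmetric] e by (simp add: power2_eq_square)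
  moreover have "0 \<le> (2 * real p)\<^sup>2 - (S g)\<^sup>2" if "g \<in> G" for g using S_le[OF that] by simp
  ultimately have "(2 * real p)\<^sup>2 - (S g)\<^sup>2 = 0" if "g \<in> G" for g
    using sum_nonneg_eq_0_iff[OF fin_G, of "\<lambda>g. (2 * real p)\<^sup>2 - (S g)\<^sup>2"] that by blast
  then have "(\<forall>x\<in>Q. \<eta> (g x) = \<eta> x) \<or> (\<forall>x\<in>Q. \<eta> (g x) = - \<eta> x)" if "g \<in> G" for g
    using S_eq_imp[OF that] that by simp
  then have "\<eta> (bp True) = \<eta> (bp False)" using no_sign[of \<eta>] eta_cases bp_in by blast
  then show False using eta_pt[of True 0] eta_pt[of False 0] by (simp add: pt_0)
qed

lemma H_int: "H x y \<in> \<int>"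
  unfolding H_def by (intro Ints_sum) (auto simp: \<eta>_def)

lemma evH_int: "ev H \<in> \<int>"
proof -
  have "\<eta> (bp True) = 1" using eta_pt[of True 0] by (simp add: pt_0)
  then have "ev H = (\<Sum>y\<in>Q. H (bp True) y * \<eta> y)" using eta_right[OF H_ginv bp_in, of True] by simp
  also have "\<dots> \<in> \<int>" by (intro Ints_sum Ints_mult H_int) (auto simp: \<eta>_def)
  finally show ?thesis .
qed

lemma H_rowsum: "(\<Sum>y\<in>Q. H x y) = 0"
proof -
  have "(\<Sum>y\<in>Q. H x y) = (\<Sum>g\<in>G. \<eta> (g x) * (\<Sum>y\<in>Q. \<eta> (g y)))"
    unfolding H_def by (subst sum.swap) (simp add: sum_distrib_left)
  also have "\<dots> = (\<Sum>g\<in>G. \<eta> (g x) * 0)"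
    by (intro sum.cong refl) (simp add: sum_image sum_eta)
  finally show ?thesis by simp
qed

text \<open>Entries at shift \<open>k\<close> within an orbit, added over both orbits. These are the
  coefficients whose Fourier transform gives the traces of the blocks, and unlike the single blocks
  they are integers for an integer matrix.\<close>

definition w :: "('a \<Rightarrow> 'a \<Rightarrow> 'b::ab_group_add) \<Rightarrow> nat \<Rightarrow> 'b"
  where "w K k = K (bp True) (pt True k) + K (bp False) (pt False k)"

lemma w_sum: fixes K :: "'a \<Rightarrow> 'a \<Rightarrow> real" assumes K: "ginv G Q K"
  shows "(\<Sum>k<p. w K k) = (\<Sum>y\<in>Q. K (bp True) y) + ev K"
proof -
  define s where "s = (\<lambda>a b. \<Sum>k<p. K (bp a) (pt b k))"
  have e: "\<eta> (bp b) = (if b then 1 else -1)" for b using eta_pt[of b 0] by (simp add: pt_0)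
  have "s a True - s a False = ev K * \<eta> (bp a)" for a
    using eta_right[OF K bp_in[of a]] unfolding sum_pt UNIV_bool
    by (simp add: eta_pt s_def sum_negf)
  from this[of True] this[of False] have "s True True - s True False = ev K" "s False True - s False False = - ev K"
    by (simp_all add: e)
  moreover have r: "(\<Sum>y\<in>Q. K (bp a) y) = s a True + s a False" for a
    unfolding sum_pt UNIV_bool s_def by (simp add: add.commute)
  have "s True True + s True False = s False True + s False False"
    using rowsum_const[OF K bp_in bp_in, of True False] unfolding r .
  moreover have "(\<Sum>k<p. w K k) = s True True + s False False"
    by (simp add: w_def s_def sum.distrib)
  ultimately show ?thesis unfolding r by simp
qed

text \<open>By \<open>H_right\<close> the quotient of \<open>H\<close> by \<open>ev H\<close> is
  idempotent, so its block at frequency 1 is an idempotent 2 by 2 matrix.\<close>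

lemma trace_FH: "\<exists>d\<in>{0, 1, 2 :: int}. (\<Sum>k<p. complex_of_real (w H k) * \<zeta> ^ k) = of_int d * complex_of_real (ev H)"
proof -
  let ?P = "\<lambda>x y. complex_of_real (H x y / ev H)"
  have zP: "zinv ?P" using ginv_zinv[OF H_ginv] by (simp add: zinv_def)
  have idem: "mmul Q ?P ?P x y = ?P x y" if "x \<in> Q" "y \<in> Q" for x y
  proof -
    have "mmul Q ?P ?P x y = complex_of_real (mmul Q H H x y / (ev H * ev H))"
      by (simp add: mmul_def sum_divide_distrib)
    then show ?thesis using H_right[OF H_ginv that] evH_pos by simp
  qed
  have Fi': "F 1 ?P a True * F 1 ?P True b + F 1 ?P a False * F 1 ?P False b = F 1 ?P a b" for a b
  proof -
    have "F 1 (mmul Q ?P ?P) a b = F 1 ?P a b"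
      unfolding F_def by (intro sum.cong refl) (simp only: idem[OF bp_in pt_in])
    then show ?thesis unfolding F_mult2[OF zP] .
  qed
  have "F 1 ?P True True + F 1 ?P False False \<in> {0, 1, 2}"
    by (rule idempotent_2x2_trace[OF Fi' Fi' Fi' Fi'])
  then have "\<exists>d :: int. d \<in> {0, 1, 2} \<and> F 1 ?P True True + F 1 ?P False False = of_int d"
    by (elim insertE emptyE, intro exI[of _ 0], simp, intro exI[of _ 1], simp, intro exI[of _ 2], simp)
  then obtain d :: int where d: "d \<in> {0, 1, 2}" "F 1 ?P True True + F 1 ?P False False = of_int d"
    by (elim exE conjE)
  have "(\<Sum>k<p. complex_of_real (w H k) * \<zeta> ^ k) = complex_of_real (ev H) * (F 1 ?P True True + F 1 ?P False False)"
    unfolding F_def w_def sum.distrib[symmetric] sum_distrib_left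
    by (intro sum.cong refl) (use evH_pos in \<open>simp add: field_simps\<close>)
  then show ?thesis using d by (intro bexI[of _ d]) simp_all
qed

text \<open>The transform of the weights of \<open>H\<close> at frequency 1 is an integer, so by
  \<open>root1_relation\<close> all weights at shifts \<open>k >= 1\<close> are equal. Block trace 0
  means a projection of rank 1 and contradicts \<open>evH_ne\<close>; block trace 1 means rank
  \<open>p\<close>; block trace 2 means rank \<open>2 * p - 1\<close>, which is the projection along
  the constants.\<close>

lemma dichotomy:
  "(\<forall>K x y. ginv G Q K \<longrightarrow> x \<in> Q \<longrightarrow> y \<in> Q \<longrightarrow>
      K x y = (\<Sum>y\<in>Q. K (bp True) y) / (2 * p) + ev K * ((if x = y then 1 else 0) - 1 / (2 * p)))
    \<or> (ev H = 2 * card G \<and> (\<forall>k\<in>{1..<p}. w H k = 0))"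
proof -
  obtain d :: int where d: "d \<in> {0, 1, 2}"
    "(\<Sum>k<p. complex_of_real (w H k) * \<zeta> ^ k) = of_int d * complex_of_real (ev H)"
    using trace_FH by (rule bexE)
  have "\<forall>k. \<exists>c :: int. w H k = of_int c"
  proof
    fix k
    have "w H k \<in> \<int>" unfolding w_def by (intro Ints_add H_int)
    then show "\<exists>c :: int. w H k = of_int c" by (auto elim: Ints_cases)
  qed
  then obtain c :: "nat \<Rightarrow> int" where c: "\<And>k. w H k = of_int (c k)" by metis
  obtain a :: int where a: "ev H = of_int a" using evH_int by (auto elim: Ints_cases)
  define q where "q = (\<lambda>k. c k - (if k = 0 then d * a else 0))"
  have "(\<Sum>k<p. of_int (q k) * \<zeta> ^ k) = (\<Sum>k<p. complex_of_real (w H k) * \<zeta> ^ k) - (\<Sum>k<p. if k = 0 then of_int (d * a) else 0)"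
    unfolding sum_subtractf[symmetric] by (intro sum.cong refl) (simp add: q_def c algebra_simps)
  also have "\<dots> = 0" unfolding d(2) a using p_pos by simp
  finally have q: "q k = q (p - 1)" if "k < p" for k
    by (rule root1_relation[OF p p_pos(1) dvd_refl _ that])
  have w: "w H k = w H (p - 1)" if "1 \<le> k" "k < p" for k
    using q[OF that(2)] that p2 by (simp add: q_def c)
  have "c 0 = c (p - 1) + d * a" using q[OF p_pos(1)] p2 by (simp add: q_def)
  then have w0: "w H 0 = w H (p - 1) + d * ev H" unfolding c a by simp
  have w00: "w H 0 = 2 * card G" by (simp add: w_def pt_0 H_diag)
  have "ev H = (\<Sum>k<p. w H k)" using w_sum[OF H_ginv] H_rowsum by simp
  also have "\<dots> = w H 0 + (\<Sum>k\<in>{1..<p}. w H k)"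
    using p_pos by (simp add: lessThan_atLeast0 sum.atLeast_Suc_lessThan)
  also have "(\<Sum>k\<in>{1..<p}. w H k) = (\<Sum>k\<in>{1..<p}. w H (p - 1))"
  proof (rule sum.cong[OF refl])
    fix k assume "k \<in> {1..<p}"
    then show "w H k = w H (p - 1)" by (intro w) simp_all
  qed
  also have "\<dots> = (real p - 1) * w H (p - 1)" using p_pos by (simp add: of_nat_diff)
  finally have eq: "p * w H (p - 1) + d * ev H = ev H" "2 * card G = w H (p - 1) + d * ev H"
    unfolding w00 using w0 w00 by (simp_all add: left_diff_distrib)
  consider "d = 0" | "d = 1" | "d = 2" using d by blast
  then show ?thesis
  proof cases
    case 1
    then have "ev H = p * w H (p - 1)" "w H (p - 1) = 2 * card G" using eq by simp_all
    then have "ev H = 2 * p * card G" by simp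
    then show ?thesis using evH_ne by simp
  next
    case 2
    then have "w H (p - 1) = 0" using eq p_pos by simp
    then show ?thesis using eq w 2 by simp
  next
    case 3
    then have e: "p * w H (p - 1) = - ev H" "2 * card G = w H (p - 1) + 2 * ev H" using eq by simp_all
    have "real p * (2 * card G) = p * w H (p - 1) + 2 * p * ev H" unfolding e(2) by (simp add: algebra_simps)
    then have G2: "2 * p * card G = (2 * real p - 1) * ev H" unfolding e(1) by (simp add: algebra_simps)
    \<comment> \<open>The projection \<open>H / ev H\<close> is contained in the projection along
      the constants. Their difference \<open>E\<close> is again a symmetric projection, and its
      vanishing diagonal forces it to be 0.\<close>
    define E where "E = (\<lambda>x y. (if x = y then 1 else 0) - 1 / (2 * real p) - H x y / ev H)"
    have Exy: "E x y = (if x = y then 1 else 0) - 1 / (2 * real p) - H x y / ev H" for x y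
      by (simp add: E_def)
    have Esym: "E x y = E y x" for x y using H_sym[of x y] by (simp add: Exy)
    have rowE: "(\<Sum>y\<in>Q. E x y) = 0" if "x \<in> Q" for x
    proof -
      have "(\<Sum>y\<in>Q. E x y) = (\<Sum>y\<in>Q. if x = y then 1 else 0) - (\<Sum>y\<in>Q. 1 / (2 * real p)) - (\<Sum>y\<in>Q. H x y) / ev H"
        unfolding Exy sum_subtractf sum_divide_distrib ..
      also have "\<dots> = 1 - 1 - 0" using that fin card_Q p_pos H_rowsum[of x] by simp
      finally show ?thesis by simp
    qed
    have HE: "(\<Sum>y\<in>Q. H z y * E y x) = 0" if xz: "x \<in> Q" "z \<in> Q" for x z
    proof -
      have "(\<Sum>y\<in>Q. H z y * E y x) = (\<Sum>y\<in>Q. (if y = x then H z y else 0)) - (\<Sum>y\<in>Q. H z y) / (2 * p) - mmul Q H H z x / ev H"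
        unfolding mmul_def sum_divide_distrib sum_subtractf[symmetric]
        by (intro sum.cong refl) (simp add: Exy right_diff_distrib)
      also have "\<dots> = H z x - 0 - H z x"
        using xz fin H_rowsum[of z] H_right[OF H_ginv xz(2,1)] evH_pos by simp
      finally show ?thesis by simp
    qed
    have E0: "E x y = 0" if "x \<in> Q" "y \<in> Q" for x y
    proof -
      have "(\<Sum>y\<in>Q. E x y * E y x) = (\<Sum>y\<in>Q. (if y = x then E y x else 0)) - (\<Sum>y\<in>Q. E y x) / (2 * p) - (\<Sum>y\<in>Q. H x y * E y x) / ev H"
        unfolding sum_divide_distrib sum_subtractf[symmetric]
      proof (rule sum.cong[OF refl])
        fix y
        show "E x y * E y x = (if y = x then E y x else 0) - E y x / (2 * p) - H x y * E y x / ev H"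
          by (subst Exy[of x y]) (simp add: left_diff_distrib)
      qed
      also have "(\<Sum>y\<in>Q. E y x) = (\<Sum>y\<in>Q. E x y)" by (intro sum.cong refl Esym)
      also have "(\<Sum>y\<in>Q. if y = x then E y x else 0) - (\<Sum>y\<in>Q. E x y) / (2 * p) - (\<Sum>y\<in>Q. H x y * E y x) / ev H = E x x"
        using HE[OF that(1,1)] rowE[OF that(1)] fin that(1) by simp
      also have "\<dots> = 0"
      proof -
        have "card G / ev H = (2 * p - 1) / (2 * p)" using G2 evH_pos p_pos by (simp add: field_simps)
        then show ?thesis using p_pos by (simp add: Exy H_diag field_simps)
      qed
      finally have "(\<Sum>y\<in>Q. (E x y)\<^sup>2) = 0" by (simp only: power2_eq_square Esym[of _ x])
      then show ?thesis using that fin by (simp add: sum_nonneg_eq_0_iff)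
    qed
    have "K x y = (\<Sum>y\<in>Q. K (bp True) y) / (2 * p) + ev K * ((if x = y then 1 else 0) - 1 / (2 * p))"
      if K: "ginv G Q K" and xy: "x \<in> Q" "y \<in> Q" for K x y
    proof -
      have Hxy: "H u v = ev H * ((if u = v then 1 else 0) - 1 / (2 * p))" if "u \<in> Q" "v \<in> Q" for u v
        using E0[OF that] evH_pos by (simp add: Exy field_simps)
      have "mmul Q K H x y = (\<Sum>u\<in>Q. K x u * (ev H * ((if u = y then 1 else 0) - 1 / (2 * p))))"
        unfolding mmul_def by (intro sum.cong refl) (simp only: Hxy xy)
      also have "\<dots> = ev H * ((\<Sum>u\<in>Q. if u = y then K x u else 0) - (\<Sum>u\<in>Q. K x u) / (2 * p))"
        unfolding sum_divide_distrib sum_subtractf[symmetric] sum_distrib_left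
        by (intro sum.cong refl) (simp add: algebra_simps)
      also have "\<dots> = ev H * (K x y - (\<Sum>u\<in>Q. K (bp True) u) / (2 * p))"
        using fin xy rowsum_const[OF K xy(1) bp_in, of True] by simp
      finally have "ev H * (K x y - (\<Sum>u\<in>Q. K (bp True) u) / (2 * p)) = ev K * H x y"
        using H_left[OF K xy] by simp
      then have "ev H * (K x y - (\<Sum>u\<in>Q. K (bp True) u) / (2 * p)) = ev H * (ev K * ((if x = y then 1 else 0) - 1 / (2 * p)))"
        unfolding Hxy[OF xy] by (simp add: algebra_simps)
      then show ?thesis using evH_pos by (simp only: mult_cancel_left) simp
    qed
    then show ?thesis by blast
  qed
qed

end

text \<open>With \<open>R\<close> the matrix of rows \<open>(r, s)\<close> and
  \<open>(t, - r)\<close>, the hypotheses say that \<open>K R\<close> and \<open>R K\<close> both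
  equal \<open>a (R + 1) - K\<close>. So \<open>K\<close> is \<open>a\<close> on the image of
  \<open>1 + R\<close> and, by its trace, \<open>c\<close> on the image of \<open>1 - R\<close>,
  which amounts to \<open>2 K = a (1 + R) + c (1 - R)\<close>.\<close>

lemma block_form:
  fixes k11 k12 k21 k22 a r s t :: complex
  assumes "k11 * r + k12 * t = a * (r + 1) - k11" "k11 * s + k12 * - r = a * s - k12"
    and "k21 * r + k22 * t = a * t - k21" "k21 * s + k22 * - r = a * (- r + 1) - k22"
    and "r * k11 + s * k21 = a * (r + 1) - k11" "r * k12 + s * k22 = a * s - k12"
    and "t * k11 + - r * k21 = a * t - k21" "t * k12 + - r * k22 = a * (- r + 1) - k22"
  defines "c \<equiv> k11 + k22 - a"
  shows "2 * k11 = a * (1 + r) + c * (1 - r)" "2 * k12 = (a - c) * s"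
    "2 * k21 = (a - c) * t" "2 * k22 = a * (1 - r) + c * (1 + r)"
proof -
  have e: "k11 * (1 + r) - k22 * (1 - r) - 2 * a * r = 0"
  proof -
    have "k11 * (1 + r) - k22 * (1 - r) - 2 * a * r
        = (k11 * r + k12 * t - (a * (r + 1) - k11)) - (t * k12 + - r * k22 - (a * (- r + 1) - k22))"
      by (simp add: algebra_simps)
    then show ?thesis unfolding assms(1,8) by simp
  qed
  have "2 * k11 - (a * (1 + r) + c * (1 - r)) = k11 * (1 + r) - k22 * (1 - r) - 2 * a * r"
    "2 * k22 - (a * (1 - r) + c * (1 + r)) = - (k11 * (1 + r) - k22 * (1 - r) - 2 * a * r)"
    by (simp_all add: c_def algebra_simps)
  then show "2 * k11 = a * (1 + r) + c * (1 - r)" "2 * k22 = a * (1 - r) + c * (1 + r)"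
    unfolding e by simp_all
  have "2 * k12 - (a - c) * s = (k11 * s + k12 * - r - (a * s - k12)) + (r * k12 + s * k22 - (a * s - k12))"
    by (simp add: c_def algebra_simps)
  then show "2 * k12 = (a - c) * s" unfolding assms(2,6) by simp
  have "2 * k21 - (a - c) * t = (k21 * r + k22 * t - (a * t - k21)) + (t * k11 + - r * k21 - (a * t - k21))"
    by (simp add: c_def algebra_simps)
  then show "2 * k21 = (a - c) * t" unfolding assms(3,7) by simp
qed

text \<open>Both matrices are combinations of the same two projections \<open>(1 + R) / 2\<close>
  and \<open>(1 - R) / 2\<close>, so the eigenvalues multiply pairwise. Computing with four times
  the trace avoids a diagonalization.\<close>

lemma block_trace:
  fixes k11 k12 k21 k22 l11 l12 l21 l22 a b c d r s t :: complex
  assumes "2 * k11 = a * (1 + r) + c * (1 - r)" "2 * k12 = (a - c) * s"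
    "2 * k21 = (a - c) * t" "2 * k22 = a * (1 - r) + c * (1 + r)"
    "2 * l11 = b * (1 + r) + d * (1 - r)" "2 * l12 = (b - d) * s"
    "2 * l21 = (b - d) * t" "2 * l22 = b * (1 - r) + d * (1 + r)"
    and sq: "r * r + s * t = 1"
  shows "k11 * l11 + k12 * l21 + (k21 * l12 + k22 * l22) = a * b + c * d"
proof -
  have "4 * (k11 * l11 + k12 * l21 + (k21 * l12 + k22 * l22))
      = (2 * k11) * (2 * l11) + (2 * k12) * (2 * l21) + ((2 * k21) * (2 * l12) + (2 * k22) * (2 * l22))"
    by (simp add: algebra_simps)
  also have "\<dots> = 2 * (a * b + c * d) + 2 * (a * b + c * d - a * d - b * c) * (r * r + s * t)
      + 2 * (a * d + b * c)"
    unfolding assms(1-8) by (simp add: algebra_simps)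
  also have "\<dots> = 4 * (a * b + c * d)" unfolding sq by (simp add: algebra_simps)
  finally have "4 * (k11 * l11 + k12 * l21 + (k21 * l12 + k22 * l22)) = 4 * (a * b + c * d)" .
  then show ?thesis by (simp only: mult_cancel_left) auto
qed

text \<open>The second alternative of \<open>dichotomy\<close>: the projection
  \<open>H / ev H\<close> has rank \<open>p\<close>, with one dimension in each Fourier
  block.\<close>

locale split_orbits = two_orbits +
  assumes evH: "ev H = 2 * card G" and wH: "k \<in> {1..<p} \<Longrightarrow> w H k = 0"
begin

lemma card_G_pos: "card G > 0" using evH_pos evH by simp

text \<open>As \<open>ev H = 2 * card G\<close>, this is the reflection \<open>2 * P - 1\<close> for
  \<open>P = H / ev H\<close>. Its diagonal vanishes because \<open>P\<close> has diagonal
  \<open>1 / 2\<close>.\<close>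

definition Rm :: "'a \<Rightarrow> 'a \<Rightarrow> real"
  where "Rm x y = H x y / card G - (if x = y then 1 else 0)"

lemma Rm_sym: "Rm x y = Rm y x"
  using H_sym[of x y] by (simp add: Rm_def)

lemma Rm_diag: "Rm x x = 0"
  using card_G_pos by (simp add: Rm_def H_diag)

lemma Rm_ginv: "ginv G Q Rm"
  unfolding ginv_def
proof (intro ballI)
  fix g x y assume g: "g \<in> G" "x \<in> Q" "y \<in> Q"
  then have "H (g x) (g y) = H x y" using H_ginv by (simp add: ginv_def)
  then show "Rm (g x) (g y) = Rm x y" using inj_G[OF g(1)] by (simp add: Rm_def)
qed

lemma Rm_right: assumes K: "ginv G Q K" and xy: "x \<in> Q" "y \<in> Q"
  shows "(\<Sum>u\<in>Q. K x u * Rm u y) = ev K * (Rm x y + (if x = y then 1 else 0)) - K x y"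
proof -
  have "(\<Sum>u\<in>Q. K x u * Rm u y) = (\<Sum>u\<in>Q. K x u * H u y) / card G - (\<Sum>u\<in>Q. if u = y then K x u else 0)"
    unfolding sum_divide_distrib sum_subtractf[symmetric]
    by (intro sum.cong refl) (simp add: Rm_def right_diff_distrib)
  also have "(\<Sum>u\<in>Q. K x u * H u y) = ev K * H x y" using H_left[OF K xy] by (simp add: mmul_def)
  also have "ev K * H x y / card G = ev K * (Rm x y + (if x = y then 1 else 0))" by (simp add: Rm_def)
  finally show ?thesis using xy fin by simp
qed

lemma Rm_left: assumes K: "ginv G Q K" and xy: "x \<in> Q" "y \<in> Q"
  shows "(\<Sum>u\<in>Q. Rm x u * K u y) = ev K * (Rm x y + (if x = y then 1 else 0)) - K x y"
proof -
  have "(\<Sum>u\<in>Q. Rm x u * K u y) = (\<Sum>u\<in>Q. K u y * Rm u x)"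
    using Rm_sym by (intro sum.cong refl) (simp add: mult.commute)
  then show ?thesis
    using Rm_right[OF ginv_transpose[OF K] xy(2,1)] Rm_sym[of x y] ev_transpose[of K] by auto
qed

lemma ev_eq: assumes K: "ginv G Q K" and x: "x \<in> Q"
  shows "ev K = (\<Sum>y\<in>Q. K x y * Rm x y) + K x x"
proof -
  have "(\<Sum>y\<in>Q. K x y * Rm x y) = (\<Sum>y\<in>Q. K x y * Rm y x)" by (intro sum.cong refl) (simp add: Rm_sym)
  then show ?thesis using Rm_right[OF K x x] by (simp add: Rm_diag)
qed

lemma Rm_rowsum: assumes "x \<in> Q" shows "(\<Sum>y\<in>Q. Rm x y) = -1"
  using assms fin H_rowsum[of x]
  by (simp add: Rm_def sum_subtractf sum_divide_distrib[symmetric])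

lemma ev_Rm: "ev Rm = 1"
proof -
  have e: "\<eta> (bp True) = 1" using eta_pt[of True 0] by (simp add: pt_0)
  have "ev Rm = (\<Sum>y\<in>Q. Rm (bp True) y * \<eta> y)" using eta_right[OF Rm_ginv bp_in, of True] e by simp
  also have "\<dots> = (\<Sum>y\<in>Q. H (bp True) y * \<eta> y) / card G - (\<Sum>y\<in>Q. if y = bp True then \<eta> y else 0)"
    unfolding sum_divide_distrib sum_subtractf[symmetric]
    by (intro sum.cong refl) (auto simp: Rm_def left_diff_distrib)
  also have "\<dots> = 1" using eta_right[OF H_ginv bp_in, of True] e evH card_G_pos fin bp_in by simp
  finally show ?thesis .
qed

lemma Rm_square: "x \<in> Q \<Longrightarrow> y \<in> Q \<Longrightarrow> (\<Sum>u\<in>Q. Rm x u * Rm u y) = (if x = y then 1 else 0)"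
  using Rm_right[OF Rm_ginv] ev_Rm by simp

lemma Rm_norm: assumes "x \<in> Q" shows "(\<Sum>y\<in>Q. (Rm x y)\<^sup>2) = 1"
proof -
  have "(\<Sum>y\<in>Q. (Rm x y)\<^sup>2) = (\<Sum>y\<in>Q. Rm x y * Rm y x)"
    by (intro sum.cong refl) (simp add: Rm_sym power2_eq_square)
  then show ?thesis using Rm_square[OF assms assms] by simp
qed

lemma w_Rm: assumes "k < p" shows "w Rm k = 0"
proof (cases "k = 0")
  case True then show ?thesis by (simp add: w_def pt_0 Rm_diag)
next
  case False
  then have "bp b \<noteq> pt b k" for b
    using pt_inj[OF p_pos(1) assms, of b b] by (simp add: pt_0)
  moreover have "w H k = 0" using wH False assms by simp
  ultimately show ?thesis by (simp add: w_def Rm_def add_divide_distrib[symmetric])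
qed

abbreviation "cx K \<equiv> (\<lambda>x y. complex_of_real (K x y))"

definition kap :: "('a \<Rightarrow> 'a \<Rightarrow> real) \<Rightarrow> nat \<Rightarrow> complex"
  where "kap K j = F j (cx K) True True + F j (cx K) False False"

lemma kap_w: "kap K j = (\<Sum>k<p. complex_of_real (w K k) * \<zeta> ^ (j * k))"
  unfolding kap_def F_def w_def of_real_add distrib_right sum.distrib ..

lemma kap_Rm: "kap Rm j = 0"
  unfolding kap_w by (simp add: w_Rm)

lemma zinv_cx: "ginv G Q K \<Longrightarrow> zinv (cx K)"
  using ginv_zinv[of K] by (simp add: zinv_def)

definition idm :: "'a \<Rightarrow> 'a \<Rightarrow> complex" where "idm x y = (if x = y then 1 else 0)"

lemma F_idm: "F j idm a b = (if a = b then 1 else 0)"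
proof -
  have "F j idm a b = (\<Sum>k<p. if k = 0 then (if a = b then 1 else 0) else 0)"
    unfolding F_def idm_def
  proof (rule sum.cong[OF refl])
    fix k assume "k \<in> {..<p}"
    then have e: "(bp a = pt b k) = (a = b \<and> 0 = k)"
      using pt_inj[OF p_pos(1), of k a b, unfolded pt_0] by blast
    show "(if bp a = pt b k then 1 else 0) * \<zeta> ^ (j * k) = (if k = 0 then (if a = b then 1 else 0) else 0)"
      unfolding e by (cases "k = 0") simp_all
  qed
  also have "\<dots> = (if a = b then 1 else 0)" using p_pos(1) by (simp only: sum.delta finite_lessThan lessThan_iff if_True)
  finally show ?thesis .
qed

lemma F_linear: "F j (\<lambda>x y. c * K x y + d * L x y) a b = c * F j K a b + d * F j L a b"
  by (simp add: F_def sum_distrib_left sum.distrib algebra_simps)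

lemma F_cong: "(\<And>x y. x \<in> Q \<Longrightarrow> y \<in> Q \<Longrightarrow> K x y = L x y) \<Longrightarrow> F j K a b = F j L a b"
  unfolding F_def using bp_in pt_in by (intro sum.cong refl) simp

lemma F_Rm:
  assumes K: "ginv G Q K"
  shows "F j (cx K) a True * F j (cx Rm) True b + F j (cx K) a False * F j (cx Rm) False b
      = ev K * (F j (cx Rm) a b + (if a = b then 1 else 0)) - F j (cx K) a b" (is ?A)
    and "F j (cx Rm) a True * F j (cx K) True b + F j (cx Rm) a False * F j (cx K) False b
      = ev K * (F j (cx Rm) a b + (if a = b then 1 else 0)) - F j (cx K) a b" (is ?B)
proof -
  have rhs: "F j (\<lambda>x y. complex_of_real (ev K) * (cx Rm x y + idm x y) + (-1) * cx K x y) a b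
      = ev K * (F j (cx Rm) a b + (if a = b then 1 else 0)) - F j (cx K) a b"
    using F_linear[of j 1 "cx Rm" 1 idm a b] by (subst F_linear) (simp add: F_idm)
  have "F j (mmul Q (cx K) (cx Rm)) a b = F j (\<lambda>x y. complex_of_real (ev K) * (cx Rm x y + idm x y) + (-1) * cx K x y) a b"
  proof (rule F_cong)
    fix x y assume "x \<in> Q" "y \<in> Q"
    then have "mmul Q (cx K) (cx Rm) x y = complex_of_real (ev K * (Rm x y + (if x = y then 1 else 0)) - K x y)"
      using arg_cong[OF Rm_right[OF K, of x y], of complex_of_real] by (simp only: mmul_def of_real_sum of_real_mult)
    then show "mmul Q (cx K) (cx Rm) x y = complex_of_real (ev K) * (cx Rm x y + idm x y) + (-1) * cx K x y"
      by (simp add: idm_def)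
  qed
  then show ?A unfolding F_mult2[OF zinv_cx[OF Rm_ginv]] rhs .
  have "F j (mmul Q (cx Rm) (cx K)) a b = F j (\<lambda>x y. complex_of_real (ev K) * (cx Rm x y + idm x y) + (-1) * cx K x y) a b"
  proof (rule F_cong)
    fix x y assume "x \<in> Q" "y \<in> Q"
    then have "mmul Q (cx Rm) (cx K) x y = complex_of_real (ev K * (Rm x y + (if x = y then 1 else 0)) - K x y)"
      using arg_cong[OF Rm_left[OF K, of x y], of complex_of_real] by (simp only: mmul_def of_real_sum of_real_mult)
    then show "mmul Q (cx Rm) (cx K) x y = complex_of_real (ev K) * (cx Rm x y + idm x y) + (-1) * cx K x y"
      by (simp add: idm_def)
  qed
  then show ?B unfolding F_mult2[OF zinv_cx[OF K]] rhs .
qed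

lemma F_Rm_FF: "F j (cx Rm) False False = - F j (cx Rm) True True"
  using kap_Rm[of j] by (simp add: kap_def eq_neg_iff_add_eq_0 add.commute)

lemma F_Rm_sq: "F j (cx Rm) True True * F j (cx Rm) True True + F j (cx Rm) True False * F j (cx Rm) False True = 1"
  using F_Rm(1)[OF Rm_ginv, of j True True] by (simp add: ev_Rm)

text \<open>An instance of \<open>block_form\<close>, where \<open>kap_Rm\<close> supplies that the
  block of \<open>Rm\<close> has trace 0.\<close>

lemma F_form:
  assumes K: "ginv G Q K"
  shows "2 * F j (cx K) True True = ev K * (1 + F j (cx Rm) True True) + (kap K j - ev K) * (1 - F j (cx Rm) True True)"
    "2 * F j (cx K) True False = (ev K - (kap K j - ev K)) * F j (cx Rm) True False"
    "2 * F j (cx K) False True = (ev K - (kap K j - ev K)) * F j (cx Rm) False True"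
    "2 * F j (cx K) False False = ev K * (1 - F j (cx Rm) True True) + (kap K j - ev K) * (1 + F j (cx Rm) True True)"
proof -
  note f1 = F_Rm(1)[OF K, of j, unfolded F_Rm_FF] and f2 = F_Rm(2)[OF K, of j, unfolded F_Rm_FF]
  have h: "F j (cx K) True True * F j (cx Rm) True True + F j (cx K) True False * F j (cx Rm) False True = ev K * (F j (cx Rm) True True + 1) - F j (cx K) True True"
    "F j (cx K) True True * F j (cx Rm) True False + F j (cx K) True False * - F j (cx Rm) True True = ev K * F j (cx Rm) True False - F j (cx K) True False"
    "F j (cx K) False True * F j (cx Rm) True True + F j (cx K) False False * F j (cx Rm) False True = ev K * F j (cx Rm) False True - F j (cx K) False True"
    "F j (cx K) False True * F j (cx Rm) True False + F j (cx K) False False * - F j (cx Rm) True True = ev K * (- F j (cx Rm) True True + 1) - F j (cx K) False False"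
    using f1[of True True] F_Rm(1)[OF K, of j True False] f1[of False True] F_Rm(1)[OF K, of j False False]
    unfolding F_Rm_FF by simp_all
  have h': "F j (cx Rm) True True * F j (cx K) True True + F j (cx Rm) True False * F j (cx K) False True = ev K * (F j (cx Rm) True True + 1) - F j (cx K) True True"
    "F j (cx Rm) True True * F j (cx K) True False + F j (cx Rm) True False * F j (cx K) False False = ev K * F j (cx Rm) True False - F j (cx K) True False"
    "F j (cx Rm) False True * F j (cx K) True True + - F j (cx Rm) True True * F j (cx K) False True = ev K * F j (cx Rm) False True - F j (cx K) False True"
    "F j (cx Rm) False True * F j (cx K) True False + - F j (cx Rm) True True * F j (cx K) False False = ev K * (- F j (cx Rm) True True + 1) - F j (cx K) False False"
    using F_Rm(2)[OF K, of j True True] F_Rm(2)[OF K, of j True False] F_Rm(2)[OF K, of j False True] F_Rm(2)[OF K, of j False False]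
    unfolding F_Rm_FF by simp_all
  have c: "kap K j - ev K = F j (cx K) True True + F j (cx K) False False - ev K" by (simp add: kap_def)
  show "2 * F j (cx K) True True = ev K * (1 + F j (cx Rm) True True) + (kap K j - ev K) * (1 - F j (cx Rm) True True)"
    "2 * F j (cx K) True False = (ev K - (kap K j - ev K)) * F j (cx Rm) True False"
    "2 * F j (cx K) False True = (ev K - (kap K j - ev K)) * F j (cx Rm) False True"
    "2 * F j (cx K) False False = ev K * (1 - F j (cx Rm) True True) + (kap K j - ev K) * (1 + F j (cx Rm) True True)"
    unfolding c by (rule block_form[OF h h'])+
qed

lemma trace_parseval:
  assumes K: "ginv G Q K" and L: "ginv G Q L"
  shows "(\<Sum>x\<in>Q. \<Sum>y\<in>Q. complex_of_real (K x y * L y x))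
    = (\<Sum>j<p. ev K * ev L + (kap K j - ev K) * (kap L j - ev L))"
proof -
  have zm: "zinv (mmul Q (cx K) (cx L))"
    unfolding zinv_def mmul_def
  proof (intro ballI)
    fix x y assume xy: "x \<in> Q" "y \<in> Q"
    have "(\<Sum>u\<in>Q. cx K (z x) u * cx L u (z y)) = (\<Sum>u\<in>Q. cx K (z x) (z u) * cx L (z u) (z y))"
      by (rule sum_image[OF zG, symmetric])
    also have "\<dots> = (\<Sum>u\<in>Q. cx K x u * cx L u y)"
      using K L zG xy by (intro sum.cong refl) (simp add: ginv_def)
    finally show "(\<Sum>u\<in>Q. cx K (z x) u * cx L u (z y)) = (\<Sum>u\<in>Q. cx K x u * cx L u y)" .
  qed
  have "(\<Sum>x\<in>Q. \<Sum>y\<in>Q. complex_of_real (K x y * L y x)) = (\<Sum>x\<in>Q. mmul Q (cx K) (cx L) x x)"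
    by (simp add: mmul_def)
  also have "\<dots> = (\<Sum>j<p. F j (mmul Q (cx K) (cx L)) True True + F j (mmul Q (cx K) (cx L)) False False)"
    by (rule trace_F[OF zm])
  also have "\<dots> = (\<Sum>j<p. ev K * ev L + (kap K j - ev K) * (kap L j - ev L))"
    unfolding F_mult2[OF zinv_cx[OF L]] of_real_mult
    by (intro sum.cong refl block_trace[OF F_form[OF K] F_form[OF L] F_Rm_sq])
  finally show ?thesis .
qed

lemma kap_transpose: assumes L: "ginv G Q L"
  shows "kap (\<lambda>x y. L y x) j = (\<Sum>k<p. complex_of_real (w L k) * \<zeta> ^ (j * (p - k)))"
proof -
  define g where "g k = complex_of_real (w (\<lambda>x y. L y x) k) * \<zeta> ^ (j * k)" for k
  have "g (k + p) = g k" for k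
    by (simp add: g_def w_def pt_add_p zeta_period)
  then have "(\<Sum>k<p. g k) = (\<Sum>k<p. g (k + 1))" using sum_periodic_shift[of g p 1] by simp
  also have "\<dots> = (\<Sum>k<p. g (p - Suc k + 1))" by (rule sum.nat_diff_reindex[symmetric])
  also have "\<dots> = (\<Sum>k<p. complex_of_real (w L k) * \<zeta> ^ (j * (p - k)))"
  proof (rule sum.cong[OF refl])
    fix k assume "k \<in> {..<p}"
    then have k: "p - Suc k + 1 = p - k" "p - k + k = p" by auto
    have "pt b p = bp b" for b using pt_add_p[of b 0] by (simp add: pt_0)
    then have "L (pt b (p - k)) (bp b) = L (bp b) (pt b k)" for b
      using zinv_pt[OF ginv_zinv[OF L], of b "p - k" b k] k(2) by simp
    then show "g (p - Suc k + 1) = complex_of_real (w L k) * \<zeta> ^ (j * (p - k))"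
      unfolding g_def w_def k(1) by simp
  qed
  finally show ?thesis unfolding kap_w g_def .
qed

lemma kap_inverse: "k < p \<Longrightarrow> (\<Sum>j<p. kap K j * \<zeta> ^ (j * (p - k))) = of_nat p * complex_of_real (w K k)"
  unfolding kap_def distrib_right sum.distrib F_inverse w_def of_real_add distrib_left ..

lemma sum_kap: assumes "\<And>x. x \<in> Q \<Longrightarrow> K x x = 0" shows "(\<Sum>j<p. kap K j) = 0"
proof -
  have "\<zeta> ^ (j * p) = 1" for j unfolding root1_power_eq_1[OF p_pos(1)] by simp
  then show ?thesis using kap_inverse[OF p_pos(1), of K] assms bp_in by (simp add: w_def pt_0)
qed

text \<open>The trace of \<open>K\<close> times the transpose of \<open>L\<close> is computed from
  the entries and from the eigenvalues of the blocks. Zero diagonals make the block traces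
  \<open>kap\<close> sum to 0, which removes the mixed terms, and the products of block traces
  become products of weights.\<close>

lemma parseval:
  assumes K: "ginv G Q K" and L: "ginv G Q L"
    and K0: "\<And>x. x \<in> Q \<Longrightarrow> K x x = 0" and L0: "\<And>x. x \<in> Q \<Longrightarrow> L x x = 0"
    and x: "x \<in> Q"
  shows "2 * (\<Sum>y\<in>Q. K x y * L x y) = 2 * ev K * ev L + (\<Sum>k<p. w K k * w L k)"
proof -
  have KL: "ginv G Q (\<lambda>x y. K x y * L x y)" using K L by (simp add: ginv_def)
  have "(\<Sum>x\<in>Q. \<Sum>y\<in>Q. K x y * L x y) = (\<Sum>u\<in>Q. \<Sum>y\<in>Q. K x y * L x y)"
    by (rule sum.cong[OF refl]) (rule rowsum_const[OF KL _ x])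
  then have l: "(\<Sum>x\<in>Q. \<Sum>y\<in>Q. complex_of_real (K x y * L x y)) = of_nat p * complex_of_real (2 * (\<Sum>y\<in>Q. K x y * L x y))"
    unfolding of_real_sum[symmetric] by (simp add: card_Q)
  have q: "(\<Sum>j<p. kap K j * kap (\<lambda>x y. L y x) j) = of_nat p * (\<Sum>k<p. complex_of_real (w K k * w L k))"
  proof -
    have "(\<Sum>j<p. kap K j * kap (\<lambda>x y. L y x) j)
        = (\<Sum>k<p. \<Sum>j<p. complex_of_real (w L k) * (kap K j * \<zeta> ^ (j * (p - k))))"
      unfolding kap_transpose[OF L] sum_distrib_left
      by (subst sum.swap) (simp only: mult.left_commute)
    also have "\<dots> = (\<Sum>k<p. of_nat p * complex_of_real (w K k * w L k))"
      by (intro sum.cong refl) (simp add: kap_inverse sum_distrib_left[symmetric])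
    finally show ?thesis by (simp add: sum_distrib_left)
  qed
  have sk: "(\<Sum>j<p. kap K j) = 0" by (rule sum_kap) (rule K0)
  have sl: "(\<Sum>j<p. kap (\<lambda>x y. L y x) j) = 0" by (rule sum_kap) (rule L0)
  have "(\<Sum>x\<in>Q. \<Sum>y\<in>Q. complex_of_real (K x y * L x y))
      = (\<Sum>j<p. ev K * ev L + (kap K j - ev K) * (kap (\<lambda>x y. L y x) j - ev L))"
    using trace_parseval[OF K ginv_transpose[OF L]] unfolding ev_transpose[of L] .
  also have "\<dots> = (\<Sum>j<p. kap K j * kap (\<lambda>x y. L y x) j + complex_of_real (2 * ev K * ev L)
      - complex_of_real (ev L) * kap K j - complex_of_real (ev K) * kap (\<lambda>x y. L y x) j)"
    by (intro sum.cong refl) (simp add: algebra_simps)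
  also have "\<dots> = of_nat p * complex_of_real (2 * ev K * ev L + (\<Sum>k<p. w K k * w L k))"
    unfolding sum_subtractf sum.distrib sum_distrib_left[symmetric] q
    using sk sl by (simp add: algebra_simps)
  finally have "of_nat p * complex_of_real (2 * (\<Sum>y\<in>Q. K x y * L x y))
      = of_nat p * complex_of_real (2 * ev K * ev L + (\<Sum>k<p. w K k * w L k))" unfolding l .
  then have "complex_of_real (2 * (\<Sum>y\<in>Q. K x y * L x y)) = complex_of_real (2 * ev K * ev L + (\<Sum>k<p. w K k * w L k))"
    using p_pos(1) by (simp only: mult_cancel_left) simp
  then show ?thesis by (simp only: of_real_eq_iff)
qed

text \<open>Symmetry is not demanded: these are arbitrary unions of orbits of \<open>G\<close> on
  pairs of distinct points.\<close>

definition graph :: "('a \<Rightarrow> 'a \<Rightarrow> bool) \<Rightarrow> bool"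
  where "graph E \<longleftrightarrow> (\<forall>x\<in>Q. \<not> E x x) \<and> (\<forall>g\<in>G. \<forall>x\<in>Q. \<forall>y\<in>Q. E (g x) (g y) = E x y)"

abbreviation ind :: "('a \<Rightarrow> 'a \<Rightarrow> bool) \<Rightarrow> 'a \<Rightarrow> 'a \<Rightarrow> real"
  where "ind E \<equiv> (\<lambda>x y. if E x y then 1 else 0)"

definition valency :: "('a \<Rightarrow> 'a \<Rightarrow> bool) \<Rightarrow> nat"
  where "valency E = card {y \<in> Q. E (bp True) y}"

lemma ginv_ind: "graph E \<Longrightarrow> ginv G Q (ind E)"
  by (simp add: graph_def ginv_def)

lemma sum_ind: "(\<Sum>y\<in>Q. ind E x y) = card {y \<in> Q. E x y}"
proof -
  have "(\<Sum>y\<in>Q. ind E x y) = (\<Sum>y\<in>{y \<in> Q. E x y}. 1)"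
    using fin by (simp only: sum.inter_filter)
  then show ?thesis by simp
qed

lemma card_valency: assumes E: "graph E" and x: "x \<in> Q" shows "card {y \<in> Q. E x y} = valency E"
  using rowsum_const[OF ginv_ind[OF E] x bp_in[of True]] unfolding sum_ind valency_def by (simp only: of_nat_eq_iff)

lemma rowsum_ind: "graph E \<Longrightarrow> x \<in> Q \<Longrightarrow> (\<Sum>y\<in>Q. ind E x y) = valency E"
  unfolding sum_ind by (simp only: card_valency)

lemma valency_pos: assumes E: "graph E" and xy: "x \<in> Q" "y \<in> Q" "E x y" shows "valency E > 0"
proof -
  have "card {y \<in> Q. E x y} > 0" using xy fin by (subst card_gt_0_iff) auto
  then show ?thesis using card_valency[OF E xy(1)] by simp
qed

lemma valency_0: assumes E: "graph E" and z: "valency E = 0" and xy: "x \<in> Q" "y \<in> Q" shows "\<not> E x y"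
  using valency_pos[OF E xy] z by linarith

lemma w_ind_nonneg: "w (ind E) k \<ge> 0" by (simp add: w_def)

lemma ev_ind_level:
  assumes E: "graph E" and v: "\<And>x y. x \<in> Q \<Longrightarrow> y \<in> Q \<Longrightarrow> E x y \<Longrightarrow> Rm x y = v"
  shows "ev (ind E) = v * valency E"
proof -
  have b: "bp True \<in> Q" by (rule bp_in)
  have "ev (ind E) = (\<Sum>y\<in>Q. ind E (bp True) y * Rm (bp True) y) + ind E (bp True) (bp True)"
    by (rule ev_eq[OF ginv_ind[OF E] b])
  also have "\<dots> = (\<Sum>y\<in>Q. v * ind E (bp True) y)"
    using E b v[OF b] by (auto simp: graph_def intro!: sum.cong)
  also have "\<dots> = v * valency E" unfolding sum_distrib_left[symmetric] rowsum_ind[OF E b] ..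
  finally show ?thesis .
qed

lemma parseval_disjoint:
  assumes E: "graph E" and E': "graph E'" and d: "\<And>x y. x \<in> Q \<Longrightarrow> y \<in> Q \<Longrightarrow> E x y \<Longrightarrow> \<not> E' x y"
  shows "2 * ev (ind E) * ev (ind E') + (\<Sum>k<p. w (ind E) k * w (ind E') k) = 0"
proof -
  have "(\<Sum>y\<in>Q. ind E (bp True) y * ind E' (bp True) y) = 0"
    using d bp_in by (intro sum.neutral) auto
  then show ?thesis
    using parseval[OF ginv_ind[OF E] ginv_ind[OF E'] _ _ bp_in, of True] E E' by (simp add: graph_def)
qed

text \<open>For disjoint graphs the left side of \<open>parseval\<close> is 0, while the weights are
  nonnegative.\<close>

lemma ev_disjoint:
  assumes "graph E" "graph E'" "\<And>x y. x \<in> Q \<Longrightarrow> y \<in> Q \<Longrightarrow> E x y \<Longrightarrow> \<not> E' x y"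
  shows "ev (ind E) * ev (ind E') \<le> 0"
proof -
  have "(\<Sum>k<p. w (ind E) k * w (ind E') k) \<ge> 0"
    by (intro sum_nonneg mult_nonneg_nonneg w_ind_nonneg)
  then show ?thesis using parseval_disjoint[OF assms] by simp
qed

lemma graph_Rm: assumes P: "\<not> P 0" shows "graph (\<lambda>x y. P (Rm x y))"
proof -
  have "Rm (g x) (g y) = Rm x y" if "g \<in> G" "x \<in> Q" "y \<in> Q" for g x y
    using Rm_ginv that by (simp add: ginv_def)
  then show ?thesis unfolding graph_def using P by (simp add: Rm_diag)
qed

lemma graph_sub:
  assumes M: "ginv G Q M" and E: "graph E" shows "graph (\<lambda>x y. E x y \<and> P (M x y))"
proof -
  have "M (g x) (g y) = M x y" if "g \<in> G" "x \<in> Q" "y \<in> Q" for g x y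
    using M that by (simp add: ginv_def)
  then show ?thesis using E unfolding graph_def by simp
qed

text \<open>Otherwise \<open>M\<close> splits the level into two nonempty disjoint graphs, whose
  eigenvalues are \<open>v\<close> times their valencies and so have the same sign, against
  \<open>ev_disjoint\<close>.\<close>

lemma level_const:
  assumes M: "ginv G Q M" and v: "v \<noteq> 0"
    and xy: "x \<in> Q" "y \<in> Q" "Rm x y = v" and xy': "x' \<in> Q" "y' \<in> Q" "Rm x' y' = v"
  shows "M x y = M x' y'"
proof (rule ccontr)
  assume ne: "M x y \<noteq> M x' y'"
  let ?E = "\<lambda>u w. Rm u w = v \<and> M u w = M x y" and ?E' = "\<lambda>u w. Rm u w = v \<and> M u w \<noteq> M x y"
  have g: "graph (\<lambda>u w. Rm u w = v)" using graph_Rm[of "\<lambda>t. t = v"] v by simp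
  have E: "graph ?E" using graph_sub[OF M g, of "\<lambda>t. t = M x y"] .
  have E': "graph ?E'" using graph_sub[OF M g, of "\<lambda>t. t \<noteq> M x y"] .
  have "ev (ind ?E) * ev (ind ?E') \<le> 0" by (rule ev_disjoint[OF E E']) simp
  moreover have "ev (ind ?E) = v * valency ?E" by (rule ev_ind_level[OF E]) simp
  moreover have "ev (ind ?E') = v * valency ?E'" by (rule ev_ind_level[OF E']) simp
  moreover have "valency ?E > 0" using valency_pos[OF E xy(1,2)] xy by simp
  moreover have "valency ?E' > 0" using valency_pos[OF E' xy'(1,2)] xy' ne by simp
  ultimately have "(v * v) * (real (valency ?E) * real (valency ?E')) \<le> 0" by (simp add: mult_ac)
  moreover have "(v * v) * (real (valency ?E) * real (valency ?E')) > 0"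
  proof (rule mult_pos_pos)
    show "v * v > 0" using v by (simp add: zero_less_mult_iff linorder_neq_iff disj_commute)
    show "real (valency ?E) * real (valency ?E') > 0" using \<open>valency ?E > 0\<close> \<open>valency ?E' > 0\<close> by simp
  qed
  ultimately show False by simp
qed

text \<open>Level sets of \<open>Rm\<close> of the same sign coincide, because eigenvalues of disjoint graphs have
  opposite signs.\<close>

lemma level_unique:
  assumes xy: "x \<in> Q" "y \<in> Q" and xy': "x' \<in> Q" "y' \<in> Q" and s: "Rm x y * Rm x' y' > 0"
  shows "Rm x y = Rm x' y'"
proof (rule ccontr)
  assume ne: "Rm x y \<noteq> Rm x' y'"
  let ?E = "\<lambda>u w. Rm u w = Rm x y" and ?E' = "\<lambda>u w. Rm u w = Rm x' y'"
  have nz: "Rm x y \<noteq> 0" "Rm x' y' \<noteq> 0" using s by auto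
  have E: "graph ?E" using graph_Rm[of "\<lambda>t. t = Rm x y"] nz by simp
  have E': "graph ?E'" using graph_Rm[of "\<lambda>t. t = Rm x' y'"] nz by simp
  have "ev (ind ?E) * ev (ind ?E') \<le> 0" by (rule ev_disjoint[OF E E']) (use ne in simp)
  moreover have "ev (ind ?E) = Rm x y * valency ?E" by (rule ev_ind_level[OF E]) simp
  moreover have "ev (ind ?E') = Rm x' y' * valency ?E'" by (rule ev_ind_level[OF E']) simp
  moreover have "valency ?E > 0" using valency_pos[OF E xy] by simp
  moreover have "valency ?E' > 0" using valency_pos[OF E' xy'] by simp
  ultimately have "(Rm x y * Rm x' y') * (real (valency ?E) * real (valency ?E')) \<le> 0" by (simp add: mult_ac)
  moreover have "(Rm x y * Rm x' y') * (real (valency ?E) * real (valency ?E')) > 0"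
    using \<open>valency ?E > 0\<close> \<open>valency ?E' > 0\<close> s by simp
  ultimately show False by simp
qed

abbreviation Np where "Np \<equiv> (\<lambda>x y. Rm x y > 0)"
abbreviation Nm where "Nm \<equiv> (\<lambda>x y. Rm x y < 0)"
abbreviation N0 where "N0 \<equiv> (\<lambda>x y. x \<noteq> y \<and> Rm x y = 0)"

lemma ev_int: assumes K: "ginv G Q K" and i: "\<And>x y. K x y \<in> \<int>" shows "ev K \<in> \<int>"
proof -
  have "\<eta> y \<in> \<int>" for y using eta_pm[of y] by auto
  then have "(\<Sum>y\<in>Q. K (bp True) y * \<eta> y) \<in> \<int>" using i by (intro Ints_sum Ints_mult) auto
  moreover have "\<eta> (bp True) = 1" using eta_pt[of True 0] by (simp add: pt_0)
  ultimately show ?thesis using eta_right[OF K bp_in, of True] by simp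
qed

lemma graph_Np: "graph Np" and graph_Nm: "graph Nm"
  using graph_Rm[of "\<lambda>t. t > 0"] graph_Rm[of "\<lambda>t. t < 0"] by simp_all

lemma graph_N0: "graph N0"
proof -
  have "Rm (g x) (g y) = Rm x y" if "g \<in> G" "x \<in> Q" "y \<in> Q" for g x y
    using Rm_ginv that by (simp add: ginv_def)
  then show ?thesis using inj_G by (simp add: graph_def)
qed

end

text \<open>That \<open>T\<close> is a fixed-point-free involution commuting with \<open>G\<close>
  follows from the zero diagonal, the symmetry and the invariance of \<open>Rm\<close>.\<close>

locale matching_case = split_orbits +
  fixes T :: "'a \<Rightarrow> 'a"
  assumes T_in: "x \<in> Q \<Longrightarrow> T x \<in> Q"
    and Rm_T: "x \<in> Q \<Longrightarrow> y \<in> Q \<Longrightarrow> Rm x y = (if y = T x then -1 else 0)"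

text \<open>Zeros of \<open>Rm\<close> off the diagonal are still possible here. The last assumption
  records that at each shift either both base points meet a zero, or one of them meets a positive
  and the other a negative entry.\<close>

locale srg_case = split_orbits +
  fixes s :: nat
  assumes s_pos: "s \<ge> 1"
    and Rm_values: "x \<in> Q \<Longrightarrow> y \<in> Q \<Longrightarrow> Rm x y \<in> {0, 1 / (2 * s + 1), - 1 / (2 * s + 1)}"
    and deg_Np: "valency Np = s * (2 * s + 1)"
    and deg_Nm: "valency Nm = (s + 1) * (2 * s + 1)"
    and w_Np_le: "k < p \<Longrightarrow> w (ind Np) k = 0 \<and> w (ind Nm) k = 0 \<or> w (ind Np) k = 1 \<and> w (ind Nm) k = 1"

section \<open>The two possible shapes of \<open>Rm\<close>\<close>

context split_orbits
begin

lemma ex_Nm: obtains y where "y \<in> Q" "Rm (bp True) y < 0"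
proof -
  have "\<exists>y\<in>Q. Rm (bp True) y < 0"
  proof (rule ccontr)
    assume "\<not> (\<exists>y\<in>Q. Rm (bp True) y < 0)"
    then have "0 \<le> (\<Sum>y\<in>Q. Rm (bp True) y)" by (intro sum_nonneg) (simp add: not_less)
    then show False unfolding Rm_rowsum[OF bp_in] by simp
  qed
  then show thesis using that by blast
qed

text \<open>With a single nonzero level \<open>- v\<close> of valency \<open>k\<close>, the row sum
  -1 and the row norm 1 read \<open>v * k = 1\<close> and \<open>v * v * k = 1\<close>, so both
  numbers are 1.\<close>

lemma matching_if_no_Np:
  assumes "valency Np = 0"
  shows "\<exists>T. matching_case Q G p z bp T"
proof -
  obtain y0 where y0: "y0 \<in> Q" "Rm (bp True) y0 < 0" by (rule ex_Nm)
  define v where "v = - Rm (bp True) y0"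
  have v: "v > 0" using y0 by (simp add: v_def)
  have val: "Nm x y \<Longrightarrow> Rm x y = - v" "\<not> Nm x y \<Longrightarrow> Rm x y = 0" if "x \<in> Q" "y \<in> Q" for x y
  proof -
    have "\<not> Np x y" by (rule valency_0[OF graph_Np assms that])
    then show "Rm x y = 0" if "\<not> Nm x y" using that by simp
    show "Rm x y = - v" if "Rm x y < 0"
      using level_unique[OF \<open>x \<in> Q\<close> \<open>y \<in> Q\<close> bp_in[of True] y0(1)] mult_neg_neg[OF that y0(2)]
      by (simp add: v_def)
  qed
  have b: "bp True \<in> Q" by (rule bp_in)
  have bal: "Rm (bp True) y = - v * ind Nm (bp True) y \<and> (Rm (bp True) y)\<^sup>2 = v\<^sup>2 * ind Nm (bp True) y"
    if "y \<in> Q" for y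
  proof (cases "Nm (bp True) y")
    case True
    then have "Rm (bp True) y = - v" by (rule val(1)[OF b that])
    then show ?thesis using v by simp
  next
    case False
    then show ?thesis using val(2)[OF b that] by simp
  qed
  have s1: "(\<Sum>y\<in>Q. Rm (bp True) y) = (\<Sum>y\<in>Q. - v * ind Nm (bp True) y)"
    by (intro sum.cong refl) (use bal in blast)
  have k1: "v * valency Nm = 1"
    using s1 unfolding Rm_rowsum[OF b] sum_distrib_left[symmetric] rowsum_ind[OF graph_Nm b] by simp
  have s2: "(\<Sum>y\<in>Q. (Rm (bp True) y)\<^sup>2) = (\<Sum>y\<in>Q. v\<^sup>2 * ind Nm (bp True) y)"
    by (intro sum.cong refl) (use bal in blast)
  have k2: "v\<^sup>2 * valency Nm = 1"
    using s2 unfolding Rm_norm[OF b] sum_distrib_left[symmetric] rowsum_ind[OF graph_Nm b] by simp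
  have v1: "v = 1" using k1 k2 by (simp add: power2_eq_square mult.assoc)
  then have d1: "valency Nm = 1" using k1 by simp
  have "\<exists>t. {y \<in> Q. Nm x y} = {t}" if "x \<in> Q" for x
    using card_valency[OF graph_Nm that] d1 card_1_singletonE by metis
  then obtain T where T: "\<And>x. x \<in> Q \<Longrightarrow> {y \<in> Q. Nm x y} = {T x}" by metis
  have "matching_case Q G p z bp T"
  proof unfold_locales
    show "T x \<in> Q" if "x \<in> Q" for x using T[OF that] by blast
    show "Rm x y = (if y = T x then -1 else 0)" if "x \<in> Q" "y \<in> Q" for x y
    proof -
      have "Nm x y \<longleftrightarrow> y = T x" using T[OF that(1)] that(2) by blast
      then show ?thesis using val[OF that] v1 by (cases "Nm x y") simp_all
    qed
  qed
  then show ?thesis by blast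
qed

text \<open>The eigenvalues of \<open>Np\<close> and \<open>Nm\<close> have opposite signs, so by
  \<open>parseval_disjoint\<close> some shift carries one edge of each graph, and
  \<open>w_Rm\<close> at that shift forces the two levels to be opposite. The eigenvalue of
  \<open>Np\<close> is a positive integer \<open>s\<close>, and the row sum and row norm then
  express everything through \<open>s\<close>.\<close>

lemma srg_if_Np:
  assumes "valency Np \<noteq> 0"
  shows "\<exists>s. srg_case Q G p z bp s"
proof -
  have b: "bp True \<in> Q" by (rule bp_in)
  obtain y0 where y0: "y0 \<in> Q" "Rm (bp True) y0 < 0" by (rule ex_Nm)
  have "{y \<in> Q. Np (bp True) y} \<noteq> {}" using assms by (metis card.empty valency_def)
  then obtain y1 where y1: "y1 \<in> Q" "Rm (bp True) y1 > 0" by blast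
  define u where "u = - Rm (bp True) y0"
  define v where "v = Rm (bp True) y1"
  have uv: "u > 0" "v > 0" using y0 y1 by (simp_all add: u_def v_def)
  have val: "Rm x y = v * ind Np x y - u * ind Nm x y" if xy: "x \<in> Q" "y \<in> Q" for x y
  proof (cases "Rm x y" "0 :: real" rule: linorder_cases)
    case less
    then show ?thesis using level_unique[OF xy b y0(1)] mult_neg_neg[OF less y0(2)] by (simp add: u_def)
  next
    case greater
    then show ?thesis using level_unique[OF xy b y1(1)] y1(2) by (simp add: v_def)
  qed simp
  have evp: "ev (ind Np) = v * valency Np"
  proof (rule ev_ind_level[OF graph_Np])
    fix x y assume "x \<in> Q" "y \<in> Q" "Np x y"
    then show "Rm x y = v" using val[of x y] by (simp only: if_True not_less_iff_gr_or_eq) simp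
  qed
  have evm: "ev (ind Nm) = - u * valency Nm"
  proof (rule ev_ind_level[OF graph_Nm])
    fix x y assume "x \<in> Q" "y \<in> Q" "Nm x y"
    then show "Rm x y = - u" using val[of x y] by (simp only: if_True not_less_iff_gr_or_eq) simp
  qed
  have dp: "valency Np > 0" and dm: "valency Nm > 0"
    using valency_pos[OF graph_Np b y1(1)] valency_pos[OF graph_Nm b y0(1)] y0 y1 by simp_all
  have wv: "v * w (ind Np) k = u * w (ind Nm) k" if "k < p" for k
  proof -
    have "w Rm k = v * w (ind Np) k - u * w (ind Nm) k"
    proof -
      have "w Rm k = (v * ind Np (bp True) (pt True k) - u * ind Nm (bp True) (pt True k))
          + (v * ind Np (bp False) (pt False k) - u * ind Nm (bp False) (pt False k))"
        unfolding w_def by (rule arg_cong2[of _ _ _ _ "(+)", OF val[OF bp_in pt_in] val[OF bp_in pt_in]])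
      then show ?thesis unfolding w_def distrib_left by simp
    qed
    then show ?thesis using w_Rm[OF that] by simp
  qed
  have wle: "w (ind Np) k + w (ind Nm) k \<le> 2" for k by (simp add: w_def)
  have wcase: "w (ind E) k \<in> {0, 1, 2}" for E k by (simp add: w_def)
  have "2 * ev (ind Np) * ev (ind Nm) + (\<Sum>k<p. w (ind Np) k * w (ind Nm) k) = 0"
    by (rule parseval_disjoint[OF graph_Np graph_Nm]) simp
  moreover have "ev (ind Np) * ev (ind Nm) < 0" unfolding evp evm using uv dp dm
    by (intro mult_pos_neg mult_neg_pos mult_pos_pos) auto
  ultimately have "(\<Sum>k<p. w (ind Np) k * w (ind Nm) k) \<noteq> 0" by simp
  then obtain k where k: "k < p" "w (ind Np) k * w (ind Nm) k \<noteq> 0"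
    using sum.neutral[of "{..<p}" "\<lambda>k. w (ind Np) k * w (ind Nm) k"] by auto
  then have "w (ind Np) k = 1" "w (ind Nm) k = 1" using wle[of k] wcase[of Np k] wcase[of Nm k] by auto
  then have uv': "u = v" using wv[OF k(1)] by simp
  have s1: "(\<Sum>y\<in>Q. Rm (bp True) y) = (\<Sum>y\<in>Q. v * ind Np (bp True) y - v * ind Nm (bp True) y)"
    using val[OF b] unfolding uv' by (intro sum.cong refl)
  have e1: "v * valency Nm = v * valency Np + 1"
    using s1 unfolding Rm_rowsum[OF b] sum_subtractf sum_distrib_left[symmetric]
      rowsum_ind[OF graph_Nm b] rowsum_ind[OF graph_Np b] by simp
  have s2: "(\<Sum>y\<in>Q. (Rm (bp True) y)\<^sup>2) = (\<Sum>y\<in>Q. v\<^sup>2 * ind Np (bp True) y + v\<^sup>2 * ind Nm (bp True) y)"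
  proof (intro sum.cong refl)
    fix y assume "y \<in> Q"
    then have e: "(Rm (bp True) y)\<^sup>2 = (v * ind Np (bp True) y - v * ind Nm (bp True) y)\<^sup>2"
      using arg_cong[OF val[OF b], of y power2] uv' by simp
    show "(Rm (bp True) y)\<^sup>2 = v\<^sup>2 * ind Np (bp True) y + v\<^sup>2 * ind Nm (bp True) y"
      by (rule HOL.trans[OF e]) auto
  qed
  have e2: "v\<^sup>2 * valency Np + v\<^sup>2 * valency Nm = 1"
    using s2 unfolding Rm_norm[OF b] sum.distrib sum_distrib_left[symmetric]
      rowsum_ind[OF graph_Nm b] rowsum_ind[OF graph_Np b] by simp
  have "v * valency Np \<in> \<int>" unfolding evp[symmetric] by (rule ev_int[OF ginv_ind[OF graph_Np]]) simp
  then obtain i where i: "v * valency Np = of_int i" by (rule Ints_cases)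
  have "v * valency Np > 0" using uv dp by simp
  then have "i > 0" using i by simp
  define s where "s = nat i"
  have s: "v * valency Np = real s" "s \<ge> 1" using i \<open>i > 0\<close> by (simp_all add: s_def)
  have "v * (v * valency Np) + v * (v * valency Nm) = 1" using e2 by (simp add: power2_eq_square mult.assoc)
  then have "v * (2 * s + 1) = 1" unfolding e1 s(1) by (simp add: algebra_simps)
  then have v: "v = 1 / (2 * s + 1)" by (simp add: eq_divide_eq)
  have "real (valency Np) = real (s * (2 * s + 1))" using s(1) unfolding v by (simp add: field_simps)
  then have kp: "valency Np = s * (2 * s + 1)" by (simp only: of_nat_eq_iff)
  have "real (valency Nm) = real ((s + 1) * (2 * s + 1))"
    using e1 s(1) unfolding v by (simp add: field_simps)
  then have km: "valency Nm = (s + 1) * (2 * s + 1)" by (simp only: of_nat_eq_iff)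
  have "srg_case Q G p z bp s"
  proof unfold_locales
    show "Rm x y \<in> {0, 1 / (2 * s + 1), - 1 / (2 * s + 1)}" if "x \<in> Q" "y \<in> Q" for x y
      by (rule linorder_cases[of "Rm x y" 0]) (use val[OF that] uv' v in simp_all)
    show "w (ind Np) k = 0 \<and> w (ind Nm) k = 0 \<or> w (ind Np) k = 1 \<and> w (ind Nm) k = 1" if "k < p" for k
    proof -
      have "w (ind Np) k = w (ind Nm) k" using wv[OF that] uv' uv by simp
      then show ?thesis using wle[of k] wcase[of Np k] by auto
    qed
  qed (use s kp km in simp_all)
  then show ?thesis ..
qed

lemma split_cases: "(\<exists>T. matching_case Q G p z bp T) \<or> (\<exists>s. srg_case Q G p z bp s)"
  using matching_if_no_Np srg_if_Np by blast

section \<open>Spectral idempotents and eigenvalues modulo \<open>p\<close>\<close>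

definition Ej :: "nat \<Rightarrow> bool \<Rightarrow> bool \<Rightarrow> complex"
  where "Ej j a b = ((if a = b then 1 else 0) - F j (cx Rm) a b) / 2"

text \<open>Each Fourier block of an invariant matrix has the eigenvalue \<open>ev K\<close> in common; the idempotent
  \<open>Ej\<close> projects to the other one, which is \<open>om K j\<close>.\<close>

abbreviation om :: "('a \<Rightarrow> 'a \<Rightarrow> real) \<Rightarrow> nat \<Rightarrow> complex"
  where "om K j \<equiv> kap K j - ev K"

lemma Ej_double: "2 * Ej j a b = (if a = b then 1 else 0) - F j (cx Rm) a b"
  by (simp add: Ej_def)

lemma Ej_K:
  assumes K: "ginv G Q K"
  shows "Ej j a True * F j (cx K) True b + Ej j a False * F j (cx K) False b = om K j * Ej j a b"
proof -
  have l: "F j (cx Rm) a True * F j (cx K) True b + F j (cx Rm) a False * F j (cx K) False b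
      = ev K * (F j (cx Rm) a b + (if a = b then 1 else 0)) - F j (cx K) a b" by (rule F_Rm(2)[OF K])
  have "2 * F j (cx K) a b = ev K * ((if a = b then 1 else 0) + F j (cx Rm) a b)
      + om K j * ((if a = b then 1 else 0) - F j (cx Rm) a b)"
    using F_form[OF K, of j] F_Rm_FF[of j] by (cases a; cases b) (simp_all add: algebra_simps)
  then have f: "2 * F j (cx K) a b - ev K * (F j (cx Rm) a b + (if a = b then 1 else 0)) = om K j * (2 * Ej j a b)"
    unfolding Ej_double by (simp add: algebra_simps)
  have "2 * (Ej j a True * F j (cx K) True b + Ej j a False * F j (cx K) False b)
      = (2 * Ej j a True) * F j (cx K) True b + (2 * Ej j a False) * F j (cx K) False b"
    by (simp add: algebra_simps)
  also have "\<dots> = F j (cx K) a b - (F j (cx Rm) a True * F j (cx K) True b + F j (cx Rm) a False * F j (cx K) False b)"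
    unfolding Ej_double by (cases a) (simp_all add: algebra_simps)
  also have "\<dots> = 2 * (om K j * Ej j a b)" unfolding l using f by (simp add: algebra_simps)
  finally have "2 * (Ej j a True * F j (cx K) True b + Ej j a False * F j (cx K) False b) = 2 * (om K j * Ej j a b)" .
  then show ?thesis by (simp only: mult_cancel_left) simp
qed

lemma Ej_trace: "Ej j True True + Ej j False False = 1"
  unfolding Ej_def F_Rm_FF by (simp add: field_simps)

lemma Ej_idem: "Ej j a True * Ej j True b + Ej j a False * Ej j False b = Ej j a b"
proof -
  have "om Rm j = -1" by (simp add: kap_Rm ev_Rm)
  then have "Ej j a True * F j (cx Rm) True b + Ej j a False * F j (cx Rm) False b = - Ej j a b"
    using Ej_K[OF Rm_ginv, of j a b] by simp
  moreover have "2 * (Ej j a True * Ej j True b + Ej j a False * Ej j False b)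
      = Ej j a b - (Ej j a True * F j (cx Rm) True b + Ej j a False * F j (cx Rm) False b)"
  proof -
    have "2 * (Ej j a True * Ej j True b + Ej j a False * Ej j False b)
        = Ej j a True * (2 * Ej j True b) + Ej j a False * (2 * Ej j False b)" by (simp add: algebra_simps)
    then show ?thesis unfolding Ej_double by (cases b) (simp_all add: algebra_simps)
  qed
  ultimately have "2 * (Ej j a True * Ej j True b + Ej j a False * Ej j False b) = 2 * Ej j a b" by simp
  then show ?thesis by (simp only: mult_cancel_left) simp
qed

lemma zinv_mmul: assumes K: "zinv K" and L: "zinv (L :: 'a \<Rightarrow> 'a \<Rightarrow> complex)" shows "zinv (mmul Q K L)"
  unfolding zinv_def mmul_def
proof (intro ballI)
  fix x y assume xy: "x \<in> Q" "y \<in> Q"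
  have "(\<Sum>u\<in>Q. K (z x) u * L u (z y)) = (\<Sum>u\<in>Q. K (z x) (z u) * L (z u) (z y))"
    by (rule sum_image[OF zG, symmetric])
  also have "\<dots> = (\<Sum>u\<in>Q. K x u * L u y)"
    using K L xy by (intro sum.cong refl) (simp add: zinv_def)
  finally show "(\<Sum>u\<in>Q. K (z x) u * L u (z y)) = (\<Sum>u\<in>Q. K x u * L u y)" .
qed

lemma ginv_mmul: assumes K: "ginv G Q K" and L: "ginv G Q (L :: 'a \<Rightarrow> 'a \<Rightarrow> complex)" shows "ginv G Q (mmul Q K L)"
  unfolding ginv_def mmul_def
proof (intro ballI)
  fix g x y assume g: "g \<in> G" and xy: "x \<in> Q" "y \<in> Q"
  have "(\<Sum>u\<in>Q. K (g x) u * L u (g y)) = (\<Sum>u\<in>Q. K (g x) (g u) * L (g u) (g y))"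
    by (rule sum_image[OF g, symmetric])
  also have "\<dots> = (\<Sum>u\<in>Q. K x u * L u y)"
    using K L g xy by (intro sum.cong refl) (simp add: ginv_def)
  finally show "(\<Sum>u\<in>Q. K (g x) u * L u (g y)) = (\<Sum>u\<in>Q. K x u * L u y)" .
qed

text \<open>At frequency 0 the block has row sums -1, is symmetric and has trace 0; these conditions
  determine it.\<close>

lemma F0_Rm: "F 0 (cx Rm) a b = (if a = b then 0 else -1)"
proof -
  have row: "F 0 (cx Rm) a True + F 0 (cx Rm) a False = -1" for a
  proof -
    have "(\<Sum>k<p. Rm (bp a) (pt True k)) + (\<Sum>k<p. Rm (bp a) (pt False k)) = -1"
      using Rm_rowsum[OF bp_in[of a]] unfolding sum_pt UNIV_bool by (simp add: add.commute)
    then have "complex_of_real ((\<Sum>k<p. Rm (bp a) (pt True k)) + (\<Sum>k<p. Rm (bp a) (pt False k))) = -1" by simp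
    then show ?thesis by (simp add: F_def)
  qed
  have sym: "F 0 (cx Rm) True False = F 0 (cx Rm) False True"
  proof -
    have "F 0 (cx (\<lambda>x y. Rm y x)) a b = F 0 (cx Rm) b a" for a b
    proof -
      define g where "g k = Rm (pt b k) (bp a)" for k
      have "g (k + p) = g k" for k by (simp add: g_def pt_add_p)
      then have "(\<Sum>k<p. g k) = (\<Sum>k<p. g (k + 1))" using sum_periodic_shift[of g p 1] by simp
      also have "\<dots> = (\<Sum>k<p. g (p - Suc k + 1))" by (rule sum.nat_diff_reindex[symmetric])
      also have "\<dots> = (\<Sum>k<p. Rm (bp b) (pt a k))"
      proof (rule sum.cong[OF refl])
        fix k assume "k \<in> {..<p}"
        then have k: "p - Suc k + 1 = p - k" "p - k + k = p" by auto
        have "pt a p = bp a" using pt_add_p[of a 0] by (simp add: pt_0)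
        then show "g (p - Suc k + 1) = Rm (bp b) (pt a k)"
          using zinv_pt[OF ginv_zinv[OF Rm_ginv], of b "p - k" a k] k by (simp add: g_def)
      qed
      finally have "(\<Sum>k<p. Rm (pt b k) (bp a)) = (\<Sum>k<p. Rm (bp b) (pt a k))" unfolding g_def .
      then show ?thesis by (simp add: F_def of_real_sum[symmetric] del: of_real_sum)
    qed
    moreover have "(\<lambda>x y. Rm y x) = Rm" using Rm_sym by blast
    ultimately show ?thesis by metis
  qed
  have 1: "F 0 (cx Rm) True True + F 0 (cx Rm) True False = -1" by (rule row)
  have 2: "F 0 (cx Rm) True False - F 0 (cx Rm) True True = -1" using row[of False] unfolding sym F_Rm_FF by simp
  have "F 0 (cx Rm) True False = -1 - F 0 (cx Rm) True True" using 1 by (simp add: eq_diff_eq add.commute)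
  then have "2 * F 0 (cx Rm) True True = 0" using 2 by simp
  then have t: "F 0 (cx Rm) True True = 0" by simp
  then show ?thesis using 1 sym F_Rm_FF[of 0] by (cases a; cases b) simp_all
qed

lemma F_const: "F j (\<lambda>x y. c) a b = (if p dvd j then of_nat p * c else 0)"
proof (cases "p dvd j")
  case True
  then have "\<zeta> ^ (j * k) = 1" for k unfolding root1_power_eq_1[OF p_pos(1)] by simp
  then show ?thesis using True by (simp add: F_def)
next
  case False
  then show ?thesis using sum_root1[OF p_pos(1) False] by (simp add: F_def sum_distrib_left[symmetric])
qed

text \<open>At frequency 0 the block of \<open>(1 - Rm) / 2\<close> is the projection to the
  constants, so subtracting the constant matrix removes this frequency and touches no other.\<close>

lemma F_E0:
  assumes "j < p"
  shows "F j (\<lambda>x y. (1/2) * idm x y + (-1/2) * cx Rm x y + (- 1 / (2 * of_nat p)) * 1) a b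
    = (if j = 0 then 0 else Ej j a b)"
proof -
  have "F j (\<lambda>x y. (1/2) * idm x y + (-1/2) * cx Rm x y + (- 1 / (2 * of_nat p)) * 1) a b
      = 1 * F j (\<lambda>x y. (1/2) * idm x y + (-1/2) * cx Rm x y) a b + (- 1 / (2 * of_nat p)) * F j (\<lambda>x y. 1) a b"
    using F_linear[of j 1 "\<lambda>x y. (1/2) * idm x y + (-1/2) * cx Rm x y" "- 1 / (2 * of_nat p)" "\<lambda>x y. 1" a b] by simp
  also have "\<dots> = Ej j a b + (- 1 / (2 * of_nat p)) * (if p dvd j then of_nat p else 0)"
    unfolding F_linear F_const F_idm by (simp add: Ej_def field_simps)
  also have "\<dots> = (if j = 0 then 0 else Ej j a b)"
  proof (cases "j = 0")
    case True
    then show ?thesis using p_pos by (simp add: Ej_def F0_Rm)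
  next
    case False
    then have "\<not> p dvd j" using assms nat_dvd_not_less by auto
    then show ?thesis using False by simp
  qed
  finally show ?thesis .
qed

text \<open>Lagrange interpolation: the spectral idempotent of \<open>K\<close> for the eigenvalue \<open>l\<close>.\<close>

lemma spectral_product:
  assumes K: "ginv G Q K" and A: "finite A"
  shows "\<exists>Y. ginv G Q Y \<and> (\<forall>j<p. \<forall>a b. F j Y a b = (if j = 0 then 0 else (\<Prod>m\<in>A. (om K j - m) / (l - m)) * Ej j a b))"
  using A
proof (induction A)
  case empty
  have "ginv G Q (\<lambda>x y. (1/2) * idm x y + (-1/2) * cx Rm x y + (- 1 / (2 * of_nat p)) * 1)"
    using Rm_ginv inj_G by (simp add: ginv_def idm_def)
  then show ?case using F_E0 by (intro exI[of _ "\<lambda>x y. (1/2) * idm x y + (-1/2) * cx Rm x y + (- 1 / (2 * of_nat p)) * 1"]) simp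
next
  case (insert m A)
  then obtain Y where Y: "ginv G Q Y"
    and FY: "\<And>j a b. j < p \<Longrightarrow> F j Y a b = (if j = 0 then 0 else (\<Prod>m\<in>A. (om K j - m) / (l - m)) * Ej j a b)" by blast
  have cK: "ginv G Q (cx K)" using K by (simp add: ginv_def)
  define Z where "Z = (\<lambda>x y. (1 / (l - m)) * mmul Q Y (cx K) x y + (- m / (l - m)) * Y x y)"
  have "ginv G Q Z" using ginv_mmul[OF Y cK] Y by (simp add: Z_def ginv_def)
  moreover have "F j Z a b = (if j = 0 then 0 else (\<Prod>m\<in>insert m A. (om K j - m) / (l - m)) * Ej j a b)" if j: "j < p" for j a b
  proof (cases "j = 0")
    case True
    then show ?thesis unfolding Z_def F_linear F_mult2[OF zinv_cx[OF K]] using FY[OF j] by simp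
  next
    case False
    define c where "c = (\<Prod>m\<in>A. (om K j - m) / (l - m))"
    have f: "F j Y a b = c * Ej j a b" for a b using FY[OF j] False by (simp add: c_def)
    have "F j Z a b = (1 / (l - m)) * (c * (Ej j a True * F j (cx K) True b + Ej j a False * F j (cx K) False b))
        + (- m / (l - m)) * (c * Ej j a b)"
      unfolding Z_def F_linear F_mult2[OF zinv_cx[OF K]] f by (simp only: distrib_left mult.assoc)
    also have "\<dots> = ((om K j - m) / (l - m)) * c * Ej j a b"
      unfolding Ej_K[OF K] by (simp add: diff_divide_distrib add_divide_distrib algebra_simps)
    also have "\<dots> = (\<Prod>m\<in>insert m A. (om K j - m) / (l - m)) * Ej j a b"
      using insert.hyps by (simp add: c_def)
    finally show ?thesis using False by simp
  qed
  ultimately show ?case by blast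
qed

text \<open>The interpolation nodes are the other values of \<open>om K\<close>. Leaving out
  frequency 0 keeps the rank of \<open>Y\<close> below \<open>p\<close>, and \<open>om_div\<close>
  needs a rank that is invertible modulo \<open>p\<close>.\<close>

lemma spectral_idempotent:
  assumes K: "ginv G Q K"
  obtains Y where "ginv G Q Y"
    "\<And>j a b. j < p \<Longrightarrow> F j Y a b = (if j \<noteq> 0 \<and> om K j = l then Ej j a b else 0)"
    "\<And>x y. x \<in> Q \<Longrightarrow> y \<in> Q \<Longrightarrow> mmul Q Y Y x y = Y x y"
proof -
  define A where "A = om K ` {..<p} - {l}"
  obtain Y where Y: "ginv G Q Y"
    and FY: "\<And>j a b. j < p \<Longrightarrow> F j Y a b = (if j = 0 then 0 else (\<Prod>m\<in>A. (om K j - m) / (l - m)) * Ej j a b)"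
    using spectral_product[OF K, of A l] by (auto simp: A_def)
  have FY': "F j Y a b = (if j \<noteq> 0 \<and> om K j = l then Ej j a b else 0)" if j: "j < p" for j a b
  proof (cases "om K j = l")
    case True
    have "(\<Prod>m\<in>A. (om K j - m) / (l - m)) = 1"
      unfolding True by (rule prod.neutral) (auto simp: A_def)
    then show ?thesis using FY[OF j] True by simp
  next
    case False
    then have "om K j \<in> A" "finite A" using j by (auto simp: A_def)
    then have "(\<Prod>m\<in>A. (om K j - m) / (l - m)) = 0" by (intro prod_zero bexI[of _ "om K j"]) auto
    then show ?thesis using FY[OF j] False by simp
  qed
  have zY: "zinv Y" using Y zG by (simp add: ginv_def zinv_def)
  have "mmul Q Y Y x y = Y x y" if xy: "x \<in> Q" "y \<in> Q" for x y
  proof -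
    let ?D = "\<lambda>x y. 1 * mmul Q Y Y x y + (-1) * Y x y"
    have "zinv ?D" using zinv_mmul[OF zY zY] zY unfolding zinv_def by simp
    moreover have "F j ?D a b = 0" if "j < p" for j a b
      unfolding F_linear F_mult2[OF zY] FY'[OF that] using Ej_idem[of j a b] by simp
    ultimately have "?D x y = 0" using xy by (rule F_zero)
    then show ?thesis by simp
  qed
  then show thesis using that[OF Y FY'] by blast
qed

text \<open>Right translations are the model; their powers and the products of the translations of
  \<open>a\<close> and \<open>T a\<close> are used as well.\<close>

definition equivariant :: "('a \<Rightarrow> 'a \<Rightarrow> 'a) \<Rightarrow> bool"
  where "equivariant \<gamma> \<longleftrightarrow> (\<forall>a\<in>Q. \<gamma> a \<in> G) \<and> (\<forall>g\<in>G. \<forall>a\<in>Q. \<forall>x\<in>Q. \<gamma> (g a) (g x) = g (\<gamma> a x))"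

definition cnt :: "('a \<Rightarrow> 'a \<Rightarrow> 'a) \<Rightarrow> 'a \<Rightarrow> 'a \<Rightarrow> real"
  where "cnt \<gamma> x y = card {a \<in> Q. \<gamma> a x = y}"

lemma cnt_sum: "cnt \<gamma> x y = (\<Sum>a\<in>Q. if \<gamma> a x = y then 1 else 0)"
proof -
  have "(\<Sum>a\<in>Q. if \<gamma> a x = y then 1 else 0) = (\<Sum>a\<in>{a \<in> Q. \<gamma> a x = y}. 1::real)"
    using fin by (simp only: sum.inter_filter)
  then show ?thesis by (simp add: cnt_def)
qed

lemma cnt_ginv: assumes \<gamma>: "equivariant \<gamma>" shows "ginv G Q (cnt \<gamma>)"
  unfolding ginv_def
proof (intro ballI)
  fix g x y assume g: "g \<in> G" and xy: "x \<in> Q" "y \<in> Q"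
  have "cnt \<gamma> (g x) (g y) = (\<Sum>a\<in>Q. if \<gamma> (g a) (g x) = g y then 1 else 0)"
    unfolding cnt_sum by (rule sum_image[OF g, symmetric])
  also have "\<dots> = cnt \<gamma> x y" unfolding cnt_sum
    using \<gamma> g xy inj_G[OF g] by (intro sum.cong refl) (simp add: equivariant_def)
  finally show "cnt \<gamma> (g x) (g y) = cnt \<gamma> x y" .
qed

text \<open>The matrix \<open>cnt \<gamma>\<close> is the sum of the permutation matrices of all
  \<open>\<gamma> a\<close>. These are conjugate under \<open>G\<close>, and the trace against an
  invariant \<open>Y\<close> is the same for each of them.\<close>

lemma trace_shift:
  assumes \<gamma>: "equivariant \<gamma>" and Y: "ginv G Q (Y :: 'a \<Rightarrow> 'a \<Rightarrow> complex)" and a: "a \<in> Q"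
  shows "(\<Sum>x\<in>Q. mmul Q (cx (cnt \<gamma>)) Y x x) = 2 * of_nat p * (\<Sum>x\<in>Q. Y (\<gamma> a x) x)"
proof -
  have "mmul Q (cx (cnt \<gamma>)) Y x x = (\<Sum>b\<in>Q. Y (\<gamma> b x) x)" if x: "x \<in> Q" for x
  proof -
    have "mmul Q (cx (cnt \<gamma>)) Y x x = (\<Sum>u\<in>Q. \<Sum>b\<in>Q. (if \<gamma> b x = u then 1 else 0) * Y u x)"
      unfolding mmul_def cnt_sum by (simp add: sum_distrib_right if_distrib[of complex_of_real] cong: if_cong)
    also have "\<dots> = (\<Sum>b\<in>Q. \<Sum>u\<in>Q. if \<gamma> b x = u then Y u x else 0)"
      by (subst sum.swap) (intro sum.cong refl, simp)
    also have "\<dots> = (\<Sum>b\<in>Q. Y (\<gamma> b x) x)"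
    proof (rule sum.cong[OF refl])
      fix b assume "b \<in> Q"
      then have "\<gamma> b x \<in> Q" using \<gamma> x mem by (simp add: equivariant_def)
      then show "(\<Sum>u\<in>Q. if \<gamma> b x = u then Y u x else 0) = Y (\<gamma> b x) x" using fin by (simp add: sum.delta')
    qed
    finally show ?thesis .
  qed
  then have "(\<Sum>x\<in>Q. mmul Q (cx (cnt \<gamma>)) Y x x) = (\<Sum>b\<in>Q. \<Sum>x\<in>Q. Y (\<gamma> b x) x)"
    by (subst sum.swap) simp
  also have "\<dots> = (\<Sum>b\<in>Q. \<Sum>x\<in>Q. Y (\<gamma> a x) x)"
  proof (rule sum.cong[OF refl])
    fix b assume b: "b \<in> Q"
    obtain g where g: "g \<in> G" "g a = b" using trans[OF a b] by blast
    have "(\<Sum>x\<in>Q. Y (\<gamma> b x) x) = (\<Sum>x\<in>Q. Y (\<gamma> b (g x)) (g x))" by (rule sum_image[OF g(1), symmetric])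
    also have "\<dots> = (\<Sum>x\<in>Q. Y (\<gamma> a x) x)"
    proof (rule sum.cong[OF refl])
      fix x assume x: "x \<in> Q"
      have "\<gamma> b (g x) = g (\<gamma> a x)" using \<gamma> g a x by (auto simp: equivariant_def)
      moreover have "\<gamma> a x \<in> Q" using \<gamma> a x mem by (simp add: equivariant_def)
      ultimately show "Y (\<gamma> b (g x)) (g x) = Y (\<gamma> a x) x" using Y g x by (simp add: ginv_def)
    qed
    finally show "(\<Sum>x\<in>Q. Y (\<gamma> b x) x) = (\<Sum>x\<in>Q. Y (\<gamma> a x) x)" .
  qed
  finally show ?thesis using card_Q by simp
qed

text \<open>The idempotent \<open>Y\<close> commutes with the permutation
  \<open>h = \<gamma> a\<close>, so the product \<open>B\<close> of the two returns to itself after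
  \<open>n\<close> further factors, and \<open>trace_periodic\<close> applies.\<close>

lemma trace_zring:
  assumes \<gamma>: "equivariant \<gamma>" and Y: "ginv G Q (Y :: 'a \<Rightarrow> 'a \<Rightarrow> complex)"
    and YY: "\<And>x y. x \<in> Q \<Longrightarrow> y \<in> Q \<Longrightarrow> mmul Q Y Y x y = Y x y"
    and a: "a \<in> Q" and n: "n > 0" "\<gamma> a ^^ n = id"
  shows "(\<Sum>x\<in>Q. Y (\<gamma> a x) x) \<in> zring (p * n)"
proof -
  define h where "h = \<gamma> a"
  have h: "h \<in> G" using \<gamma> a by (simp add: h_def equivariant_def)
  define B where "B = (\<lambda>x y. Y (h x) y)"
  have it: "((\<lambda>K. mmul Q K B) ^^ m) B x y = Y ((h ^^ Suc m) x) y" if "x \<in> Q" "y \<in> Q" for m x y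
    using that(2)
  proof (induction m arbitrary: y)
    case 0 then show ?case by (simp add: B_def)
  next
    case (Suc m)
    have hx: "(h ^^ Suc (Suc m)) x \<in> Q" using mem[OF power_in[OF h] that(1)] .
    have "((\<lambda>K. mmul Q K B) ^^ Suc m) B x y = (\<Sum>u\<in>Q. Y ((h ^^ Suc m) x) u * Y (h u) y)"
      using Suc.IH unfolding funpow.simps(2) comp_apply mmul_def B_def by (intro sum.cong refl) simp
    also have "\<dots> = (\<Sum>u\<in>Q. Y ((h ^^ Suc (Suc m)) x) (h u) * Y (h u) y)"
    proof (rule sum.cong[OF refl])
      fix u assume u: "u \<in> Q"
      have "(h ^^ Suc m) x \<in> Q" using mem[OF power_in[OF h] that(1)] .
      then have "Y (h ((h ^^ Suc m) x)) (h u) = Y ((h ^^ Suc m) x) u" using Y h u by (simp add: ginv_def)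
      then show "Y ((h ^^ Suc m) x) u * Y (h u) y = Y ((h ^^ Suc (Suc m)) x) (h u) * Y (h u) y" by simp
    qed
    also have "\<dots> = (\<Sum>u\<in>Q. Y ((h ^^ Suc (Suc m)) x) u * Y u y)" by (rule sum_image[OF h])
    also have "\<dots> = Y ((h ^^ Suc (Suc m)) x) y" using YY[OF hx Suc.prems] by (simp only: mmul_def)
    finally show ?case .
  qed
  have "((\<lambda>K. mmul Q K B) ^^ n) B x y = B x y" if "x \<in> Q" "y \<in> Q" for x y
    using it[OF that] n(2) by (simp add: B_def h_def)
  then have "(\<Sum>x\<in>Q. B x x) \<in> zring (p * n)"
    by (intro trace_periodic[where n = n]) (use fin n p_pos in auto)
  then show ?thesis by (simp add: B_def h_def)
qed

text \<open>The trace of \<open>cnt \<gamma>\<close> on an eigenspace gives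
  \<open>e * l = 2 * p * t\<close>, where \<open>e\<close> is the number of nonzero frequencies with
  eigenvalue \<open>l\<close> and \<open>t\<close> is the trace of a single permutation, an element
  of the ring. As \<open>0 < e < p\<close>, a Bezout relation transfers the factor \<open>p\<close>
  to \<open>l\<close>.\<close>

lemma om_div:
  assumes \<gamma>: "equivariant \<gamma>" and a: "a \<in> Q" and n: "n > 0" "\<gamma> a ^^ n = id"
    and om: "om (cnt \<gamma>) j0 \<in> zring (p * n)" and j0: "j0 \<in> {1..<p}"
  shows "om (cnt \<gamma>) j0 / of_nat p \<in> zring (p * n)"
proof -
  define l where "l = om (cnt \<gamma>) j0"
  obtain Y where Y: "ginv G Q Y"
    and FY: "\<And>j a b. j < p \<Longrightarrow> F j Y a b = (if j \<noteq> 0 \<and> om (cnt \<gamma>) j = l then Ej j a b else 0)"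
    and YY: "\<And>x y. x \<in> Q \<Longrightarrow> y \<in> Q \<Longrightarrow> mmul Q Y Y x y = Y x y"
    by (rule spectral_idempotent[OF cnt_ginv[OF \<gamma>], of l]) blast
  have zY: "zinv Y" and cM: "ginv G Q (cx (cnt \<gamma>))" using Y cnt_ginv[OF \<gamma>] zG by (simp_all add: ginv_def zinv_def)
  define e where "e = card {j\<in>{..<p}. j \<noteq> 0 \<and> om (cnt \<gamma>) j = l}"
  define t where "t = (\<Sum>x\<in>Q. Y (\<gamma> a x) x)"
  have tz: "t \<in> zring (p * n)" unfolding t_def by (rule trace_zring[OF \<gamma> Y YY a n])
  have YM: "(\<Sum>x\<in>Q. mmul Q (cx (cnt \<gamma>)) Y x x) = (\<Sum>x\<in>Q. mmul Q Y (cx (cnt \<gamma>)) x x)"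
    unfolding mmul_def by (subst sum.swap) (simp only: mult.commute)
  have "2 * of_nat p * t = (\<Sum>j<p. F j (mmul Q Y (cx (cnt \<gamma>))) True True + F j (mmul Q Y (cx (cnt \<gamma>))) False False)"
    unfolding t_def trace_shift[OF \<gamma> Y a, symmetric] YM
    by (rule trace_F[OF zinv_mmul[OF zY zinv_cx[OF cnt_ginv[OF \<gamma>]]]])
  also have "\<dots> = (\<Sum>j<p. if j \<noteq> 0 \<and> om (cnt \<gamma>) j = l then l else 0)"
  proof (rule sum.cong[OF refl])
    fix j assume "j \<in> {..<p}"
    then have j: "j < p" by simp
    show "F j (mmul Q Y (cx (cnt \<gamma>))) True True + F j (mmul Q Y (cx (cnt \<gamma>))) False False
        = (if j \<noteq> 0 \<and> om (cnt \<gamma>) j = l then l else 0)"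
    proof (cases "j \<noteq> 0 \<and> om (cnt \<gamma>) j = l")
      case True
      then have f: "F j Y a b = Ej j a b" for a b using FY[OF j] by simp
      have "F j (mmul Q Y (cx (cnt \<gamma>))) b b = l * Ej j b b" for b
        unfolding F_mult2[OF zinv_cx[OF cnt_ginv[OF \<gamma>]]] f Ej_K[OF cnt_ginv[OF \<gamma>]] using True by simp
      then show ?thesis using True Ej_trace[of j] by (simp add: distrib_left[symmetric])
    next
      case False
      then have f: "F j Y a b = 0" for a b unfolding FY[OF j, of a b] by (rule if_not_P)
      show ?thesis unfolding F_mult2[OF zinv_cx[OF cnt_ginv[OF \<gamma>]]] f if_not_P[OF False] by simp
    qed
  qed
  also have "\<dots> = (\<Sum>j\<in>{j\<in>{..<p}. j \<noteq> 0 \<and> om (cnt \<gamma>) j = l}. l)" by (simp only: sum.inter_filter finite_lessThan)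
  also have "\<dots> = of_nat e * l" by (simp add: e_def)
  finally have "2 * of_nat p * t = of_nat e * l" .
  then have el: "of_nat e * l = of_nat p * (2 * t)" by (simp only: mult_ac)
  have "j0 \<in> {j\<in>{..<p}. j \<noteq> 0 \<and> om (cnt \<gamma>) j = l}" using j0 by (simp add: l_def)
  then have "e > 0" unfolding e_def by (subst card_gt_0_iff) auto
  have "{j\<in>{..<p}. j \<noteq> 0 \<and> om (cnt \<gamma>) j = l} \<subseteq> {1..<p}" by auto
  then have "e \<le> card {1..<p}" unfolding e_def by (intro card_mono) auto
  then have "e < p" using p_pos by simp
  then have "\<not> p dvd e" using \<open>e > 0\<close> nat_dvd_not_less by blast
  then have "coprime p e" using p prime_imp_coprime by blast
  then have "coprime (int e) (int p)" by (simp add: coprime_commute)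
  then obtain u v where uv: "u * int e + v * int p = 1" using bezout_int[of "int e" "int p"] by (auto simp: coprime_iff_gcd_eq_1)
  then have "of_int (u * int e + v * int p) = (1 :: complex)" by simp
  then have one: "of_int u * of_nat e + of_int v * of_nat p = (1 :: complex)" by simp
  have "l = (of_int u * of_nat e + of_int v * of_nat p) * l" unfolding one by simp
  also have "\<dots> = of_int u * (of_nat e * l) + of_int v * of_nat p * l" by (simp add: algebra_simps)
  also have "\<dots> = of_nat p * (of_int u * (2 * t) + of_int v * l)" unfolding el by (simp add: algebra_simps)
  finally have "l / of_nat p = of_int u * (2 * t) + of_int v * l" using p_pos by (simp add: field_simps)
  also have "\<dots> \<in> zring (p * n)" using tz om unfolding l_def by (intro zring_add zring_mult zring_int zring_numbers)
  finally show ?thesis by (simp add: l_def)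
qed

text \<open>The eigenvalues \<open>om\<close> are the transform of the weights with
  \<open>ev\<close> subtracted at shift 0. By \<open>om_div\<close> they are divisible by
  \<open>p\<close>, so \<open>coeffs_cong\<close> makes these corrected weights congruent. The
  correction is the reason why shift 0 is missing from the conclusion.\<close>

lemma cnt_cong:
  assumes \<gamma>: "equivariant \<gamma>"
  obtains c :: int where "\<And>k. k \<in> {1..<p} \<Longrightarrow> \<exists>i::int. w (cnt \<gamma>) k = c + int p * i"
proof -
  obtain n where n: "n > 0" "\<gamma> (bp True) ^^ n = id"
    using finite_order \<gamma> bp_in by (metis equivariant_def)
  have i: "cnt \<gamma> x y \<in> \<int>" for x y by (simp add: cnt_def)
  obtain d where d: "ev (cnt \<gamma>) = of_int d" using ev_int[OF cnt_ginv[OF \<gamma>] i] by (rule Ints_cases)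
  define q where "q k = (\<Sum>b\<in>UNIV. int (card {a \<in> Q. \<gamma> a (bp b) = pt b k})) - (if k = 0 then d else 0)" for k
  have wq: "w (cnt \<gamma>) k = of_int (q k + (if k = 0 then d else 0))" for k
    by (simp add: w_def cnt_def q_def UNIV_bool)
  have om: "om (cnt \<gamma>) j = (\<Sum>k<p. of_int (q k) * \<zeta> ^ (j * k))" for j
  proof -
    have "kap (cnt \<gamma>) j = (\<Sum>k<p. of_int (q k) * \<zeta> ^ (j * k) + (if k = 0 then of_int d else 0))"
      unfolding kap_w wq by (intro sum.cong refl) (simp add: distrib_right)
    also have "\<dots> = (\<Sum>k<p. of_int (q k) * \<zeta> ^ (j * k)) + of_int d"
      using p_pos by (simp add: sum.distrib)
    finally show ?thesis by (simp add: d)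
  qed
  have z: "\<zeta> \<in> zring (p * n)" using n(1) p_pos
    by (intro zring_root_of_unity[of _ p]) (simp_all add: root1_power_N)
  have dv: "int p dvd q k - q 0" if "k < p" for k
  proof (rule coeffs_cong[OF p _ _ _ that, of "p * n"])
    show "p * n > 0" "p dvd p * n" using n p_pos by auto
    fix j assume j: "j \<in> {1..<p}"
    have "om (cnt \<gamma>) j \<in> zring (p * n)" unfolding om
      by (intro zring_sum zring_mult zring_int zring_power z)
    from om_div[OF \<gamma> bp_in n this j]
    show "(\<Sum>k<p. of_int (q k) * \<zeta> ^ (j * k)) / of_nat p \<in> zring (p * n)" unfolding om .
  qed
  have "\<exists>i::int. w (cnt \<gamma>) k = q 0 + int p * i" if "k \<in> {1..<p}" for k
  proof -
    obtain i where "q k - q 0 = int p * i" using dv[of k] \<open>k \<in> {1..<p}\<close> by auto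
    then have "q k = q 0 + int p * i" by simp
    then show ?thesis using wq[of k] \<open>k \<in> {1..<p}\<close> by auto
  qed
  then show thesis by (rule that)
qed

lemma vanish:
  assumes K: "ginv G Q K" and K0: "\<And>x. x \<in> Q \<Longrightarrow> K x x = 0" and e: "ev K = 0"
    and wz: "\<And>k. k < p \<Longrightarrow> w K k = 0" and xy: "x \<in> Q" "y \<in> Q"
  shows "K x y = 0"
proof -
  have "(\<Sum>k<p. w K k * w K k) = 0" using wz by (intro sum.neutral) simp
  then have "(\<Sum>y\<in>Q. K x y * K x y) = 0"
    using parseval[OF K K K0 K0 xy(1)] e by simp
  then show ?thesis using fin xy(2) by (simp add: sum_nonneg_eq_0_iff)
qed

text \<open>\<open>V\<close> is the row of \<open>1 - Rm\<close> at the shifted base point. The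
  squared distances between the rows of \<open>K\<close> at the two base points and
  \<open>c / 2\<close> times these vectors add up to \<open>2 * c * c - 2 * c * w K k0\<close>,
  which is 0.\<close>

lemma single_frequency:
  assumes K: "ginv G Q K" and K0: "\<And>x. x \<in> Q \<Longrightarrow> K x x = 0" and e: "ev K = 0"
    and k0: "k0 < p" and wk: "\<And>k. k < p \<Longrightarrow> w K k = (if k = k0 then c else 0)" and y: "y \<in> Q"
  shows "K (bp a) y = c / 2 * ((if pt a k0 = y then 1 else 0) - Rm (pt a k0) y)"
proof -
  define V where "V a y = (if pt a k0 = y then 1 else 0) - Rm (pt a k0) y" for a y
  define D where "D a = (\<Sum>y\<in>Q. (K (bp a) y - c / 2 * V a y)\<^sup>2)" for a
  have KK: "(\<Sum>y\<in>Q. (K (bp a) y)\<^sup>2) = c\<^sup>2 / 2" for a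
  proof -
    have "(\<Sum>k<p. w K k * w K k) = (\<Sum>k<p. if k = k0 then c\<^sup>2 else 0)"
      using wk by (intro sum.cong refl) (simp add: power2_eq_square)
    then show ?thesis using parseval[OF K K K0 K0 bp_in[of a]] e k0 by (simp add: power2_eq_square)
  qed
  have VV: "(\<Sum>y\<in>Q. (V a y)\<^sup>2) = 2" for a
  proof -
    have "(\<Sum>y\<in>Q. (V a y)\<^sup>2) = (\<Sum>y\<in>Q. (if pt a k0 = y then 1 else 0) + (Rm (pt a k0) y)\<^sup>2)"
      by (intro sum.cong refl) (auto simp: V_def Rm_diag)
    then show ?thesis using Rm_norm[OF pt_in[of a k0]] fin pt_in by (simp add: sum.distrib)
  qed
  have KV: "(\<Sum>y\<in>Q. K (bp a) y * V a y) = 2 * K (bp a) (pt a k0)" for a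
  proof -
    have "(\<Sum>y\<in>Q. K (bp a) y * V a y)
        = (\<Sum>y\<in>Q. if pt a k0 = y then K (bp a) y else 0) - (\<Sum>y\<in>Q. K (bp a) y * Rm y (pt a k0))"
      unfolding sum_subtractf[symmetric]
      by (intro sum.cong refl) (simp add: V_def right_diff_distrib Rm_sym[of "pt a k0"])
    then show ?thesis using Rm_right[OF K bp_in pt_in, of a a k0] fin pt_in by (simp add: e)
  qed
  have Da: "D a = c\<^sup>2 - 2 * c * K (bp a) (pt a k0)" for a
  proof -
    have "D a = (\<Sum>y\<in>Q. (K (bp a) y)\<^sup>2 - c * (K (bp a) y * V a y) + c\<^sup>2 / 4 * (V a y)\<^sup>2)"
      unfolding D_def by (intro sum.cong refl) (simp add: power2_eq_square field_simps)
    also have "\<dots> = c\<^sup>2 / 2 - c * (2 * K (bp a) (pt a k0)) + c\<^sup>2 / 4 * 2"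
      unfolding sum.distrib sum_subtractf sum_distrib_left[symmetric] KK KV VV ..
    finally show ?thesis by simp
  qed
  have "D True + D False = 2 * c\<^sup>2 - 2 * c * w K k0" unfolding Da by (simp add: w_def algebra_simps)
  then have "D True + D False = 0" using wk[OF k0] by (simp add: power2_eq_square)
  moreover have "D b \<ge> 0" for b unfolding D_def by (intro sum_nonneg) simp
  ultimately have "D True = 0 \<and> D False = 0" using add_nonneg_eq_0_iff[of "D True" "D False"] by blast
  then have "D a = 0" by (cases a) simp_all
  then have "(K (bp a) y - c / 2 * V a y)\<^sup>2 = 0" using fin y by (simp add: D_def sum_nonneg_eq_0_iff)
  then show ?thesis by (simp add: V_def)
qed

text \<open>The deviation from the value \<open>c\<close> to be proved. Cutting down to
  \<open>N0\<close> makes \<open>ev\<close> vanish, because \<open>Rm\<close> is 0 there.\<close>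

definition off :: "('a \<Rightarrow> 'a \<Rightarrow> real) \<Rightarrow> real \<Rightarrow> 'a \<Rightarrow> 'a \<Rightarrow> real"
  where "off M c x y = (if N0 x y then M x y - c else 0)"

text \<open>The weights of \<open>off M c\<close> are nonnegative multiples of \<open>p\<close>, and
  they sum to a row sum of \<open>off M c\<close>, which is less than \<open>2 * p\<close> because
  the positive diagonal entry is lost. So either all weights vanish or exactly one is
  \<open>p\<close>, and \<open>vanish\<close> or \<open>single_frequency\<close> applies.\<close>

lemma N0_dichotomy:
  fixes M :: "'a \<Rightarrow> 'a \<Rightarrow> real" and c :: real
  assumes M: "ginv G Q M" and nonneg: "\<And>x y. M x y \<ge> 0"
    and row: "(\<Sum>y\<in>Q. M (bp True) y) = 2 * p" and fixed: "M (bp True) (bp True) > 0" and c: "c \<ge> 0"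
    and wn: "\<And>k. k < p \<Longrightarrow> \<exists>n::nat. w (off M c) k = real p * n"
  shows "(\<forall>x\<in>Q. \<forall>y\<in>Q. N0 x y \<longrightarrow> M x y = c)
    \<or> (\<exists>u\<in>Q. \<forall>y\<in>Q. off M c (bp True) y = p / 2 * ((if u = y then 1 else 0) - Rm u y))"
proof -
  have K: "ginv G Q (off M c)"
    unfolding ginv_def off_def using M Rm_ginv inj_G by (simp add: ginv_def)
  have K0: "off M c x x = 0" for x by (simp add: off_def)
  have e: "ev (off M c) = 0"
    unfolding ev_eq[OF K bp_in[of True]] K0 by (simp add: off_def cong: if_cong)
  obtain n :: "nat \<Rightarrow> nat" where n: "\<And>k. k < p \<Longrightarrow> w (off M c) k = real p * n k" using wn by metis
  have "real p * real (\<Sum>k<p. n k) = (\<Sum>k<p. w (off M c) k)"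
    by (simp add: n sum_distrib_left)
  also have "\<dots> = (\<Sum>y\<in>Q. off M c (bp True) y)" using w_sum[OF K] e by simp
  also have "\<dots> \<le> (\<Sum>y\<in>Q. M (bp True) y - (if y = bp True then M (bp True) y else 0))"
    using c nonneg by (intro sum_mono) (auto simp: off_def)
  also have "\<dots> = 2 * p - M (bp True) (bp True)" using fin bp_in by (simp add: sum_subtractf row)
  also have "\<dots> < real p * 2" using fixed by simp
  finally have "real (\<Sum>k<p. n k) < real 2" using p_pos by (simp only: mult_less_cancel_left_pos of_nat_0_less_iff of_nat_numeral)
  then have "(\<Sum>k<p. n k) < 2" by (simp only: of_nat_less_iff)
  then consider "(\<Sum>k<p. n k) = 0" | "(\<Sum>k<p. n k) = 1" by linarith
  then show ?thesis
  proof cases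
    case 1
    then have "w (off M c) k = 0" if "k < p" for k using n[OF that] that by simp
    from vanish[OF K K0 e this] have "off M c x y = 0" if "x \<in> Q" "y \<in> Q" for x y using that by blast
    then have "M x y = c" if "x \<in> Q" "y \<in> Q" "N0 x y" for x y
      using that unfolding off_def by (metis eq_iff_diff_eq_0)
    then show ?thesis by blast
  next
    case 2
    then obtain k0 where k0: "k0 < p" "n k0 \<noteq> 0" by (metis lessThan_iff sum.neutral zero_neq_one)
    have "(\<Sum>k<p. n k) = n k0 + (\<Sum>k\<in>{..<p} - {k0}. n k)" using k0 by (simp add: sum.remove)
    then have "n k0 = 1" "(\<Sum>k\<in>{..<p} - {k0}. n k) = 0" using 2 k0 by linarith+
    then have "n k = (if k = k0 then 1 else 0)" if "k < p" for k using that by auto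
    then have wk: "w (off M c) k = (if k = k0 then real p else 0)" if "k < p" for k using n[OF that] that by simp
    show ?thesis using single_frequency[OF K K0 e k0(1) wk, of _ True] pt_in by blast
  qed
qed

lemma cnt_nonneg: "cnt \<gamma> x y \<ge> 0" by (simp add: cnt_def)

lemma cnt_row: assumes \<gamma>: "equivariant \<gamma>" and x: "x \<in> Q" shows "(\<Sum>y\<in>Q. cnt \<gamma> x y) = 2 * p"
proof -
  have "(\<Sum>y\<in>Q. cnt \<gamma> x y) = (\<Sum>a\<in>Q. \<Sum>y\<in>Q. if \<gamma> a x = y then 1 else 0)"
    unfolding cnt_sum by (rule sum.swap)
  also have "\<dots> = (\<Sum>a\<in>Q. 1)"
  proof (rule sum.cong[OF refl])
    fix a assume "a \<in> Q"
    then have "\<gamma> a x \<in> Q" using \<gamma> x mem by (simp add: equivariant_def)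
    then show "(\<Sum>y\<in>Q. if \<gamma> a x = y then 1 else 0) = (1::real)" using fin by simp
  qed
  finally show ?thesis by (simp add: card_Q)
qed

end

lemma card_two_less:
  assumes "finite Q" "a \<in> Q" "b \<in> Q" "card Q > 4"
  obtains y where "y \<in> Q" "y \<noteq> a" "y \<noteq> b" "y \<noteq> c" "y \<noteq> d"
proof -
  have "card {a, b, c, d} \<le> 4" by (simp add: card_insert_if)
  then have "\<not> Q \<subseteq> {a, b, c, d}" using assms card_mono[of "{a, b, c, d}" Q] by auto
  then show thesis using that by blast
qed

context split_orbits
begin

lemma cnt_weights:
  assumes \<gamma>: "equivariant \<gamma>" and k: "k < p"
  shows "w (cnt \<gamma>) k \<ge> 0" "w (cnt \<gamma>) k \<in> \<int>"
  by (simp_all add: w_def cnt_def)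

lemma cnt_weight_residue:
  assumes \<gamma>: "equivariant \<gamma>"
  obtains h :: nat where "h < p" "\<And>k. k \<in> {1..<p} \<Longrightarrow> \<exists>n::nat. w (cnt \<gamma>) k = h + real p * n"
proof -
  obtain c where c: "\<And>k. k \<in> {1..<p} \<Longrightarrow> \<exists>i::int. w (cnt \<gamma>) k = c + int p * i" using cnt_cong[OF \<gamma>] by blast
  define h where "h = nat (c mod int p)"
  have hm: "int h = c mod int p" using p_pos by (simp add: h_def)
  then have hp: "h < p" using p_pos by (metis of_nat_0_less_iff of_nat_less_iff pos_mod_bound)
  have "\<exists>n::nat. w (cnt \<gamma>) k = h + real p * n" if k: "k \<in> {1..<p}" for k
  proof -
    obtain i where i: "w (cnt \<gamma>) k = of_int (c + int p * i)" using c[OF k] by auto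
    define j where "j = c div int p + i"
    have "c = int h + int p * (c div int p)" unfolding hm by simp
    then have e: "c + int p * i = int h + int p * j" by (simp add: j_def distrib_left)
    have "0 \<le> (of_int (c + int p * i) :: real)"
      using cnt_weights(1)[OF \<gamma>, of k] k unfolding i by (simp del: of_int_add of_int_mult)
    then have "c + int p * i \<ge> 0" by (simp only: of_int_0_le_iff)
    then have "int p * j > int p * (-1)" using e hp by simp
    then have "-1 < j" using mult_less_cancel_left_pos[of "int p" "-1" j] p_pos by simp
    then have "j \<ge> 0" by simp
    then have "w (cnt \<gamma>) k = h + real p * nat j" unfolding i e by simp
    then show ?thesis by blast
  qed
  then show thesis using that hp by blast
qed

lemma sum_pointed:
  assumes x: "x \<in> Q" "y \<in> Q" "x \<noteq> y" shows "(\<Sum>u\<in>Q. f u) = f x + f y + (\<Sum>u\<in>Q - {x, y}. f u :: real)"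
  using fin x by (simp add: sum.remove[of Q x] sum.remove[of "Q - {x}" y] Diff_insert2[symmetric] insert_commute)

end

section \<open>Counts when \<open>Rm\<close> is minus a matching\<close>

context matching_case
begin

lemma T_ne: "x \<in> Q \<Longrightarrow> T x \<noteq> x"
  using Rm_T[of x x] Rm_diag[of x] by (auto split: if_splits)

lemma T_T: "x \<in> Q \<Longrightarrow> T (T x) = x"
  using Rm_T[of x "T x"] Rm_T[of "T x" x] T_in[of x] Rm_sym[of x "T x"] by (auto split: if_splits)

lemma T_commute: assumes "g \<in> G" "x \<in> Q" shows "T (g x) = g (T x)"
proof -
  have "Rm (g x) (g (T x)) = Rm x (T x)" using Rm_ginv assms T_in by (simp add: ginv_def)
  then show ?thesis using Rm_T[of x "T x"] Rm_T[of "g x" "g (T x)"] assms T_in mem by (simp split: if_splits)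
qed

lemma N0_iff: "x \<in> Q \<Longrightarrow> y \<in> Q \<Longrightarrow> N0 x y \<longleftrightarrow> y \<noteq> x \<and> y \<noteq> T x"
  using Rm_T[of x y] by auto

text \<open>The two entries of \<open>Rm\<close> at a nonzero shift sum to 0 and neither is
  positive; so no point is matched within its own orbit.\<close>

lemma N0_pt: assumes k: "k \<in> {1..<p}" shows "N0 (bp b) (pt b k)"
proof -
  have "Rm (bp True) (pt True k) + Rm (bp False) (pt False k) = 0"
    using w_Rm[of k] k by (simp add: w_def)
  moreover have "Rm (bp c) (pt c k) \<le> 0" for c using Rm_T[OF bp_in pt_in] by simp
  from this[of True] this[of False]
  have "Rm (bp True) (pt True k) \<le> 0" "Rm (bp False) (pt False k) \<le> 0" .
  ultimately have "Rm (bp True) (pt True k) = 0 \<and> Rm (bp False) (pt False k) = 0" by linarith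
  then have "Rm (bp b) (pt b k) = 0" by (cases b) (simp_all only:)
  moreover have "bp b \<noteq> pt b k" using pt_inj[OF p_pos(1), of k b b] k by (simp add: pt_0)
  ultimately show ?thesis by simp
qed

text \<open>All nonzero shifts lie in \<open>N0\<close>, so half of the residue \<open>h\<close> is
  the expected value there. An exceptional row in \<open>N0_dichotomy\<close> would contain two
  counts that differ by \<open>p / 2\<close>, which is not an integer. Since \<open>x\<close> and
  \<open>T x\<close> both fix \<open>x\<close>, the row sum \<open>2 * p\<close> leaves only the
  values 0 and 1 on \<open>N0\<close>.\<close>

theorem matching_counts:
  assumes \<gamma>: "equivariant \<gamma>" and fix_self: "\<And>a. a \<in> Q \<Longrightarrow> \<gamma> a a = a"
  shows "(\<forall>a\<in>Q. \<forall>x\<in>Q. \<gamma> a x \<in> {x, T x})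
    \<or> (\<forall>x\<in>Q. \<forall>y\<in>Q. card {a\<in>Q. \<gamma> a x = y} = (if y = x then 2 else if y = T x then 0 else 1))"
proof -
  let ?M = "cnt \<gamma>"
  have b: "bp True \<in> Q" by (rule bp_in)
  have gT: "\<gamma> (T x) x = x" if x: "x \<in> Q" for x
  proof -
    have "\<gamma> (T x) \<in> G" using \<gamma> T_in[OF x] by (simp add: equivariant_def)
    then have "T (\<gamma> (T x) (T x)) = \<gamma> (T x) (T (T x))" using T_commute T_in[OF x] by blast
    then show ?thesis using fix_self[OF T_in[OF x]] T_T[OF x] by simp
  qed
  have two: "?M x x \<ge> 2" if x: "x \<in> Q" for x
  proof -
    have "{x, T x} \<subseteq> {a \<in> Q. \<gamma> a x = x}" using x gT fix_self T_in by auto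
    then have "card {x, T x} \<le> card {a \<in> Q. \<gamma> a x = x}" using fin by (intro card_mono) auto
    then show ?thesis using T_ne[OF x] by (simp add: cnt_def)
  qed
  obtain h where h: "h < p" "\<And>k. k \<in> {1..<p} \<Longrightarrow> \<exists>n::nat. w ?M k = h + real p * n"
    using cnt_weight_residue[OF \<gamma>] by blast
  have wn: "\<exists>n::nat. w (off ?M (real h / 2)) k = real p * n" if "k < p" for k
  proof (cases "k = 0")
    case True then show ?thesis by (intro exI[of _ 0]) (simp add: w_def off_def pt_0)
  next
    case False
    then have k: "k \<in> {1..<p}" using that by simp
    have "w (off ?M (real h / 2)) k = w ?M k - h"
      using N0_pt[OF k, of True] N0_pt[OF k, of False] by (simp add: w_def off_def)
    then show ?thesis using h(2)[OF k] by auto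
  qed
  have M0: "?M (bp True) (bp True) > 0" using two[OF b] by simp
  have "card Q > 4" using card_Q p2 by simp
  then have const: "\<forall>x\<in>Q. \<forall>y\<in>Q. N0 x y \<longrightarrow> ?M x y = real h / 2"
  proof -
    { fix u assume u: "u \<in> Q" and *: "\<forall>y\<in>Q. off ?M (real h / 2) (bp True) y = p / 2 * ((if u = y then 1 else 0) - Rm u y)"
      obtain y where y: "y \<in> Q" "y \<noteq> bp True" "y \<noteq> u" "y \<noteq> T (bp True)" "y \<noteq> T u"
        using card_two_less[OF fin b u \<open>card Q > 4\<close>] by blast
      have "off ?M (real h / 2) (bp True) y = 0" using *[rule_format, OF y(1)] y Rm_T[OF u y(1)] by simp
      then have y2: "?M (bp True) y = real h / 2" using y N0_iff[OF b y(1)] by (simp add: off_def)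
      have "off ?M (real h / 2) (bp True) u = p / 2" using *[rule_format, OF u] Rm_diag by simp
      then have "?M (bp True) u - real h / 2 = p / 2" using p_pos by (simp add: off_def split: if_splits)
      then have "2 * (?M (bp True) u - ?M (bp True) y) = real p" using y2 by simp
      then have "of_int (2 * (int (card {a \<in> Q. \<gamma> a (bp True) = u}) - int (card {a \<in> Q. \<gamma> a (bp True) = y}))) = (of_int (int p) :: real)"
        by (simp add: cnt_def)
      then have "2 * (int (card {a \<in> Q. \<gamma> a (bp True) = u}) - int (card {a \<in> Q. \<gamma> a (bp True) = y})) = int p"
        by (simp only: of_int_eq_iff)
      then have "2 dvd int p" by (rule dvdI[OF sym])
      then have "2 dvd p" by simp
      then have False using p p2 primes_dvd_imp_eq[OF two_is_prime_nat p] by simp }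
    note no = this
    have "real h / 2 \<ge> 0" by simp
    from N0_dichotomy[OF cnt_ginv[OF \<gamma>] cnt_nonneg cnt_row[OF \<gamma> b] M0 this wn]
    show ?thesis
    proof
      assume "\<exists>u\<in>Q. \<forall>y\<in>Q. off ?M (real h / 2) (bp True) y = p / 2 * ((if u = y then 1 else 0) - Rm u y)"
      then show ?thesis using no by blast
    qed
  qed
  have row: "?M x x + ?M x (T x) + (2 * real p - 2) * (real h / 2) = 2 * p" if x: "x \<in> Q" for x
  proof -
    have "(\<Sum>u\<in>Q - {x, T x}. ?M x u) = (\<Sum>u\<in>Q - {x, T x}. real h / 2)"
      using const N0_iff[OF x] x by (intro sum.cong refl) auto
    also have "\<dots> = (2 * real p - 2) * (real h / 2)"
    proof -
      have "card (Q - {x, T x}) = 2 * p - 2" using fin x T_in[OF x] T_ne[OF x] card_Q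
        by (subst card_Diff_subset) auto
      then have "real (card (Q - {x, T x})) = 2 * real p - 2" using p_pos by simp
      then show ?thesis by simp
    qed
    finally show ?thesis using cnt_row[OF \<gamma> x] sum_pointed[OF x T_in[OF x] T_ne[OF x, symmetric], of "?M x"] by simp
  qed
  obtain y where y: "y \<in> Q" "y \<noteq> bp True" "y \<noteq> T (bp True)"
    using card_two_less[OF fin b b \<open>card Q > 4\<close>, of "T (bp True)"] by blast
  then have "?M (bp True) y = real h / 2" using const b N0_iff[OF b y(1)] by blast
  then obtain c :: nat where c: "real h / 2 = real c" using that[of "card {a \<in> Q. \<gamma> a (bp True) = y}"] by (simp add: cnt_def)
  consider "c = 0" | "c = 1" | "c \<ge> 2" by linarith
  then show ?thesis
  proof cases
    case 1
    have "\<gamma> a x \<in> {x, T x}" if a: "a \<in> Q" and x: "x \<in> Q" for a x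
    proof -
      let ?A = "{a \<in> Q. \<gamma> a x = x}" and ?B = "{a \<in> Q. \<gamma> a x = T x}"
      have "?M x x + ?M x (T x) = 2 * p" using row[OF x] c 1 by simp
      then have "card ?A + card ?B = card Q" using card_Q by (simp add: cnt_def of_nat_add[symmetric] del: of_nat_add)
      moreover have "card (?A \<union> ?B) = card ?A + card ?B"
        using fin T_ne[OF x] by (intro card_Un_disjoint) auto
      ultimately have "?A \<union> ?B = Q" using fin by (intro card_subset_eq) auto
      then show ?thesis using a by blast
    qed
    then show ?thesis by blast
  next
    case 2
    have e: "?M x x = 2 \<and> ?M x (T x) = 0" if "x \<in> Q" for x
      using row[OF that] two[OF that] cnt_nonneg[of \<gamma> x "T x"] c 2 by simp
    have "card {a\<in>Q. \<gamma> a x = y} = (if y = x then 2 else if y = T x then 0 else 1)" if "x \<in> Q" "y \<in> Q" for x y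
    proof -
      have "N0 x y \<Longrightarrow> ?M x y = 1" using const c 2 that by simp
      then have "?M x y = (if y = x then 2 else if y = T x then 0 else 1)"
        using e[OF that(1)] N0_iff[OF that] by auto
      then have "real (card {a\<in>Q. \<gamma> a x = y}) = real (if y = x then 2 else if y = T x then 0 else 1)"
        by (simp add: cnt_def)
      then show ?thesis by (simp only: of_nat_eq_iff)
    qed
    then show ?thesis by blast
  next
    case 3
    have "real c * (2 * real p - 2) \<ge> 2 * (2 * real p - 2)" using 3 p_pos by (intro mult_right_mono) auto
    moreover have "real p \<ge> 3" using p2 by simp
    ultimately have False using row[OF b] two[OF b] cnt_nonneg[of \<gamma> "bp True" "T (bp True)"] c
      by (simp add: mult.commute)
    then show ?thesis ..
  qed
qed

end

section \<open>Counts when \<open>Rm\<close> has positive and negative entries\<close>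

context srg_case
begin

lemma Np_iff: "x \<in> Q \<Longrightarrow> y \<in> Q \<Longrightarrow> Np x y \<longleftrightarrow> Rm x y = 1 / (2 * s + 1)"
  using Rm_values[of x y] by (auto simp: divide_less_0_iff zero_less_divide_iff)

lemma Nm_iff: "x \<in> Q \<Longrightarrow> y \<in> Q \<Longrightarrow> Nm x y \<longleftrightarrow> Rm x y = - 1 / (2 * s + 1)"
  using Rm_values[of x y] by (auto simp: divide_less_0_iff zero_less_divide_iff)

lemma Np_const: assumes M: "ginv G Q M" and "x \<in> Q" "y \<in> Q" "Np x y" "x' \<in> Q" "y' \<in> Q" "Np x' y'"
  shows "M x y = M x' y'"
  by (rule level_const[OF M, of "1 / (2 * real s + 1)"]) (use assms Np_iff in auto)

lemma Nm_const: assumes M: "ginv G Q M" and "x \<in> Q" "y \<in> Q" "Nm x y" "x' \<in> Q" "y' \<in> Q" "Nm x' y'"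
  shows "M x y = M x' y'"
  by (rule level_const[OF M, of "- 1 / (2 * real s + 1)"]) (use assms Nm_iff in auto)

lemma ex_neighbours: assumes "x \<in> Q"
  obtains y y' where "y \<in> Q" "Np x y" "y' \<in> Q" "Nm x y'"
proof -
  have "card {y \<in> Q. Np x y} > 0" "card {y \<in> Q. Nm x y} > 0"
    using card_valency[OF graph_Np assms] card_valency[OF graph_Nm assms] s_pos by (simp_all add: deg_Np deg_Nm)
  then show thesis using that by (auto simp: card_gt_0_iff)
qed

lemma card_square: "1 + (2 * s + 1)\<^sup>2 + valency N0 = 2 * p"
proof -
  let ?b = "bp True"
  have "Q = insert ?b ({y\<in>Q. Np ?b y} \<union> {y\<in>Q. Nm ?b y} \<union> {y\<in>Q. N0 ?b y})"
    using bp_in by (auto simp: Rm_diag)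
  then have "card Q = card (insert ?b ({y\<in>Q. Np ?b y} \<union> {y\<in>Q. Nm ?b y} \<union> {y\<in>Q. N0 ?b y}))" by simp
  also have "\<dots> = 1 + (valency Np + valency Nm + valency N0)"
    using fin by (subst card_insert_disjoint)
      (simp_all add: Rm_diag card_Un_disjoint Int_def valency_def conj_commute disjoint_iff)
  finally show ?thesis using card_Q deg_Np deg_Nm by (simp add: power2_eq_square algebra_simps)
qed

text \<open>On \<open>Np\<close> and \<open>Nm\<close> the counts are constant by
  \<open>level_const\<close>. A shift with one edge of each has weight \<open>mp + mm\<close>, and
  as this is less than \<open>p\<close> it is the common residue. The shifts with two zero entries
  then satisfy the hypothesis of \<open>N0_dichotomy\<close> for half of this residue.\<close>

theorem srg_counts:
  assumes \<gamma>: "equivariant \<gamma>" and fix_self: "\<And>a. a \<in> Q \<Longrightarrow> \<gamma> a a = a"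
  obtains f mp mm :: nat where
    "\<And>x. x \<in> Q \<Longrightarrow> card {a\<in>Q. \<gamma> a x = x} = f"
    "\<And>x y. x \<in> Q \<Longrightarrow> y \<in> Q \<Longrightarrow> Np x y \<Longrightarrow> card {a\<in>Q. \<gamma> a x = y} = mp"
    "\<And>x y. x \<in> Q \<Longrightarrow> y \<in> Q \<Longrightarrow> Nm x y \<Longrightarrow> card {a\<in>Q. \<gamma> a x = y} = mm"
    "\<And>x y. x \<in> Q \<Longrightarrow> y \<in> Q \<Longrightarrow> N0 x y \<Longrightarrow> 2 * card {a\<in>Q. \<gamma> a x = y} = mp + mm"
    "f \<ge> 1"
    "2 * f + 2 * mp * (s * (2 * s + 1)) + 2 * mm * ((s + 1) * (2 * s + 1)) + (mp + mm) * valency N0 = 4 * p"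
proof -
  let ?M = "cnt \<gamma>"
  have b: "bp True \<in> Q" by (rule bp_in)
  obtain yp ym where y: "yp \<in> Q" "Np (bp True) yp" "ym \<in> Q" "Nm (bp True) ym" by (rule ex_neighbours[OF b])
  define f where "f = card {a\<in>Q. \<gamma> a (bp True) = bp True}"
  define mp where "mp = card {a\<in>Q. \<gamma> a (bp True) = yp}"
  define mm where "mm = card {a\<in>Q. \<gamma> a (bp True) = ym}"
  have Mp: "?M u v = mp" if "u \<in> Q" "v \<in> Q" "Np u v" for u v
    using Np_const[OF cnt_ginv[OF \<gamma>] that b y(1,2)] by (simp add: cnt_def mp_def)
  have Mm: "?M u v = mm" if "u \<in> Q" "v \<in> Q" "Nm u v" for u v
    using Nm_const[OF cnt_ginv[OF \<gamma>] that b y(3,4)] by (simp add: cnt_def mm_def)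
  have Mf: "?M u u = f" if u: "u \<in> Q" for u
  proof -
    obtain g where "g \<in> G" "g (bp True) = u" using trans[OF b u] by blast
    then have "?M u u = ?M (bp True) (bp True)" using cnt_ginv[OF \<gamma>] b by (auto simp: ginv_def)
    then show ?thesis by (simp add: cnt_def f_def)
  qed
  have f1: "f \<ge> 1"
  proof -
    have "bp True \<in> {a\<in>Q. \<gamma> a (bp True) = bp True}" using b fix_self by simp
    then have "f > 0" unfolding f_def using fin by (subst card_gt_0_iff) auto
    then show ?thesis by simp
  qed
  have row: "f + mp * real (valency Np) + mm * real (valency Nm) + (\<Sum>u\<in>Q. ind N0 (bp True) u * ?M (bp True) u) = 2 * p"
  proof -
    have "2 * real p = (\<Sum>u\<in>Q. ?M (bp True) u)" using cnt_row[OF \<gamma> b] by simp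
    also have "\<dots> = (\<Sum>u\<in>Q. (if u = bp True then real f else 0) + mp * ind Np (bp True) u
        + mm * ind Nm (bp True) u + ind N0 (bp True) u * ?M (bp True) u)"
    proof (rule sum.cong[OF refl])
      fix u assume u: "u \<in> Q"
      consider "u = bp True" | "Np (bp True) u" | "Nm (bp True) u" | "N0 (bp True) u"
        using linorder_less_linear[of "Rm (bp True) u" 0] by blast
      then show "?M (bp True) u = (if u = bp True then real f else 0) + mp * ind Np (bp True) u
          + mm * ind Nm (bp True) u + ind N0 (bp True) u * ?M (bp True) u"
      proof cases
        case 1 then show ?thesis using Mf[OF b] by (simp add: Rm_diag)
      next
        case 2 then show ?thesis using Mp[OF b u] by (auto simp: Rm_diag)
      next
        case 3 then show ?thesis using Mm[OF b u] by (auto simp: Rm_diag)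
      qed auto
    qed
    also have "\<dots> = f + mp * real (valency Np) + mm * real (valency Nm) + (\<Sum>u\<in>Q. ind N0 (bp True) u * ?M (bp True) u)"
      unfolding sum.distrib sum_distrib_left[symmetric] rowsum_ind[OF graph_Np b] rowsum_ind[OF graph_Nm b]
      using fin b by simp
    finally show ?thesis by simp
  qed
  have nn: "(\<Sum>u\<in>Q. ind N0 (bp True) u * ?M (bp True) u) \<ge> 0" by (intro sum_nonneg) (simp add: cnt_nonneg)
  have hp: "mp + mm < p"
  proof -
    have "valency Np \<ge> 3" "valency Nm \<ge> 3"
      using s_pos mult_mono[of 1 s 3 "2 * s + 1"] mult_mono[of 1 "s + 1" 3 "2 * s + 1"] by (simp_all add: deg_Np deg_Nm)
    then have "mp * real (valency Np) \<ge> mp * 3" "mm * real (valency Nm) \<ge> mm * 3" by (simp_all add: mult_left_mono)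
    then have "3 * (real mp + real mm) < 2 * real p" using row nn f1 by simp
    then show ?thesis by simp
  qed
  obtain h where h: "h < p" "\<And>k. k \<in> {1..<p} \<Longrightarrow> \<exists>n::nat. w ?M k = h + real p * n"
    using cnt_weight_residue[OF \<gamma>] by blast
  have ne: "bp c \<noteq> pt c k" if "k \<in> {1..<p}" for c k using pt_inj[OF p_pos(1), of k c c] that by (simp add: pt_0)
  have mixed: "w ?M k = mp + mm \<and> w (off ?M q) k = 0" if k: "k \<in> {1..<p}" "w (ind Np) k = 1" "w (ind Nm) k = 1" for k q
  proof -
    have "Np (bp True) (pt True k) \<and> Nm (bp False) (pt False k) \<or> Nm (bp True) (pt True k) \<and> Np (bp False) (pt False k)"
      using k(2,3) by (simp add: w_def split: if_splits)
    then show ?thesis using Mp[OF bp_in pt_in] Mm[OF bp_in pt_in]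
      by (elim disjE conjE) (simp_all add: w_def off_def)
  qed
  obtain k1 where k1: "k1 \<in> {1..<p}" "w (ind Np) k1 = 1" "w (ind Nm) k1 = 1"
  proof -
    have e: "ev (ind Np) = 1 / (2 * real s + 1) * valency Np"
      by (rule ev_ind_level[OF graph_Np]) (use Np_iff in simp)
    have "ev (ind Np) > 0"
      unfolding e using valency_pos[OF graph_Np b y(1,2)] by (intro mult_pos_pos) auto
    then have "(\<Sum>k<p. w (ind Np) k) \<noteq> 0"
      using w_sum[OF ginv_ind[OF graph_Np]] unfolding rowsum_ind[OF graph_Np b] by linarith
    then obtain k where k: "k < p" "w (ind Np) k \<noteq> 0"
      using sum.neutral[of "{..<p}" "w (ind Np)"] by blast
    have "k \<noteq> 0"
    proof
      assume "k = 0"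
      then have "w (ind Np) k = 0" by (simp add: w_def pt_0 Rm_diag)
      then show False using k(2) by simp
    qed
    then show thesis using that[of k] k w_Np_le[OF k(1)] by auto
  qed
  have hm: "h = mp + mm"
  proof -
    obtain n :: nat where "real mp + real mm = h + real p * n" using h(2)[OF k1(1)] mixed[OF k1] by auto
    then have "real (mp + mm) = real (h + p * n)" by simp
    then have e: "mp + mm = h + p * n" by (simp only: of_nat_eq_iff)
    then have "n = 0" using hp by (cases n) auto
    then show ?thesis using e by simp
  qed
  have wn: "\<exists>n::nat. w (off ?M (real h / 2)) k = real p * n" if kp: "k < p" for k
  proof (cases "k = 0")
    case True then show ?thesis by (intro exI[of _ 0]) (simp add: w_def off_def pt_0)
  next
    case False
    then have k: "k \<in> {1..<p}" using kp by simp
    consider "w (ind Np) k = 0" "w (ind Nm) k = 0" | "w (ind Np) k = 1" "w (ind Nm) k = 1"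
      using w_Np_le[OF kp] by blast
    then show ?thesis
    proof cases
      case 1
      then have "Rm (bp c) (pt c k) = 0" for c
        by (cases c) (simp_all add: w_def not_less split: if_splits)
      then have "w (off ?M (real h / 2)) k = w ?M k - h"
        using ne[OF k] by (simp add: w_def off_def)
      then show ?thesis using h(2)[OF k] by auto
    next
      case 2
      then show ?thesis using mixed[OF k 2] by (intro exI[of _ 0]) simp
    qed
  qed
  have M0: "?M (bp True) (bp True) > 0" using Mf[OF b] f1 by simp
  have const: "\<forall>x\<in>Q. \<forall>y\<in>Q. N0 x y \<longrightarrow> ?M x y = real h / 2"
  proof -
    \<comment> \<open>An exceptional row has an entry \<open>p / (2 * (2 * s + 1))\<close>, whose
      double is an integer. So \<open>2 * s + 1\<close> divides \<open>p\<close> and equals it,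
      which \<open>card_square\<close> does not allow.\<close>
    { fix u assume u: "u \<in> Q" and *: "\<forall>y\<in>Q. off ?M (real h / 2) (bp True) y = p / 2 * ((if u = y then 1 else 0) - Rm u y)"
      obtain y where y: "y \<in> Q" "Nm u y" using ex_neighbours[OF u] by blast
      have r: "Rm u y = - 1 / (2 * s + 1)" "u \<noteq> y" using Nm_iff[OF u y(1)] y(2) by (auto simp: Rm_diag)
      have e: "2 * off ?M (real h / 2) (bp True) y = p / (2 * s + 1)" using *[rule_format, OF y(1)] r(2) unfolding r(1) by (simp add: field_simps)
      obtain i :: int where i: "2 * off ?M (real h / 2) (bp True) y = of_int i"
      proof (cases "N0 (bp True) y")
        case True
        then show ?thesis using that[of "2 * int (card {a \<in> Q. \<gamma> a (bp True) = y}) - int h"]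
          by (simp add: off_def cnt_def)
      next
        case False
        then have "off ?M (real h / 2) (bp True) y = 0" unfolding off_def by (rule if_not_P)
        then show ?thesis using that[of 0] by simp
      qed
      have "real p = of_int i * (2 * s + 1)" using e unfolding i by (simp add: field_simps)
      then have "(of_int (int p) :: real) = of_int (i * (2 * int s + 1))" by simp
      then have "int p = i * (2 * int s + 1)" by (simp only: of_int_eq_iff)
      then have "int p = int (2 * s + 1) * i" by (simp add: mult.commute)
      then have "int (2 * s + 1) dvd int p" by (rule dvdI)
      then have "2 * s + 1 dvd p" by (simp only: of_nat_dvd_iff)
      then have "2 * s + 1 = p" using p s_pos by (auto simp: prime_nat_iff)
      then have "1 + p\<^sup>2 \<le> 2 * p" using card_square by simp
      then have "p * p \<le> 2 * p" unfolding power2_eq_square by linarith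
      then have False using mult_le_mono1[of 3 p p] p2 by linarith }
    note no = this
    have "real h / 2 \<ge> 0" by simp
    from N0_dichotomy[OF cnt_ginv[OF \<gamma>] cnt_nonneg cnt_row[OF \<gamma> b] M0 this wn]
    show ?thesis
    proof
      assume "\<exists>u\<in>Q. \<forall>y\<in>Q. off ?M (real h / 2) (bp True) y = p / 2 * ((if u = y then 1 else 0) - Rm u y)"
      then show ?thesis using no by blast
    qed
  qed
  have "(\<Sum>u\<in>Q. ind N0 (bp True) u * ?M (bp True) u) = (\<Sum>u\<in>Q. real h / 2 * ind N0 (bp True) u)"
    using const b by (intro sum.cong refl) auto
  also have "\<dots> = real h / 2 * valency N0" unfolding sum_distrib_left[symmetric] rowsum_ind[OF graph_N0 b] ..
  finally have "2 * real f + 2 * mp * real (valency Np) + 2 * mm * real (valency Nm) + h * real (valency N0) = 4 * p"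
    using row by simp
  then have "real (2 * f + 2 * mp * (s * (2 * s + 1)) + 2 * mm * ((s + 1) * (2 * s + 1)) + (mp + mm) * valency N0) = real (4 * p)"
    unfolding deg_Np deg_Nm hm by (simp add: algebra_simps)
  then have tot: "2 * f + 2 * mp * (s * (2 * s + 1)) + 2 * mm * ((s + 1) * (2 * s + 1)) + (mp + mm) * valency N0 = 4 * p"
    by (simp only: of_nat_eq_iff)
  show thesis
  proof (rule that[of f mp mm])
    show "2 * card {a\<in>Q. \<gamma> a x = y} = mp + mm" if "x \<in> Q" "y \<in> Q" "N0 x y" for x y
    proof -
      have "?M x y = real h / 2" using const that by blast
      then have "real (2 * card {a\<in>Q. \<gamma> a x = y}) = real (mp + mm)" by (simp add: cnt_def hm)
      then show ?thesis by (simp only: of_nat_eq_iff)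
    qed
    show "card {a\<in>Q. \<gamma> a x = y} = mp" if "x \<in> Q" "y \<in> Q" "Np x y" for x y
      using Mp[OF that] by (simp add: cnt_def)
    show "card {a\<in>Q. \<gamma> a x = y} = mm" if "x \<in> Q" "y \<in> Q" "Nm x y" for x y
      using Mm[OF that] by (simp add: cnt_def)
    show "card {a\<in>Q. \<gamma> a x = x} = f" if "x \<in> Q" for x
      using Mf[OF that] by (simp add: cnt_def)
  qed (use f1 tot in auto)
qed

end

section \<open>Connected racks of order \<open>2p\<close>\<close>

locale conn_rack = finite_rack +
  fixes p :: nat
  assumes pr: "Factorial_Ring.prime p" and p3: "p > 3" and card_Y: "card Y = 2 * p"
    and conn: "x \<in> Y \<Longrightarrow> y \<in> Y \<Longrightarrow> \<exists>g\<in>I. g x = y"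
begin

lemma odd_p: "odd p"
  using prime_odd_nat[OF pr] p3 by simp

lemma invariant_all:
  assumes U: "U \<subseteq> Y" "u \<in> U" and inv: "\<And>a x. a \<in> Y \<Longrightarrow> x \<in> U \<Longrightarrow> r a x \<in> U"
  shows "U = Y"
proof -
  have "g u \<in> U" if "g \<in> I" for g
    using that unfolding I_def
  proof induction
    case (gen_step s g)
    then obtain a where "a \<in> Y" "s = R a" by blast
    then show ?case using gen_step(3) inv U(1) by auto
  qed (simp add: U)
  then show ?thesis using conn U by blast
qed

lemma not_fixed_point: assumes "a \<in> Y" shows "\<exists>c\<in>Y. r c a \<noteq> a"
proof (rule ccontr)
  assume "\<not> ?thesis"
  then have "{a} = Y" using assms by (intro invariant_all[of _ a]) auto
  then have "card Y = card {a}" by simp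
  then show False using card_Y p3 by simp
qed

text \<open>A translation fixes its own point, so it cannot negate \<open>e\<close>. The level sets
  of \<open>e\<close> are then invariant under all translations.\<close>

lemma no_sign:
  assumes pm: "\<And>x. x \<in> Y \<Longrightarrow> e x = 1 \<or> e x = (-1::real)"
    and sg: "\<And>g. g \<in> I \<Longrightarrow> (\<forall>x\<in>Y. e (g x) = e x) \<or> (\<forall>x\<in>Y. e (g x) = - e x)"
    and xy: "x \<in> Y" "y \<in> Y"
  shows "e x = e y"
proof -
  have eq: "{u \<in> Y. e u = e x} = Y"
  proof (rule invariant_all[of _ x])
    fix a u assume a: "a \<in> Y" and u: "u \<in> {u \<in> Y. e u = e x}"
    have "e (R a a) \<noteq> - e a" using a r_idem[OF a] pm[OF a] by auto
    then have "e (R a u) = e u" using sg[OF R_in[OF a]] a u by auto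
    then show "r a u \<in> {u \<in> Y. e u = e x}" using a u r_closed by simp
  qed (use xy in auto)
  have "y \<in> {u \<in> Y. e u = e x}" unfolding eq by (rule xy(2))
  then show ?thesis by simp
qed

lemma R_conj_pow: assumes "g \<in> I" "a \<in> Y" shows "(R (g a) ^^ n) (g x) = g ((R a ^^ n) x)"
proof (induction n)
  case (Suc n)
  have "R (g a) (g u) = g (R a u)" for u using R_conj[OF assms] by (metis comp_apply)
  then show ?case using Suc by simp
qed simp

lemma cycle_free:
  assumes z: "z ^^ p = id" and k: "0 < k" "k < p" "(z ^^ k) x = x" shows "z x = x"
proof -
  have "coprime k p" using pr k nat_dvd_not_less prime_imp_coprime coprime_commute by blast
  then obtain u v where uv: "k * u = p * v + 1" using k(1) coprime_bezout_strong[of k p] p3 by auto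
  have "(z ^^ (k * m)) x = x" for m by (induction m) (simp_all add: funpow_add k(3) add.commute[of k])
  then have a: "(z ^^ (p * v + 1)) x = x" unfolding uv[symmetric] .
  have "z ^^ (p * m) = id" for m by (induction m) (simp_all add: funpow_add z add.commute[of p])
  then have "z x = (z ^^ (p * v + 1)) x" by simp
  then show ?thesis using a by simp
qed

lemma pow_inj:
  assumes z: "z \<in> I" "z ^^ p = id" and x: "z x \<noteq> x" and kl: "k < p" "l < p" "(z ^^ k) x = (z ^^ l) x"
  shows "k = l"
proof -
  have *: "k = l" if "k \<le> l" "k < p" "l < p" "(z ^^ k) x = (z ^^ l) x" for k l
  proof (rule ccontr)
    assume "k \<noteq> l"
    have "(z ^^ l) x = (z ^^ k) ((z ^^ (l - k)) x)" using that(1) by (simp flip: funpow_add comp_apply[of "z ^^ k"])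
    then have "(z ^^ (l - k)) x = x" using that(4) inj_G[OF power_in[OF z(1)]] by metis
    moreover have "0 < l - k" "l - k < p" using that(1,3) \<open>k \<noteq> l\<close> by linarith+
    ultimately show False using cycle_free[OF z(2), of "l - k" x] x by blast
  qed
  show ?thesis using *[of k l] *[of l k] kl by (cases "k \<le> l") auto
qed

lemma orbit_card:
  assumes "z \<in> I" "z ^^ p = id" "z x \<noteq> x" shows "card ((\<lambda>k. (z ^^ k) x) ` {..<p}) = p"
  using pow_inj[OF assms] by (subst card_image) (auto simp: inj_on_def)

lemma orbit_subset:
  assumes z: "z \<in> I" and x: "x \<in> Y" "z x \<noteq> x"
  shows "(\<lambda>k. (z ^^ k) x) ` A \<subseteq> {y \<in> Y. z y \<noteq> y}"
proof
  fix y assume "y \<in> (\<lambda>k. (z ^^ k) x) ` A"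
  then obtain k where k: "y = (z ^^ k) x" by blast
  have "z y = (z ^^ k) (z x)" by (simp add: k funpow_swap1)
  then have "z y \<noteq> y" using k x(2) inj_G[OF power_in[OF z]] by metis
  then show "y \<in> {y \<in> Y. z y \<noteq> y}" using k mem[OF power_in[OF z] x(1)] by simp
qed

lemma pow_mod: assumes "z ^^ p = id" shows "z ^^ (k mod p) = z ^^ k"
proof -
  have "z ^^ (p * m) = id" for m by (induction m) (simp_all add: funpow_add assms add.commute[of p])
  then have "z ^^ (p * (k div p) + k mod p) = z ^^ (k mod p)" unfolding funpow_add by simp
  then show ?thesis by simp
qed

lemma orbits_disjoint:
  assumes z: "z \<in> I" "z ^^ p = id" and y: "y \<notin> (\<lambda>k. (z ^^ k) x) ` {..<p}"
  shows "(\<lambda>k. (z ^^ k) x) ` {..<p} \<inter> (\<lambda>k. (z ^^ k) y) ` {..<p} = {}"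
proof (rule ccontr)
  assume "\<not> ?thesis"
  then obtain k l where kl: "k < p" "l < p" "(z ^^ k) x = (z ^^ l) y" by auto
  have "(z ^^ (p - l)) ((z ^^ l) y) = y" using kl(2) z(2) by (simp flip: funpow_add comp_apply[of "z ^^ (p - l)"])
  then have "y = (z ^^ (p - l + k)) x" unfolding kl(3)[symmetric] by (simp add: funpow_add)
  then have "y = (z ^^ ((p - l + k) mod p)) x" unfolding pow_mod[OF z(2)] .
  then show False using y p3 by auto
qed

lemma coordinates:
  assumes z: "z \<in> I" "z ^^ p = id" and free: "\<And>x. x \<in> Y \<Longrightarrow> z x \<noteq> x"
  shows "\<exists>bp :: bool \<Rightarrow> 'a. bij_betw (\<lambda>(b, k). (z ^^ k) (bp b)) (UNIV \<times> {..<p}) Y"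
proof -
  have "Y \<noteq> {}" using card_Y p3 by auto
  then obtain x where x: "x \<in> Y" by blast
  let ?O = "\<lambda>x. (\<lambda>k. (z ^^ k) x) ` {..<p}"
  have "card (?O x) < card Y" using orbit_card[OF z free[OF x]] card_Y p3 by simp
  then have "\<not> Y \<subseteq> ?O x" using card_mono[of "?O x" Y] by fastforce
  then obtain y where y: "y \<in> Y" "y \<notin> ?O x" by blast
  define bp where "bp b = (if b then x else y)" for b
  have "inj_on (\<lambda>(b, k). (z ^^ k) (bp b)) (UNIV \<times> {..<p})"
  proof (rule inj_onI, clarsimp)
    fix b k c l assume kl: "k < p" "l < p" "(z ^^ k) (bp b) = (z ^^ l) (bp c)"
    have "b = c"
    proof (rule ccontr)
      assume "b \<noteq> c"
      then have "?O x \<inter> ?O y \<noteq> {}" using kl by (cases b; cases c) (auto simp: bp_def)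
      then show False using orbits_disjoint[OF z y(2)] by simp
    qed
    moreover have "z (bp c) \<noteq> bp c" using free x y by (simp add: bp_def)
    ultimately show "b = c \<and> k = l" using pow_inj[OF z, of "bp c" k l] kl by simp
  qed
  moreover have "(\<lambda>(b, k). (z ^^ k) (bp b)) ` (UNIV \<times> {..<p}) = Y"
  proof (rule card_subset_eq[OF finY])
    show "(\<lambda>(b, k). (z ^^ k) (bp b)) ` (UNIV \<times> {..<p}) \<subseteq> Y"
      using mem[OF power_in[OF z(1)]] x y by (auto simp: bp_def)
    show "card ((\<lambda>(b, k). (z ^^ k) (bp b)) ` (UNIV \<times> {..<p})) = card Y"
      using card_image[OF calculation] card_Y by (simp add: card_cartesian_product)
  qed
  ultimately show ?thesis unfolding bij_betw_def by blast
qed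

lemma ex_two_orbits:
  assumes "z \<in> I" "z ^^ p = id" "\<And>x. x \<in> Y \<Longrightarrow> z x \<noteq> x"
  shows "\<exists>bp. two_orbits Y I p z bp"
proof -
  obtain bp :: "bool \<Rightarrow> 'a" where bp: "bij_betw (\<lambda>(b, k). (z ^^ k) (bp b)) (UNIV \<times> {..<p}) Y"
    using coordinates[OF assms] by blast
  have "two_orbits Y I p z bp"
    by unfold_locales (use pr p3 assms(1,2) bp conn no_sign in simp_all)
  then show ?thesis by blast
qed

lemma ex_order_p: obtains z where "z \<in> I" "z \<noteq> id" "z ^^ p = id"
proof -
  obtain x where x: "x \<in> Y" using card_Y p3 by fastforce
  have "card I = card Y * card {g\<in>I. g x = x}" using conn x by (intro orbit_stabilizer) auto
  then have "p dvd card I" using card_Y by simp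
  then show thesis using cauchy[OF pr] that by blast
qed

text \<open>All nontrivial cycles of \<open>z\<close> have length \<open>p\<close>, so there are one
  or two of them among the \<open>2 * p\<close> points.\<close>

lemma free_or_half:
  assumes z: "z \<in> I" "z \<noteq> id" "z ^^ p = id"
  obtains "\<And>x. x \<in> Y \<Longrightarrow> z x \<noteq> x"
  | x where "x \<in> Y" "z x \<noteq> x" "{y \<in> Y. z y \<noteq> y} = (\<lambda>k. (z ^^ k) x) ` {..<p}" "card {y \<in> Y. z y = y} = p"
proof -
  let ?O = "\<lambda>x. (\<lambda>k. (z ^^ k) x) ` {..<p}" and ?W = "{y \<in> Y. z y \<noteq> y}" and ?Z = "{y \<in> Y. z y = y}"
  have "\<exists>x\<in>Y. z x \<noteq> x"
  proof (rule ccontr)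
    assume "\<not> ?thesis"
    then have "z x = x" for x using perm[OF z(1)] by (cases "x \<in> Y") (auto simp: permutes_def)
    then show False using z(2) by auto
  qed
  then obtain x where x: "x \<in> Y" "z x \<noteq> x" by blast
  have Ox: "?O x \<subseteq> ?W" "card (?O x) = p" using orbit_subset[OF z(1) x] orbit_card[OF z(1,3) x(2)] .
  have ZW: "card ?Z + card ?W = 2 * p"
  proof -
    have "?Z \<union> ?W = Y" "?Z \<inter> ?W = {}" by auto
    then show ?thesis using card_Un_disjoint[of ?Z ?W] finY card_Y by simp
  qed
  show thesis
  proof (cases "?W = ?O x")
    case True
    then show thesis using that(2)[OF x True] ZW Ox by simp
  next
    case False
    then obtain y where y: "y \<in> Y" "z y \<noteq> y" "y \<notin> ?O x" using Ox by blast
    have Oy: "?O y \<subseteq> ?W" "card (?O y) = p" using orbit_subset[OF z(1) y(1,2)] orbit_card[OF z(1,3) y(2)] .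
    have "card (?O x \<union> ?O y) = 2 * p"
      using card_Un_disjoint[OF _ _ orbits_disjoint[OF z(1,3) y(3)]] Ox Oy by simp
    moreover have "card (?O x \<union> ?O y) \<le> card ?W" using Ox Oy finY by (intro card_mono) auto
    ultimately have "card ?Z = 0" using ZW by simp
    then have "?Z = {}" using finY by simp
    then show thesis using that(1) by blast
  qed
qed

section \<open>Faithful quandles and freeness of elements of order \<open>p\<close>\<close>

definition faithful :: bool
  where "faithful \<longleftrightarrow> (\<forall>a\<in>Y. \<forall>b\<in>Y. (\<forall>x\<in>Y. r a x = r b x) \<longrightarrow> a = b)"

text \<open>From \<open>r a b = b\<close> the translations by \<open>a\<close> and \<open>b\<close>
  commute, so the points \<open>r b a\<close> and \<open>a\<close> have the same
  translation.\<close>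

lemma commute_sym:
  assumes "faithful" and a: "a \<in> Y" "b \<in> Y" and ab: "r a b = b" shows "r b a = a"
proof -
  have "r (r b a) x = r a x" if x: "x \<in> Y" for x
  proof -
    obtain y where y: "y \<in> Y" "x = r b y"
      using R_permutes[OF a(2)] x permutes_image[of "R b" Y] by (metis R_apply imageE)
    have "r (r b a) x = r b (r a y)" using r_distr[OF a(2,1) y(1)] y by simp
    also have "\<dots> = r a x"
      using r_distr[OF a(1,2) y(1)] ab y(2) by simp
    finally show ?thesis .
  qed
  then show ?thesis using assms(1) r_closed a by (simp add: faithful_def)
qed

text \<open>Suppose that \<open>z\<close> has one cycle \<open>W\<close> and a fixed set
  \<open>Z\<close>, of \<open>p\<close> points each. Translations by points of \<open>Z\<close>
  commute with \<open>z\<close> and act on \<open>W\<close> as powers of \<open>z\<close>. If one of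
  them is trivial on \<open>W\<close>, the points of \<open>Z\<close> with this property form an
  invariant set; otherwise \<open>Z\<close> and \<open>W\<close> become blocks and \<open>W\<close>
  is invariant. Both contradict connectedness.\<close>

lemma order_p_free:
  assumes f: "faithful" and z: "z \<in> I" "z \<noteq> id" "z ^^ p = id" and x: "x \<in> Y"
  shows "z x \<noteq> x"
proof (rule free_or_half[OF z])
  fix x0 assume x0: "x0 \<in> Y" "z x0 \<noteq> x0" and W: "{y \<in> Y. z y \<noteq> y} = (\<lambda>k. (z ^^ k) x0) ` {..<p}"
    and Z: "card {y \<in> Y. z y = y} = p"
  let ?Z = "{y \<in> Y. z y = y}" and ?W = "{y \<in> Y. z y \<noteq> y}"
  have comm: "r y ((z ^^ k) u) = (z ^^ k) (r y u)" if "y \<in> ?Z" "u \<in> Y" for y u k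
  proof (induction k)
    case (Suc k)
    then show ?case using aut[OF z(1), of y "(z ^^ k) u"] mem[OF power_in[OF z(1)]] that by simp
  qed simp
  have comm1: "z (r y u) = r y (z u)" if "y \<in> ?Z" "u \<in> Y" for y u using comm[OF that, of 1] by simp
  have presZ: "r y u \<in> ?Z" if "y \<in> ?Z" "u \<in> ?Z" for y u using comm1[of y u] that r_closed by simp
  have presW: "r y u \<in> ?W" if "y \<in> ?Z" "u \<in> ?W" for y u
  proof -
    have "r y (z u) \<noteq> r y u" using r_inj[of y] that mem[OF z(1)] unfolding inj_on_def by blast
    then show ?thesis using comm1[of y u] that r_closed by simp
  qed
  have x0W: "x0 \<in> ?W" using x0 by simp
  have power: "\<exists>k<p. \<forall>u\<in>?W. r y u = (z ^^ k) u" if y: "y \<in> ?Z" for y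
  proof -
    obtain k where k: "k < p" "r y x0 = (z ^^ k) x0" using presW[OF y x0W] W by auto
    have "r y u = (z ^^ k) u" if "u \<in> ?W" for u
    proof -
      have "u \<in> (\<lambda>k. (z ^^ k) x0) ` {..<p}" unfolding W[symmetric] by (rule that)
      then obtain l where l: "u = (z ^^ l) x0" by blast
      have "r y u = (z ^^ l) ((z ^^ k) x0)" using comm[OF y x0(1)] k l by simp
      then show ?thesis unfolding l by (simp flip: funpow_add comp_apply[of "z ^^ l"] comp_apply[of "z ^^ k"] add: add.commute)
    qed
    then show ?thesis using k by blast
  qed
  show "z x \<noteq> x"
  proof (cases "\<exists>y\<in>?Z. r y x0 = x0")
    case True
    then obtain y0 where y0: "y0 \<in> ?Z" "r y0 x0 = x0" by blast
    have triv: "r y u = u" if y: "y \<in> ?Z" "r y x0 = x0" and u: "u \<in> ?W" for y u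
    proof -
      have "u \<in> (\<lambda>k. (z ^^ k) x0) ` {..<p}" unfolding W[symmetric] by (rule u)
      then obtain l where "u = (z ^^ l) x0" by blast
      then show ?thesis using comm[OF y(1) x0(1)] y(2) by simp
    qed
    have "{y \<in> ?Z. r y x0 = x0} = Y"
    proof (rule invariant_all[of _ y0])
      fix a y assume a: "a \<in> Y" and "y \<in> {y \<in> ?Z. r y x0 = x0}"
      then have y: "y \<in> ?Z" "y \<in> Y" "r y x0 = x0" by auto
      show "r a y \<in> {y \<in> ?Z. r y x0 = x0}"
      proof (cases "z a = a")
        case True
        then have aZ: "a \<in> ?Z" using a by simp
        have ay: "r a y \<in> ?Z" by (rule presZ[OF aZ y(1)])
        obtain k where k: "r a x0 = (z ^^ k) x0" using power[OF aZ] x0W by blast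
        have "r (r a y) (r a x0) = r a x0" using r_distr[OF a y(2) x0(1)] y(3) by simp
        then have "(z ^^ k) (r (r a y) x0) = (z ^^ k) x0" using k comm[OF ay x0(1)] by simp
        then have "r (r a y) x0 = x0" using inj_G[OF power_in[OF z(1)]] by simp
        then show ?thesis using ay by simp
      next
        case False
        then have "r y a = a" using triv[OF y(1,3)] a by simp
        then have "r a y = y" using commute_sym[OF f y(2) a] by simp
        then show ?thesis using y by simp
      qed
    qed (use y0 in auto)
    then show ?thesis using x0 by blast
  next
    case False
    \<comment> \<open>The factorial is a multiple of every cycle length below \<open>p\<close> and
      is prime to \<open>p\<close>. So for \<open>y\<close> in \<open>Z\<close> the power
      \<open>R y ^^ E\<close> is trivial on \<open>Z\<close>, where \<open>y\<close> is fixed and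
      only \<open>p - 1\<close> other points remain, but it acts on the cycle as a nontrivial power
      of \<open>z\<close>.\<close>
    define E where "E = (fact (p - 1) :: nat)"
    define P where "P a = {u \<in> Y. (R a ^^ E) u = u}" for a
    have PZ: "P y = ?Z" if y: "y \<in> ?Z" for y
    proof -
      have yY: "y \<in> Y" using y by simp
      have Rpow: "(R y ^^ n) u \<in> ?Z - {y}" if "u \<in> ?Z - {y}" for n u
      proof (induction n)
        case (Suc n)
        then have v: "(R y ^^ n) u \<in> ?Z - {y}" .
        have "R y ((R y ^^ n) u) \<noteq> R y y" using v inj_G[OF R_in[OF yY], of "(R y ^^ n) u" y] by blast
        then show ?case using presZ[OF y] v r_idem[OF yY] yY by simp
      qed (use that in simp)
      have 1: "(R y ^^ E) u = u" if u: "u \<in> ?Z" for u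
      proof (cases "u = y")
        case True
        have "(R y ^^ n) y = y" for n by (induction n) (use r_idem[OF yY] yY in auto)
        then show ?thesis using True by simp
      next
        case False
        have "card ((\<lambda>i. (R y ^^ i) u) ` {..<p}) \<le> card (?Z - {y})"
          using Rpow[of u] u False finY by (intro card_mono) auto
        also have "\<dots> < card {..<p}" using Z y finY p3 by simp
        finally have "\<not> inj_on (\<lambda>i. (R y ^^ i) u) {..<p}" by (rule pigeonhole)
        then obtain i j where ij: "i < p" "j < p" "i < j" "(R y ^^ i) u = (R y ^^ j) u"
          unfolding inj_on_def by (metis lessThan_iff linorder_less_linear)
        have "(R y ^^ j) u = (R y ^^ i) ((R y ^^ (j - i)) u)"
          using ij(3) by (simp flip: funpow_add comp_apply[of "R y ^^ i"])
        then have d: "(R y ^^ (j - i)) u = u" using ij(4) inj_G[OF power_in[OF R_in[OF yY]]] by metis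
        have "(j - i) dvd E" unfolding E_def using ij by (intro dvd_fact) auto
        then obtain m where m: "E = (j - i) * m" by blast
        have "(R y ^^ ((j - i) * m)) u = u" by (induction m) (simp_all add: funpow_add d add.commute[of "j - i"])
        then show ?thesis by (simp add: m)
      qed
      have 2: "(R y ^^ E) u \<noteq> u" if u: "u \<in> ?W" for u
      proof
        obtain k where k: "k < p" "\<And>u. u \<in> ?W \<Longrightarrow> r y u = (z ^^ k) u" using power[OF y] by blast
        have "k \<noteq> 0"
        proof
          assume "k = 0"
          then have "r y x0 = x0" using k(2)[OF x0W] by simp
          then show False using False y by blast
        qed
        have zW: "(z ^^ m) u \<in> ?W" for m using orbit_subset[OF z(1), of u UNIV] u by auto
        have it: "(R y ^^ n) u = (z ^^ (k * n)) u" for n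
        proof (induction n)
          case (Suc n)
          have "(R y ^^ Suc n) u = r y ((z ^^ (k * n)) u)" using Suc zW[of "k * n"] by simp
          also have "\<dots> = (z ^^ k) ((z ^^ (k * n)) u)" by (rule k(2)[OF zW])
          finally show ?case by (simp add: funpow_add)
        qed simp
        assume "(R y ^^ E) u = u"
        then have "(z ^^ ((k * E) mod p)) u = u" unfolding it pow_mod[OF z(3)] .
        moreover have "\<not> p dvd k * E"
        proof
          assume "p dvd k * E"
          then consider "p dvd k" | "p dvd E" using pr prime_dvd_mult_iff by blast
          then show False
          proof cases
            case 1 then show False using k(1) \<open>k \<noteq> 0\<close> nat_dvd_not_less by blast
          next
            case 2 then show False using prime_dvd_fact_iff[OF pr] p3 by (simp add: E_def)
          qed
        qed
        then have "0 < (k * E) mod p" "(k * E) mod p < p" using p3 by (auto simp: mod_greater_zero_iff_not_dvd)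
        ultimately show False using cycle_free[OF z(3)] u by blast
      qed
      show ?thesis unfolding P_def using 1 2 by blast
    qed
    have Pg: "P (g a) = g ` P a" if g: "g \<in> I" and a: "a \<in> Y" for g a
    proof
      show "g ` P a \<subseteq> P (g a)" using R_conj_pow[OF g a] mem[OF g] by (auto simp: P_def)
      show "P (g a) \<subseteq> g ` P a"
      proof
        fix v assume v: "v \<in> P (g a)"
        obtain u where u: "u \<in> Y" "v = g u" using v permutes_image[OF perm[OF g]] by (auto simp: P_def)
        have "g ((R a ^^ E) u) = g u" using v u R_conj_pow[OF g a] by (simp add: P_def)
        then show "v \<in> g ` P a" using u inj_G[OF g] by (simp add: P_def)
      qed
    qed
    have "?Z \<noteq> {}"
    proof
      assume e: "?Z = {}"
      show False using Z p3 unfolding e by simp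
    qed
    then obtain y where y: "y \<in> ?Z" by blast
    have eq: "card (P a) = p \<and> a \<in> P a \<and> (\<forall>b\<in>P a. P b = P a)" if a: "a \<in> Y" for a
    proof -
      obtain g where g: "g \<in> I" "g y = a" using conn y a by blast
      have P: "P a = g ` ?Z" using Pg[OF g(1), of y] g(2) y PZ by simp
      have "inj_on g ?Z" using inj_G[OF g(1)] by (simp add: inj_on_def)
      then have "card (P a) = p" using P Z by (simp add: card_image)
      moreover have "P b = P a" if b: "b \<in> P a" for b
      proof -
        obtain c where "c \<in> ?Z" "b = g c" using b P by blast
        then show ?thesis using Pg[OF g(1), of c] PZ P by simp
      qed
      moreover have "a \<in> P a" using P y g by blast
      ultimately show ?thesis by blast
    qed
    \<comment> \<open>The sets \<open>P a\<close> partition \<open>Y\<close> into classes of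
      \<open>p\<close> points, and \<open>Z\<close> is one of them. The class of a point of the
      cycle avoids \<open>Z\<close> and therefore is the cycle.\<close>
    have PW: "P w = ?W" if w: "w \<in> ?W" for w
    proof (rule card_subset_eq)
      have wY: "w \<in> Y" using w by simp
      show "P w \<subseteq> ?W"
      proof
        fix b assume b: "b \<in> P w"
        have "b \<notin> ?Z"
        proof
          assume "b \<in> ?Z"
          then have "P b = ?Z" by (rule PZ)
          moreover have "P b = P w" "w \<in> P w" using eq[OF wY] b by blast+
          ultimately have "w \<in> ?Z" by simp
          then show False using w by simp
        qed
        moreover have "b \<in> Y" using b by (simp add: P_def)
        ultimately show "b \<in> ?W" by simp
      qed
      have "card (P w) = p" using eq[OF wY] by blast
      moreover have "card ?W = p" unfolding W by (rule orbit_card[OF z(1,3) x0(2)])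
      ultimately show "card (P w) = card ?W" by (simp only:)
    qed (use finY in simp)
    have "?W = Y"
    proof (rule invariant_all[OF _ x0W])
      fix a u assume a: "a \<in> Y" and u: "u \<in> ?W"
      show "r a u \<in> ?W"
      proof (cases "z a = a")
        case True then show ?thesis using presW[of a u] a u by simp
      next
        case False
        then have aW: "a \<in> ?W" using a by simp
        have "R a u \<in> R a ` P a" using PW[OF aW] u by blast
        also have "R a ` P a = P (R a a)" using Pg[OF R_in[OF a] a] by simp
        also have "\<dots> = ?W" using PW[OF aW] a r_idem[OF a] by simp
        finally show ?thesis using u by simp
      qed
    qed auto
    then show ?thesis using x by blast
  qed
qed (use x in blast)

end

context split_orbits
begin

text \<open>The graph of \<open>T\<close> has valency 1, so \<open>v = Rm x (T x)\<close> is its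
  eigenvalue and an integer. By \<open>parseval\<close> and \<open>w_sum\<close> its weights have
  square sum \<open>2 - 2 * v * v\<close> and sum \<open>1 + v\<close>, hence \<open>v\<close> is
  -1, 0 or 1. For \<open>v = 0\<close> the parities of the two sums disagree; for
  \<open>v = 1\<close> all weights vanish although their sum is 2.\<close>

lemma Rm_fixpoint_free:
  assumes T: "\<And>x. x \<in> Q \<Longrightarrow> T x \<in> Q" "\<And>x. x \<in> Q \<Longrightarrow> T x \<noteq> x"
    and Tg: "\<And>g x. g \<in> G \<Longrightarrow> x \<in> Q \<Longrightarrow> T (g x) = g (T x)" and x: "x \<in> Q"
  shows "Rm x (T x) = -1"
proof -
  define E where "E = (\<lambda>x y. y = T x)"
  have nE: "\<not> E u u" if "u \<in> Q" for u using T(2)[OF that] by (simp add: E_def)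
  have E: "graph E"
    unfolding graph_def
  proof (intro conjI ballI)
    show "E (g u) (g y) = E u y" if "g \<in> G" "u \<in> Q" "y \<in> Q" for g u y
      using Tg[OF that(1,2)] inj_G[OF that(1)] by (simp add: E_def)
  qed (use nE in blast)
  have Rx: "Rm y (T y) = Rm x (T x)" if y: "y \<in> Q" for y
  proof -
    obtain g where g: "g \<in> G" "g x = y" using trans[OF x y] by blast
    have "Rm (g x) (g (T x)) = Rm x (T x)" using Rm_ginv g(1) x T(1) by (simp add: ginv_def)
    then show ?thesis using g Tg[OF g(1) x] by simp
  qed
  define v where "v = Rm x (T x)"
  have "{y \<in> Q. E x y} = {T x}" using T(1)[OF x] by (auto simp: E_def)
  then have val: "valency E = 1" using card_valency[OF E x] by simp
  have ev: "ev (ind E) = v"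
    using ev_ind_level[OF E, of v] Rx by (simp add: E_def v_def val[unfolded E_def])
  have "v \<in> \<int>" unfolding ev[symmetric] by (rule ev_int[OF ginv_ind[OF E]]) simp
  then obtain i :: int where i: "v = of_int i" by (rule Ints_cases)
  have "2 * (\<Sum>y\<in>Q. ind E x y * ind E x y) = 2 * ev (ind E) * ev (ind E) + (\<Sum>k<p. w (ind E) k * w (ind E) k)"
    by (rule parseval[OF ginv_ind[OF E] ginv_ind[OF E] _ _ x]) (use nE in simp_all)
  moreover have "(\<Sum>y\<in>Q. ind E x y * ind E x y) = (\<Sum>y\<in>Q. ind E x y)" by (intro sum.cong refl) simp
  ultimately have ww: "(\<Sum>k<p. w (ind E) k * w (ind E) k) = 2 - 2 * (v * v)"
    using rowsum_ind[OF E x] val ev by simp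
  have ws: "(\<Sum>k<p. w (ind E) k) = 1 + v"
    using w_sum[OF ginv_ind[OF E]] rowsum_ind[OF E bp_in[of True]] val ev by simp
  have "(\<Sum>k<p. w (ind E) k * w (ind E) k) \<ge> 0" by (intro sum_nonneg) simp
  then have "v * v \<le> 1" using ww by simp
  then have "of_int (i * i) \<le> (of_int 1 :: real)" unfolding i by simp
  then have "i * i \<le> 1" by (simp only: of_int_le_iff)
  then have "\<bar>i\<bar> \<le> 1" using abs_le_square_iff[of i 1] by (simp add: power2_eq_square)
  then consider "i = -1" | "i = 0" | "i = 1" by linarith
  then show ?thesis
  proof cases
    case 1 then show ?thesis using i v_def by simp
  next
    case 2
    have "(\<Sum>k<p. w (ind E) k * w (ind E) k) - (\<Sum>k<p. w (ind E) k) = 1" using ww ws i 2 by simp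
    moreover have "(\<Sum>k<p. w (ind E) k * w (ind E) k) - (\<Sum>k<p. w (ind E) k)
        = (\<Sum>k<p. of_nat (if w (ind E) k = 2 then 2 else 0))"
      unfolding sum_subtractf[symmetric] by (intro sum.cong refl) (simp add: w_def)
    moreover have "\<dots> = real (2 * (\<Sum>k<p. if w (ind E) k = 2 then 1 else 0))"
      unfolding of_nat_sum[symmetric] sum_distrib_left by (intro arg_cong[of _ _ real] sum.cong refl) simp
    ultimately have "real (2 * (\<Sum>k<p. if w (ind E) k = 2 then 1 else 0)) = real 1" by simp
    then have "2 * (\<Sum>k<p. if w (ind E) k = 2 then 1 else 0) = (1::nat)" by (simp only: of_nat_eq_iff)
    then have "even (1::nat)" by (metis dvd_triv_left)
    then show ?thesis by simp
  next
    case 3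
    have "(\<Sum>k<p. w (ind E) k * w (ind E) k) = 0" using ww i 3 by simp
    then have "w (ind E) k = 0" if "k < p" for k using that by (simp add: sum_nonneg_eq_0_iff)
    then have "(\<Sum>k<p. w (ind E) k) = 0" by (intro sum.neutral) simp
    then show ?thesis using ws i 3 by simp
  qed
qed

end

section \<open>Classes of points with equal translations\<close>

context conn_rack
begin

text \<open>The first alternative of \<open>dichotomy\<close> in a form that mentions neither
  \<open>z\<close> nor base points.\<close>

definition scalar :: "bool"
  where "scalar \<longleftrightarrow> (\<forall>K. ginv I Y K \<longrightarrow> (\<exists>c. \<forall>x\<in>Y. \<forall>y\<in>Y. x \<noteq> y \<longrightarrow> K x y = (c :: real)))"

lemma scalarD: "scalar \<Longrightarrow> ginv I Y K \<Longrightarrow> \<exists>c. \<forall>x\<in>Y. \<forall>y\<in>Y. x \<noteq> y \<longrightarrow> K x y = (c :: real)"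
  unfolding scalar_def by (erule allE, erule mp)

lemma trichotomy:
  assumes "two_orbits Y I p z bp"
  shows "scalar \<or> (\<exists>T. matching_case Y I p z bp T) \<or> (\<exists>s. srg_case Y I p z bp s)"
proof -
  interpret O: two_orbits Y I p z bp by fact
  from O.dichotomy show ?thesis
  proof
    assume "\<forall>K x y. ginv I Y K \<longrightarrow> x \<in> Y \<longrightarrow> y \<in> Y \<longrightarrow>
      K x y = (\<Sum>y\<in>Y. K (bp True) y) / (2 * p) + O.ev K * ((if x = y then 1 else 0) - 1 / (2 * p))"
    then have *: "K x y = (\<Sum>y\<in>Y. K (bp True) y) / (2 * p) + O.ev K * ((if x = y then 1 else 0) - 1 / (2 * p))"
      if "ginv I Y K" "x \<in> Y" "y \<in> Y" for K x y using that by blast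
    have "scalar" unfolding scalar_def
    proof (intro allI impI)
      fix K :: "'a \<Rightarrow> 'a \<Rightarrow> real" assume K: "ginv I Y K"
      have "\<forall>x\<in>Y. \<forall>y\<in>Y. x \<noteq> y \<longrightarrow> K x y = (\<Sum>y\<in>Y. K (bp True) y) / (2 * p) + O.ev K * (0 - 1 / (2 * p))"
      proof (intro ballI impI)
        fix x y assume xy: "x \<in> Y" "y \<in> Y" "x \<noteq> y"
        show "K x y = (\<Sum>y\<in>Y. K (bp True) y) / (2 * p) + O.ev K * (0 - 1 / (2 * p))"
          using *[OF K xy(1,2)] unfolding if_not_P[OF xy(3)] .
      qed
      then show "\<exists>c. \<forall>x\<in>Y. \<forall>y\<in>Y. x \<noteq> y \<longrightarrow> K x y = c" by blast
    qed
    then show ?thesis by blast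
  next
    assume "O.ev O.H = 2 * card I \<and> (\<forall>k\<in>{1..<p}. O.w O.H k = 0)"
    then interpret S: split_orbits Y I p z bp by unfold_locales auto
    show ?thesis using S.split_cases by blast
  qed
qed

lemma equivariant_R:
  assumes "split_orbits Y I p z bp" shows "split_orbits.equivariant Y I R"
proof -
  interpret S: split_orbits Y I p z bp by fact
  have "R (g a) (g x) = g (R a x)" if "g \<in> I" "a \<in> Y" for g a x using R_conj[OF that] by (metis comp_apply)
  then show ?thesis unfolding S.equivariant_def using R_in by blast
qed

text \<open>A family that does not distinguish \<open>a\<close> and \<open>T a\<close> cannot have a count equal to one.\<close>

lemma matching_blocks:
  assumes M: "matching_case Y I p z bp T" and \<gamma>: "split_orbits.equivariant Y I \<gamma>"
    and fix_self: "\<And>a. a \<in> Y \<Longrightarrow> \<gamma> a a = a"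
    and sym: "\<And>a x. a \<in> Y \<Longrightarrow> x \<in> Y \<Longrightarrow> \<gamma> (T a) x = \<gamma> a x"
    and a: "a \<in> Y" and x: "x \<in> Y"
  shows "\<gamma> a x \<in> {x, T x}"
proof -
  interpret M: matching_case Y I p z bp T by fact
  from M.matching_counts[OF \<gamma> fix_self] show ?thesis
  proof
    assume *: "\<forall>x\<in>Y. \<forall>y\<in>Y. card {a\<in>Y. \<gamma> a x = y} = (if y = x then 2 else if y = T x then 0 else 1)"
    obtain y where y: "y \<in> Y" "y \<noteq> x" "y \<noteq> T x"
      using card_two_less[OF finY x x, of "T x"] card_Y p3 by auto
    have "even (card {a\<in>Y. \<gamma> a x = y})"
      by (rule even_card_fixpoint_free[of _ T]) (use finY M.T_in M.T_T M.T_ne sym x in auto)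
    then show ?thesis using *[rule_format, OF x y(1)] y by simp
  qed (use a x in auto)
qed

text \<open>A pair \<open>{x, T x}\<close> would be invariant under all translations.\<close>

lemma no_matching_blocks:
  assumes T: "\<And>x. x \<in> Y \<Longrightarrow> T x \<in> Y" "\<And>x. x \<in> Y \<Longrightarrow> T (T x) = x"
    and bl: "\<And>a x. a \<in> Y \<Longrightarrow> x \<in> Y \<Longrightarrow> r a x \<in> {x, T x}"
  shows False
proof -
  obtain x where x: "x \<in> Y" using card_Y p3 by fastforce
  have "{x, T x} = Y"
  proof (rule invariant_all[of _ x])
    fix a u assume "a \<in> Y" "u \<in> {x, T x}"
    then show "r a u \<in> {x, T x}" using bl[of a x] bl[of a "T x"] T(1)[OF x] T(2)[OF x] x by auto
  qed (use T x in auto)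
  then have "card Y = card {x, T x}" by simp
  also have "\<dots> \<le> 2" by (simp add: card_insert_if)
  finally show False using card_Y p3 by simp
qed

lemma matching_count_R:
  assumes M: "matching_case Y I p z bp T" and x: "x \<in> Y" "y \<in> Y"
  shows "card {a\<in>Y. r a x = y} = (if y = x then 2 else if y = T x then 0 else 1)"
proof -
  interpret M: matching_case Y I p z bp T by fact
  have "R a a = a" if "a \<in> Y" for a using that r_idem by simp
  from M.matching_counts[OF equivariant_R[OF M.split_orbits_axioms] this]
  show ?thesis
  proof
    assume "\<forall>a\<in>Y. \<forall>x\<in>Y. R a x \<in> {x, T x}"
    then have "r a x \<in> {x, T x}" if "a \<in> Y" "x \<in> Y" for a x using that by (metis R_apply)
    then show ?thesis using no_matching_blocks[of T] M.T_in M.T_T by blast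
  next
    assume "\<forall>x\<in>Y. \<forall>y\<in>Y. card {a\<in>Y. R a x = y} = (if y = x then 2 else if y = T x then 0 else 1)"
    then show ?thesis using x by simp
  qed
qed

definition fibre :: "'a \<Rightarrow> 'a set"
  where "fibre a = {b\<in>Y. \<forall>x\<in>Y. r b x = r a x}"

lemma fibre_self: "a \<in> Y \<Longrightarrow> a \<in> fibre a" by (simp add: fibre_def)

lemma fibre_eq: "b \<in> fibre a \<Longrightarrow> fibre b = fibre a" by (auto simp: fibre_def)

lemma fibre_image: assumes g: "g \<in> I" and a: "a \<in> Y" shows "fibre (g a) = g ` fibre a"
proof
  show "g ` fibre a \<subseteq> fibre (g a)"
  proof
    fix c assume "c \<in> g ` fibre a"
    then obtain b where b: "b \<in> Y" "c = g b" "\<And>x. x \<in> Y \<Longrightarrow> r b x = r a x" by (auto simp: fibre_def)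
    have "r c y = r (g a) y" if y: "y \<in> Y" for y
    proof -
      obtain x where x: "x \<in> Y" "y = g x" using y permutes_image[OF perm[OF g]] by blast
      then show ?thesis using aut[OF g b(1) x(1)] aut[OF g a x(1)] b by simp
    qed
    then show "c \<in> fibre (g a)" using mem[OF g] b by (simp add: fibre_def)
  qed
  show "fibre (g a) \<subseteq> g ` fibre a"
  proof
    fix c assume c: "c \<in> fibre (g a)"
    then have cY: "c \<in> Y" by (simp add: fibre_def)
    then obtain b where b: "b \<in> Y" "c = g b" using permutes_image[OF perm[OF g]] by blast
    have "r b x = r a x" if x: "x \<in> Y" for x
    proof -
      have "r (g b) (g x) = r (g a) (g x)" using c b mem[OF g x] by (simp add: fibre_def)
      then have "g (r b x) = g (r a x)" using aut[OF g b(1) x] aut[OF g a x] by simp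
      then show ?thesis using inj_G[OF g] by simp
    qed
    then show "c \<in> g ` fibre a" using b by (simp add: fibre_def)
  qed
qed

lemma fibre_card: assumes "a \<in> Y" "b \<in> Y" shows "card (fibre b) = card (fibre a)"
proof -
  obtain g where g: "g \<in> I" "g a = b" using conn assms by blast
  have "inj_on g (fibre a)" using inj_G[OF g(1)] by (simp add: inj_on_def)
  then show ?thesis using fibre_image[OF g(1) assms(1)] g(2) by (simp add: card_image)
qed

lemma fibre_card_dvd: assumes a: "a \<in> Y" shows "card (fibre a) dvd 2 * p"
proof -
  have "card (fibre a) * card (fibre ` Y) = card (\<Union> (fibre ` Y))"
  proof (rule card_partition)
    show "finite (fibre ` Y)" using finY by simp
    show "finite (\<Union> (fibre ` Y))" using finY by (simp add: fibre_def)
    show "card c = card (fibre a)" if c: "c \<in> fibre ` Y" for c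
    proof -
      obtain y where y: "y \<in> Y" "c = fibre y" using c by blast
      show ?thesis unfolding y(2) by (rule fibre_card[OF a y(1)])
    qed
    show "c1 \<inter> c2 = {}" if "c1 \<in> fibre ` Y" "c2 \<in> fibre ` Y" "c1 \<noteq> c2" for c1 c2
      using that fibre_eq by blast
  qed
  moreover have "\<Union> (fibre ` Y) = Y" using fibre_self by (auto simp: fibre_def)
  ultimately have "2 * p = card (fibre a) * card (fibre ` Y)" using card_Y by simp
  then show ?thesis by (rule dvdI)
qed

lemma fibre_fixed: assumes "a \<in> Y" "b \<in> fibre a" shows "r a b = b"
proof -
  have b: "b \<in> Y" "r b b = r a b" using assms(2) by (auto simp: fibre_def)
  then show ?thesis using r_idem[OF b(1)] by simp
qed

text \<open>With classes of at least \<open>p\<close> points there are at most two of them. The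
  translation by \<open>c\<close> fixes the class of \<open>c\<close> pointwise, so it moves no
  point into that class. Thus the class of \<open>a\<close> is invariant and everything fixes
  \<open>a\<close>.\<close>

lemma fibre_card_less: assumes a: "a \<in> Y" shows "card (fibre a) < p"
proof (rule ccontr)
  assume "\<not> ?thesis"
  then have le: "p \<le> card (fibre a)" by simp
  have sub: "fibre c \<subseteq> Y" for c by (auto simp: fibre_def)
  have "fibre a = Y"
  proof (rule invariant_all[OF sub fibre_self[OF a]])
    fix c x assume c: "c \<in> Y" and x: "x \<in> fibre a"
    have xY: "x \<in> Y" using x sub by blast
    show "r c x \<in> fibre a"
    proof (cases "c \<in> fibre a")
      case True
      then have "x \<in> fibre c" using x fibre_eq by blast
      then show ?thesis using fibre_fixed[OF c] x by simp
    next
      case False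
      have dis: "fibre a \<inter> fibre c = {}" using False fibre_eq fibre_self[OF c] by blast
      have "card (fibre a \<union> fibre c) = card (fibre a) + card (fibre c)"
        using dis finY finite_subset[OF sub] by (intro card_Un_disjoint) auto
      also have "\<dots> \<ge> card Y" using le fibre_card[OF a c] card_Y by simp
      finally have "fibre a \<union> fibre c = Y" using finY sub by (intro card_seteq) auto
      moreover have "r c x \<notin> fibre c"
      proof
        assume "r c x \<in> fibre c"
        then have "r c (r c x) = r c x" by (rule fibre_fixed[OF c])
        then have "r c x = x" using inj_onD[OF r_inj[OF c]] r_closed[OF c xY] xY by blast
        then show False using \<open>r c x \<in> fibre c\<close> x dis by auto
      qed
      ultimately show ?thesis using r_closed[OF c xY] by blast
    qed
  qed
  have "r c a = a" if "c \<in> Y" for c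
  proof (rule fibre_fixed[OF that])
    have "c \<in> fibre a" using that \<open>fibre a = Y\<close> by simp
    then show "a \<in> fibre c" using fibre_eq fibre_self[OF a] by blast
  qed
  then show False using not_fixed_point[OF a] by blast
qed

lemma fibre_two: assumes nf: "\<not> faithful" and a: "a \<in> Y" shows "card (fibre a) = 2"
proof -
  obtain b c where bc: "b \<in> Y" "c \<in> Y" "b \<noteq> c" "\<And>x. x \<in> Y \<Longrightarrow> r b x = r c x"
    using nf by (auto simp: faithful_def)
  have "{b, c} \<subseteq> fibre b" using bc by (simp add: fibre_def)
  then have "card {b, c} \<le> card (fibre b)" using finY by (intro card_mono) (auto simp: fibre_def)
  then have ge: "2 \<le> card (fibre a)" using bc fibre_card[OF a bc(1)] by simp
  have "\<not> p dvd card (fibre a)" using fibre_card_less[OF a] ge nat_dvd_not_less[of "card (fibre a)" p] by simp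
  then have "coprime p (card (fibre a))" using pr prime_imp_coprime by blast
  then have "card (fibre a) dvd 2" using fibre_card_dvd[OF a]
    using coprime_dvd_mult_left_iff[of "card (fibre a)" p 2] by (simp add: coprime_commute)
  then show ?thesis using ge dvd_imp_le[of "card (fibre a)" 2] by simp
qed

text \<open>Otherwise the classes are pairs \<open>{a, T a}\<close> with an equivariant
  fixed-point-free \<open>T\<close>. It pairs off the fixed points of an element of order
  \<open>p\<close>, whose number cannot be the odd \<open>p\<close>, so the trichotomy is available
  before faithfulness is known. \<open>Rm_fixpoint_free\<close> leaves the matching case with
  matching \<open>T\<close>, where \<open>matching_blocks\<close> contradicts connectedness.\<close>

theorem is_faithful: faithful
proof (rule ccontr)
  assume nf: "\<not> faithful"
  have "\<exists>t. fibre a = {a, t} \<and> t \<noteq> a" if "a \<in> Y" for a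
    using fibre_two[OF nf that] fibre_self[OF that] by (auto simp: card_2_iff)
  then obtain T where T: "\<And>a. a \<in> Y \<Longrightarrow> fibre a = {a, T a}" "\<And>a. a \<in> Y \<Longrightarrow> T a \<noteq> a" by metis
  have TY: "T a \<in> Y" if "a \<in> Y" for a using T(1)[OF that] by (auto simp: fibre_def)
  have TT: "T (T a) = a" if a: "a \<in> Y" for a
  proof -
    have "fibre (T a) = fibre a" using T(1)[OF a] by (intro fibre_eq) simp
    then show ?thesis using T(1)[OF a] T(1)[OF TY[OF a]] T(2)[OF TY[OF a]] by auto
  qed
  have Tr: "r (T a) x = r a x" if a: "a \<in> Y" and x: "x \<in> Y" for a x
  proof -
    have "T a \<in> fibre a" using T(1)[OF a] by simp
    then show ?thesis using x by (simp add: fibre_def)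
  qed
  have Tg: "T (g x) = g (T x)" if g: "g \<in> I" and x: "x \<in> Y" for g x
  proof -
    have "{g x, T (g x)} = g ` {x, T x}" using fibre_image[OF g x] T(1)[OF x] T(1)[OF mem[OF g x]] by simp
    then have "T (g x) \<in> {g x, g (T x)}" by auto
    then show ?thesis using T(2)[OF mem[OF g x]] by blast
  qed
  obtain z where z: "z \<in> I" "z \<noteq> id" "z ^^ p = id" by (rule ex_order_p)
  have free: "z x \<noteq> x" if "x \<in> Y" for x
  proof (rule free_or_half[OF z])
    assume c: "card {y \<in> Y. z y = y} = p"
    have "even (card {y \<in> Y. z y = y})"
    proof (rule even_card_fixpoint_free[of _ T])
      show "T y \<in> {y \<in> Y. z y = y}" if "y \<in> {y \<in> Y. z y = y}" for y
        using that TY Tg[OF z(1), of y] by simp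
    qed (use finY TT T(2) in auto)
    then show ?thesis using c odd_p by simp
  qed (use that in blast)
  obtain bp where O: "two_orbits Y I p z bp" using ex_two_orbits[OF z(1,3) free] by blast
  obtain x where x: "x \<in> Y" using card_Y p3 by fastforce
  obtain y where y: "y \<in> Y" "y \<noteq> x" "y \<noteq> T x"
    using card_two_less[OF finY x x, of "T x"] card_Y p3 by auto
  from trichotomy[OF O] consider "scalar" | T' where "matching_case Y I p z bp T'" | s where "srg_case Y I p z bp s" by blast
  then show False
  proof cases
    case 1
    define K where "K = (\<lambda>x y. if y = T x then 1 else 0 :: real)"
    have "ginv I Y K" unfolding ginv_def K_def using Tg inj_G by simp
    from scalarD[OF 1 this] obtain c where c: "\<forall>x\<in>Y. \<forall>y\<in>Y. x \<noteq> y \<longrightarrow> K x y = c" by blast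
    have "K x y = c" by (rule c[rule_format, OF x y(1) y(2)[symmetric]])
    moreover have "K x (T x) = c" by (rule c[rule_format, OF x TY[OF x] T(2)[OF x, symmetric]])
    ultimately show False using y(3) by (simp add: K_def)
  next
    case 2
    then interpret M: matching_case Y I p z bp T' .
    have "M.Rm a (T a) = -1" if "a \<in> Y" for a by (rule M.Rm_fixpoint_free[OF TY T(2) Tg that])
    then have T': "T' a = T a" if "a \<in> Y" for a using M.Rm_T[OF that TY[OF that]] that by (auto split: if_splits)
    have "r a x \<in> {x, T' x}" if a: "a \<in> Y" and x: "x \<in> Y" for a x
    proof -
      have "R a x \<in> {x, T' x}"
        by (rule matching_blocks[OF 2 equivariant_R[OF M.split_orbits_axioms]]) (use a x r_idem T' TY Tr in simp_all)
      then show ?thesis using x by simp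
    qed
    then show False using no_matching_blocks[of T'] M.T_in M.T_T by blast
  next
    case 3
    then interpret S: srg_case Y I p z bp s .
    have "S.Rm x (T x) = -1" by (rule S.Rm_fixpoint_free[OF TY T(2) Tg x])
    then show False using S.Rm_values[OF x TY[OF x]] S.s_pos by (auto simp: field_simps)
  qed
qed

section \<open>Exclusion of the scalar case and of the matching case\<close>

lemma ex_free: obtains z bp where "two_orbits Y I p z bp"
proof -
  obtain z where z: "z \<in> I" "z \<noteq> id" "z ^^ p = id" by (rule ex_order_p)
  show thesis using ex_two_orbits[OF z(1,3) order_p_free[OF is_faithful z]] that by blast
qed

lemma latin_False:
  assumes "\<And>x y. x \<in> Y \<Longrightarrow> y \<in> Y \<Longrightarrow> card {a\<in>Y. r a x = y} = 1"
  shows False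
proof (rule no_latin_quandle[OF finite_rack_axioms])
  have "2 * p mod 4 = 2" using odd_p by presburger
  then show "card Y mod 4 = 2" using card_Y by simp
  fix a b assume "a \<in> Y" "b \<in> Y"
  then obtain u where "{v\<in>Y. r v a = b} = {u}" using assms card_1_singletonE by metis
  then have "v \<in> Y \<and> r v a = b \<longleftrightarrow> v = u" for v by (simp add: set_eq_iff)
  then show "\<exists>!u. u \<in> Y \<and> r u a = b" by (intro ex1I[of _ u]) simp_all
qed

lemma two_others:
  assumes "a \<in> Y" "b \<in> Y" "c \<in> Y"
  obtains y where "y \<in> Y" "y \<notin> {a, a', b, b', c, c'}"
proof -
  have "card {a, a', b, b', c, c'} \<le> 6" by (simp add: card_insert_if)
  moreover have "card Y \<le> card {a, a', b, b', c, c'}" if "Y \<subseteq> {a, a', b, b', c, c'}"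
    using that by (intro card_mono) simp_all
  ultimately have "\<not> Y \<subseteq> {a, a', b, b', c, c'}" using card_Y p3 by linarith
  then show thesis using that by blast
qed

lemma ex_point: obtains x where "x \<in> Y"
proof -
  have "Y \<noteq> {}"
  proof
    assume e: "Y = {}"
    show False using card_Y p3 unfolding e by simp
  qed
  then show thesis using that by blast
qed

lemma not_all_commute: assumes "a \<in> Y" shows "\<exists>x\<in>Y. r a x \<noteq> x"
proof -
  obtain c where c: "c \<in> Y" "r c a \<noteq> a" using not_fixed_point[OF assms] by blast
  then have "r a c \<noteq> c" using commute_sym[OF is_faithful assms c(1)] by blast
  then show ?thesis using c by blast
qed

lemma counts_sum: assumes x: "x \<in> Y" shows "(\<Sum>y\<in>Y. card {a\<in>Y. r a x = y}) = 2 * p"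
proof -
  have "(\<Sum>y\<in>Y. card {a\<in>Y. r a x = y}) = card (\<Union>y\<in>Y. {a\<in>Y. r a x = y})"
    using finY by (subst card_UN_disjoint) auto
  also have "(\<Union>y\<in>Y. {a\<in>Y. r a x = y}) = Y" using r_closed x by auto
  finally show ?thesis using card_Y by simp
qed

lemma commute_invariant:
  assumes "g \<in> I" "x \<in> Y" "y \<in> Y" shows "(r (g x) (g y) = g y) \<longleftrightarrow> (r x y = y)"
  unfolding aut[OF assms, symmetric] inj_G[OF assms(1)] ..

text \<open>Commutation is an invariant matrix, so all pairs of distinct points commute or none do,
  and \<open>not_all_commute\<close> excludes the former. Then each point is fixed only by its own
  translation, the row sum makes all other counts 1, and the quandle is Latin.\<close>

lemma no_scalar: "\<not> scalar"
proof
  assume sc: "scalar"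
  obtain x where x: "x \<in> Y" by (rule ex_point)
  define A where "A = (\<lambda>x y. if r x y = y then 1 else 0 :: real)"
  have "ginv I Y A"
    unfolding ginv_def
  proof (intro ballI)
    fix g x y assume "g \<in> I" "x \<in> Y" "y \<in> Y"
    then show "A (g x) (g y) = A x y" unfolding A_def by (simp only: commute_invariant[of g x y])
  qed
  from scalarD[OF sc this] obtain c where c: "\<forall>x\<in>Y. \<forall>y\<in>Y. x \<noteq> y \<longrightarrow> A x y = c" by blast
  obtain y where y: "y \<in> Y" "r x y \<noteq> y" using not_all_commute[OF x] by blast
  have "x \<noteq> y" using y(2) r_idem[OF x] by (cases "x = y") simp_all
  then have "A x y = c" by (rule c[rule_format, OF x y(1)])
  moreover have "A x y = 0" unfolding A_def by (rule if_not_P[OF y(2)])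
  ultimately have c0: "c = 0" by (simp only:)
  have A0: "r a b \<noteq> b" if ab: "a \<in> Y" "b \<in> Y" "a \<noteq> b" for a b
  proof
    assume "r a b = b"
    then have "A a b = 1" by (simp add: A_def)
    moreover have "A a b = c" by (rule c[rule_format, OF ab])
    ultimately show False using c0 by simp
  qed
  define M where "M = (\<lambda>x y. real (card {a\<in>Y. r a x = y}))"
  have "ginv I Y M"
    unfolding ginv_def M_def
  proof (intro ballI)
    fix g x y assume g: "g \<in> I" and xy: "x \<in> Y" "y \<in> Y"
    have e1: "{a\<in>Y. r a (g x) = g y} = g ` {a\<in>Y. r a x = y}"
    proof
      show "g ` {a\<in>Y. r a x = y} \<subseteq> {a\<in>Y. r a (g x) = g y}"
      proof
        fix b assume "b \<in> g ` {a\<in>Y. r a x = y}"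
        then obtain a where a: "a \<in> Y" "b = g a" "r a x = y" by blast
        then show "b \<in> {a\<in>Y. r a (g x) = g y}" using mem[OF g a(1)] aut[OF g a(1) xy(1)] by simp
      qed
      show "{a\<in>Y. r a (g x) = g y} \<subseteq> g ` {a\<in>Y. r a x = y}"
      proof
        fix b assume b: "b \<in> {a\<in>Y. r a (g x) = g y}"
        then have "b \<in> g ` Y" unfolding permutes_image[OF perm[OF g]] by simp
        then obtain a where a: "a \<in> Y" "b = g a" by (elim imageE)
        then have "g (r a x) = g y" using aut[OF g a(1) xy(1)] b by simp
        then have "r a x = y" unfolding inj_G[OF g] .
        then have "a \<in> {a\<in>Y. r a x = y}" using a(1) by simp
        then show "b \<in> g ` {a\<in>Y. r a x = y}" unfolding a(2) by (rule imageI)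
      qed
    qed
    have e2: "inj_on g {a\<in>Y. r a x = y}" using inj_G[OF g] by (simp add: inj_on_def)
    show "real (card {a\<in>Y. r a (g x) = g y}) = real (card {a\<in>Y. r a x = y})" unfolding e1 card_image[OF e2] ..
  qed
  from scalarD[OF sc this] obtain d where d: "\<forall>x\<in>Y. \<forall>y\<in>Y. x \<noteq> y \<longrightarrow> M x y = d" by blast
  have Mx: "card {a\<in>Y. r a x = x} = 1" if x: "x \<in> Y" for x
  proof -
    have "{a\<in>Y. r a x = x} = {x}"
    proof (intro equalityI subsetI)
      fix a assume a: "a \<in> {a\<in>Y. r a x = x}"
      then show "a \<in> {x}" using A0[of a x] x by (cases "a = x") simp_all
    next
      fix a assume "a \<in> {x}"
      then show "a \<in> {a\<in>Y. r a x = x}" using x r_idem[OF x] by simp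
    qed
    then show ?thesis by (simp only: card.insert card.empty finite.emptyI empty_iff not_False_eq_True One_nat_def)
  qed
  show False
  proof (rule latin_False)
    fix x y assume x: "x \<in> Y" and y: "y \<in> Y"
    have "2 * real p = M x x + (\<Sum>y\<in>Y - {x}. M x y)"
    proof -
      have "2 * p = card {a\<in>Y. r a x = x} + (\<Sum>y\<in>Y - {x}. card {a\<in>Y. r a x = y})"
        unfolding counts_sum[OF x, symmetric] by (rule sum.remove[OF finY x])
      then have "real (2 * p) = real (card {a\<in>Y. r a x = x} + (\<Sum>y\<in>Y - {x}. card {a\<in>Y. r a x = y}))" by (rule arg_cong)
      then show ?thesis by (simp add: M_def)
    qed
    also have "(\<Sum>y\<in>Y - {x}. M x y) = (\<Sum>y\<in>Y - {x}. d)"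
    proof (rule sum.cong[OF refl])
      fix v assume "v \<in> Y - {x}"
      then have v: "v \<in> Y" "x \<noteq> v" by auto
      show "M x v = d" by (rule d[rule_format, OF x v])
    qed
    also have "\<dots> = (2 * real p - 1) * d" using x finY card_Y p3 by simp
    also have "M x x = 1" using Mx[OF x] by (simp add: M_def)
    finally have "(2 * real p - 1) * (d - 1) = 0" by (simp add: algebra_simps)
    then have "d = 1" using p3 by simp
    show "card {a\<in>Y. r a x = y} = 1"
    proof (cases "x = y")
      case True then show ?thesis using Mx[OF x] by simp
    next
      case False
      then have "M x y = 1" using d[rule_format, OF x y False] \<open>d = 1\<close> by (simp only:)
      then show ?thesis by (simp add: M_def)
    qed
  qed
qed

text \<open>The aim is a \<open>star_rack\<close>, whose order would be 2. Two of its conditions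
  need an argument, namely that \<open>T a\<close> acts as the inverse of \<open>a\<close> and that
  translations have a common odd period; both come from the triviality of inner automorphisms that
  preserve every pair \<open>{y, T y}\<close>.\<close>

lemma no_matching:
  assumes M: "matching_case Y I p z bp T" shows False
proof -
  interpret M: matching_case Y I p z bp T by fact
  note cnt = matching_count_R[OF M]
  have TY: "T x \<in> Y" and TT: "T (T x) = x" and Tne: "T x \<noteq> x" if "x \<in> Y" for x
    using M.T_in M.T_T M.T_ne that by auto
  have Tg: "T (g x) = g (T x)" if "g \<in> I" "x \<in> Y" for g x by (rule M.T_commute[OF that])
  have rT: "r a (T x) = T (r a x)" if "a \<in> Y" "x \<in> Y" for a x
    using Tg[OF R_in[OF that(1)] that(2)] TY that by simp
  have Tx: "r (T x) x = x" if x: "x \<in> Y" for x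
    using rT[OF TY[OF x] TY[OF x]] TT[OF x] r_idem[OF TY[OF x]] by simp
  have xT: "r x (T x) = T x" if x: "x \<in> Y" for x using rT[OF x x] r_idem[OF x] by simp
  have fixed: "a \<in> {x, T x}" if "a \<in> Y" "x \<in> Y" "r a x = x" for a x
  proof -
    have "card {x, T x} = 2" using Tne[OF that(2)] by simp
    moreover have "card {a\<in>Y. r a x = x} = 2" using cnt[OF that(2,2)] by simp
    moreover have "{x, T x} \<subseteq> {a\<in>Y. r a x = x}" using that(2) Tx xT TY r_idem by auto
    ultimately have "{x, T x} = {a\<in>Y. r a x = x}" using finY by (intro card_subset_eq) auto
    then show ?thesis using that by blast
  qed
  have never: "r a x \<noteq> T x" if "a \<in> Y" "x \<in> Y" for a x
  proof
    assume "r a x = T x"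
    then have "a \<in> {a\<in>Y. r a x = T x}" using that by simp
    moreover have "{a\<in>Y. r a x = T x} = {}"
    proof -
      have c: "card {a\<in>Y. r a x = T x} = 0" using cnt[OF that(2) TY[OF that(2)]] Tne[OF that(2)] by simp
      have "finite {a\<in>Y. r a x = T x}" using finY by simp
      then show ?thesis using c by (rule card_0_eq[THEN iffD1])
    qed
    ultimately show False by blast
  qed
  have one: "card {a\<in>Y. r a x = y} = 1" if "x \<in> Y" "y \<in> Y" "y \<noteq> x" "y \<noteq> T x" for x y
    using cnt[OF that(1,2)] that(3,4) by simp
  have uniq: "a = b" if h: "a \<in> Y" "b \<in> Y" "x \<in> Y" "r a x \<notin> {x, T x}" "r b x = r a x" for a b x
  proof -
    have "card {c\<in>Y. r c x = r a x} = 1" by (rule one[OF h(3) r_closed[OF h(1,3)]]) (use h(4) in blast)+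
    then obtain u where u: "{c\<in>Y. r c x = r a x} = {u}" by (rule card_1_singletonE)
    have "a \<in> {u}" "b \<in> {u}" unfolding u[symmetric] using h by simp_all
    then show ?thesis by simp
  qed
  have Y0: "\<exists>x. x \<in> Y" using ex_point by blast
  \<comment> \<open>If \<open>\<kappa>\<close> swaps a pair, then the translations by
    \<open>a\<close> and \<open>T a\<close> differ by swaps, and \<open>\<delta> a\<close> swaps
    exactly the pairs other than \<open>{a, T a}\<close>. A product of two such maps moves only four
    points, which is too few among at least 10.\<close>
  have kernel: "\<kappa> x = x" if k: "\<kappa> \<in> I" and bl: "\<And>y. y \<in> Y \<Longrightarrow> \<kappa> y \<in> {y, T y}" and x: "x \<in> Y" for \<kappa> x
  proof (rule ccontr)
    assume "\<kappa> x \<noteq> x"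
    then have kx: "\<kappa> x = T x" using bl[OF x] by blast
    have P0: "r (T x) y \<in> {r x y, T (r x y)}" if y: "y \<in> Y" for y
    proof -
      have e: "r (T x) (\<kappa> y) = \<kappa> (r x y)" using aut[OF k x y] kx by simp
      have b: "\<kappa> (r x y) \<in> {r x y, T (r x y)}" by (rule bl[OF r_closed[OF x y]])
      show ?thesis
      proof (cases "\<kappa> y = y")
        case True then show ?thesis using e b by simp
      next
        case False
        then have "\<kappa> y = T y" using bl[OF y] by blast
        then have "T (r (T x) y) = \<kappa> (r x y)" using e rT[OF TY[OF x] y] by simp
        then have "r (T x) y = T (\<kappa> (r x y))" using TT[OF r_closed[OF TY[OF x] y]] by simp
        then show ?thesis using b TT[OF r_closed[OF x y]] by auto
      qed
    qed
    have P: "r (T a) y \<in> {r a y, T (r a y)}" if a: "a \<in> Y" and y: "y \<in> Y" for a y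
    proof -
      obtain g where g: "g \<in> I" "g x = a" using conn x a by blast
      obtain u where u: "u \<in> Y" "y = g u" using permutes_image[OF perm[OF g(1)]] y by blast
      have "r (T a) y = g (r (T x) u)" using aut[OF g(1) TY[OF x] u(1)] Tg[OF g(1) x] g(2) u(2) by simp
      moreover have "g (r x u) = r a y" using aut[OF g(1) x u(1)] g(2) u(2) by simp
      moreover have "g (T (r x u)) = T (g (r x u))" using Tg[OF g(1) r_closed[OF x u(1)]] by simp
      ultimately show ?thesis using P0[OF u(1)] by auto
    qed
    have Q: "r (T a) y = T (r a y)" if a: "a \<in> Y" and y: "y \<in> Y" and na: "y \<notin> {a, T a}" for a y
    proof (rule ccontr)
      assume "r (T a) y \<noteq> T (r a y)"
      then have e: "r (T a) y = r a y" using P[OF a y] by blast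
      have "r a y \<noteq> y" using fixed[OF a y] na TT[OF y] by auto
      then have "a = T a" using uniq[OF a TY[OF a] y _ e] never[OF a y] by blast
      then show False using Tne[OF a] by (rule notE[OF _ sym, rotated])
    qed
    define \<delta> where "\<delta> a = R (T a) \<circ> inv_into UNIV (R a)" for a
    have dI: "\<delta> a \<in> I" if a: "a \<in> Y" for a
      unfolding \<delta>_def by (rule comp_in[OF R_in[OF TY[OF a]] inv_in[OF R_in[OF a]]])
    have d0: "\<delta> a y = y" if a: "a \<in> Y" and y: "y \<in> {a, T a}" for a y
    proof -
      have yY: "y \<in> Y" using a y TY by auto
      have "R a y = y" using y a xT r_idem TY by auto
      then have "inv_into UNIV (R a) y = y" using inv_left[OF R_in[OF a], of y] by simp
      moreover have "r (T a) y = y" using y a Tx r_idem TY by auto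
      ultimately show ?thesis using yY by (simp add: \<delta>_def)
    qed
    have d1: "\<delta> a y = T y" if a: "a \<in> Y" and y: "y \<in> Y" "y \<notin> {a, T a}" for a y
    proof -
      define u where "u = inv_into UNIV (R a) y"
      have u: "u \<in> Y" "R a u = y" using mem[OF inv_in[OF R_in[OF a]] y(1)] inv_right[OF R_in[OF a]] by (simp_all add: u_def)
      have "u \<notin> {a, T a}"
      proof
        assume "u \<in> {a, T a}"
        then have "r a u = u" using xT r_idem a by auto
        then show False using u y \<open>u \<in> {a, T a}\<close> by simp
      qed
      then have "r (T a) u = T (r a u)" by (rule Q[OF a u(1)])
      then show ?thesis using u by (simp add: \<delta>_def flip: u_def)
    qed
    obtain a where a: "a \<in> Y" using Y0 by blast
    obtain c where c: "c \<in> Y" "c \<notin> {a, T a, a, T a, a, T a}" by (rule two_others[OF a a a])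
    \<comment> \<open>The automorphism \<open>l\<close> moves only the pairs of \<open>a\<close> and
      \<open>b\<close>. It fixes \<open>c\<close> and sends \<open>a\<close> to \<open>T a\<close>,
      hence it swaps the pair of \<open>r c a\<close>, which must be one of these two pairs.\<close>
    have main: "r c a \<in> {a, T a, b, T b}" if b: "b \<in> Y" "b \<notin> {a, T a}" "c \<notin> {b, T b}" for b
    proof (rule ccontr)
      assume v: "r c a \<notin> {a, T a, b, T b}"
      define l where "l = \<delta> a \<circ> \<delta> b"
      have l: "l \<in> I" unfolding l_def by (rule comp_in[OF dI[OF a] dI[OF b(1)]])
      have l0: "l y = y" if y: "y \<in> Y" "y \<notin> {a, T a, b, T b}" for y
      proof -
        have "T y \<notin> {a, T a}" using y TT[OF y(1)] TT[OF a] by auto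
        then show ?thesis using d1[OF b(1) y(1)] d1[OF a TY[OF y(1)]] y TT[OF y(1)] by (simp add: l_def)
      qed
      have "a \<notin> {b, T b}" using b TT[OF b(1)] by auto
      then have la: "l a = T a" using d1[OF b(1) a] d0[OF a, of "T a"] by (simp add: l_def)
      have "l (r c a) = r (l c) (l a)" by (rule aut[OF l c(1) a])
      then have "l (r c a) = T (r c a)" using l0[OF c(1)] la rT[OF c(1) a] c(2) b(3) by simp
      moreover have "l (r c a) = r c a" by (rule l0[OF r_closed[OF c(1) a] v])
      ultimately show False using Tne[OF r_closed[OF c(1) a]] by simp
    qed
    obtain b where b: "b \<in> Y" "b \<notin> {a, T a, c, T c, c, T c}" by (rule two_others[OF a c(1) c(1)])
    obtain b' where b': "b' \<in> Y" "b' \<notin> {a, T a, c, T c, b, T b}" by (rule two_others[OF a c(1) b(1)])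
    have cT: "c \<notin> {u, T u}" if "u \<in> Y" "u \<notin> {c, T c}" for u using that TT[OF that(1)] by auto
    have 1: "r c a \<in> {a, T a, b, T b}" by (rule main[OF b(1)]) (use b cT[OF b(1)] in auto)
    have 2: "r c a \<in> {a, T a, b', T b'}" by (rule main[OF b'(1)]) (use b' cT[OF b'(1)] in auto)
    have "{b, T b} \<inter> {b', T b'} = {}" using b' TT[OF b'(1)] TT[OF b(1)] by auto
    then have "r c a \<in> {a, T a}" using 1 2 by blast
    then have "r c a = a" using never[OF c(1) a] by blast
    then show False using fixed[OF c(1) a] c(2) by blast
  qed
  \<comment> \<open>By \<open>matching_blocks\<close> such a family preserves all pairs, and
    \<open>kernel\<close> then makes it trivial.\<close>
  have sym_trivial: "\<gamma> a x = x"
    if \<gamma>: "M.equivariant \<gamma>" "\<And>a. a \<in> Y \<Longrightarrow> \<gamma> a a = a"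
      "\<And>a x. a \<in> Y \<Longrightarrow> x \<in> Y \<Longrightarrow> \<gamma> (T a) x = \<gamma> a x" and a: "a \<in> Y" and x: "x \<in> Y" for \<gamma> a x
  proof (rule kernel[OF _ _ x])
    show "\<gamma> a \<in> I" using \<gamma>(1) a by (simp add: M.equivariant_def)
    show "\<gamma> a y \<in> {y, T y}" if "y \<in> Y" for y by (rule matching_blocks[OF M \<gamma> a that])
  qed
  have Rg: "R (g a) (g x) = g (R a x)" if "g \<in> I" "a \<in> Y" for g a x using R_conj[OF that] by (metis comp_apply)
  have inverse: "r a (r (T a) x) = x" if a: "a \<in> Y" and x: "x \<in> Y" for a x
  proof -
    have comm: "r a (r (T a) x) = r (T a) (r a x)" if "a \<in> Y" "x \<in> Y" for a x
      using r_distr[OF that(1) TY[OF that(1)] that(2)] xT[OF that(1)] by simp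
    have "(\<lambda>a. R a \<circ> R (T a)) a x = x"
    proof (rule sym_trivial[OF _ _ _ a x])
      show "M.equivariant (\<lambda>a. R a \<circ> R (T a))"
        unfolding M.equivariant_def
      proof (intro conjI ballI)
        show "R a \<circ> R (T a) \<in> I" if "a \<in> Y" for a using comp_in[OF R_in R_in] that TY by blast
        show "(R (g a) \<circ> R (T (g a))) (g x) = g ((R a \<circ> R (T a)) x)" if "g \<in> I" "a \<in> Y" "x \<in> Y" for g a x
          using Rg[OF that(1) TY[OF that(2)]] Rg[OF that(1,2)] Tg[OF that(1,2)] by simp
      qed
      show "(R a \<circ> R (T a)) a = a" if "a \<in> Y" for a using Tx[OF that] r_idem[OF that] that by simp
      show "(R (T a) \<circ> R (T (T a))) x = (R a \<circ> R (T a)) x" if "a \<in> Y" "x \<in> Y" for a x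
        using comm[OF that] that TT[OF that(1)] r_closed TY by simp
    qed
    then show ?thesis using x r_closed[OF TY[OF a] x] by simp
  qed
  have inverse': "r (T a) (r a x) = x" if "a \<in> Y" "x \<in> Y" for a x
    using inverse[OF TY[OF that(1)] that(2)] TT[OF that(1)] by simp
  have pow_in_Y: "(R a ^^ m) x \<in> Y" if "a \<in> Y" "x \<in> Y" for a x m
    using mem[OF power_in[OF R_in[OF that(1)]] that(2)] .
  have pow_inverse: "(R (T a) ^^ m) ((R a ^^ m) x) = x" if a: "a \<in> Y" and x: "x \<in> Y" for a x m
  proof (induction m)
    case (Suc m)
    have "(R (T a) ^^ Suc m) ((R a ^^ Suc m) x) = (R (T a) ^^ m) (R (T a) (R a ((R a ^^ m) x)))"
      by (simp add: funpow_swap1)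
    then show ?case using inverse'[OF a pow_in_Y[OF a x, of m]] Suc pow_in_Y[OF a x, of m] r_closed[OF a pow_in_Y[OF a x]] by simp
  qed simp
  \<comment> \<open>If \<open>2 * m\<close> is a period, the \<open>m\<close>-th power of the
    translation by \<open>a\<close> is its own inverse and so agrees with the \<open>m\<close>-th
    power for \<open>T a\<close>. The family of \<open>m\<close>-th powers is therefore trivial, and
    repeated halving ends in an odd period.\<close>
  have halve: "\<forall>a\<in>Y. \<forall>x\<in>Y. (R a ^^ m) x = x" if dbl: "\<forall>a\<in>Y. \<forall>x\<in>Y. (R a ^^ (2 * m)) x = x" for m
  proof (intro ballI)
    fix a x assume a: "a \<in> Y" and x: "x \<in> Y"
    show "(R a ^^ m) x = x"
    proof (rule sym_trivial[of "\<lambda>a. R a ^^ m", OF _ _ _ a x])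
      show "M.equivariant (\<lambda>a. R a ^^ m)"
        unfolding M.equivariant_def using power_in[OF R_in] R_conj_pow by blast
      show "(R a ^^ m) a = a" if "a \<in> Y" for a by (induction m) (use that r_idem in simp_all)
      show "(R (T a) ^^ m) x = (R a ^^ m) x" if a: "a \<in> Y" and x: "x \<in> Y" for a x
      proof -
        have "(R (T a) ^^ m) ((R a ^^ m) ((R a ^^ m) x)) = (R a ^^ m) x"
          by (rule pow_inverse[OF a pow_in_Y[OF a x]])
        moreover have "(R a ^^ m) ((R a ^^ m) x) = x"
          using dbl a x by (simp add: mult_2 funpow_add)
        ultimately show ?thesis by simp
      qed
    qed
  qed
  obtain b where b: "b \<in> Y" using Y0 by blast
  obtain n where n: "n > 0" "R b ^^ n = id" using finite_order[OF R_in[OF b]] by blast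
  have per: "\<forall>a\<in>Y. \<forall>x\<in>Y. (R a ^^ n) x = x"
  proof (intro ballI)
    fix a x assume a: "a \<in> Y" and x: "x \<in> Y"
    obtain g where g: "g \<in> I" "g b = a" using conn b a by blast
    obtain u where "x = g u" using permutes_image[OF perm[OF g(1)]] x by blast
    then show "(R a ^^ n) x = x" using R_conj_pow[OF g(1) b, of n u] n(2) g(2) by simp
  qed
  have "\<exists>m. odd m \<and> (\<forall>a\<in>Y. \<forall>x\<in>Y. (R a ^^ m) x = x)"
    using n(1) per
  proof (induction n rule: less_induct)
    case (less n)
    show ?case
    proof (cases "odd n")
      case False
      then obtain m where m: "n = 2 * m" by blast
      then show ?thesis using less.IH[of m] less.prems halve[of m] by simp
    qed (use less.prems in blast)
  qed
  then obtain m where m: "odd m" "\<forall>a\<in>Y. \<forall>x\<in>Y. (R a ^^ m) x = x" by blast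
  have Rr: "(R a ^^ k) x = (r a ^^ k) x \<and> (r a ^^ k) x \<in> Y" if "a \<in> Y" "x \<in> Y" for a x k
    by (induction k) (use that r_closed in simp_all)
  have "star_rack Y r T m"
  proof unfold_locales
    show "\<exists>!u. u \<in> Y \<and> r u x = y" if xy: "x \<in> Y" "y \<in> Y" "y \<noteq> x" "y \<noteq> T x" for x y
    proof -
      obtain u where "{c\<in>Y. r c x = y} = {u}" using one[OF xy] card_1_singletonE by metis
      then have "v \<in> Y \<and> r v x = y \<longleftrightarrow> v = u" for v by (simp add: set_eq_iff)
      then show ?thesis by (intro ex1I[of _ u]) simp_all
    qed
    show "(r a ^^ m) x = x" if "a \<in> Y" "x \<in> Y" for a x using Rr[OF that, of m] m(2) that by simp
  qed (use TY TT Tne rT inverse' m(1) in auto)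
  then have "card Y = 2"
  proof (rule star_rack_card)
    have "2 * p mod 4 = 2" using odd_p by presburger
    then show "card Y mod 4 = 2" using card_Y by simp
  qed
  then show False using card_Y p3 by simp
qed

lemma ex_srg: obtains z bp s where "srg_case Y I p z bp s"
  using ex_free trichotomy no_scalar no_matching by metis

end

section \<open>Strongly regular commutation\<close>

text \<open>What survives of the matrix analysis: commutation is a strongly regular graph, with one
  common neighbour fewer for adjacent than for non-adjacent points, and no translation moves a point
  along an edge. The condition \<open>lam\<close> adds 1 on the left in order to avoid subtraction
  of natural numbers.\<close>

locale strong_rack = finite_rack +
  fixes s :: nat
  assumes s_pos: "s \<ge> 1"
    and com_sym: "a \<in> Y \<Longrightarrow> b \<in> Y \<Longrightarrow> r a b = b \<Longrightarrow> r b a = a"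
    and card_Y: "card Y = 4 * s\<^sup>2 + 4 * s + 2"
    and card_C: "x \<in> Y \<Longrightarrow> card {u\<in>Y. u \<noteq> x \<and> r x u = u} = s * (2 * s + 1)"
    and lam: "x \<in> Y \<Longrightarrow> y \<in> Y \<Longrightarrow> x \<noteq> y \<Longrightarrow> r x y = y \<Longrightarrow>
      card {u\<in>Y. u \<noteq> x \<and> r x u = u \<and> u \<noteq> y \<and> r y u = u} + 1 = s\<^sup>2"
    and mu: "x \<in> Y \<Longrightarrow> y \<in> Y \<Longrightarrow> x \<noteq> y \<Longrightarrow> r x y \<noteq> y \<Longrightarrow>
      card {u\<in>Y. u \<noteq> x \<and> r x u = u \<and> u \<noteq> y \<and> r y u = u} = s\<^sup>2"
    and move: "a \<in> Y \<Longrightarrow> x \<in> Y \<Longrightarrow> r a x \<noteq> x \<Longrightarrow> r x (r a x) \<noteq> r a x"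

text \<open>The equation is the row sum of the counts. \<open>P\<close> and \<open>M\<close> are the
  counts on \<open>Np\<close> and \<open>Nm\<close>, \<open>ep\<close> and \<open>em\<close> tell
  whether these graphs consist of commuting pairs, \<open>S2\<close> is the valency of
  \<open>N0\<close>, and \<open>e\<close> is its commuting part. As \<open>km > kp >= 3\<close>, all
  counts are small, and the parity conditions remove the intermediate values.\<close>

lemma arith_cases:
  fixes kp km S2 P M e t :: nat and ep em :: bool
  assumes E: "2 * (1 + (if ep then kp else 0) + (if em then km else 0) + e) + 2 * P * kp + 2 * M * km + (P + M) * S2
      = 2 * (1 + kp + km + S2)"
    and k: "kp = t * (2 * t + 1)" "km = (t + 1) * (2 * t + 1)" "t \<ge> 1"
    and e: "even e" "e \<le> S2" and par: "S2 > 0 \<Longrightarrow> even (P + M)"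
    and na: "\<not> (ep \<and> em \<and> e = S2)"
  shows "P = 1 \<and> M = 1 \<and> \<not> ep \<and> \<not> em \<and> e = 0
    \<or> S2 = 0 \<and> P = 0 \<and> M = 1 \<and> ep \<and> \<not> em \<or> S2 = 0 \<and> P = 1 \<and> M = 0 \<and> \<not> ep \<and> em
    \<or> t = 1 \<and> M = 0 \<and> \<not> em"
proof -
  define a where "a = (if ep then 1 else 0 :: nat)"
  define b where "b = (if em then 1 else 0 :: nat)"
  have a01: "a = 0 \<and> \<not> ep \<or> a = 1 \<and> ep" and b01: "b = 0 \<and> \<not> em \<or> b = 1 \<and> em"
    by (simp_all add: a_def b_def)
  have ab: "(if ep then kp else 0) = a * kp" "(if em then km else 0) = b * km" by (simp_all add: a_def b_def)
  define U where "U = (a + P) * kp"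
  define V where "V = (b + M) * km"
  define W where "W = (P + M) * S2"
  have E2: "2 * U + 2 * V + 2 * e + W = 2 * kp + 2 * km + 2 * S2"
    using E unfolding ab U_def V_def W_def by (simp add: algebra_simps)
  have km: "km = kp + 2 * t + 1" unfolding k(1,2) by (simp add: algebra_simps)
  have "1 * 3 \<le> t * (2 * t + 1)" using k(3) by (intro mult_le_mono) simp_all
  then have kp3: "kp \<ge> 3" unfolding k(1) by simp
  have Uge: "n * kp \<le> U" if "n \<le> a + P" for n unfolding U_def using that by (rule mult_le_mono1)
  have Vge: "n * km \<le> V" if "n \<le> b + M" for n unfolding V_def using that by (rule mult_le_mono1)
  have Wge: "n * S2 \<le> W" if "n \<le> P + M" for n unfolding W_def using that by (rule mult_le_mono1)
  have W2: "2 * S2 \<le> W" if h: "P + M \<ge> 1"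
  proof (cases "S2 = 0")
    case False
    then have "even (P + M)" using par by simp
    then have "P + M \<noteq> 1" by (metis odd_one)
    then show ?thesis using h by (intro Wge) linarith
  qed simp
  have V1: "b + M \<le> 1"
  proof (rule ccontr)
    assume "\<not> ?thesis"
    then have h: "2 \<le> b + M" by linarith
    then have "P + M \<ge> 1" using b01 by linarith
    then show False using E2 W2 Vge[OF h] km by linarith
  qed
  have U1: "a + P \<le> 1" if h: "U \<le> kp"
  proof (rule ccontr)
    assume "\<not> ?thesis"
    then have "2 \<le> a + P" by linarith
    then show False using Uge[of 2] h kp3 by linarith
  qed
  consider "b = 0" "M = 1" | "b = 1" "M = 0" | "b = 0" "M = 0" using V1 by linarith
  then show ?thesis
  proof cases
    case 1
    have "V = km" unfolding V_def 1 by simp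
    then have "U \<le> kp" using E2 W2 1(2) by linarith
    then have aP: "a + P \<le> 1" by (rule U1)
    show ?thesis
    proof (cases "S2 = 0")
      case True
      have W0: "W = 0" unfolding W_def True by simp
      have e0: "e = 0" using True e(2) by linarith
      have "U = kp" using E2 \<open>V = km\<close> W0 e0 True by linarith
      then have "a + P \<noteq> 0" using kp3 by (cases "a + P = 0") (simp_all add: U_def)
      then have "a = 0 \<and> P = 1 \<or> a = 1 \<and> P = 0" using aP by linarith
      then show ?thesis
      proof
        assume h: "a = 0 \<and> P = 1"
        then have "\<not> ep" "\<not> em" using a01 b01 1(1) by linarith+
        then show ?thesis using h 1(2) e0 by blast
      next
        assume h: "a = 1 \<and> P = 0"
        then have "ep" "\<not> em" using a01 b01 1(1) by linarith+
        then show ?thesis using h 1(2) True by blast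
      qed
    next
      case False
      then have "even (P + 1)" using par 1(2) by simp
      then have "P \<noteq> 0" by (metis add_0 odd_one)
      then have P1: "P = 1" and a0: "a = 0" using aP by linarith+
      have "U = kp" unfolding U_def P1 a0 by simp
      moreover have "W = 2 * S2" unfolding W_def P1 1(2) by simp
      ultimately have e0: "e = 0" using E2 \<open>V = km\<close> by linarith
      have "\<not> ep" "\<not> em" using a01 b01 1(1) a0 by linarith+
      then show ?thesis using P1 1(2) e0 by blast
    qed
  next
    case 2
    have Vk: "V = km" unfolding V_def 2 by simp
    have em using b01 2(1) by linarith
    show ?thesis
    proof (cases "P = 0")
      case True
      have W0: "W = 0" unfolding W_def True 2(2) by simp
      from a01 show ?thesis
      proof
        assume h: "a = 0 \<and> \<not> ep"
        then have "U = 0" unfolding U_def True by simp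
        then show ?thesis using E2 Vk W0 e(2) kp3 by linarith
      next
        assume h: "a = 1 \<and> ep"
        then have "U = kp" unfolding U_def True by simp
        then have "e = S2" using E2 Vk W0 by linarith
        then show ?thesis using na h \<open>em\<close> by blast
      qed
    next
      case False
      then have "U \<le> kp" using E2 W2 Vk 2(2) by linarith
      then have aP: "a + P \<le> 1" by (rule U1)
      then have P1: "P = 1" and a0: "a = 0" using False by linarith+
      have "S2 = 0"
      proof (rule ccontr)
        assume "S2 \<noteq> 0"
        then have "even (P + M)" using par by simp
        then show False unfolding P1 2(2) by simp
      qed
      moreover have "\<not> ep" using a01 a0 by linarith
      ultimately show ?thesis using P1 2(2) \<open>em\<close> by blast
    qed
  next
    case 3
    have V0: "V = 0" unfolding V_def 3 by simp
    have "\<not> em" using b01 3(1) by linarith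
    have "t = 1"
    proof (rule ccontr)
      assume "t \<noteq> 1"
      then have t2: "2 \<le> t" using k(3) by linarith
      then have "2 * (2 * t + 1) \<le> kp" unfolding k(1) by (rule mult_le_mono1)
      then have kk: "km < 2 * kp" unfolding km by simp
      consider "P = 0" | "P = 1" | "P = 2" | "3 \<le> P" by linarith
      then show False
      proof cases
        case p0: 1
        have "a * kp \<le> 1 * kp" using a01 by (intro mult_le_mono1) linarith
        then have "U \<le> kp" unfolding U_def p0 by simp
        moreover have "W = 0" unfolding W_def p0 3(2) by simp
        ultimately show ?thesis using E2 V0 e(2) km by linarith
      next
        case p1: 2
        have "S2 = 0"
        proof (rule ccontr)
          assume "S2 \<noteq> 0"
          then have "even (P + M)" using par by simp
          then show False unfolding p1 3(2) by simp
        qed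
        moreover have "W = 0" unfolding W_def \<open>S2 = 0\<close> by simp
        moreover have "(a + P) * kp \<le> 2 * kp" using a01 p1 by (intro mult_le_mono1) linarith
        ultimately show ?thesis using E2 V0 e(2) km unfolding U_def[symmetric] by linarith
      next
        case p2: 3
        have W2: "W = 2 * S2" unfolding W_def p2 3(2) by simp
        from a01 show ?thesis
        proof
          assume "a = 0 \<and> \<not> ep"
          then have "U = 2 * kp" unfolding U_def p2 by simp
          then have "e = 2 * t + 1" using E2 V0 W2 km by linarith
          then show ?thesis using e(1) by simp
        next
          assume "a = 1 \<and> ep"
          then have "U = 3 * kp" unfolding U_def p2 by simp
          then show ?thesis using E2 V0 W2 kk by linarith
        qed
      next
        case p3: 4
        have "3 * kp \<le> U" "2 * S2 \<le> W" using p3 by (auto intro!: Uge Wge)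
        then show ?thesis using E2 V0 kk by linarith
      qed
    qed
    then show ?thesis using 3(2) \<open>\<not> em\<close> by blast
  qed
qed

section \<open>From the counts to strongly regular commutation\<close>

locale srg_rack = conn_rack +
  fixes z :: "'a \<Rightarrow> 'a" and bp :: "bool \<Rightarrow> 'a" and s :: nat
  assumes srg: "srg_case Y I p z bp s"
begin

sublocale S: srg_case Y I p z bp s by (rule srg)

lemma com_sym: "a \<in> Y \<Longrightarrow> b \<in> Y \<Longrightarrow> r a b = b \<Longrightarrow> r b a = a"
  by (rule commute_sym[OF is_faithful])

lemma com_ginv: "ginv I Y (\<lambda>x y. if r x y = y then 1 else 0 :: real)"
  unfolding ginv_def
proof (intro ballI)
  fix g x y assume "g \<in> I" "x \<in> Y" "y \<in> Y"
  then show "(if r (g x) (g y) = g y then 1 else 0) = (if r x y = y then 1 else 0 :: real)"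
    by (simp only: commute_invariant[of g x y])
qed

lemma com_Np: assumes "x \<in> Y" "y \<in> Y" "S.Np x y" "x' \<in> Y" "y' \<in> Y" "S.Np x' y'"
  shows "r x y = y \<longleftrightarrow> r x' y' = y'"
  using S.Np_const[OF com_ginv assms] by (simp split: if_splits)

lemma com_Nm: assumes "x \<in> Y" "y \<in> Y" "S.Nm x y" "x' \<in> Y" "y' \<in> Y" "S.Nm x' y'"
  shows "r x y = y \<longleftrightarrow> r x' y' = y'"
  using S.Nm_const[OF com_ginv assms] by (simp split: if_splits)

text \<open>The eigenvalue of this graph is 0, so its valency is the sum of its weights, that is,
  the number of base points with a shift leading to a neighbour. The graph is symmetric, so
  replacing the shift \<open>k\<close> by \<open>p - k\<close> pairs these off, without fixed points
  because \<open>p\<close> is odd.\<close>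

lemma even_com_N0: assumes x: "x \<in> Y" shows "even (card {y\<in>Y. S.N0 x y \<and> r x y = y})"
proof -
  define E where "E = (\<lambda>x y. S.N0 x y \<and> r x y = y)"
  have E: "S.graph E"
    unfolding S.graph_def E_def
  proof (intro conjI ballI)
    fix g x y assume g: "g \<in> I" "x \<in> Y" "y \<in> Y"
    have "S.N0 (g x) (g y) = S.N0 x y" using S.graph_N0 g unfolding S.graph_def by blast
    then show "(S.N0 (g x) (g y) \<and> r (g x) (g y) = g y) = (S.N0 x y \<and> r x y = y)"
      unfolding commute_invariant[OF g] by blast
  qed simp
  have Esym: "E y x" if "x \<in> Y" "y \<in> Y" "E x y" for x y
  proof -
    have e: "x \<noteq> y" "S.Rm x y = 0" "r x y = y" using that(3) by (simp_all add: E_def)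
    have "S.Rm y x = 0" using e(2) S.Rm_sym[of x y] by (rule HOL.trans[OF sym, rotated])
    then show ?thesis using e(1) com_sym[OF that(1,2) e(3)] by (simp add: E_def)
  qed
  have e0: "S.ev (S.ind E) = 0" using S.ev_ind_level[OF E, of 0] by (simp add: E_def)
  define D where "D = {(b, k). k < p \<and> E (bp b) (S.pt b k)}"
  have finD: "finite D"
    by (rule finite_subset[of _ "UNIV \<times> {..<p}"]) (auto simp: D_def)
  have "real (card D) = (\<Sum>(b, k)\<in>UNIV \<times> {..<p}. S.ind E (bp b) (S.pt b k))"
  proof -
    have "D = {bk \<in> UNIV \<times> {..<p}. case bk of (b, k) \<Rightarrow> E (bp b) (S.pt b k)}" by (auto simp: D_def)
    then have "real (card D) = (\<Sum>bk\<in>{bk \<in> UNIV \<times> {..<p}. case bk of (b, k) \<Rightarrow> E (bp b) (S.pt b k)}. 1)" by simp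
    also have "\<dots> = (\<Sum>bk\<in>UNIV \<times> {..<p}. if (case bk of (b, k) \<Rightarrow> E (bp b) (S.pt b k)) then 1 else 0)"
      by (rule sum.inter_filter) simp
    finally show ?thesis by (simp add: case_prod_beta)
  qed
  also have "\<dots> = (\<Sum>k<p. S.w (S.ind E) k)"
    unfolding sum.cartesian_product[symmetric] S.w_def UNIV_bool by (simp add: sum.distrib)
  also have "\<dots> = S.valency E" using S.w_sum[OF S.ginv_ind[OF E]] S.rowsum_ind[OF E S.bp_in] e0 by simp
  finally have "card D = S.valency E" by (simp only: of_nat_eq_iff)
  moreover have "even (card D)"
  proof (rule even_card_fixpoint_free[of _ "\<lambda>(b, k). (b, p - k)", OF finD])
    fix bk assume "bk \<in> D"
    then obtain b k where bk: "bk = (b, k)" "k < p" "E (bp b) (S.pt b k)" by (auto simp: D_def)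
    have k0: "k \<noteq> 0"
    proof
      assume "k = 0"
      then show False using bk(3) by (simp add: E_def S.pt_0)
    qed
    have "S.pt b (p - k + k) = bp b" using bk(2) S.pt_add_p[of b 0] by (simp add: S.pt_0)
    moreover have zE: "S.zinv (S.ind E)" by (rule S.ginv_zinv[OF S.ginv_ind[OF E]])
    ultimately have "S.ind E (S.pt b k) (bp b) = S.ind E (bp b) (S.pt b (p - k))"
      using S.zinv_pt[OF zE, of b k b "p - k"] by (simp add: add.commute)
    moreover have "E (S.pt b k) (bp b)" by (rule Esym[OF S.bp_in S.pt_in bk(3)])
    ultimately have "E (bp b) (S.pt b (p - k))" by (simp split: if_splits)
    then show "(\<lambda>(b, k). (b, p - k)) bk \<in> D" using bk k0 by (simp add: D_def)
    show "(\<lambda>(b, k). (b, p - k)) ((\<lambda>(b, k). (b, p - k)) bk) = bk" using bk by simp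
    have "p - k \<noteq> k" using odd_p bk(2) by presburger
    then show "(\<lambda>(b, k). (b, p - k)) bk \<noteq> bk" using bk by simp
  qed
  ultimately have "even (S.valency E)" by simp
  then show ?thesis using S.card_valency[OF E x] by (simp add: E_def)
qed

lemma card_ind: "card {y\<in>Y. P y} = (\<Sum>y\<in>Y. if P y then 1 else 0)"
proof -
  have "(\<Sum>y\<in>{y\<in>Y. P y}. 1) = (\<Sum>y\<in>Y. if P y then 1 else 0 :: nat)" by (rule sum.inter_filter[OF finY])
  then show ?thesis by simp
qed

lemma card_split: assumes x: "x \<in> Y" shows
  "card {y\<in>Y. P y} = (if P x then 1 else 0) + card {y\<in>Y. S.Np x y \<and> P y} + card {y\<in>Y. S.Nm x y \<and> P y}
    + card {y\<in>Y. S.N0 x y \<and> P y}"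
proof -
  have "card {y\<in>Y. P y} = (\<Sum>y\<in>Y. (if y = x then (if P x then 1 else 0) else 0) + (if S.Np x y \<and> P y then 1 else 0)
      + (if S.Nm x y \<and> P y then 1 else 0) + (if S.N0 x y \<and> P y then 1 else 0))"
    unfolding card_ind
  proof (rule sum.cong[OF refl])
    fix y assume "y \<in> Y"
    show "(if P y then 1 else 0 :: nat) = (if y = x then (if P x then 1 else 0) else 0) + (if S.Np x y \<and> P y then 1 else 0)
      + (if S.Nm x y \<and> P y then 1 else 0) + (if S.N0 x y \<and> P y then 1 else 0)"
    proof (cases "y = x")
      case True
      then show ?thesis by (simp add: S.Rm_diag)
    next
      case False
      then show ?thesis by (cases "S.Rm x y" "0 :: real" rule: linorder_cases) simp_all
    qed
  qed
  also have "\<dots> = (if P x then 1 else 0) + card {y\<in>Y. S.Np x y \<and> P y} + card {y\<in>Y. S.Nm x y \<and> P y}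
    + card {y\<in>Y. S.N0 x y \<and> P y}"
    unfolding sum.distrib card_ind using x finY by (simp only: sum.delta if_True)
  finally show ?thesis .
qed

end

lemma cancel_frac: "c \<noteq> 0 \<Longrightarrow> 1 / c * (a * c) = a" "c \<noteq> 0 \<Longrightarrow> - 1 / c * (a * c) = - (a :: real)"
  by simp_all

lemma odd_nz: "2 * real s + 1 \<noteq> 0"
  by linarith

context srg_rack
begin

lemma Np_sym: "S.Np x y \<longleftrightarrow> S.Np y x" and Nm_sym: "S.Nm x y \<longleftrightarrow> S.Nm y x"
  using S.Rm_sym[of x y] by simp_all

lemma ne_Np: "S.Np x y \<Longrightarrow> x \<noteq> y" and ne_Nm: "S.Nm x y \<Longrightarrow> x \<noteq> y"
  using S.Rm_diag[of x] by auto

lemma ev_Np: "S.ev (S.ind S.Np) = s"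
proof -
  have "S.ev (S.ind S.Np) = 1 / (2 * real s + 1) * S.valency S.Np"
    by (rule S.ev_ind_level[OF S.graph_Np]) (use S.Np_iff in simp)
  also have "real (S.valency S.Np) = real s * (2 * real s + 1)" unfolding S.deg_Np by (simp add: algebra_simps)
  finally show ?thesis by (simp only: cancel_frac[OF odd_nz])
qed

text \<open>By \<open>Rm_right\<close> the values \<open>Rm v y + 1 / 3\<close>, summed over the
  three \<open>Np\<close>-neighbours \<open>v\<close> of \<open>x\<close>, give
  \<open>1 / 3\<close>. The term of \<open>v = y\<close> already accounts for this, and the others
  are nonnegative, so they vanish.\<close>

lemma Np_Np_Nm:
  assumes s1: "s = 1" and xy: "x \<in> Y" "y \<in> Y" "u \<in> Y" "S.Np x y" "S.Np x u" "u \<noteq> y"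
  shows "S.Nm u y"
proof -
  define t where "t v = S.ind S.Np x v * (S.Rm v y + 1 / 3)" for v
  have vals: "S.Rm v y \<in> {0, 1 / 3, - (1 / 3)}" if "v \<in> Y" for v using S.Rm_values[OF that xy(2)] s1 by simp
  have Rxy: "S.Rm x y = 1 / 3" using S.Np_iff[OF xy(1,2)] xy(4) s1 by simp
  have "(\<Sum>v\<in>Y. t v) = (\<Sum>v\<in>Y. S.ind S.Np x v * S.Rm v y) + (\<Sum>v\<in>Y. S.ind S.Np x v) * (1 / 3)"
    unfolding t_def sum_distrib_right sum.distrib[symmetric] by (simp only: distrib_left)
  also have "(\<Sum>v\<in>Y. S.ind S.Np x v * S.Rm v y) = - 2 / 3"
    unfolding S.Rm_right[OF S.ginv_ind[OF S.graph_Np] xy(1,2)] ev_Np Rxy using ne_Np[OF xy(4)] s1 by simp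
  also have "(\<Sum>v\<in>Y. S.ind S.Np x v) = 3"
    unfolding S.rowsum_ind[OF S.graph_Np xy(1)] S.deg_Np s1 by simp
  finally have "(\<Sum>v\<in>Y. t v) = 1 / 3" by simp
  moreover have "t y = 1 / 3" using xy(4) by (simp add: t_def S.Rm_diag)
  moreover have "(\<Sum>v\<in>Y. t v) = t y + (\<Sum>v\<in>Y - {y}. t v)" by (rule sum.remove[OF finY xy(2)])
  ultimately have "(\<Sum>v\<in>Y - {y}. t v) = 0" by simp
  moreover have "t v \<ge> 0" if "v \<in> Y - {y}" for v using vals[of v] that by (auto simp: t_def)
  ultimately have "\<forall>v\<in>Y - {y}. t v = 0" using finY by (subst (asm) sum_nonneg_eq_0_iff) auto
  then have "t u = 0" using xy by blast
  then have "S.Rm u y + 1 / 3 = 0" using xy(5) by (simp add: t_def)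
  then show ?thesis by simp
qed

lemma no_N0: assumes "S.valency S.N0 = 0" "u \<in> Y" "v \<in> Y" "u \<noteq> v" shows "S.Np u v \<or> S.Nm u v"
  using S.valency_0[OF S.graph_N0 assms(1-3)] assms(4) by linarith

text \<open>Without zeros off the diagonal, \<open>(2 * s + 1) * Rm\<close> is a matrix of signs
  there, so that \<open>Rm_right\<close> for the indicator of \<open>Np\<close> is a count of common
  neighbours.\<close>

lemma Np_Np_count:
  assumes z: "S.valency S.N0 = 0" and xy: "x \<in> Y" "y \<in> Y" "x \<noteq> y"
  shows "card {u\<in>Y. S.Np x u \<and> S.Np y u} + (if S.Np x y then 1 else 0) = s\<^sup>2"
proof -
  let ?c = "card {u\<in>Y. S.Np x u \<and> S.Np y u}"
  have R: "(2 * real s + 1) * S.Rm u y = 2 * S.ind S.Np y u - 1 + (if u = y then 1 else 0)" if u: "u \<in> Y" for u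
  proof (cases "u = y")
    case True then show ?thesis by (simp add: S.Rm_diag)
  next
    case False
    show ?thesis
    proof (cases "S.Np u y")
      case True
      then have "S.Rm u y = 1 / (2 * s + 1)" "S.Np y u" using S.Np_iff[OF u xy(2)] Np_sym[of u y] by simp_all
      then show ?thesis using False by simp
    next
      case f: False
      then have "S.Nm u y" using no_N0[OF z u xy(2) False] by simp
      then have "S.Rm u y = - 1 / (2 * s + 1)" "\<not> S.Np y u" using S.Nm_iff[OF u xy(2)] Np_sym[of u y] f by simp_all
      then show ?thesis using False by simp
    qed
  qed
  have "(2 * real s + 1) * (\<Sum>u\<in>Y. S.ind S.Np x u * S.Rm u y)
      = (\<Sum>u\<in>Y. S.ind S.Np x u * ((2 * real s + 1) * S.Rm u y))"
    unfolding sum_distrib_left by (simp only: mult.left_commute)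
  also have "\<dots> = (\<Sum>u\<in>Y. 2 * S.ind (\<lambda>x u. S.Np x u \<and> S.Np y u) x u - S.ind S.Np x u
      + (if u = y then S.ind S.Np x u else 0))"
    using R by (intro sum.cong refl) simp
  also have "\<dots> = 2 * real ?c - (\<Sum>u\<in>Y. S.ind S.Np x u) + S.ind S.Np x y"
    unfolding sum.distrib sum_subtractf sum_distrib_left[symmetric] S.sum_ind[of "\<lambda>x u. S.Np x u \<and> S.Np y u" x]
    using finY xy(2) by (simp only: sum.delta if_True)
  also have "(\<Sum>u\<in>Y. S.ind S.Np x u) = s * (2 * s + 1)"
    unfolding S.rowsum_ind[OF S.graph_Np xy(1)] S.deg_Np ..
  also have "(\<Sum>u\<in>Y. S.ind S.Np x u * S.Rm u y) = s * S.Rm x y - S.ind S.Np x y"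
    unfolding S.Rm_right[OF S.ginv_ind[OF S.graph_Np] xy(1,2)] ev_Np using xy(3) by simp
  finally have eq: "(2 * real s + 1) * (s * S.Rm x y - S.ind S.Np x y) = 2 * real ?c - real (s * (2 * s + 1)) + S.ind S.Np x y" .
  have "real (2 * (?c + (if S.Np x y then 1 else 0))) = real (2 * s\<^sup>2)"
  proof (cases "S.Np x y")
    case True
    then have c: "(2 * real s + 1) * S.Rm x y = 1" using S.Np_iff[OF xy(1,2)] by simp
    have "(2 * real s + 1) * (s * S.Rm x y - 1) = s * ((2 * real s + 1) * S.Rm x y) - (2 * real s + 1)"
      by (simp add: algebra_simps)
    then have "(2 * real s + 1) * (s * S.Rm x y - 1) = s - (2 * real s + 1)" unfolding c by simp
    then show ?thesis using eq True by (simp add: power2_eq_square algebra_simps)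
  next
    case False
    then have "S.Nm x y" using no_N0[OF z xy] by simp
    then have c: "(2 * real s + 1) * S.Rm x y = - 1" using S.Nm_iff[OF xy(1,2)] by simp
    have "(2 * real s + 1) * (s * S.Rm x y - 0) = s * ((2 * real s + 1) * S.Rm x y)"
      by (simp add: algebra_simps)
    then have "(2 * real s + 1) * (s * S.Rm x y - 0) = - real s" unfolding c by simp
    then show ?thesis using eq False by (simp add: power2_eq_square algebra_simps)
  qed
  then have "2 * (?c + (if S.Np x y then 1 else 0)) = 2 * s\<^sup>2" by (simp only: of_nat_eq_iff)
  then show ?thesis by simp
qed

lemma Nm_Nm_count:
  assumes z: "S.valency S.N0 = 0" and xy: "x \<in> Y" "y \<in> Y" "S.Np x y"
  shows "card {u\<in>Y. S.Nm x u \<and> S.Nm y u} = (s + 1)\<^sup>2"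
proof -
  have e: "card {u\<in>Y. S.N0 x u \<and> S.Np y u} = 0" "card {u\<in>Y. S.N0 y u \<and> S.Nm x u} = 0"
  proof -
    have "{u\<in>Y. S.N0 x u \<and> S.Np y u} = {}" "{u\<in>Y. S.N0 y u \<and> S.Nm x u} = {}"
      using S.valency_0[OF S.graph_N0 z xy(1)] S.valency_0[OF S.graph_N0 z xy(2)] by blast+
    then show "card {u\<in>Y. S.N0 x u \<and> S.Np y u} = 0" "card {u\<in>Y. S.N0 y u \<and> S.Nm x u} = 0"
      by (simp_all only: card.empty)
  qed
  have c: "{u\<in>Y. S.Np y u \<and> S.Nm x u} = {u\<in>Y. S.Nm x u \<and> S.Np y u}"
    "{u\<in>Y. S.Nm y u \<and> S.Nm x u} = {u\<in>Y. S.Nm x u \<and> S.Nm y u}" by blast+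
  have "card {u\<in>Y. S.Np x u \<and> S.Np y u} + 1 = s\<^sup>2" using Np_Np_count[OF z xy(1,2) ne_Np[OF xy(3)]] xy(3) by simp
  moreover have "card {u\<in>Y. S.Np y u} = s * (2 * s + 1)" unfolding S.card_valency[OF S.graph_Np xy(2)] by (rule S.deg_Np)
  moreover have "card {u\<in>Y. S.Nm x u} = (s + 1) * (2 * s + 1)" unfolding S.card_valency[OF S.graph_Nm xy(1)] by (rule S.deg_Nm)
  moreover have "card {u\<in>Y. S.Np y u} = 1 + card {u\<in>Y. S.Np x u \<and> S.Np y u} + card {u\<in>Y. S.Nm x u \<and> S.Np y u}"
    unfolding card_split[OF xy(1), of "S.Np y"] e using xy(3) Np_sym[of x y] by simp
  moreover have "card {u\<in>Y. S.Nm x u} = card {u\<in>Y. S.Nm x u \<and> S.Np y u} + card {u\<in>Y. S.Nm x u \<and> S.Nm y u}"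
    unfolding card_split[OF xy(2), of "S.Nm x"] e c using xy(3) by simp
  moreover have "(s + 1)\<^sup>2 = s * s + 2 * s + 1" "s\<^sup>2 = s * s" "s * (2 * s + 1) = 2 * (s * s) + s"
    "(s + 1) * (2 * s + 1) = 2 * (s * s) + 3 * s + 1"
    by (simp_all add: power2_eq_square algebra_simps)
  ultimately show ?thesis by linarith
qed

lemma card_0_D: assumes "card {b\<in>Y. P b} = 0" "a \<in> Y" shows "\<not> P a"
proof
  assume "P a"
  then have "card {b\<in>Y. P b} > 0" using finY assms(2) by (subst card_gt_0_iff) auto
  then show False using assms(1) by simp
qed

lemma trichotomy_Rm: obtains "y = x" | "S.Np x y" | "S.Nm x y" | "S.N0 x y"
  using linorder_less_linear[of "S.Rm x y" 0] by blast

lemma R_self: "a \<in> Y \<Longrightarrow> R a a = a"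
  by (simp add: r_idem)

lemma Rm_r: assumes "a \<in> Y" "x \<in> Y" "y \<in> Y" shows "S.Rm (r a x) (r a y) = S.Rm x y"
  using S.Rm_ginv[unfolded ginv_def, rule_format, OF R_in[OF assms(1)] assms(2,3)] assms by simp

text \<open>By \<open>arith_cases\<close> four cases remain. The Latin one is excluded already,
  commutation along \<open>Nm\<close> fails by counting, and the case \<open>s = 1\<close> without
  commutation along \<open>Nm\<close> fails because fixed points propagate. In the remaining case
  commutation is \<open>Np\<close>, and the counts on \<open>Np\<close> are 0.\<close>

lemma ex_strong: "strong_rack Y r s"
proof (rule S.srg_counts[OF equivariant_R[OF S.split_orbits_axioms] R_self])
  fix f mp mm
  assume f: "\<And>x. x \<in> Y \<Longrightarrow> card {a\<in>Y. R a x = x} = f" and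
    mp: "\<And>x y. x \<in> Y \<Longrightarrow> y \<in> Y \<Longrightarrow> S.Np x y \<Longrightarrow> card {a\<in>Y. R a x = y} = mp" and
    mm: "\<And>x y. x \<in> Y \<Longrightarrow> y \<in> Y \<Longrightarrow> S.Nm x y \<Longrightarrow> card {a\<in>Y. R a x = y} = mm" and
    m0: "\<And>x y. x \<in> Y \<Longrightarrow> y \<in> Y \<Longrightarrow> S.N0 x y \<Longrightarrow> 2 * card {a\<in>Y. R a x = y} = mp + mm" and
    tot: "2 * f + 2 * mp * (s * (2 * s + 1)) + 2 * mm * ((s + 1) * (2 * s + 1)) + (mp + mm) * S.valency S.N0 = 4 * p"
  define kp where "kp = s * (2 * s + 1)"
  define km where "km = (s + 1) * (2 * s + 1)"
  define S2 where "S2 = S.valency S.N0"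
  have RY: "{a\<in>Y. R a x = y} = {a\<in>Y. r a x = y}" if "x \<in> Y" for x y using that by simp
  note [simp] = RY
  obtain x0 where x0: "x0 \<in> Y" by (rule ex_point)
  obtain yp ym where yp: "yp \<in> Y" "S.Np x0 yp" and ym: "ym \<in> Y" "S.Nm x0 ym" using S.ex_neighbours[OF x0] by blast
  define ep where "ep \<longleftrightarrow> r x0 yp = yp"
  define em where "em \<longleftrightarrow> r x0 ym = ym"
  have ep: "r x y = y \<longleftrightarrow> ep" if "x \<in> Y" "y \<in> Y" "S.Np x y" for x y unfolding ep_def by (rule com_Np[OF that x0 yp])
  have em: "r x y = y \<longleftrightarrow> em" if "x \<in> Y" "y \<in> Y" "S.Nm x y" for x y unfolding em_def by (rule com_Nm[OF that x0 ym])
  define e where "e = card {y\<in>Y. S.N0 x0 y \<and> r x0 y = y}"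
  have e_even: "even e" unfolding e_def by (rule even_com_N0[OF x0])
  have e_le: "e \<le> S2"
    unfolding e_def S2_def S.card_valency[OF S.graph_N0 x0, symmetric] using finY by (intro card_mono) auto
  have f_eq: "f = 1 + (if ep then kp else 0) + (if em then km else 0) + e"
  proof -
    have "{a\<in>Y. r a x0 = x0} = {a\<in>Y. r x0 a = a}" using com_sym[OF x0] com_sym[OF _ x0] by blast
    then have "f = card {a\<in>Y. r x0 a = a}" using f[OF x0] x0 by simp
    also have "\<dots> = 1 + card {y\<in>Y. S.Np x0 y \<and> r x0 y = y} + card {y\<in>Y. S.Nm x0 y \<and> r x0 y = y} + e"
      using card_split[OF x0, of "\<lambda>y. r x0 y = y"] r_idem[OF x0] by (simp add: e_def)
    also have "{y\<in>Y. S.Np x0 y \<and> r x0 y = y} = (if ep then {y\<in>Y. S.Np x0 y} else {})"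
      using ep[OF x0] by auto
    also have "{y\<in>Y. S.Nm x0 y \<and> r x0 y = y} = (if em then {y\<in>Y. S.Nm x0 y} else {})"
      using em[OF x0] by auto
    finally show ?thesis
      using S.card_valency[OF S.graph_Np x0] S.card_valency[OF S.graph_Nm x0]
      by (simp add: S.deg_Np S.deg_Nm kp_def km_def)
  qed
  have p2: "2 * p = 1 + kp + km + S2"
    using S.card_square by (simp add: kp_def km_def S2_def power2_eq_square algebra_simps)
  have E: "2 * (1 + (if ep then kp else 0) + (if em then km else 0) + e) + 2 * mp * kp + 2 * mm * km + (mp + mm) * S2
      = 2 * (1 + kp + km + S2)"
    unfolding f_eq[symmetric] p2[symmetric] using tot by (simp add: kp_def km_def S2_def)
  have par: "even (mp + mm)" if "S2 > 0"
  proof -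
    have "card {y\<in>Y. S.N0 x0 y} > 0" using that S.card_valency[OF S.graph_N0 x0] by (simp add: S2_def)
    then obtain y where "y \<in> Y" "S.N0 x0 y" using finY by (auto simp: card_gt_0_iff)
    then have "mp + mm = 2 * card {a\<in>Y. R a x0 = y}" using m0[OF x0, of y] by simp
    then show ?thesis by (rule dvdI)
  qed
  have na: "\<not> (ep \<and> em \<and> e = S2)"
  proof
    assume h: "ep \<and> em \<and> e = S2"
    have "{y\<in>Y. S.N0 x0 y \<and> r x0 y = y} = {y\<in>Y. S.N0 x0 y}"
    proof (rule card_subset_eq)
      show "card {y\<in>Y. S.N0 x0 y \<and> r x0 y = y} = card {y\<in>Y. S.N0 x0 y}"
        using h S.card_valency[OF S.graph_N0 x0] by (simp add: e_def S2_def)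
    qed (use finY in auto)
    then have N0: "r x0 y = y" if "y \<in> Y" "S.N0 x0 y" for y using that by blast
    have "r x0 y = y" if y: "y \<in> Y" for y
    proof -
      show ?thesis
        by (rule trichotomy_Rm[of y x0]) (use r_idem[OF x0] ep[OF x0 y] em[OF x0 y] N0[OF y] h in blast)+
    qed
    then show False using not_all_commute[OF x0] by blast
  qed
  from arith_cases[OF E kp_def km_def S.s_pos e_even e_le par na]
  consider (L) "mp = 1" "mm = 1" "\<not> ep" "\<not> em" "e = 0" | (a) "S2 = 0" "mp = 0" "mm = 1" "ep" "\<not> em"
    | (b) "S2 = 0" "mp = 1" "mm = 0" "\<not> ep" "em" | (c) "s = 1" "mm = 0" "\<not> em" by blast
  then show ?thesis
  proof cases
    case L
    have "card {a\<in>Y. r a x = y} = 1" if x: "x \<in> Y" and y: "y \<in> Y" for x y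
    proof -
      show ?thesis
      proof (cases rule: trichotomy_Rm[of y x])
        case 1 then show ?thesis using f[OF x] f_eq L x by simp
      next
        case 2 then show ?thesis using mp[OF x y] L x by simp
      next
        case 3 then show ?thesis using mm[OF x y] L x by simp
      next
        case 4 then show ?thesis using m0[OF x y] L x by simp
      qed
    qed
    then show ?thesis using latin_False by blast
  next
    \<comment> \<open>The common \<open>Nm\<close>-neighbours of \<open>yp\<close> and
      \<open>x0\<close> commute with \<open>x' = r x0 yp\<close> too. Since the cardinalities agree,
      the \<open>Nm\<close>-neighbours of \<open>yp\<close> and those of \<open>x'\<close> are
      disjoint outside the ones of \<open>x0\<close>, and together they do not fit into the
      \<open>Np\<close>-neighbours of \<open>x0\<close>.\<close>
    case b
    have z: "S.valency S.N0 = 0" using b(1) by (simp add: S2_def)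
    have x: "yp \<in> Y" "S.Np yp x0" using yp Np_sym by blast+
    define x' where "x' = r x0 yp"
    have x': "x' \<in> Y" using r_closed[OF x0 x(1)] by (simp add: x'_def)
    have ne: "x' \<noteq> yp" using ep[OF x0 yp] b(4) by (simp add: x'_def)
    have move: "\<not> S.Nm yp x'"
    proof
      assume "S.Nm yp x'"
      then have "card {a\<in>Y. r a yp = x'} = 0" using mm[OF x(1) x'] b(3) x(1) by simp
      then have "r x0 yp \<noteq> x'" using x0 by (rule card_0_D)
      then show False by (simp add: x'_def)
    qed
    then have pxx: "S.Np yp x'" using no_N0[OF z x(1) x'] ne by blast
    have px0: "S.Np x0 x'"
      using Rm_r[OF x0 x0 yp(1)] yp(2) r_idem[OF x0] by (simp add: x'_def)
    let ?A = "\<lambda>x. {u\<in>Y. S.Nm x u}"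
    have com: "S.Nm x u \<longleftrightarrow> r x u = u" if "x \<in> Y" "u \<in> Y" "x \<noteq> u" for x u
      using no_N0[OF z that] ep[OF that(1,2)] em[OF that(1,2)] b(4,5) by blast
    have sub: "?A yp \<inter> ?A x0 \<subseteq> ?A yp \<inter> ?A x'"
    proof
      fix u assume u: "u \<in> ?A yp \<inter> ?A x0"
      then have uY: "u \<in> Y" and n: "yp \<noteq> u" "x0 \<noteq> u" using ne_Nm by auto
      have "r yp u = u" "r x0 u = u" using u com[OF x(1) uY n(1)] com[OF x0 uY n(2)] by simp_all
      then have "r u yp = yp" "r u x0 = x0" using com_sym x x0 uY by blast+
      then have "r u x' = x'" using r_distr[OF uY x0 x(1)] by (simp add: x'_def)
      then have ux: "r x' u = u" by (rule com_sym[OF uY x'])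
      have "u \<noteq> x'" using pxx u by auto
      then have "S.Nm x' u" using com[OF x' uY] ux by simp
      then show "u \<in> ?A yp \<inter> ?A x'" using u by simp
    qed
    have cap: "card (?A yp \<inter> ?A x0) = (s + 1)\<^sup>2" "card (?A yp \<inter> ?A x') = (s + 1)\<^sup>2" "card (?A x' \<inter> ?A x0) = (s + 1)\<^sup>2"
    proof -
      have i: "?A v \<inter> ?A w = {u\<in>Y. S.Nm v u \<and> S.Nm w u}" for v w by blast
      show "card (?A yp \<inter> ?A x0) = (s + 1)\<^sup>2" unfolding i by (rule Nm_Nm_count[OF z x(1) x0 x(2)])
      show "card (?A yp \<inter> ?A x') = (s + 1)\<^sup>2" unfolding i by (rule Nm_Nm_count[OF z x(1) x' pxx])
      have "S.Np x' x0" using px0 Np_sym by blast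
      then show "card (?A x' \<inter> ?A x0) = (s + 1)\<^sup>2" unfolding i by (rule Nm_Nm_count[OF z x' x0])
    qed
    have eq: "?A yp \<inter> ?A x0 = ?A yp \<inter> ?A x'" using finY sub cap by (intro card_subset_eq) auto
    have cA: "card (?A v) = (s + 1) * (2 * s + 1)" if "v \<in> Y" for v
      using S.card_valency[OF S.graph_Nm that] S.deg_Nm by simp
    have d: "card (?A v - ?A x0) = s * (s + 1)" if "v \<in> Y" "card (?A v \<inter> ?A x0) = (s + 1)\<^sup>2" for v
    proof -
      have "card (?A v) = card (?A v \<inter> ?A x0) + card (?A v - ?A x0)"
        using finY by (subst card_Un_disjoint[symmetric]) (auto intro!: arg_cong[of _ _ card])
      then show ?thesis using cA[OF that(1)] that(2) by (simp add: power2_eq_square algebra_simps)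
    qed
    have "card ((?A yp - ?A x0) \<union> (?A x' - ?A x0)) = 2 * (s * (s + 1))"
      using finY eq d[OF x(1) cap(1)] d[OF x' cap(3)] by (subst card_Un_disjoint) auto
    moreover have sub2: "(?A yp - ?A x0) \<union> (?A x' - ?A x0) \<subseteq> {u\<in>Y. S.Np x0 u}"
    proof
      fix u assume u: "u \<in> (?A yp - ?A x0) \<union> (?A x' - ?A x0)"
      then have "u \<in> Y" "\<not> S.Nm x0 u" "u \<noteq> x0" using x(2) px0 Np_sym[of x0 x'] by auto
      then show "u \<in> {u\<in>Y. S.Np x0 u}" using no_N0[OF z x0, of u] by blast
    qed
    moreover have "card {u\<in>Y. S.Np x0 u} = s * (2 * s + 1)" using S.card_valency[OF S.graph_Np x0] S.deg_Np by simp
    moreover have "card ((?A yp - ?A x0) \<union> (?A x' - ?A x0)) \<le> card {u\<in>Y. S.Np x0 u}"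
      by (rule card_mono[OF _ sub2]) (simp add: finY)
    ultimately have "2 * (s * (s + 1)) \<le> s * (2 * s + 1)" by (simp only:)
    then show ?thesis using S.s_pos by (simp add: algebra_simps)
  next
    \<comment> \<open>No point moves along \<open>Nm\<close>, but distinct
      \<open>Np\<close>-neighbours of a point are related by \<open>Nm\<close>. So a translation
      that fixes \<open>b\<close> fixes all \<open>Np\<close>-neighbours of \<open>b\<close>, and
      two steps along \<open>Np\<close> yield a commuting pair in \<open>Nm\<close>.\<close>
    case c
    have nomove: "\<not> S.Nm u (r a u)" if "a \<in> Y" "u \<in> Y" for a u
    proof
      assume "S.Nm u (r a u)"
      then have "card {b\<in>Y. r b u = r a u} = 0" using mm[OF that(2) r_closed[OF that]] c(2) that by simp
      then have "r a u \<noteq> r a u" using that(1) by (rule card_0_D)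
      then show False by simp
    qed
    have fixes_nbr: "r a u = u" if a: "a \<in> Y" and b: "b \<in> Y" "r a b = b" and u: "u \<in> Y" "S.Np b u" for a b u
    proof (rule ccontr)
      assume ne: "r a u \<noteq> u"
      have "S.Np b (r a u)" using Rm_r[OF a b(1) u(1)] b(2) u(2) by simp
      then have "S.Nm u (r a u)"
        using Np_Np_Nm[OF c(1) b(1) u(1) r_closed[OF a u(1)] u(2) _ ne] Nm_sym by blast
      then show False using nomove[OF a u(1)] by blast
    qed
    have 1: "r x0 yp = yp" by (rule fixes_nbr[OF x0 x0 r_idem[OF x0] yp])
    have "card {u\<in>Y. S.Np yp u} = 3" using S.card_valency[OF S.graph_Np yp(1)] S.deg_Np c(1) by simp
    then have "\<not> {u\<in>Y. S.Np yp u} \<subseteq> {x0}" using card_mono[of "{x0}" "{u\<in>Y. S.Np yp u}"] by auto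
    then obtain u where u: "u \<in> Y" "S.Np yp u" "u \<noteq> x0" by blast
    have "S.Np yp x0" using yp(2) Np_sym by blast
    then have "S.Nm x0 u" using Np_Np_Nm[OF c(1) yp(1) u(1) x0 u(2)] u(3) by blast
    moreover have "r x0 u = u" by (rule fixes_nbr[OF x0 yp(1) 1 u(1,2)])
    ultimately show ?thesis using em[OF x0 u(1)] c(3) by blast
  next
    case a
    have z: "S.valency S.N0 = 0" using a(1) by (simp add: S2_def)
    have com: "S.Np x u \<longleftrightarrow> r x u = u" if "x \<in> Y" "u \<in> Y" "x \<noteq> u" for x u
      using no_N0[OF z that] ep[OF that(1,2)] em[OF that(1,2)] a(4,5) by blast
    have C: "u \<noteq> x \<and> r x u = u \<longleftrightarrow> S.Np x u" if "x \<in> Y" "u \<in> Y" for x u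
      using com[OF that] ne_Np[of x u] by blast
    have CC: "{u\<in>Y. u \<noteq> x \<and> r x u = u \<and> u \<noteq> y \<and> r y u = u} = {u\<in>Y. S.Np x u \<and> S.Np y u}" if "x \<in> Y" "y \<in> Y" for x y
      using C[OF that(1)] C[OF that(2)] by blast
    show ?thesis
    proof unfold_locales
      show "1 \<le> s" by (rule S.s_pos)
      show "r b a = a" if "a \<in> Y" "b \<in> Y" "r a b = b" for a b using com_sym that by blast
      show "card Y = 4 * s\<^sup>2 + 4 * s + 2"
        using p2 a(1) card_Y by (simp add: kp_def km_def power2_eq_square algebra_simps)
      show "card {u\<in>Y. u \<noteq> x \<and> r x u = u} = s * (2 * s + 1)" if "x \<in> Y" for x
      proof -
        have "{u\<in>Y. u \<noteq> x \<and> r x u = u} = {u\<in>Y. S.Np x u}" using C[OF that] by blast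
        then show ?thesis using S.card_valency[OF S.graph_Np that] S.deg_Np by simp
      qed
      show "card {u\<in>Y. u \<noteq> x \<and> r x u = u \<and> u \<noteq> y \<and> r y u = u} + 1 = s\<^sup>2"
        if "x \<in> Y" "y \<in> Y" "x \<noteq> y" "r x y = y" for x y
      proof -
        have "S.Np x y" using com[OF that(1-3)] that(4) by blast
        then show ?thesis unfolding CC[OF that(1,2)] using Np_Np_count[OF z that(1-3)] by simp
      qed
      show "card {u\<in>Y. u \<noteq> x \<and> r x u = u \<and> u \<noteq> y \<and> r y u = u} = s\<^sup>2"
        if "x \<in> Y" "y \<in> Y" "x \<noteq> y" "r x y \<noteq> y" for x y
      proof -
        have "\<not> S.Np x y" using com[OF that(1-3)] that(4) by blast
        then show ?thesis unfolding CC[OF that(1,2)] using Np_Np_count[OF z that(1-3)] by simp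
      qed
      show "r x (r a x) \<noteq> r a x" if h: "a \<in> Y" "x \<in> Y" "r a x \<noteq> x" for a x
      proof
        assume "r x (r a x) = r a x"
        then have "S.Np x (r a x)" using com[OF h(2) r_closed[OF h(1,2)] h(3)[symmetric]] by blast
        then have "card {b\<in>Y. r b x = r a x} = 0" using mp[OF h(2) r_closed[OF h(1,2)]] a(2) h(2) by simp
        then have "r a x \<noteq> r a x" using h(1) by (rule card_0_D)
        then show False by simp
      qed
    qed
  qed
qed

end

theorem conn_rack_strong:
  assumes "conn_rack Y r p" shows "\<exists>s. strong_rack Y r s"
proof -
  interpret conn_rack Y r p by fact
  obtain z bp s where srg: "srg_case Y I p z bp s" by (rule ex_srg)
  have "srg_rack Y r p z bp s" by (rule srg_rack.intro[OF conn_rack_axioms srg_rack_axioms.intro[OF srg]])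
  then show ?thesis using srg_rack.ex_strong by blast
qed

lemma sum_card_le:
  assumes "finite W" "sorted_wrt (\<lambda>A B. A \<inter> B = {}) L" "\<forall>A\<in>set L. A \<subseteq> W"
  shows "sum_list (map card L) \<le> card W"
  using assms
proof (induction L arbitrary: W)
  case (Cons A L)
  have A: "A \<subseteq> W" "finite A" using Cons.prems finite_subset[of A W] by auto
  have "sum_list (map card L) \<le> card (W - A)"
  proof (rule Cons.IH)
    show "finite (W - A)" using Cons.prems(1) by simp
    show "sorted_wrt (\<lambda>A B. A \<inter> B = {}) L" using Cons.prems(2) by simp
    show "\<forall>B\<in>set L. B \<subseteq> W - A"
    proof
      fix B assume B: "B \<in> set L"
      then have "A \<inter> B = {}" using Cons.prems(2) by simp
      moreover have "B \<subseteq> W" using Cons.prems(3) B by simp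
      ultimately show "B \<subseteq> W - A" by blast
    qed
  qed
  moreover have "card (W - A) = card W - card A" "card A \<le> card W"
    using A Cons.prems(1) by (simp_all add: card_Diff_subset card_mono)
  ultimately show ?case by simp
qed simp

lemma disjoint_diff: "A \<inter> B = D \<Longrightarrow> A \<inter> (B - D) = {}" "A \<inter> B = D \<Longrightarrow> (A - D) \<inter> (B - D) = {}"
  by blast+

lemma disjoint_outside: "(\<And>u. u \<in> A \<Longrightarrow> u \<in> B \<Longrightarrow> u \<in> Z) \<Longrightarrow> (A - Z) \<inter> (B - Z) = {}"
  by blast

section \<open>Lines of three points and the proof of \<open>s = 1\<close>\<close>

context strong_rack
begin

definition C :: "'a \<Rightarrow> 'a set" where "C x = {u\<in>Y. u \<noteq> x \<and> r x u = u}"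

lemma C_subset: "C x \<subseteq> Y" by (auto simp: C_def)

lemma finC: "finite (C x)" by (rule finite_subset[OF C_subset finY])

lemma CI: "u \<in> Y \<Longrightarrow> x \<in> Y \<Longrightarrow> u \<noteq> x \<Longrightarrow> r u x = x \<Longrightarrow> u \<in> C x"
  using com_sym[of u x] by (simp add: C_def)

lemma CD: assumes "u \<in> C x" "x \<in> Y" shows "u \<in> Y" "u \<noteq> x" "r u x = x" "r x u = u"
  using assms com_sym[of x u] by (simp_all add: C_def)

lemma notC: assumes "u \<in> Y" "v \<in> Y" "r u v \<noteq> v" shows "u \<notin> C v" "v \<notin> C u"
  using CD(3)[OF _ assms(2)] CD(4)[OF _ assms(1)] assms(3) by blast+

lemma CC: "C x \<inter> C y = {u\<in>Y. u \<noteq> x \<and> r x u = u \<and> u \<noteq> y \<and> r y u = u}"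
  by (auto simp: C_def)

lemma cardC: "x \<in> Y \<Longrightarrow> card (C x) = s * (2 * s + 1)"
  unfolding C_def by (rule card_C)

lemma card_CC: "x \<in> Y \<Longrightarrow> y \<in> Y \<Longrightarrow> x \<noteq> y \<Longrightarrow> r x y \<noteq> y \<Longrightarrow> card (C x \<inter> C y) = s\<^sup>2"
  unfolding CC by (rule mu)

lemma inj: assumes "a \<in> Y" "x \<in> Y" "y \<in> Y" "r a x = r a y" shows "x = y"
  using inj_onD[OF r_inj[OF assms(1)] assms(4)] assms by blast

text \<open>Adjacent points have fewer than \<open>s\<^sup>2\<close> common neighbours, so
  \<open>D\<close> forces non-adjacency and is then the whole intersection.\<close>

lemma common_eq:
  assumes x: "x \<in> Y" "y \<in> Y" "x \<noteq> y" and D: "D \<subseteq> C x" "D \<subseteq> C y" "card D = s\<^sup>2"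
  shows "r x y \<noteq> y" "C x \<inter> C y = D"
proof -
  have sub: "D \<subseteq> C x \<inter> C y" using D by blast
  then have le: "s\<^sup>2 \<le> card (C x \<inter> C y)" using card_mono[OF _ sub] finC D(3) by simp
  show nc: "r x y \<noteq> y"
  proof
    assume "r x y = y"
    then have "card (C x \<inter> C y) + 1 = s\<^sup>2" unfolding CC by (rule lam[OF x])
    then show False using le by linarith
  qed
  have "card D = card (C x \<inter> C y)" using card_CC[OF x nc] D(3) by simp
  then show "C x \<inter> C y = D" using card_subset_eq[OF _ sub] finC by simp
qed

text \<open>The neighbourhoods of the four points would pairwise meet in \<open>D\<close> only.
  Together with the points themselves they would have \<open>s\<^sup>2 + 2\<close> elements more
  than \<open>Y\<close>.\<close>

lemma line_card:
  assumes y: "y1 \<in> Y" "y2 \<in> Y" "y3 \<in> Y" "y4 \<in> Y" and dis: "distinct [y1, y2, y3, y4]"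
    and D: "D \<subseteq> C y1" "D \<subseteq> C y2" "D \<subseteq> C y3" "D \<subseteq> C y4" "card D = s\<^sup>2"
  shows False
proof -
  have ne: "y1 \<noteq> y2" "y1 \<noteq> y3" "y1 \<noteq> y4" "y2 \<noteq> y3" "y2 \<noteq> y4" "y3 \<noteq> y4" using dis by auto
  note p = common_eq[OF y(1,2) ne(1) D(1,2,5)] common_eq[OF y(1,3) ne(2) D(1,3,5)] common_eq[OF y(1,4) ne(3) D(1,4,5)]
    common_eq[OF y(2,3) ne(4) D(2,3,5)] common_eq[OF y(2,4) ne(5) D(2,4,5)] common_eq[OF y(3,4) ne(6) D(3,4,5)]
  have nin: "y1 \<notin> C y2" "y1 \<notin> C y3" "y1 \<notin> C y4" "y2 \<notin> C y1" "y2 \<notin> C y3" "y2 \<notin> C y4"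
    "y3 \<notin> C y1" "y3 \<notin> C y2" "y3 \<notin> C y4" "y4 \<notin> C y1" "y4 \<notin> C y2" "y4 \<notin> C y3"
    using notC[OF y(1,2) p(1)] notC[OF y(1,3) p(3)] notC[OF y(1,4) p(5)]
      notC[OF y(2,3) p(7)] notC[OF y(2,4) p(9)] notC[OF y(3,4) p(11)] by simp_all
  have self: "v \<notin> C v" for v by (simp add: C_def)
  have d: "card (C v - D) = s\<^sup>2 + s" if "v \<in> Y" "D \<subseteq> C v" for v
  proof -
    have "card (C v - D) = card (C v) - card D" using that(2) finite_subset[OF that(2) finC] by (rule card_Diff_subset[rotated])
    then show ?thesis using cardC[OF that(1)] D(5) by (simp add: power2_eq_square algebra_simps)
  qed
  have "sum_list (map card [C y1, C y2 - D, C y3 - D, C y4 - D, {y1, y2, y3, y4}]) \<le> card Y"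
  proof (rule sum_card_le[OF finY])
    have "C y1 \<inter> (C y2 - D) = {}" "C y1 \<inter> (C y3 - D) = {}" "C y1 \<inter> (C y4 - D) = {}"
      "(C y2 - D) \<inter> (C y3 - D) = {}" "(C y2 - D) \<inter> (C y4 - D) = {}" "(C y3 - D) \<inter> (C y4 - D) = {}"
      using disjoint_diff[OF p(2)] disjoint_diff[OF p(4)] disjoint_diff[OF p(6)]
        disjoint_diff[OF p(8)] disjoint_diff[OF p(10)] disjoint_diff[OF p(12)] by (simp_all only:)
    moreover have "C y1 \<inter> {y1, y2, y3, y4} = {}" "(C y2 - D) \<inter> {y1, y2, y3, y4} = {}"
      "(C y3 - D) \<inter> {y1, y2, y3, y4} = {}" "(C y4 - D) \<inter> {y1, y2, y3, y4} = {}"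
      using nin self by simp_all
    ultimately show "sorted_wrt (\<lambda>A B. A \<inter> B = {}) [C y1, C y2 - D, C y3 - D, C y4 - D, {y1, y2, y3, y4}]"
      by (simp only: sorted_wrt.simps list.set ball_simps)
    have "{y1, y2, y3, y4} \<subseteq> Y" using y by blast
    moreover have "C v \<subseteq> Y" "C v - D \<subseteq> Y" for v using C_subset[of v] by blast+
    ultimately show "\<forall>A\<in>set [C y1, C y2 - D, C y3 - D, C y4 - D, {y1, y2, y3, y4}]. A \<subseteq> Y"
      by (simp only: list.set ball_simps)
  qed
  moreover have "card {y1, y2, y3, y4} = 4" using ne by simp
  ultimately have "s * (2 * s + 1) + 3 * (s\<^sup>2 + s) + 4 \<le> 4 * s\<^sup>2 + 4 * s + 2"
    using d[OF y(2) D(2)] d[OF y(3) D(3)] d[OF y(4) D(4)] cardC[OF y(1)] card_Y by simp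
  moreover have "s * (2 * s + 1) + 3 * (s\<^sup>2 + s) + 4 = (4 * s\<^sup>2 + 4 * s + 2) + (s\<^sup>2 + 2)"
    by (simp add: power2_eq_square algebra_simps)
  ultimately show False by simp
qed

lemma C_closed:
  assumes a: "a \<in> Y" "x \<in> Y" "r a x \<noteq> x" and u: "u \<in> C a" "u \<in> C x" shows "u \<in> C (r a x)"
proof (rule CI)
  note ua = CD[OF u(1) a(1)] and ux = CD[OF u(2) a(2)]
  show "u \<in> Y" by (rule ua(1))
  show "r a x \<in> Y" by (rule r_closed[OF a(1,2)])
  show "r u (r a x) = r a x" using r_distr[OF ua(1) a(1,2)] ua(3) ux(3) by simp
  show "u \<noteq> r a x"
  proof
    assume "u = r a x"
    then have "r a (r a x) = r a x" using ua(4) by simp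
    then have "r a x = x" by (rule inj[OF a(1) r_closed[OF a(1,2)] a(2)])
    then show False using a(3) by simp
  qed
qed

text \<open>The common neighbours of \<open>a\<close> and \<open>x\<close> are neighbours of
  \<open>r a x\<close>, of \<open>r a (r a x)\<close> and of \<open>r x a\<close> as well. By
  \<open>line_card\<close> only \<open>a\<close>, \<open>x\<close> and \<open>r a x\<close> have
  this property, which determines the products.\<close>

lemma line:
  assumes a: "a \<in> Y" "x \<in> Y" "r a x \<noteq> x"
  shows "r a (r a x) = x" "r x a = r a x" "r a x \<noteq> a" "C a \<inter> C (r a x) = C a \<inter> C x" "C x \<inter> C (r a x) = C a \<inter> C x"
proof -
  define x' where "x' = r a x"
  define D where "D = C a \<inter> C x"
  have ax: "a \<noteq> x" using a r_idem[OF a(1)] by auto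
  have xa: "r x a \<noteq> a" using com_sym[OF a(2,1)] a(3) by blast
  have D: "D \<subseteq> C a" "D \<subseteq> C x" "card D = s\<^sup>2" using card_CC[OF a(1,2) ax a(3)] by (auto simp: D_def)
  have x'Y: "x' \<in> Y" using r_closed[OF a(1,2)] by (simp add: x'_def)
  have Dx': "D \<subseteq> C x'" unfolding D_def x'_def using C_closed[OF a] by blast
  have ne: "x' \<noteq> x" "x' \<noteq> a"
  proof -
    show "x' \<noteq> x" using a(3) by (simp add: x'_def)
    show "x' \<noteq> a"
    proof
      assume "x' = a"
      then have "r a x = r a a" using r_idem[OF a(1)] by (simp add: x'_def)
      then show False using inj[OF a(1,2,1)] ax by blast
    qed
  qed
  have ax': "r a x' \<noteq> x'"
  proof
    assume "r a x' = x'"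
    then have "x' = x" unfolding x'_def by (rule inj[OF a(1) r_closed[OF a(1,2)] a(2)])
    then show False using ne by blast
  qed
  have four: "y \<in> {a, x, x'}" if "y \<in> Y" "D \<subseteq> C y" for y
  proof (rule ccontr)
    assume "y \<notin> {a, x, x'}"
    then have "distinct [a, x, x', y]" using ax ne by auto
    then show False using line_card[OF a(1,2) x'Y that(1) _ D(1,2) Dx' that(2) D(3)] by blast
  qed
  have "D \<subseteq> C (r a x')" using C_closed[OF a(1) x'Y ax'] D(1) Dx' by blast
  then have 1: "r a x' \<in> {a, x, x'}" by (rule four[OF r_closed[OF a(1) x'Y]])
  have "r a x' \<noteq> a"
  proof
    assume "r a x' = a"
    then have "r a x' = r a a" using r_idem[OF a(1)] by simp
    then show False using inj[OF a(1) x'Y a(1)] ne by blast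
  qed
  then have 2: "r a x' = x" using 1 ax' by blast
  then show "r a (r a x) = x" by (simp add: x'_def)
  have "D \<subseteq> C (r x a)" using C_closed[OF a(2,1) xa] D(1,2) by blast
  then have 3: "r x a \<in> {a, x, x'}" by (rule four[OF r_closed[OF a(2,1)]])
  have "r x a \<noteq> x"
  proof
    assume "r x a = x"
    then have "r x a = r x x" using r_idem[OF a(2)] by simp
    then show False using inj[OF a(2,1,2)] ax by blast
  qed
  then show "r x a = r a x" using 3 xa by (simp add: x'_def)
  show "r a x \<noteq> a" using ne by (simp add: x'_def)
  show "C a \<inter> C (r a x) = C a \<inter> C x"
    using common_eq(2)[OF a(1) x'Y ne(2)[symmetric] D(1) Dx' D(3)] by (simp add: x'_def D_def)
  show "C x \<inter> C (r a x) = C a \<inter> C x"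
    using common_eq(2)[OF a(2) x'Y ne(1)[symmetric] D(2) Dx' D(3)] by (simp add: x'_def D_def)
qed

text \<open>A line \<open>{a, x, x'}\<close> and the neighbourhoods of its points leave out
  \<open>s - 1\<close> points. For such a point \<open>v\<close>, let \<open>q\<close> be the number
  of common neighbours of \<open>a\<close>, \<open>x\<close> and \<open>v\<close>. Counting the
  neighbours of \<open>v\<close> bounds \<open>q\<close> from above, and counting inside
  \<open>C a\<close> the points commuting with \<open>x\<close>, \<open>v\<close> or one of two
  further points bounds it from below; for \<open>s >= 2\<close> the bounds are
  incompatible.\<close>

lemma s_eq_1: "s = 1"
proof (rule ccontr)
  assume "s \<noteq> 1"
  then have s2: "s \<ge> 2" using s_pos by simp
  have "Y \<noteq> {}" using card_Y by auto
  then obtain a where a: "a \<in> Y" by blast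
  have "\<not> Y \<subseteq> insert a (C a)"
  proof
    assume "Y \<subseteq> insert a (C a)"
    then have "card Y \<le> card (insert a (C a))" using finC by (intro card_mono) auto
    also have "\<dots> \<le> Suc (card (C a))" using finC[of a] by (simp add: card_insert_if)
    finally have "4 * s\<^sup>2 + 4 * s + 2 \<le> Suc (s * (2 * s + 1))" unfolding card_Y cardC[OF a] .
    then show False by (simp add: power2_eq_square algebra_simps)
  qed
  then obtain x where x: "x \<in> Y" "x \<noteq> a" "x \<notin> C a" by blast
  then have nax: "r a x \<noteq> x" by (simp add: C_def)
  define x' where "x' = r a x"
  define D where "D = C a \<inter> C x"
  note L = line[OF a x(1) nax, folded x'_def D_def]
  have x'Y: "x' \<in> Y" using r_closed[OF a x(1)] by (simp add: x'_def)
  have x'x: "x' \<noteq> x" using nax by (simp add: x'_def)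
  have nax': "r a x' \<noteq> x'" using L(1) x'x by simp
  have cD: "card D = s\<^sup>2" unfolding D_def by (rule card_CC[OF a x(1) x(2)[symmetric] nax])
  have finD: "finite D" using finC by (simp add: D_def)
  have xx': "r x x' = a"
  proof -
    have "r x a \<noteq> a" using L(2,3) by simp
    from line(1)[OF x(1) a this] show ?thesis using L(2) by simp
  qed
  have x'a: "r x' a = x" using line(2)[OF a x'Y nax'] L(1) by simp
  have nxx': "r x x' \<noteq> x'" using xx' L(3) by simp
  have self: "v \<notin> C v" for v by (simp add: C_def)
  define U where "U = C a \<union> (C x - D) \<union> (C x' - D)"
  have d: "card (C v - D) = s\<^sup>2 + s" if "v \<in> Y" "D \<subseteq> C v" for v
  proof -
    have "card (C v - D) = card (C v) - card D" using that(2) finD by (intro card_Diff_subset)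
    then show ?thesis using cardC[OF that(1)] cD by (simp add: power2_eq_square algebra_simps)
  qed
  have Dsub: "D \<subseteq> C a" "D \<subseteq> C x" "D \<subseteq> C x'" using L(4) by (auto simp: D_def)
  have "card U = card (C a \<union> (C x - D)) + card (C x' - D)"
    unfolding U_def using L(4,5) finC by (intro card_Un_disjoint) (auto simp: D_def)
  also have "card (C a \<union> (C x - D)) = card (C a) + card (C x - D)"
    using finC by (intro card_Un_disjoint) (auto simp: D_def)
  finally have cU: "card U = s * (2 * s + 1) + 2 * (s\<^sup>2 + s)"
    using d[OF x(1) Dsub(2)] d[OF x'Y Dsub(3)] cardC[OF a] by simp
  define V where "V = Y - ({a, x, x'} \<union> U)"
  have UY: "U \<subseteq> Y" using C_subset by (auto simp: U_def)
  have finU: "finite U" by (rule finite_subset[OF UY finY])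
  have disU: "{a, x, x'} \<inter> U = {}"
  proof -
    have "a \<notin> C x" "a \<notin> C x'" "x \<notin> C a" "x \<notin> C x'" "x' \<notin> C a" "x' \<notin> C x"
      using notC[OF a x(1) nax] notC[OF a x'Y nax'] notC[OF x(1) x'Y nxx'] by simp_all
    then show ?thesis using self by (auto simp: U_def)
  qed
  have "card V = card Y - card ({a, x, x'} \<union> U)"
    unfolding V_def using finU UY a x x'Y by (intro card_Diff_subset) auto
  also have "card ({a, x, x'} \<union> U) = card {a, x, x'} + card U"
    using finU disU by (intro card_Un_disjoint) auto
  also have "card {a, x, x'} = 3" using x(2) x'x L(3) by simp
  finally have cV: "card V + 1 = s" using cU card_Y s2 by (simp add: power2_eq_square algebra_simps)
  then have "V \<noteq> {}" using s2 by auto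
  then obtain v where v: "v \<in> V" by blast
  have vY: "v \<in> Y" and vn: "v \<noteq> a" "v \<noteq> x" "v \<noteq> x'" and vU: "v \<notin> U"
    using v by (simp_all add: V_def)
  have vCa: "v \<notin> C a" using vU by (simp add: U_def)
  have vC: "v \<notin> C a" "v \<notin> C x" "v \<notin> C x'"
    using vU vCa Dsub(1) unfolding U_def by blast+
  have nv: "r a v \<noteq> v" "r x v \<noteq> v" "r x' v \<noteq> v" using vC vY vn by (auto simp: C_def)
  have nv': "r v a \<noteq> a" "r v x \<noteq> x" "r v x' \<noteq> x'"
    using nv com_sym[OF vY a] com_sym[OF vY x(1)] com_sym[OF vY x'Y] by blast+
  define q where "q = card (D \<inter> C v)"
  have part: "card (C v \<inter> (C u - D)) + q = s\<^sup>2" if u: "u \<in> Y" "v \<noteq> u" "r v u \<noteq> u" "D \<subseteq> C u" for u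
  proof -
    have "card (C v \<inter> C u) = card (C v \<inter> (C u - D)) + card (D \<inter> C v)"
      using finC finD u(4) by (subst card_Un_disjoint[symmetric]) (auto intro!: arg_cong[of _ _ card])
    then show ?thesis using card_CC[OF vY u(1-3)] by (simp add: q_def)
  qed
  \<comment> \<open>The neighbours of \<open>v\<close> are among the \<open>s - 2\<close> other
    left-out points or in one of the three neighbourhoods, which contribute
    \<open>s\<^sup>2\<close>, \<open>s\<^sup>2 - q\<close> and \<open>s\<^sup>2 - q\<close>.\<close>
  have q1: "2 * q + 2 \<le> s\<^sup>2"
  proof -
    have "C v \<subseteq> (V - {v}) \<union> ((C v \<inter> C a) \<union> ((C v \<inter> (C x - D)) \<union> (C v \<inter> (C x' - D))))"
    proof
      fix u assume u: "u \<in> C v"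
      then have "u \<in> Y" "u \<noteq> v" using CD[OF u vY] by blast+
      moreover have "u \<notin> {a, x, x'}"
        using u notC(2)[OF vY a nv'(1)] notC(2)[OF vY x(1) nv'(2)] notC(2)[OF vY x'Y nv'(3)]
          notC(1)[OF a vY nv(1)] notC(1)[OF x(1) vY nv(2)] notC(1)[OF x'Y vY nv(3)] by blast
      ultimately have "u \<in> Y \<and> u \<noteq> v \<and> u \<notin> {a, x, x'}" by blast
      then show "u \<in> (V - {v}) \<union> ((C v \<inter> C a) \<union> ((C v \<inter> (C x - D)) \<union> (C v \<inter> (C x' - D))))"
        using u by (auto simp: V_def U_def)
    qed
    then have "card (C v) \<le> card ((V - {v}) \<union> ((C v \<inter> C a) \<union> ((C v \<inter> (C x - D)) \<union> (C v \<inter> (C x' - D)))))"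
      using finC finY by (intro card_mono) (auto simp: V_def)
    also have "\<dots> \<le> card (V - {v}) + card ((C v \<inter> C a) \<union> ((C v \<inter> (C x - D)) \<union> (C v \<inter> (C x' - D))))"
      by (rule card_Un_le)
    also have "card ((C v \<inter> C a) \<union> ((C v \<inter> (C x - D)) \<union> (C v \<inter> (C x' - D))))
        \<le> card (C v \<inter> C a) + card ((C v \<inter> (C x - D)) \<union> (C v \<inter> (C x' - D)))" by (rule card_Un_le)
    also have "card ((C v \<inter> (C x - D)) \<union> (C v \<inter> (C x' - D))) \<le> card (C v \<inter> (C x - D)) + card (C v \<inter> (C x' - D))"
      by (rule card_Un_le)
    finally have "s * (2 * s + 1) \<le> card (V - {v}) + (s\<^sup>2 + (card (C v \<inter> (C x - D)) + card (C v \<inter> (C x' - D))))"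
      using cardC[OF vY] card_CC[OF vY a vn(1) nv'(1)] by simp
    moreover have "card (V - {v}) + 2 = s"
    proof -
      have "finite V" using finY by (simp add: V_def)
      then show ?thesis using card_Suc_Diff1[OF _ v] cV by linarith
    qed
    moreover have "s * (2 * s + 1) = 2 * s\<^sup>2 + s" by (simp add: power2_eq_square algebra_simps)
    ultimately show ?thesis
      using part[OF x(1) vn(2) nv'(2) Dsub(2)] part[OF x'Y vn(3) nv'(3) Dsub(3)] by linarith
  qed
  \<comment> \<open>For \<open>y\<close> not commuting with \<open>a\<close> this is
    \<open>C a \<inter> C y\<close>; in this form a common element for two points passes to their
    product without side conditions.\<close>
  define A where "A y = {u \<in> C a. r u y = y}" for y
  have clo: "u \<in> A (r y y')" if "u \<in> A y" "u \<in> A y'" "y \<in> Y" "y' \<in> Y" for u y y'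
    using that r_distr[of u y y'] C_subset by (auto simp: A_def)
  have Aa: "u \<in> A a" if "u \<in> C a" for u using that CD(3)[OF that a] by (simp add: A_def)
  have AC: "A y = C a \<inter> C y" if y: "y \<in> Y" "r a y \<noteq> y" for y
  proof
    show "A y \<subseteq> C a \<inter> C y"
    proof
      fix u assume u: "u \<in> A y"
      then have ua: "u \<in> C a" "r u y = y" by (simp_all add: A_def)
      have "u \<noteq> y" using CD(4)[OF ua(1) a] y(2) by auto
      then show "u \<in> C a \<inter> C y" using CI[OF CD(1)[OF ua(1) a] y(1) _ ua(2)] ua(1) by blast
    qed
    show "C a \<inter> C y \<subseteq> A y" using CD(3)[OF _ y(1)] by (auto simp: A_def)
  qed
  \<comment> \<open>\<open>w1\<close> completes the line through \<open>v\<close> and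
    \<open>x\<close>, and \<open>w2\<close> the line through \<open>v\<close> and \<open>x'\<close>.
    From \<open>a\<close> and any two of \<open>x\<close>, \<open>v\<close>, \<open>w1\<close>,
    \<open>w2\<close> the others can be reached by products, so the sets \<open>A\<close> of these
    four points meet pairwise exactly in \<open>Z\<close>.\<close>
  define w1 where "w1 = r v x"
  define w2 where "w2 = r v x'"
  have lv: "r v x = r x v" "r v x' = r x' v" "r v a = r a v"
    using line(2)[OF x(1) vY nv(2)] line(2)[OF x'Y vY nv(3)] line(2)[OF a vY nv(1)] by simp_all
  have xw1: "r x w1 = v" "r x' w2 = v" "r v w1 = x" "r v w2 = x'" "r a (r a v) = v"
    using line(1)[OF x(1) vY nv(2)] line(1)[OF x'Y vY nv(3)] line(1)[OF vY x(1) nv'(2)] line(1)[OF vY x'Y nv'(3)]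
      line(1)[OF a vY nv(1)] lv by (simp_all add: w1_def w2_def)
  have wY: "w1 \<in> Y" "w2 \<in> Y" using r_closed vY x(1) x'Y by (simp_all add: w1_def w2_def)
  have nw1: "r a w1 \<noteq> w1"
  proof
    assume "r a w1 = w1"
    then have "r (r x a) (r x w1) = r x w1" using r_distr[OF x(1) a wY(1)] by simp
    then show False using L(2) xw1(1) nv(3) by simp
  qed
  have nw2: "r a w2 \<noteq> w2"
  proof
    assume "r a w2 = w2"
    then have "r (r x' a) (r x' w2) = r x' w2" using r_distr[OF x'Y a wY(2)] by simp
    then show False using x'a xw1(2) nv(2) by simp
  qed
  have cA: "card (A y) = s\<^sup>2" if "y \<in> Y" "r a y \<noteq> y" for y
  proof -
    have "a \<noteq> y" using that r_idem[OF a] by auto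
    then show ?thesis unfolding AC[OF that] by (rule card_CC[OF a that(1) _ that(2)])
  qed
  define Z where "Z = A x \<inter> A v"
  have AY: "u \<in> C a" if "u \<in> A y" for u y using that by (simp add: A_def)
  have Axx': "u \<in> A x'" if "u \<in> A x" for u using clo[OF Aa[OF AY[OF that]] that a x(1)] by (simp add: x'_def)
  have Ax'x: "u \<in> A x" if "u \<in> A x'" for u using clo[OF Aa[OF AY[OF that]] that a x'Y] L(1) by simp
  have i13: "u \<in> Z" if "u \<in> A x" "u \<in> A w1" for u
    using clo[OF that x(1) wY(1)] that xw1(1) by (simp add: Z_def)
  have i14: "u \<in> Z" if "u \<in> A x" "u \<in> A w2" for u
    using clo[OF Axx'[OF that(1)] that(2) x'Y wY(2)] that xw1(2) by (simp add: Z_def)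
  have i23: "u \<in> Z" if "u \<in> A v" "u \<in> A w1" for u
    using clo[OF that vY wY(1)] that xw1(3) by (simp add: Z_def)
  have i24: "u \<in> Z" if "u \<in> A v" "u \<in> A w2" for u
    using Ax'x[of u] clo[OF that vY wY(2)] that xw1(4) by (simp add: Z_def)
  \<comment> \<open>The line through \<open>w1\<close> and \<open>w2\<close> contains
    \<open>r a v\<close>, and applying \<open>a\<close> once more leads back to
    \<open>v\<close>.\<close>
  have i34: "u \<in> Z" if "u \<in> A w1" "u \<in> A w2" for u
  proof -
    have "r w1 w2 = r a v" using r_distr[OF vY x(1) x'Y] xx' lv(3) by (simp add: w1_def w2_def)
    then have "u \<in> A (r a v)" using clo[OF that wY] by simp
    then have "u \<in> A v" using clo[OF Aa[OF AY[OF that(1)]] _ a r_closed[OF a vY]] xw1(5) by simp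
    then show ?thesis using that(1) by (rule i23)
  qed
  have Zsub: "Z \<subseteq> A w1" "Z \<subseteq> A w2"
  proof
    show "u \<in> A w1" if "u \<in> Z" for u using clo[of u v x] that vY x(1) by (simp add: Z_def w1_def)
    show "Z \<subseteq> A w2"
    proof
      show "u \<in> A w2" if "u \<in> Z" for u using clo[of u v x'] Axx'[of u] that vY x'Y by (simp add: Z_def w2_def)
    qed
  qed
  have cZ: "card Z = q"
  proof -
    have "Z = D \<inter> C v" unfolding Z_def AC[OF x(1) nax] AC[OF vY nv(1)] by (auto simp: D_def)
    then show ?thesis by (simp add: q_def)
  qed
  have finA: "finite (A y)" for y using finC by (simp add: A_def)
  have dA: "card (A y - Z) + q = s\<^sup>2" if "y \<in> Y" "r a y \<noteq> y" "Z \<subseteq> A y" for y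
  proof -
    have "card (A y - Z) = card (A y) - card Z" using that(3) finite_subset[OF that(3) finA] by (intro card_Diff_subset)
    moreover have "card Z \<le> card (A y)" using that(3) finA by (intro card_mono)
    ultimately show ?thesis using cA[OF that(1,2)] cZ by simp
  qed
  have "sum_list (map card [Z, A x - Z, A v - Z, A w1 - Z, A w2 - Z]) \<le> card (C a)"
  proof (rule sum_card_le[OF finC])
    have i12: "u \<in> Z" if "u \<in> A x" "u \<in> A v" for u using that by (simp add: Z_def)
    note d = disjoint_outside[OF i12] disjoint_outside[OF i13] disjoint_outside[OF i14]
      disjoint_outside[OF i23] disjoint_outside[OF i24] disjoint_outside[OF i34]
    show "sorted_wrt (\<lambda>A B. A \<inter> B = {}) [Z, A x - Z, A v - Z, A w1 - Z, A w2 - Z]"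
      by (simp only: sorted_wrt.simps list.set ball_simps Diff_disjoint d)
    show "\<forall>B\<in>set [Z, A x - Z, A v - Z, A w1 - Z, A w2 - Z]. B \<subseteq> C a" by (auto simp: A_def Z_def)
  qed
  moreover have "Z \<subseteq> A x" "Z \<subseteq> A v" by (auto simp: Z_def)
  moreover have "s * (2 * s + 1) = 2 * s\<^sup>2 + s" by (simp add: power2_eq_square algebra_simps)
  ultimately have "q + card (A x - Z) + card (A v - Z) + card (A w1 - Z) + card (A w2 - Z) \<le> 2 * s\<^sup>2 + s"
    using cZ cardC[OF a] by simp
  then have "2 * s\<^sup>2 \<le> 3 * q + s"
    using dA[OF x(1) nax \<open>Z \<subseteq> A x\<close>] dA[OF vY nv(1) \<open>Z \<subseteq> A v\<close>] dA[OF wY(1) nw1 Zsub(1)] dA[OF wY(2) nw2 Zsub(2)] by linarith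
  then have "s\<^sup>2 + 6 \<le> 2 * s" using q1 by linarith
  moreover have "2 * s \<le> s\<^sup>2" using s2 by (simp add: power2_eq_square)
  ultimately show False by linarith
qed

end

section \<open>The Petersen graph\<close>

lemma transpose_triangle:
  assumes "distinct [i, j, k]" "t1 \<in> {transpose i j, transpose i k, transpose j k}"
    "t2 \<in> {transpose i j, transpose i k, transpose j k}" "t3 \<in> {transpose i j, transpose i k, transpose j k}"
    "t1 \<noteq> t2" "t1 \<noteq> t3" "t2 \<noteq> t3"
  shows "t2 \<circ> t1 \<circ> t2 = t3"
proof -
  have "transpose j k \<circ> transpose i j \<circ> transpose j k = transpose i k"
    "transpose i k \<circ> transpose i j \<circ> transpose i k = transpose j k"
    "transpose i j \<circ> transpose i k \<circ> transpose i j = transpose j k"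
    "transpose j k \<circ> transpose i k \<circ> transpose j k = transpose i j"
    "transpose i j \<circ> transpose j k \<circ> transpose i j = transpose i k"
    "transpose i k \<circ> transpose j k \<circ> transpose i k = transpose i j"
    using assms(1) by (auto simp: fun_eq_iff transpose_def)
  then show ?thesis using assms(2-7) by (elim insertE emptyE) simp_all
qed

lemma transpose_disjoint_conj:
  assumes "{i, j} \<inter> {l, m} = {}"
  shows "transpose l m \<circ> transpose i j \<circ> transpose l m = transpose i j"
    "transpose i j \<circ> transpose l m \<circ> transpose i j = transpose l m"
  using assms by (auto simp: fun_eq_iff transpose_def)

lemma transpose_support: "l \<noteq> m \<Longrightarrow> {x. transpose l m x \<noteq> x} = {l, m}"
  by (auto simp: transpose_def)

lemma card_1_unique: "card A = 1 \<Longrightarrow> x \<in> A \<Longrightarrow> y \<in> A \<Longrightarrow> x = y"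
  by (metis card_1_singletonE singletonD)

context strong_rack
begin

lemma C_sym: "x \<in> Y \<Longrightarrow> y \<in> Y \<Longrightarrow> y \<in> C x \<longleftrightarrow> x \<in> C y"
  using com_sym[of x y] com_sym[of y x] by (auto simp: C_def)

lemma card10: "card Y = 10" and card3: "x \<in> Y \<Longrightarrow> card (C x) = 3"
  using card_Y cardC[of x] by (simp_all add: s_eq_1)

lemma no_triangle: assumes "x \<in> Y" "y \<in> C x" "u \<in> C x" shows "u \<notin> C y"
proof
  assume u: "u \<in> C y"
  have y: "y \<in> Y" "y \<noteq> x" "r x y = y" using CD[OF assms(2,1)] by blast+
  have "card (C x \<inter> C y) + 1 = s\<^sup>2" unfolding CC using lam[OF assms(1) y(1) y(2)[symmetric] y(3)] .
  then have "card (C x \<inter> C y) = 0" by (simp add: s_eq_1)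
  then have "C x \<inter> C y = {}" using finC by simp
  then show False using assms(3) u by blast
qed

lemma common_one: assumes "x \<in> Y" "y \<in> Y" "x \<noteq> y" "y \<notin> C x" shows "card (C x \<inter> C y) = 1"
proof -
  have "r x y \<noteq> y" using assms by (simp add: C_def)
  then show ?thesis using card_CC[OF assms(1-3)] by (simp add: s_eq_1)
qed

lemma no_square: assumes "x \<in> Y" "y \<in> Y" "x \<noteq> y" "u \<in> C x" "u \<in> C y" "v \<in> C x" "v \<in> C y" shows "u = v"
proof (rule card_1_unique)
  have "y \<notin> C x" using no_triangle[OF assms(1)] C_sym[OF assms(1,2)] assms CD(1)[OF assms(4,1)]
    by (metis C_sym)
  then show "card (C x \<inter> C y) = 1" by (rule common_one[OF assms(1-3)])
qed (use assms in auto)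

lemma r_third:
  assumes c: "c \<in> Y" "u \<in> C c" "v \<in> C c" "u \<noteq> v"
  shows "r v u \<in> C c" "r v u \<noteq> u" "r v u \<noteq> v"
proof -
  have Y: "u \<in> Y" "v \<in> Y" using c CD(1) by blast+
  have nc: "r v u \<noteq> u"
  proof
    assume "r v u = u"
    then have "u \<in> C v" using Y c(4) by (simp add: C_def)
    then show False using no_triangle[OF c(1) c(3) c(2)] by blast
  qed
  then show "r v u \<noteq> u" .
  have "c \<in> C v" "c \<in> C u" using C_sym c(1-3) Y by blast+
  then have "c \<in> C (r v u)" by (rule C_closed[OF Y(2,1) nc])
  then show "r v u \<in> C c" using C_sym[OF c(1) r_closed[OF Y(2,1)]] by blast
  show "r v u \<noteq> v"
  proof
    assume "r v u = v"
    then have "r v u = r v v" using r_idem[OF Y(2)] by simp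
    then show False using inj[OF Y(2,1,2)] c(4) by blast
  qed
qed

text \<open>A Petersen labelling by transpositions determines the operation, because the product of two
  non-commuting points is the third neighbour of their common neighbour.\<close>

lemma petersen_hom:
  assumes lab: "\<And>c. c \<in> Y \<Longrightarrow> \<exists>i j k l m. distinct [i, j, k, l, m] \<and> \<phi> c = transpose l m \<and>
      \<phi> ` C c = {transpose i j, transpose i k, transpose j k}"
    and inj: "inj_on \<phi> Y" and u: "u \<in> Y" and v: "v \<in> Y"
  shows "\<phi> (r v u) = \<phi> v \<circ> \<phi> u \<circ> \<phi> v"
proof -
  have inv: "\<phi> v \<circ> \<phi> v = id" using lab[OF v] by auto
  consider "u = v" | "u \<in> C v" | "u \<noteq> v" "u \<notin> C v" by blast
  then show ?thesis
  proof cases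
    case 1
    then show ?thesis using r_idem[OF v] inv by (simp add: comp_assoc)
  next
    case 2
    obtain i j k l m where d: "distinct [i, j, k, l, m]" and p: "\<phi> v = transpose l m"
      "\<phi> ` C v = {transpose i j, transpose i k, transpose j k}" using lab[OF v] by blast
    have "\<phi> u \<in> {transpose i j, transpose i k, transpose j k}" unfolding p(2)[symmetric] using 2 by (rule imageI)
    then have "\<phi> v \<circ> \<phi> u \<circ> \<phi> v = \<phi> u" unfolding p(1) using d
      by (elim insertE emptyE) (simp_all add: transpose_disjoint_conj)
    then show ?thesis using CD(4)[OF 2 v] by simp
  next
    case 3
    have "card (C v \<inter> C u) = 1" by (rule common_one[OF v u]) (use 3 in auto)
    then obtain c where c: "c \<in> C v" "c \<in> C u" by (metis IntE card_1_singletonE insertI1)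
    have cY: "c \<in> Y" by (rule CD(1)[OF c(1) v])
    have uv: "u \<in> C c" "v \<in> C c" using C_sym c cY u v by blast+
    note w = r_third[OF cY uv 3(1)]
    obtain i j k l m where d: "distinct [i, j, k, l, m]" and
      p: "\<phi> ` C c = {transpose i j, transpose i k, transpose j k}" using lab[OF cY] by blast
    have mem: "\<phi> x \<in> {transpose i j, transpose i k, transpose j k}" if "x \<in> C c" for x
      unfolding p[symmetric] using that by (rule imageI)
    have wY: "r v u \<in> Y" by (rule r_closed[OF v u])
    have "\<phi> u \<noteq> \<phi> v" "\<phi> u \<noteq> \<phi> (r v u)" "\<phi> v \<noteq> \<phi> (r v u)"
      using inj_onD[OF inj _ u v] inj_onD[OF inj _ u wY] inj_onD[OF inj _ v wY] 3(1) w(2,3) by metis+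
    moreover have "distinct [i, j, k]" using d by simp
    ultimately show ?thesis
      using transpose_triangle[OF _ mem[OF uv(1)] mem[OF uv(2)] mem[OF w(1)]] by metis
  qed
qed

lemma C_three: assumes "x \<in> Y" "a \<in> C x" "b \<in> C x" "c \<in> C x" "distinct [a, b, c]" shows "C x = {a, b, c}"
proof -
  have "card {a, b, c} = card (C x)" using card3[OF assms(1)] assms(5) by simp
  then show ?thesis using card_subset_eq[OF finC, of "{a, b, c}" x] assms(2-4) by simp
qed

text \<open>Each neighbour of \<open>a\<close> has two further neighbours, and these pairs are
  disjoint because two points never have two common neighbours. The edges between the six outer
  points are forced by the absence of triangles and the unique common neighbour of non-adjacent
  points.\<close>

lemma ex_petersen:
  obtains a b1 b2 b3 y1 z1 y2 z2 y3 z3 where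
    "distinct [a, b1, b2, b3, y1, z1, y2, z2, y3, z3]" "Y = {a, b1, b2, b3, y1, z1, y2, z2, y3, z3}"
    "C a = {b1, b2, b3}" "C b1 = {a, y1, z1}" "C b2 = {a, y2, z2}" "C b3 = {a, y3, z3}"
    "C y1 = {b1, z2, z3}" "C z1 = {b1, y2, y3}" "C y2 = {b2, z1, z3}" "C z2 = {b2, y1, y3}"
    "C y3 = {b3, z1, z2}" "C z3 = {b3, y1, y2}"
proof -
  have "Y \<noteq> {}" using card10 by auto
  then obtain a where a: "a \<in> Y" by blast
  obtain b1 b2 b3 where Ca: "C a = {b1, b2, b3}" and b: "b1 \<noteq> b2" "b1 \<noteq> b3" "b2 \<noteq> b3"
    using card3[OF a] card_3_iff[of "C a"] by metis
  have bY: "b1 \<in> Y" "b2 \<in> Y" "b3 \<in> Y" using Ca CD(1)[OF _ a] by auto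
  have ba: "b1 \<in> C a" "b2 \<in> C a" "b3 \<in> C a" using Ca by auto
  have two: "\<exists>y z. C x = {a, y, z} \<and> y \<noteq> z \<and> y \<noteq> a \<and> z \<noteq> a" if x: "x \<in> C a" for x
  proof -
    have xY: "x \<in> Y" by (rule CD(1)[OF x a])
    have ax: "a \<in> C x" using C_sym[OF a xY] x by blast
    have "card (C x - {a}) = 2" using card3[OF xY] ax finC by simp
    then obtain y z where "C x - {a} = {y, z}" "y \<noteq> z" by (auto simp: card_2_iff)
    then have "C x = {a, y, z} \<and> y \<noteq> z \<and> y \<noteq> a \<and> z \<noteq> a" using ax by blast
    then show ?thesis by blast
  qed
  have one: "y \<in> C v \<and> z \<notin> C v \<or> y \<notin> C v \<and> z \<in> C v"
    if x: "x \<in> C a" "C x = {a, y, z}" "y \<noteq> z" and v: "v \<in> Y" "v \<noteq> x" "v \<notin> C x" "a \<notin> C v" for x y z v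
  proof -
    have xY: "x \<in> Y" by (rule CD(1)[OF x(1) a])
    have 1: "card (C x \<inter> C v) = 1" by (rule common_one[OF xY v(1)]) (use v in auto)
    have "C x \<inter> C v \<noteq> {}" using 1 by auto
    then obtain u where u: "u \<in> C x" "u \<in> C v" by blast
    have "u \<in> {a, y, z}" using u(1) unfolding x(2) .
    then have "y \<in> C v \<or> z \<in> C v" using u(2) v(4) by blast
    moreover have "\<not> (y \<in> C v \<and> z \<in> C v)" using card_1_unique[OF 1, of y z] x(2,3) by blast
    ultimately show ?thesis by blast
  qed
  have outer: "v \<in> Y \<and> v \<notin> C a \<and> a \<notin> C v \<and> x \<in> C v" if x: "x \<in> C a" and v: "v \<in> C x" "v \<noteq> a" for x v
  proof -
    have xY: "x \<in> Y" by (rule CD(1)[OF x a])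
    have vY: "v \<in> Y" by (rule CD(1)[OF v(1) xY])
    have "v \<notin> C a" using no_triangle[OF a x] v(1) by blast
    then show ?thesis using C_sym[OF a vY] C_sym[OF xY vY] vY v(1) by blast
  qed
  have disj: "v \<notin> C x'" if "x \<in> C a" "x' \<in> C a" "x \<noteq> x'" "v \<in> C x" "v \<noteq> a" for x x' v
  proof
    assume "v \<in> C x'"
    moreover have "a \<in> C x" "a \<in> C x'" using C_sym[OF a] that(1,2) CD(1)[OF _ a] by blast+
    ultimately show False using no_square[OF CD(1)[OF that(1) a] CD(1)[OF that(2) a] that(3), of v a] that(4,5) by blast
  qed
  obtain y1 z1 where C1: "C b1 = {a, y1, z1}" and n1: "y1 \<noteq> z1" "y1 \<noteq> a" "z1 \<noteq> a" using two[OF ba(1)] by blast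
  have y1: "y1 \<in> Y" "y1 \<notin> C a" "a \<notin> C y1" "b1 \<in> C y1" "y1 \<notin> C b2" "y1 \<notin> C b3"
    using outer[OF ba(1), of y1] disj[OF ba(1,2) b(1), of y1] disj[OF ba(1,3) b(2), of y1] C1 n1 by blast+
  have z1: "z1 \<in> Y" "z1 \<notin> C a" "a \<notin> C z1" "b1 \<in> C z1" "z1 \<notin> C b2" "z1 \<notin> C b3"
    using outer[OF ba(1), of z1] disj[OF ba(1,2) b(1), of z1] disj[OF ba(1,3) b(2), of z1] C1 n1 by blast+
  \<comment> \<open>Each further pair is named so that \<open>z\<close> is the neighbour of
    \<open>y1\<close> and \<open>y\<close> the neighbour of \<open>z1\<close>; this fixes the
    orientation of the hexagon of outer points.\<close>
  have labelled: "\<exists>y z. C x = {a, y, z} \<and> y \<noteq> z \<and> y \<noteq> a \<and> z \<noteq> a \<and> z \<in> C y1 \<and> y \<notin> C y1 \<and> y \<in> C z1 \<and> z \<notin> C z1"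
    if x: "x \<in> C a" "b1 \<noteq> x" for x
  proof -
    have xY: "x \<in> Y" by (rule CD(1)[OF x(1) a])
    obtain y z where yz: "C x = {a, y, z}" "y \<noteq> z" "y \<noteq> a" "z \<noteq> a" using two[OF x(1)] by blast
    have v: "y1 \<noteq> x" "z1 \<noteq> x" using y1(2) z1(2) x(1) by blast+
    have vx: "y1 \<notin> C x" "z1 \<notin> C x"
      using disj[OF ba(1) x(1) x(2), of y1] disj[OF ba(1) x(1) x(2), of z1] C1 n1 by blast+
    have o1: "y \<in> C y1 \<and> z \<notin> C y1 \<or> y \<notin> C y1 \<and> z \<in> C y1" by (rule one[OF x(1) yz(1,2) y1(1) v(1) vx(1) y1(3)])
    have o2: "y \<in> C z1 \<and> z \<notin> C z1 \<or> y \<notin> C z1 \<and> z \<in> C z1" by (rule one[OF x(1) yz(1,2) z1(1) v(2) vx(2) z1(3)])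
    have both: "\<not> (v \<in> C y1 \<and> v \<in> C z1)" if "v \<in> C x" "v \<noteq> a" for v
    proof
      assume h: "v \<in> C y1 \<and> v \<in> C z1"
      have "v \<notin> C b1" using disj[OF x(1) ba(1) x(2)[symmetric] that] .
      then have "v \<noteq> b1 \<and> b1 \<in> C y1 \<and> b1 \<in> C z1" using h y1 z1 no_square[OF y1(1) z1(1) n1(1), of v b1]
        outer[OF x(1) that] ba(1) by blast
      then show False using no_square[OF y1(1) z1(1) n1(1), of v b1] h by blast
    qed
    have "\<not> (y \<in> C y1 \<and> y \<in> C z1)" "\<not> (z \<in> C y1 \<and> z \<in> C z1)" using both[of y] both[of z] yz by blast+
    then consider "z \<in> C y1" "y \<notin> C y1" "y \<in> C z1" "z \<notin> C z1" | "y \<in> C y1" "z \<notin> C y1" "z \<in> C z1" "y \<notin> C z1"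
      using o1 o2 by blast
    then show ?thesis
    proof cases
      case 1 then show ?thesis using yz by blast
    next
      case 2
      moreover have "C x = {a, z, y}" using yz(1) by blast
      ultimately show ?thesis using yz(2-4) by blast
    qed
  qed
  obtain y2 z2 where C2: "C b2 = {a, y2, z2}" and n2: "y2 \<noteq> z2" "y2 \<noteq> a" "z2 \<noteq> a"
    and e2: "z2 \<in> C y1" "y2 \<notin> C y1" "y2 \<in> C z1" "z2 \<notin> C z1" using labelled[OF ba(2) b(1)] by blast
  obtain y3 z3 where C3: "C b3 = {a, y3, z3}" and n3: "y3 \<noteq> z3" "y3 \<noteq> a" "z3 \<noteq> a"
    and e3: "z3 \<in> C y1" "y3 \<notin> C y1" "y3 \<in> C z1" "z3 \<notin> C z1" using labelled[OF ba(3) b(2)] by blast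
  have y2: "y2 \<in> Y" "y2 \<notin> C a" "a \<notin> C y2" "b2 \<in> C y2" "y2 \<notin> C b1" "y2 \<notin> C b3"
    using outer[OF ba(2), of y2] disj[OF ba(2,1) b(1)[symmetric], of y2] disj[OF ba(2,3) b(3), of y2] C2 n2 by blast+
  have z2: "z2 \<in> Y" "z2 \<notin> C a" "a \<notin> C z2" "b2 \<in> C z2" "z2 \<notin> C b1" "z2 \<notin> C b3"
    using outer[OF ba(2), of z2] disj[OF ba(2,1) b(1)[symmetric], of z2] disj[OF ba(2,3) b(3), of z2] C2 n2 by blast+
  have y3: "y3 \<in> Y" "y3 \<notin> C a" "a \<notin> C y3" "b3 \<in> C y3" "y3 \<notin> C b1" "y3 \<notin> C b2"
    using outer[OF ba(3), of y3] disj[OF ba(3,1) b(2)[symmetric], of y3] disj[OF ba(3,2) b(3)[symmetric], of y3] C3 n3 by blast+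
  have z3: "z3 \<in> Y" "z3 \<notin> C a" "a \<notin> C z3" "b3 \<in> C z3" "z3 \<notin> C b1" "z3 \<notin> C b2"
    using outer[OF ba(3), of z3] disj[OF ba(3,1) b(2)[symmetric], of z3] disj[OF ba(3,2) b(3)[symmetric], of z3] C3 n3 by blast+
  have ba': "b1 \<noteq> a" "b2 \<noteq> a" "b3 \<noteq> a" using CD(2)[OF _ a] ba by blast+
  have ynb: "v \<notin> {b1, b2, b3}" if "v \<notin> C a" for v using that Ca by blast
  have cross: "y1 \<noteq> y2" "y1 \<noteq> z2" "y1 \<noteq> y3" "y1 \<noteq> z3" "z1 \<noteq> y2" "z1 \<noteq> z2" "z1 \<noteq> y3" "z1 \<noteq> z3"
    "y2 \<noteq> y3" "y2 \<noteq> z3" "z2 \<noteq> y3" "z2 \<noteq> z3"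
    using y1(5,6) z1(5,6) y2(6) z2(6) C2 C3 by blast+
  have dist: "distinct [a, b1, b2, b3, y1, z1, y2, z2, y3, z3]"
    using b ba' n1 n2 n3 cross ynb[OF y1(2)] ynb[OF z1(2)] ynb[OF y2(2)] ynb[OF z2(2)] ynb[OF y3(2)] ynb[OF z3(2)]
    by auto
  have Y: "Y = {a, b1, b2, b3, y1, z1, y2, z2, y3, z3}"
  proof (rule card_subset_eq[OF finY, symmetric])
    show "{a, b1, b2, b3, y1, z1, y2, z2, y3, z3} \<subseteq> Y" using a bY y1 z1 y2 z2 y3 z3 by blast
    show "card {a, b1, b2, b3, y1, z1, y2, z2, y3, z3} = card Y"
      using distinct_card[OF dist] card10 by simp
  qed
  have hex: "y3 \<notin> C y2" "z3 \<notin> C z2"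
    using no_triangle[OF z1(1) e2(3) e3(3)] no_triangle[OF y1(1) e2(1) e3(1)] .
  have o1: "y3 \<in> C y2 \<and> z3 \<notin> C y2 \<or> y3 \<notin> C y2 \<and> z3 \<in> C y2"
    by (rule one[OF ba(3) C3 n3(1) y2(1) _ y2(6,3)]) (use ynb[OF y2(2)] in blast)
  have o2: "y3 \<in> C z2 \<and> z3 \<notin> C z2 \<or> y3 \<notin> C z2 \<and> z3 \<in> C z2"
    by (rule one[OF ba(3) C3 n3(1) z2(1) _ z2(6,3)]) (use ynb[OF z2(2)] in blast)
  have e4: "z3 \<in> C y2" "y3 \<in> C z2" using o1 o2 hex by blast+
  have e5: "y1 \<in> C z2" "z1 \<in> C y2" "y1 \<in> C z3" "z1 \<in> C y3" "y2 \<in> C z3" "z2 \<in> C y3"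
    using C_sym[OF y1(1) z2(1)] C_sym[OF z1(1) y2(1)] C_sym[OF y1(1) z3(1)] C_sym[OF z1(1) y3(1)]
      C_sym[OF y2(1) z3(1)] C_sym[OF z2(1) y3(1)] e2 e3 e4 by blast+
  show thesis
  proof (rule that[OF dist Y Ca C1 C2 C3])
    show "C y1 = {b1, z2, z3}" by (rule C_three[OF y1(1,4) e2(1) e3(1)]) (use dist in simp)
    show "C z1 = {b1, y2, y3}" by (rule C_three[OF z1(1,4) e2(3) e3(3)]) (use dist in simp)
    show "C y2 = {b2, z1, z3}" by (rule C_three[OF y2(1,4) e5(2) e4(1)]) (use dist in simp)
    show "C z2 = {b2, y1, y3}" by (rule C_three[OF z2(1,4) e5(1) e4(2)]) (use dist in simp)
    show "C y3 = {b3, z1, z2}" by (rule C_three[OF y3(1,4) e5(4) e5(6)]) (use dist in simp)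
    show "C z3 = {b3, y1, y2}" by (rule C_three[OF z3(1,4) e5(3) e5(5)]) (use dist in simp)
  qed
qed

theorem ex_transposition_labelling:
  obtains \<phi> :: "'a \<Rightarrow> nat \<Rightarrow> nat"
  where "bij_betw \<phi> Y {transpose k l | k l. k \<in> {1..5} \<and> l \<in> {1..5} \<and> k \<noteq> l}"
    and "\<And>u v. u \<in> Y \<Longrightarrow> v \<in> Y \<Longrightarrow> \<phi> (r v u) = \<phi> v \<circ> \<phi> u \<circ> \<phi> v"
proof -
  obtain a b1 b2 b3 y1 z1 y2 z2 y3 z3 where
    dist: "distinct [a, b1, b2, b3, y1, z1, y2, z2, y3, z3]" and Y: "Y = {a, b1, b2, b3, y1, z1, y2, z2, y3, z3}" and
    C: "C a = {b1, b2, b3}" "C b1 = {a, y1, z1}" "C b2 = {a, y2, z2}" "C b3 = {a, y3, z3}"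
    "C y1 = {b1, z2, z3}" "C z1 = {b1, y2, y3}" "C y2 = {b2, z1, z3}" "C z2 = {b2, y1, y3}"
    "C y3 = {b3, z1, z2}" "C z3 = {b3, y1, y2}"
    by (rule ex_petersen)
  \<comment> \<open>Neighbours need disjoint transpositions. With \<open>(1 2)\<close> at
    \<open>a\<close>, its neighbours get the transpositions of 3, 4, 5, and the outer neighbours of
    each \<open>b\<close> exchange the point of 3, 4, 5 that this \<open>b\<close> fixes with 1 for
    \<open>y\<close> and with 2 for \<open>z\<close>.\<close>
  define \<phi> :: "'a \<Rightarrow> nat \<Rightarrow> nat" where "\<phi> = (\<lambda>_. id)(a := transpose 1 2, b1 := transpose 3 4, b2 := transpose 3 5,
    b3 := transpose 4 5, y1 := transpose 1 5, z1 := transpose 2 5, y2 := transpose 1 4, z2 := transpose 2 4,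
    y3 := transpose 1 3, z3 := transpose 2 3)"
  have v: "\<phi> a = transpose 1 2" "\<phi> b1 = transpose 3 4" "\<phi> b2 = transpose 3 5" "\<phi> b3 = transpose 4 5"
    "\<phi> y1 = transpose 1 5" "\<phi> z1 = transpose 2 5" "\<phi> y2 = transpose 1 4" "\<phi> z2 = transpose 2 4"
    "\<phi> y3 = transpose 1 3" "\<phi> z3 = transpose 2 3"
    using dist by (simp_all add: \<phi>_def)
  have img: "\<phi> ` Y = {transpose 1 2, transpose 3 4, transpose 3 5, transpose 4 5, transpose 1 5, transpose 2 5,
      transpose 1 4, transpose 2 4, transpose 1 3, transpose 2 3}"
    unfolding Y by (simp only: image_insert image_empty v)
  have lab: "\<exists>i j k l m. distinct [i, j, k, l, m] \<and> \<phi> c = transpose l m \<and>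
      \<phi> ` C c = {transpose i j, transpose i k, transpose j k}" if "c \<in> Y" for c
  proof -
    have P: "\<exists>i j k l m. distinct [i, j, k, l, m] \<and> \<phi> c = transpose l m \<and>
        \<phi> ` C c = {transpose i j, transpose i k, transpose j k}"
      if "distinct [i, j, k, l, m]" "\<phi> c = transpose l m" "\<phi> ` C c = {transpose i j, transpose i k, transpose j k}"
      for i j k l m c using that by blast
    from that have "c = a \<or> c = b1 \<or> c = b2 \<or> c = b3 \<or> c = y1 \<or> c = z1 \<or> c = y2 \<or> c = z2 \<or> c = y3 \<or> c = z3"
      unfolding Y by simp
    then show ?thesis
    proof (elim disjE)
      assume c: "c = a" show ?thesis unfolding c by (rule P[of 3 4 5 1 2]) (simp_all add: C v)
    next
      assume c: "c = b1" show ?thesis unfolding c by (rule P[of 1 2 5 3 4]) (simp_all add: C v)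
    next
      assume c: "c = b2" show ?thesis unfolding c by (rule P[of 1 2 4 3 5]) (simp_all add: C v)
    next
      assume c: "c = b3" show ?thesis unfolding c by (rule P[of 1 2 3 4 5]) (simp_all add: C v)
    next
      assume c: "c = y1" show ?thesis unfolding c by (rule P[of 2 3 4 1 5]) (simp_all add: C v insert_commute)
    next
      assume c: "c = z1" show ?thesis unfolding c by (rule P[of 1 3 4 2 5]) (simp_all add: C v insert_commute)
    next
      assume c: "c = y2" show ?thesis unfolding c by (rule P[of 2 3 5 1 4]) (simp_all add: C v insert_commute)
    next
      assume c: "c = z2" show ?thesis unfolding c by (rule P[of 1 3 5 2 4]) (simp_all add: C v insert_commute)
    next
      assume c: "c = y3" show ?thesis unfolding c by (rule P[of 2 4 5 1 3]) (simp_all add: C v insert_commute)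
    next
      assume c: "c = z3" show ?thesis unfolding c by (rule P[of 1 4 5 2 3]) (simp_all add: C v insert_commute)
    qed
  qed
  have img2: "\<phi> ` Y = {transpose k l | k l. k \<in> {1..5} \<and> l \<in> {1..5} \<and> k \<noteq> l}"
  proof
    show "\<phi> ` Y \<subseteq> {transpose k l | k l. k \<in> {1..5} \<and> l \<in> {1..5} \<and> k \<noteq> l}"
    proof
      fix t assume "t \<in> \<phi> ` Y"
      moreover have "transpose k l \<in> {transpose k l | k l. k \<in> {1..5} \<and> l \<in> {1..5} \<and> k \<noteq> l}"
        if "k \<in> {1..5}" "l \<in> {1..5}" "k \<noteq> l" for k l :: nat using that by blast
      ultimately show "t \<in> {transpose k l | k l. k \<in> {1..5} \<and> l \<in> {1..5} \<and> k \<noteq> l}"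
        unfolding img by (elim insertE emptyE) simp_all
    qed
    have five: "k = 1 \<or> k = 2 \<or> k = 3 \<or> k = 4 \<or> k = 5" if "k \<in> {1..5}" for k :: nat using that by auto
    have less: "transpose k l \<in> \<phi> ` Y" if kl: "k \<in> {1..5}" "l \<in> {1..5}" "k < l" for k l :: nat
      using five[OF kl(1)] five[OF kl(2)] kl(3) unfolding img by (elim disjE) simp_all
    show "{transpose k l | k l. k \<in> {1..5} \<and> l \<in> {1..5} \<and> k \<noteq> l} \<subseteq> \<phi> ` Y"
    proof
      fix t :: "nat \<Rightarrow> nat" assume "t \<in> {transpose k l | k l. k \<in> {1..5} \<and> l \<in> {1..5} \<and> k \<noteq> l}"
      then obtain k l where t: "t = transpose k l" "k \<in> {1..5}" "l \<in> {1..5}" "k \<noteq> l" by blast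
      then show "t \<in> \<phi> ` Y" using less[of k l] less[of l k] transpose_commute[of k l] by (cases "k < l") simp_all
    qed
  qed
  have "card (\<phi> ` Y) = 10"
  proof -
    \<comment> \<open>The ten transpositions are told apart through their supports, which are
      explicit two-element sets.\<close>
    define supp where "supp = (\<lambda>t :: nat \<Rightarrow> nat. {x. t x \<noteq> x})"
    have supp: "supp ` \<phi> ` Y = set [{1, 2}, {3, 4}, {3, 5}, {4, 5}, {1, 5}, {2, 5}, {1, 4}, {2, 4}, {1, 3}, {2, 3}]"
      unfolding img by (simp add: supp_def transpose_support)
    have "distinct [{1::nat, 2}, {3, 4}, {3, 5}, {4, 5}, {1, 5}, {2, 5}, {1, 4}, {2, 4}, {1, 3}, {2, 3}]"
      by (simp add: doubleton_eq_iff)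
    from distinct_card[OF this] have "card (supp ` \<phi> ` Y) = 10" unfolding supp by simp
    moreover have "card (supp ` \<phi> ` Y) \<le> card (\<phi> ` Y)" using finY by (intro card_image_le) simp
    moreover have "card (\<phi> ` Y) \<le> card Y" using finY by (rule card_image_le)
    ultimately show ?thesis using card10 by simp
  qed
  then have "inj_on \<phi> Y" using finY card10 by (intro eq_card_imp_inj_on) simp_all
  moreover from this have "\<phi> (r v u) = \<phi> v \<circ> \<phi> u \<circ> \<phi> v" if "u \<in> Y" "v \<in> Y" for u v
    using petersen_hom[OF lab _ that] by blast
  ultimately show thesis using that[of \<phi>] img2 by (simp add: bij_betw_def)
qed

end

section \<open>Transfer to the record of quandles\<close>

lemma (in quandle) finite_rack:
  assumes fin: "finite (carrier Q)"
  shows "finite_rack (carrier Q) (\<lambda>a x. x \<triangleright> a)"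
proof
  show "x \<triangleright> a \<in> carrier Q" if "a \<in> carrier Q" "x \<in> carrier Q" for a x using qop_closed that by blast
  show "inj_on (\<lambda>x. x \<triangleright> a) (carrier Q)" if a: "a \<in> carrier Q" for a
  proof (rule inj_onI)
    fix x y assume xy: "x \<in> carrier Q" "y \<in> carrier Q" "x \<triangleright> a = y \<triangleright> a"
    show "x = y" by (rule ex1D[OF Q1[OF a qop_closed[OF xy(1) a]]]) (use xy in simp_all)
  qed
  show "y \<triangleright> x \<triangleright> a = (y \<triangleright> a) \<triangleright> (x \<triangleright> a)" if "a \<in> carrier Q" "x \<in> carrier Q" "y \<in> carrier Q" for a x y
    using Q2 that by blast
qed (use fin Q3 in auto)

text \<open>\<open>Inn\<close> consists of extensional functions and \<open>I\<close> of
  permutations that are the identity outside the carrier. Induction over the generation of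
  \<open>Inn\<close> finds for each element one of \<open>I\<close> that agrees with it on the
  carrier, and this preserves transitivity.\<close>

lemma (in connected_quandle) conn_rack:
  assumes fin: "finite (carrier Q)" and p: "Factorial_Ring.prime p" "p > 3" "card (carrier Q) = 2 * p"
  shows "conn_rack (carrier Q) (\<lambda>a x. x \<triangleright> a) p"
proof -
  interpret F: finite_rack "carrier Q" "\<lambda>a x. x \<triangleright> a" by (rule finite_rack[OF fin])
  have BC: "carrier (BijGroup (carrier Q)) = Bij (carrier Q)" by (simp add: BijGroup_def)
  have lift: "g \<in> Bij (carrier Q) \<and> (\<exists>h\<in>F.I. \<forall>x\<in>carrier Q. h x = g x)"
    if "g \<in> generate (BijGroup (carrier Q)) (right_translation Q ` carrier Q)" for g
    using that
  proof induction
    case one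
    have "\<one>\<^bsub>BijGroup (carrier Q)\<^esub> \<in> Bij (carrier Q)"
      using group.is_monoid[OF group_BijGroup, of "carrier Q", THEN monoid.one_closed] by (simp add: BijGroup_def)
    moreover have "\<forall>x\<in>carrier Q. id x = \<one>\<^bsub>BijGroup (carrier Q)\<^esub> x" by (simp add: BijGroup_def)
    ultimately show ?case using F.id_in by blast
  next
    case (incl h)
    then obtain a where a: "a \<in> carrier Q" "h = right_translation Q a" by blast
    then have "\<forall>x\<in>carrier Q. F.R a x = h x" by (simp add: right_translation_def)
    then show ?case using right_translation_Bij[OF a(1)] F.R_in[OF a(1)] a(2) by blast
  next
    case (inv h)
    then obtain a where a: "a \<in> carrier Q" "h = right_translation Q a" by blast
    have hB: "h \<in> Bij (carrier Q)" using right_translation_Bij a by simp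
    have inj: "inj_on h (carrier Q)" using hB by (simp add: Bij_def bij_betw_def)
    have e: "\<forall>x\<in>carrier Q. inv_into UNIV (F.R a) x = (\<lambda>x\<in>carrier Q. inv_into (carrier Q) h x) x"
    proof
      fix x assume x: "x \<in> carrier Q"
      define y where "y = inv_into UNIV (F.R a) x"
      have y: "y \<in> carrier Q" "F.R a y = x"
        unfolding y_def by (rule F.mem[OF F.inv_in[OF F.R_in[OF a(1)]] x], rule F.inv_right[OF F.R_in[OF a(1)]])
      have "h y = F.R a y" unfolding a(2) right_translation_def using y(1) by simp
      then have "inv_into (carrier Q) h x = y" unfolding y(2) using inv_into_f_f[OF inj y(1)] by simp
      then have "(\<lambda>x\<in>carrier Q. inv_into (carrier Q) h x) x = y" using x by simp
      then show "inv_into UNIV (F.R a) x = (\<lambda>x\<in>carrier Q. inv_into (carrier Q) h x) x" unfolding y_def by (rule sym)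
    qed
    have B: "inv\<^bsub>BijGroup (carrier Q)\<^esub> h \<in> Bij (carrier Q)"
      using group.inv_closed[OF group_BijGroup, of h "carrier Q"] hB unfolding BC by blast
    show ?case
    proof
      show "\<exists>g\<in>F.I. \<forall>x\<in>carrier Q. g x = (inv\<^bsub>BijGroup (carrier Q)\<^esub> h) x"
        unfolding inv_BijGroup[OF hB] by (rule bexI[of _ "inv_into UNIV (F.R a)"]) (rule e, rule F.inv_in[OF F.R_in[OF a(1)]])
    qed (rule B)
  next
    case (eng h1 h2)
    from eng.IH(1) obtain g1 where g1: "g1 \<in> F.I" "\<forall>x\<in>carrier Q. g1 x = h1 x" by (elim conjE bexE)
    from eng.IH(2) obtain g2 where g2: "g2 \<in> F.I" "\<forall>x\<in>carrier Q. g2 x = h2 x" by (elim conjE bexE)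
    have B: "h1 \<in> Bij (carrier Q)" "h2 \<in> Bij (carrier Q)"
      using conjunct1[OF eng.IH(1)] conjunct1[OF eng.IH(2)] .
    have m: "h1 \<otimes>\<^bsub>BijGroup (carrier Q)\<^esub> h2 = compose (carrier Q) h1 h2"
      using B by (simp add: BijGroup_def)
    have e: "\<forall>x\<in>carrier Q. (g1 \<circ> g2) x = compose (carrier Q) h1 h2 x"
    proof
      fix x assume x: "x \<in> carrier Q"
      have "g2 x \<in> carrier Q" by (rule F.mem[OF g2(1) x])
      then have "g1 (g2 x) = h1 (g2 x)" "g2 x = h2 x" using g1(2) g2(2) x by blast+
      then show "(g1 \<circ> g2) x = compose (carrier Q) h1 h2 x" using x by (simp add: compose_def)
    qed
    show ?case unfolding m
    proof
      show "compose (carrier Q) h1 h2 \<in> Bij (carrier Q)" by (rule compose_Bij[OF B])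
      show "\<exists>g\<in>F.I. \<forall>x\<in>carrier Q. g x = compose (carrier Q) h1 h2 x"
        by (rule bexI[of _ "g1 \<circ> g2"]) (rule e, rule F.comp_in[OF g1(1) g2(1)])
    qed
  qed
  show ?thesis
  proof unfold_locales
    fix x y assume xy: "x \<in> carrier Q" "y \<in> carrier Q"
    obtain g where g: "g \<in> carrier (Inn Q)" "g x = y"
      using connected_quandle_iff[THEN iffD1, OF connected_quandle_axioms, rule_format, OF xy] by (elim bexE)
    then have "\<exists>h\<in>F.I. \<forall>x\<in>carrier Q. h x = g x" using lift[of g] by (simp add: Inn_def)
    then obtain h where "h \<in> F.I" "\<forall>x\<in>carrier Q. h x = g x" by (elim bexE)
    then show "\<exists>g\<in>F.I. g x = y" using g(2) xy(1) by (intro bexI[of _ h]) simp_all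
  qed (use p in auto)
qed

theorem theorem2:
  fixes Q :: "('a, 'm) quandle_scheme" and p :: nat
  assumes "connected_quandle Q"
    and "Factorial_Ring.prime p" and "p > 3"
    and "card (carrier Q) = 2 * p"
  shows "card (carrier Q) = 10 \<and>
    quandle_isomorphic Q
      (conjugation_quandle (sym_group 5) (conjugacy_class (sym_group 5) (transpose 1 2)))"
proof -
  interpret Q: connected_quandle Q by fact
  have fin: "finite (carrier Q)" using assms(3,4) by (intro card_ge_0_finite) simp
  from conn_rack_strong[OF Q.conn_rack[OF fin assms(2-4)]]
  obtain s where "strong_rack (carrier Q) (\<lambda>a x. x \<triangleright>\<^bsub>Q\<^esub> a) s" by (elim exE)
  then interpret S: strong_rack "carrier Q" "\<lambda>a x. x \<triangleright>\<^bsub>Q\<^esub> a" s .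
  define T where "T = {transpose k l | k l. k \<in> {1..5::nat} \<and> l \<in> {1..5} \<and> k \<noteq> l}"
  have cls: "conjugacy_class (sym_group 5) (transpose 1 2) = T"
    unfolding T_def by (rule conjugacy_class_transpose) simp_all
  \<comment> \<open>Transpositions are self-inverse, so conjugation in the target quandle takes the
    form \<open>\<phi> v \<circ> \<phi> u \<circ> \<phi> v\<close> delivered by the
    labelling.\<close>
  have inv_t: "inv\<^bsub>sym_group 5\<^esub> t = t" if tT: "t \<in> T" for t
  proof -
    obtain k l where t: "t = transpose k l" "k \<in> {1..5}" "l \<in> {1..5}"
      using tT unfolding T_def mem_Collect_eq by (elim exE conjE)
    have "t permutes {1..5}" unfolding t(1) by (rule permutes_swap_id[OF t(2,3)])
    then have "t \<in> carrier (sym_group 5)" by (simp add: sym_group_carrier)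
    moreover have "t \<otimes>\<^bsub>sym_group 5\<^esub> t = \<one>\<^bsub>sym_group 5\<^esub>" by (simp add: sym_group_mult sym_group_one t)
    ultimately show ?thesis by (intro group.inv_equality[OF sym_group_is_group])
  qed
  show ?thesis
  proof (rule S.ex_transposition_labelling, fold T_def)
    fix \<phi> assume bij: "bij_betw \<phi> (carrier Q) T"
      and hom: "\<And>u v. u \<in> carrier Q \<Longrightarrow> v \<in> carrier Q \<Longrightarrow> \<phi> (u \<triangleright>\<^bsub>Q\<^esub> v) = \<phi> v \<circ> \<phi> u \<circ> \<phi> v"
    have mem: "\<phi> u \<in> T" if "u \<in> carrier Q" for u by (rule bij_betw_apply[OF bij that])
    have "\<phi> \<in> quandle_iso Q (conjugation_quandle (sym_group 5) T)"
      unfolding quandle_iso_def quandle_hom_def conjugation_quandle_def mem_Collect_eq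
    proof (intro conjI ballI)
      fix a b assume a: "a \<in> carrier Q" and b: "b \<in> carrier Q"
      show "\<phi> (a \<triangleright>\<^bsub>Q\<^esub> b) = \<phi> a \<triangleright>\<^bsub>\<lparr>carrier = T, qop = \<lambda>a b. inv\<^bsub>sym_group 5\<^esub> b \<otimes>\<^bsub>sym_group 5\<^esub> a \<otimes>\<^bsub>sym_group 5\<^esub> b\<rparr>\<^esub> \<phi> b"
        by (simp only: quandle.simps inv_t[OF mem[OF b]] sym_group_mult hom[OF a b])
    qed (simp_all add: mem bij)
    then have "quandle_isomorphic Q (conjugation_quandle (sym_group 5) T)"
      unfolding quandle_isomorphic_def by blast
    then show ?thesis unfolding cls using S.card10 by simp
  qed
qed

end
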